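(* Let $X=X(\Sigma)$ be an $n$-dimensional poly weighted space (PWS) of rank $r$ admitting a reduced weight matrix $Q=(\mathbf q_1,\dots,\mathbf q_{n+r})$. 1. Let $U_Q=(u_{ij})\in\mathrm{GL}_{n+r}(\mathbb Z)$ be a matrix such that $U_Q\cdot Q^T$ is in Hermite normal form, and let ${}^rU_Q$ be the submatrix of $U_Q$ given by its upper $r$ rows. Then the rows of ${}^rU_Q$ describe the following set of generators of $\mathrm{Cl}(X)$: for $1\le i\le r$ put $L_i:=\sum_{j=1}^{n+r}u_{ij}D_j\in\mathcal W_T(X)$; then $$\mathrm{Cl}(X)=\bigoplus_{i=1}^r\mathbb Z[d(L_i)].$$ 2. Let $V$ be a fan matrix of $X$ and define $$\mathcal I_\Sigma=\{I\subset\{1,\dots,n+r\}:\langle V^I\rangle\in\Sigma(n)\}.$$ Through the identification of $\mathrm{Cl}(X)$ with $\mathbb Z^r$ given by the basis $d(L_1),\dots,d(L_r)$ of part 1, $$\mathrm{Pic}(X)=\bigcap_{I\in\mathcal I_\Sigma}\mathcal L_c(Q_I).$$ 3. Let $\mathbf b_1,\dots,\mathbf b_r$ be a basis of $\mathrm{Pic}(X)$ in $\mathbb Z^r\simeq\mathrm{Cl}(X)$, and let $B$ be the $r\times r$ matrix having $\mathbf b_1,\dots,\mathbf b_r$ as rows. Then a basis of $\mathcal C_T(X)\subseteq\mathbb Z^{n+r}\simeq\mathcal W_T(X)$ is given by the rows of the matrix $$C=\begin{pmatrix}B&\mathbf 0_{r,n}\\ \mathbf 0_{n,r}&\mathbf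 I_n\end{pmatrix}\cdot U_Q=\begin{pmatrix}B\cdot{}^rU_Q\\ V\end{pmatrix},$$ where $V$ is the fan matrix of $X$ given by the lower $n$ rows of $U_Q$. 4. Setting $\delta_\Sigma:=\mathrm{lcm}\left(\det(Q_I):I\in\mathcal I_\Sigma\right)$, one has $$\delta_\Sigma\,\mathcal W_T(X)\subseteq\mathcal C_T(X)$$ and $\delta_\Sigma$ divides the index $[\mathrm{Cl}(X):\mathrm{Pic}(X)]=[\mathcal W_T(X):\mathcal C_T(X)]$.
   Context: $N$ is a lattice of rank $n$ with dual $M=\mathrm{Hom}(N,\mathbb Z)$, and $\Sigma$ is a fan of rational strictly convex cones in $N\otimes\mathbb R$; $X(\Sigma)$ is the associated toric variety over $\mathbb C$. It is $\mathbb Q$-factorial and complete when all cones of $\Sigma$ are simplicial and their union is $N\otimes\mathbb R$; then the rank is $r=\mathrm{rk}\,\mathrm{Pic}(X)\geq 1$ and $\Sigma$ has $n+r$ rays $\rho_1,\dots,\rho_{n+r}$. $\Sigma(n)$ is the set of $n$-dimensional cones of $\Sigma$. Let $\mathbf v_j$ be the generator of the monoid $\rho_j\cap N$ and $D_j$ the torus-invariant prime divisor of $\rho_j$ (closure of the torus orbit). A (reduced) fan matrix of $X$ is the $n\times(n+r)$ matrix $V=(\mathbf v_1,\dots,\mathbf v_{n+r})$, with coordinates taken in some $\mathbb Z$-basis of $N$. A poly weighted space is a $\mathbb Q$-factorial complete toric variety such that $\mathbf v_1,\dots,\mathbf v_{n+r}$ generate $N$ as a group (equivalently, $\mathrm{Cl}(X)$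 is torsion free). $\mathcal W_T(X)=\bigoplus_j\mathbb Z D_j\cong\mathbb Z^{n+r}$ is the group of torus-invariant Weil divisors, $\mathcal C_T(X)$ its subgroup of Cartier divisors, $\mathrm{Pic}(X)\subseteq\mathrm{Cl}(X)$ the group of Cartier divisor classes, and there is an exact sequence $$0\to M\xrightarrow{\ div\ }\mathcal W_T(X)\xrightarrow{\ d\ }\mathrm{Cl}(X)\to0,\qquad div(\mathbf u)=\sum_j\langle\mathbf u,\mathbf v_j\rangle D_j,$$ where $d$ sends a divisor to its class. A weight matrix of $X$ is an $r\times(n+r)$ integer matrix $Q$ whose transpose $Q^T$ represents the dual map $d^\vee:\mathrm{Hom}(\mathrm{Cl}(X),\mathbb Z)\to\mathrm{Hom}(\mathcal W_T(X),\mathbb Z)=\mathbb Z^{n+r}$ (with respect to some $\mathbb Z$-basis of $\mathrm{Hom}(\mathrm{Cl}(X),\mathbb Z)$ and the dual basis of $D_1,\dots,D_{n+r}$); its columns are indexed by the divisors $D_j$ as for $V$. It is reduced if for every $i=1,\dots,n+r$ the quotient $\mathbb Z^{n+r-1}/\mathcal L_r(Q^i)$ is torsion free, where $Q^i$ is $Q$ with its $i$-th column removed. Notation: $\mathcal L_r(A)$ and $\mathcal L_c(A)$ are the lattices spanned over $\mathbb Z$ by the rows and by the columns of $A$; for a set $I$ of column indices, $A_I$ is the submatrix of the columns indexed by $I$ and $A^I$ the submatrix of the columns indexed by the complement of $I$; $\langle V^I\rangle$ is the cone generated by the columns of $V^I$. The lcm of integers is the positive one. Hermite normal form (HNF): an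 integer $p\times q$ matrix $(m_{ij})$ is in HNF if there are $s\le p$ and a strictly increasing $f:\{1,\dots,s\}\to\{1,\dots,q\}$ such that for $1\le i\le s$: $m_{i,f(i)}\ge1$, $m_{ij}=0$ if $j<f(i)$, and $0\le m_{i,f(k)}<m_{k,f(k)}$ if $i<k\leq s$; and the last $p-s$ rows are zero. *)

theory Defs
  imports
    "HOL-Library.Poly_Mapping"
    "HOL-Computational_Algebra.Fraction_Field"
    "HOL-Algebra.Free_Abelian_Groups"
    "HOL-Algebra.QuotRing"
    "Jordan_Normal_Form.Determinant"
begin

section \<open>Finitely generated abelian groups and integer matrices\<close>

text \<open>Abelian groups are written multiplicatively, as everywhere in HOL-Algebra:
  \<open>Z_comb G k x c\<close> is the integral combination \<open>c\<^sub>0 x\<^sub>0 + \<dots> + c\<^sub>k\<^sub>-\<^sub>1 x\<^sub>k\<^sub>-\<^sub>1\<close>.\<close>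

definition Z_comb :: "('g, 'm) monoid_scheme \<Rightarrow> nat \<Rightarrow> (nat \<Rightarrow> 'g) \<Rightarrow> int vec \<Rightarrow> 'g" where
  "Z_comb G k x c = (\<Otimes>\<^bsub>G\<^esub>i\<in>{..<k}. x i [^]\<^bsub>G\<^esub> (c $ i))"

definition Z_basis :: "('g, 'm) monoid_scheme \<Rightarrow> nat \<Rightarrow> (nat \<Rightarrow> 'g) \<Rightarrow> bool" where
  "Z_basis G k x \<longleftrightarrow> (\<forall>i<k. x i \<in> carrier G) \<and>
     (\<forall>y\<in>carrier G. \<exists>!c. c \<in> carrier_vec k \<and> y = Z_comb G k x c)"

definition Z_independent :: "('g, 'm) monoid_scheme \<Rightarrow> nat \<Rightarrow> (nat \<Rightarrow> 'g) \<Rightarrow> bool" where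
  "Z_independent G k x \<longleftrightarrow> (\<forall>i<k. x i \<in> carrier G) \<and>
     (\<forall>c\<in>carrier_vec k. Z_comb G k x c = \<one>\<^bsub>G\<^esub> \<longrightarrow> c = 0\<^sub>v k)"

definition has_rank :: "('g, 'm) monoid_scheme \<Rightarrow> nat \<Rightarrow> bool" where
  "has_rank G k \<longleftrightarrow> (\<exists>x. Z_independent G k x) \<and> \<not> (\<exists>x. Z_independent G (Suc k) x)"

definition torsion_free :: "('g, 'm) monoid_scheme \<Rightarrow> bool" where
  "torsion_free G \<longleftrightarrow> (\<forall>x\<in>carrier G. \<forall>k::nat. 0 < k \<longrightarrow> x [^]\<^bsub>G\<^esub> k = \<one>\<^bsub>G\<^esub> \<longrightarrow> x = \<one>\<^bsub>G\<^esub>)"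

text \<open>The group \<open>Hom(G, \<int>)\<close>; homomorphisms are normalised outside the carrier of \<open>G\<close>.\<close>

definition dual_group :: "('g, 'm) monoid_scheme \<Rightarrow> ('g \<Rightarrow> int) monoid" where
  "dual_group G =
     \<lparr>carrier = hom G integer_group \<inter> extensional (carrier G),
      monoid.mult = (\<lambda>\<phi> \<psi>. \<lambda>x\<in>carrier G. \<phi> x + \<psi> x),
      one = (\<lambda>x\<in>carrier G. 0)\<rparr>"

definition int_vec_group :: "nat \<Rightarrow> int vec monoid" where
  "int_vec_group m = \<lparr>carrier = carrier_vec m, monoid.mult = (+), one = 0\<^sub>v m\<rparr>"

abbreviation real_mat :: "int mat \<Rightarrow> real mat" where
  "real_mat A \<equiv> map_mat real_of_int A"

abbreviation real_vec :: "int vec \<Rightarrow> real vec" where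
  "real_vec v \<equiv> map_vec real_of_int v"

definition col_lattice :: "int mat \<Rightarrow> int vec set" where
  "col_lattice A = {A *\<^sub>v c | c. c \<in> carrier_vec (dim_col A)}"

definition row_lattice :: "int mat \<Rightarrow> int vec set" where
  "row_lattice A = col_lattice (transpose_mat A)"

text \<open>The submatrices \<open>A\<^sub>I\<close> and \<open>A\<^sup>I\<close>; column indices start at 0.\<close>

definition cols_in :: "'a mat \<Rightarrow> nat set \<Rightarrow> 'a mat" where
  "cols_in A I = mat_of_cols (dim_row A) (map (col A) (sorted_list_of_set (I \<inter> {..<dim_col A})))"

definition cols_off :: "'a mat \<Rightarrow> nat set \<Rightarrow> 'a mat" where
  "cols_off A I = cols_in A ({..<dim_col A} - I)"

definition upper_rows :: "nat \<Rightarrow> 'a mat \<Rightarrow> 'a mat" where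
  "upper_rows k A = mat_of_rows (dim_col A) (map (row A) [0..<k])"

definition lower_rows :: "nat \<Rightarrow> 'a mat \<Rightarrow> 'a mat" where
  "lower_rows k A = mat_of_rows (dim_col A) (map (row A) [dim_row A - k..<dim_row A])"

definition hermite_normal_form :: "int mat \<Rightarrow> bool" where
  "hermite_normal_form A \<longleftrightarrow>
     (\<exists>s f. s \<le> dim_row A \<and> strict_mono_on {..<s} f \<and> f ` {..<s} \<subseteq> {..<dim_col A} \<and>
        (\<forall>i<s. 1 \<le> A $$ (i, f i) \<and>
               (\<forall>j<f i. A $$ (i, j) = 0) \<and>
               (\<forall>k. i < k \<and> k < s \<longrightarrow> 0 \<le> A $$ (i, f k) \<and> A $$ (i, f k) < A $$ (k, f k))) \<and>
        (\<forall>i j. s \<le> i \<and> i < dim_row A \<and> j < dim_col A \<longrightarrow> A $$ (i, j) = 0))"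


section \<open>Cones and fans\<close>

text \<open>The lattice is \<open>N = \<int>\<^sup>n\<close> (as \<^typ>\<open>int vec\<close>), with \<open>N \<otimes> \<real> = \<real>\<^sup>n\<close>.\<close>

definition mat_cone :: "real mat \<Rightarrow> real vec set" where
  "mat_cone A = {A *\<^sub>v c | c. c \<in> carrier_vec (dim_col A) \<and> (\<forall>i<dim_col A. 0 \<le> c $ i)}"

definition cols_independent :: "real mat \<Rightarrow> bool" where
  "cols_independent A \<longleftrightarrow>
     (\<forall>c\<in>carrier_vec (dim_col A). A *\<^sub>v c = 0\<^sub>v (dim_row A) \<longrightarrow> c = 0\<^sub>v (dim_col A))"

definition rational_cone :: "nat \<Rightarrow> real vec set \<Rightarrow> bool" where
  "rational_cone n \<sigma> \<longleftrightarrow> (\<exists>k. \<exists>A\<in>carrier_mat n k. \<sigma> = mat_cone (real_mat A))"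

definition strictly_convex :: "nat \<Rightarrow> real vec set \<Rightarrow> bool" where
  "strictly_convex n \<sigma> \<longleftrightarrow> (\<forall>x\<in>\<sigma>. - x \<in> \<sigma> \<longrightarrow> x = 0\<^sub>v n)"

definition simplicial_cone :: "nat \<Rightarrow> real vec set \<Rightarrow> bool" where
  "simplicial_cone n \<sigma> \<longleftrightarrow> (\<exists>k. \<exists>A\<in>carrier_mat n k. cols_independent A \<and> \<sigma> = mat_cone A)"

text \<open>The dimension of a cone is that of its linear span: a basis of the span can be
  chosen inside the cone.\<close>

definition has_dim :: "nat \<Rightarrow> real vec set \<Rightarrow> nat \<Rightarrow> bool" where
  "has_dim n \<sigma> k \<longleftrightarrow>
     (\<exists>A\<in>carrier_mat n k. cols_independent A \<and> set (cols A) \<subseteq> \<sigma> \<and>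
        (\<forall>x\<in>\<sigma>. \<exists>c\<in>carrier_vec k. x = A *\<^sub>v c))"

definition face :: "nat \<Rightarrow> real vec set \<Rightarrow> real vec set \<Rightarrow> bool" where
  "face n \<tau> \<sigma> \<longleftrightarrow>
     (\<exists>u\<in>carrier_vec n. (\<forall>x\<in>\<sigma>. 0 \<le> u \<bullet> x) \<and> \<tau> = {x\<in>\<sigma>. u \<bullet> x = 0})"

definition fan :: "nat \<Rightarrow> real vec set set \<Rightarrow> bool" where
  "fan n \<Sigma> \<longleftrightarrow> finite \<Sigma> \<and> \<Sigma> \<noteq> {} \<and>
     (\<forall>\<sigma>\<in>\<Sigma>. rational_cone n \<sigma> \<and> strictly_convex n \<sigma>) \<and>
     (\<forall>\<sigma>\<in>\<Sigma>. \<forall>\<tau>. face n \<tau> \<sigma> \<longrightarrow> \<tau> \<in> \<Sigma>) \<and>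
     (\<forall>\<sigma>\<in>\<Sigma>. \<forall>\<tau>\<in>\<Sigma>. face n (\<sigma> \<inter> \<tau>) \<sigma> \<and> face n (\<sigma> \<inter> \<tau>) \<tau>)"

definition complete_fan :: "nat \<Rightarrow> real vec set set \<Rightarrow> bool" where
  "complete_fan n \<Sigma> \<longleftrightarrow> \<Union> \<Sigma> = carrier_vec n"

definition cones :: "nat \<Rightarrow> real vec set set \<Rightarrow> nat \<Rightarrow> real vec set set" where
  "cones n \<Sigma> k = {\<sigma>\<in>\<Sigma>. has_dim n \<sigma> k}"

text \<open>The generator of the monoid \<open>\<tau> \<inter> N\<close> of a ray \<open>\<tau>\<close>.\<close>

definition ray_gen :: "nat \<Rightarrow> real vec set \<Rightarrow> int vec" where
  "ray_gen n \<tau> =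
     (THE v. v \<in> carrier_vec n \<and>
        {x \<in> carrier_vec n. real_vec x \<in> \<tau>} = {int k \<cdot>\<^sub>v v | k. True})"


section \<open>The toric variety of a fan over the complex numbers\<close>

text \<open>The dual lattice \<open>M = Hom(N, \<int>) = \<int>\<^sup>n\<close> consists of the finitely supported
  sequences that vanish from index \<open>n\<close> on. The group algebra \<open>\<complex>[M]\<close> is the set of those elements
  of the domain \<^typ>\<open>(nat \<Rightarrow>\<^sub>0 int) \<Rightarrow>\<^sub>0 complex\<close> (whose multiplication is convolution)
  with exponents in \<open>M\<close>, and all rational functions on the toric variety live in the field
  of fractions of this domain. (Using \<^typ>\<open>nat \<Rightarrow>\<^sub>0 int\<close> for the exponents makes the library's
  linear order, hence its domain structure, available.)\<close>

type_synonym laurent = "(nat \<Rightarrow>\<^sub>0 int) \<Rightarrow>\<^sub>0 complex"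
type_synonym ratfun = "laurent fract"

definition M_lattice :: "nat \<Rightarrow> (nat \<Rightarrow>\<^sub>0 int) set" where
  "M_lattice n = {u. Poly_Mapping.keys u \<subseteq> {..<n}}"

definition pairing :: "nat \<Rightarrow> (nat \<Rightarrow>\<^sub>0 int) \<Rightarrow> real vec \<Rightarrow> real" where
  "pairing n u x = (\<Sum>i<n. real_of_int (Poly_Mapping.lookup u i) * x $ i)"

definition dual_monoid :: "nat \<Rightarrow> real vec set \<Rightarrow> (nat \<Rightarrow>\<^sub>0 int) set" where
  "dual_monoid n \<sigma> = {u\<in>M_lattice n. \<forall>x\<in>\<sigma>. 0 \<le> pairing n u x}"

definition perp :: "nat \<Rightarrow> real vec set \<Rightarrow> (nat \<Rightarrow>\<^sub>0 int) set" where
  "perp n \<sigma> = {u\<in>M_lattice n. \<forall>x\<in>\<sigma>. pairing n u x = 0}"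

definition function_field :: "nat \<Rightarrow> ratfun set" where
  "function_field n = {Fract p q | p q. Poly_Mapping.keys p \<subseteq> M_lattice n \<and>
     Poly_Mapping.keys q \<subseteq> M_lattice n \<and> q \<noteq> 0}"

text \<open>The coordinate ring \<open>\<complex>[\<sigma>\<^sup>\<or> \<inter> M]\<close> of the affine chart \<open>U\<^sub>\<sigma>\<close>, as a subring of the
  function field.\<close>

definition coord_ring :: "nat \<Rightarrow> real vec set \<Rightarrow> ratfun set" where
  "coord_ring n \<sigma> = {Fract p 1 | p. Poly_Mapping.keys p \<subseteq> dual_monoid n \<sigma>}"

definition subring_of :: "ratfun set \<Rightarrow> ratfun ring" where
  "subring_of A = \<lparr>carrier = A, monoid.mult = (*), one = 1, zero = 0, add = (+)\<rparr>"

definition prime_ideals :: "ratfun set \<Rightarrow> ratfun set set" where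
  "prime_ideals A = {P. primeideal P (subring_of A)}"

definition height_one_primes :: "ratfun set \<Rightarrow> ratfun set set" where
  "height_one_primes A = {P\<in>prime_ideals A. P \<noteq> {0} \<and>
     (\<forall>P'\<in>prime_ideals A. P' \<subseteq> P \<longrightarrow> P' = {0} \<or> P' = P)}"

definition local_ring :: "ratfun set \<Rightarrow> ratfun set \<Rightarrow> ratfun set" where
  "local_ring A P = {a / b | a b. a \<in> A \<and> b \<in> A - P}"

text \<open>The charts \<open>U\<^sub>\<sigma>\<close> are glued inside the function field, so that a point of \<open>X(\<Sigma>)\<close> is
  determined by its local ring (the variety being separated), independently of the chart
  used. A prime divisor is represented by the local ring of its generic point.\<close>

definition prime_divisors :: "nat \<Rightarrow> real vec set set \<Rightarrow> ratfun set set" where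
  "prime_divisors n \<Sigma> =
     (\<Union>\<sigma>\<in>\<Sigma>. local_ring (coord_ring n \<sigma>) ` height_one_primes (coord_ring n \<sigma>))"

text \<open>The order of a rational function along a prime divisor: \<open>X(\<Sigma>)\<close> is normal, so the local
  ring \<open>R\<close> of a prime divisor is a discrete valuation ring.\<close>

definition ring_unit :: "ratfun set \<Rightarrow> ratfun \<Rightarrow> bool" where
  "ring_unit R w \<longleftrightarrow> w \<in> R \<and> w \<noteq> 0 \<and> inverse w \<in> R"

definition uniformizer :: "ratfun set \<Rightarrow> ratfun \<Rightarrow> bool" where
  "uniformizer R t \<longleftrightarrow> t \<in> R \<and> t \<noteq> 0 \<and> {x\<in>R. \<not> ring_unit R x} = {t * a | a. a \<in> R}"

definition ord_along :: "ratfun set \<Rightarrow> ratfun \<Rightarrow> int" where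
  "ord_along R f = (THE k. \<exists>t w. uniformizer R t \<and> ring_unit R w \<and> f = w * t powi k)"

type_synonym divisor = "ratfun set \<Rightarrow>\<^sub>0 int"

definition weil :: "nat \<Rightarrow> real vec set set \<Rightarrow> divisor monoid" where
  "weil n \<Sigma> = free_Abelian_group (prime_divisors n \<Sigma>)"

definition principal :: "nat \<Rightarrow> real vec set set \<Rightarrow> divisor set" where
  "principal n \<Sigma> = {D\<in>carrier (weil n \<Sigma>). \<exists>f\<in>function_field n. f \<noteq> 0 \<and>
     (\<forall>Y\<in>prime_divisors n \<Sigma>. Poly_Mapping.lookup D Y = ord_along Y f)}"

definition Cl :: "nat \<Rightarrow> real vec set set \<Rightarrow> divisor set monoid" where
  "Cl n \<Sigma> = weil n \<Sigma> Mod principal n \<Sigma>"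

definition div_class :: "nat \<Rightarrow> real vec set set \<Rightarrow> divisor \<Rightarrow> divisor set" where
  "div_class n \<Sigma> D = principal n \<Sigma> #>\<^bsub>weil n \<Sigma>\<^esub> D"

text \<open>A divisor is Cartier if it is locally principal: every point \<open>P\<close> of a chart \<open>U\<^sub>\<sigma>\<close> has a
  basic open neighbourhood \<open>{g \<noteq> 0}\<close> in \<open>U\<^sub>\<sigma>\<close> on which the divisor is the divisor of a rational
  function \<open>f\<close>; the prime divisors that meet this neighbourhood are those given by the
  height one primes \<open>P'\<close> with \<open>g \<notin> P'\<close>.\<close>

definition cartier :: "nat \<Rightarrow> real vec set set \<Rightarrow> divisor set" where
  "cartier n \<Sigma> = {D\<in>carrier (weil n \<Sigma>).
     \<forall>\<sigma>\<in>\<Sigma>. \<forall>P\<in>prime_ideals (coord_ring n \<sigma>).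
       \<exists>g\<in>coord_ring n \<sigma> - P. \<exists>f\<in>function_field n. f \<noteq> 0 \<and>
         (\<forall>P'\<in>height_one_primes (coord_ring n \<sigma>). g \<notin> P' \<longrightarrow>
            Poly_Mapping.lookup D (local_ring (coord_ring n \<sigma>) P') =
            ord_along (local_ring (coord_ring n \<sigma>) P') f)}"

definition Pic :: "nat \<Rightarrow> real vec set set \<Rightarrow> divisor set set" where
  "Pic n \<Sigma> = div_class n \<Sigma> ` cartier n \<Sigma>"

abbreviation Pic_group :: "nat \<Rightarrow> real vec set set \<Rightarrow> divisor set monoid" where
  "Pic_group n \<Sigma> \<equiv> (Cl n \<Sigma>)\<lparr>carrier := Pic n \<Sigma>\<rparr>"


subsection \<open>Torus-invariant divisors\<close>

text \<open>The closed points of \<open>U\<^sub>\<sigma>\<close> are the monoid homomorphisms \<open>\<gamma>\<close> from \<open>\<sigma>\<^sup>\<or> \<inter> M\<close> to \<open>\<complex>\<close>, and the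
  value of \<open>\<Sum>\<^sub>u c\<^sub>u \<chi>\<^sup>u\<close> at \<open>\<gamma>\<close> is \<open>\<Sum>\<^sub>u c\<^sub>u \<gamma>(u)\<close>. The orbit \<open>O(\<sigma>)\<close> is the orbit, under the torus
  \<open>(\<complex>\<^sup>*)\<^sup>n\<close>, of the distinguished point, which is 1 on \<open>\<sigma>\<^sup>\<bottom>\<close> and 0 elsewhere.\<close>

definition eval_at :: "laurent \<Rightarrow> ((nat \<Rightarrow>\<^sub>0 int) \<Rightarrow> complex) \<Rightarrow> complex" where
  "eval_at p \<gamma> = (\<Sum>u\<in>Poly_Mapping.keys p. Poly_Mapping.lookup p u * \<gamma> u)"

definition torus_orbit :: "nat \<Rightarrow> real vec set \<Rightarrow> ((nat \<Rightarrow>\<^sub>0 int) \<Rightarrow> complex) set" where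
  "torus_orbit n \<sigma> =
     {\<lambda>u. if u \<in> perp n \<sigma> then (\<Prod>i<n. t i powi Poly_Mapping.lookup u i) else 0
      | t :: nat \<Rightarrow> complex. \<forall>i<n. t i \<noteq> 0}"

definition orbit_ideal :: "nat \<Rightarrow> real vec set \<Rightarrow> ratfun set" where
  "orbit_ideal n \<sigma> = {Fract p 1 | p. Poly_Mapping.keys p \<subseteq> dual_monoid n \<sigma> \<and>
     (\<forall>\<gamma>\<in>torus_orbit n \<sigma>. eval_at p \<gamma> = 0)}"

text \<open>The closure of the orbit of a ray \<open>\<tau>\<close>, again represented by the local ring at its
  generic point.\<close>

definition orbit_divisor :: "nat \<Rightarrow> real vec set \<Rightarrow> ratfun set" where
  "orbit_divisor n \<tau> = local_ring (coord_ring n \<tau>) (orbit_ideal n \<tau>)"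

definition W_T :: "nat \<Rightarrow> real vec set set \<Rightarrow> divisor monoid" where
  "W_T n \<Sigma> = free_Abelian_group (orbit_divisor n ` cones n \<Sigma> 1)"

definition C_T :: "nat \<Rightarrow> real vec set set \<Rightarrow> divisor set" where
  "C_T n \<Sigma> = carrier (W_T n \<Sigma>) \<inter> cartier n \<Sigma>"

abbreviation C_T_group :: "nat \<Rightarrow> real vec set set \<Rightarrow> divisor monoid" where
  "C_T_group n \<Sigma> \<equiv> (W_T n \<Sigma>)\<lparr>carrier := C_T n \<Sigma>\<rparr>"

text \<open>From here on \<open>\<rho>\<close> enumerates the rays of the fan.\<close>

definition toric_divisor :: "nat \<Rightarrow> (nat \<Rightarrow> real vec set) \<Rightarrow> int vec \<Rightarrow> divisor" where
  "toric_divisor n \<rho> a =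
     (\<Sum>j<dim_vec a. Poly_Mapping.single (orbit_divisor n (\<rho> j)) (a $ j))"


section \<open>Poly weighted spaces, fan matrices and weight matrices\<close>

definition poly_weighted_space ::
    "nat \<Rightarrow> nat \<Rightarrow> real vec set set \<Rightarrow> (nat \<Rightarrow> real vec set) \<Rightarrow> bool" where
  "poly_weighted_space n r \<Sigma> \<rho> \<longleftrightarrow>
     fan n \<Sigma> \<and> (\<forall>\<sigma>\<in>\<Sigma>. simplicial_cone n \<sigma>) \<and> complete_fan n \<Sigma> \<and>
     has_rank (Pic_group n \<Sigma>) r \<and>
     bij_betw \<rho> {..<n + r} (cones n \<Sigma> 1) \<and>
     (\<forall>x\<in>carrier_vec n. \<exists>c\<in>carrier_vec (n + r).
        x = Z_comb (int_vec_group n) (n + r) (\<lambda>j. ray_gen n (\<rho> j)) c)"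

text \<open>\<open>V\<close> holds the coordinates of the ray generators in the \<open>\<int>\<close>-basis of \<open>N\<close> formed by the
  columns of \<open>E\<close>.\<close>

definition fan_matrix ::
    "nat \<Rightarrow> nat \<Rightarrow> (nat \<Rightarrow> real vec set) \<Rightarrow> int mat \<Rightarrow> int mat \<Rightarrow> bool" where
  "fan_matrix n r \<rho> E V \<longleftrightarrow>
     E \<in> carrier_mat n n \<and> Z_basis (int_vec_group n) n (col E) \<and>
     V \<in> carrier_mat n (n + r) \<and> (\<forall>j<n + r. ray_gen n (\<rho> j) = E *\<^sub>v col V j)"

text \<open>The cone \<open>\<langle>V\<^sup>I\<rangle>\<close> is expressed in the coordinates of \<open>E\<close>, hence the image under \<open>E\<close>.\<close>

definition index_sets ::
    "nat \<Rightarrow> nat \<Rightarrow> real vec set set \<Rightarrow> int mat \<Rightarrow> int mat \<Rightarrow> nat set set" where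
  "index_sets n r \<Sigma> E V = {I. I \<subseteq> {..<n + r} \<and>
     (\<lambda>x. real_mat E *\<^sub>v x) ` mat_cone (real_mat (cols_off V I)) \<in> cones n \<Sigma> n}"

text \<open>\<open>d\<^sup>\<or>(\<phi>) = \<phi> \<circ> d\<close> has coordinates \<open>\<phi>(d(D\<^sub>j))\<close> in the dual basis of the \<open>D\<^sub>j\<close>.\<close>

definition weight_matrix ::
    "nat \<Rightarrow> nat \<Rightarrow> real vec set set \<Rightarrow> (nat \<Rightarrow> real vec set) \<Rightarrow> int mat \<Rightarrow> bool" where
  "weight_matrix n r \<Sigma> \<rho> Q \<longleftrightarrow> Q \<in> carrier_mat r (n + r) \<and>
     (\<exists>\<phi>. Z_basis (dual_group (Cl n \<Sigma>)) r \<phi> \<and>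
        (\<forall>i<r. \<forall>j<n + r. Q $$ (i, j) =
           \<phi> i (div_class n \<Sigma> (Poly_Mapping.single (orbit_divisor n (\<rho> j)) 1))))"

text \<open>The divisor \<open>L\<^sub>i = \<Sum>\<^sub>j u\<^sub>i\<^sub>j D\<^sub>j\<close> of the \<open>i\<close>-th row of \<open>U\<close>, and its class.\<close>

definition row_class ::
    "nat \<Rightarrow> real vec set set \<Rightarrow> (nat \<Rightarrow> real vec set) \<Rightarrow> int mat \<Rightarrow> nat \<Rightarrow> divisor set" where
  "row_class n \<Sigma> \<rho> U i = div_class n \<Sigma> (toric_divisor n \<rho> (row U i))"

definition reduced_matrix :: "int mat \<Rightarrow> bool" where
  "reduced_matrix Q \<longleftrightarrow> (\<forall>i<dim_col Q.
     torsion_free (int_vec_group (dim_col Q - 1) Mod row_lattice (cols_off Q {i})))"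

definition delta :: "int mat \<Rightarrow> nat set set \<Rightarrow> int" where
  "delta Q \<I> = Lcm ((\<lambda>I. det (cols_in Q I)) ` \<I>)"

end

theory Submission
  imports Defs
begin

text \<open>On a complete simplicial toric variety every divisor class contains an invariant divisor, the invariant principal
  divisors are those of the characters, and an invariant divisor is Cartier exactly if on each full-dimensional cone its
  coefficients are the values of some character on the ray generators. Everything else is integral linear algebra with the
  exact sequence \<open>0 \<rightarrow> M \<rightarrow> \<int>\<^sup>n\<^sup>+\<^sup>r \<rightarrow> Cl \<rightarrow> 0\<close>.

  The geometric facts are obtained from the function field. The Laurent polynomial ring is factorial
  (\<open>factorial_laurent_ring\<close>, from the Gauss lemma \<open>factorial_polys_over\<close>). In the coordinate ring of a
  simplicial cone the primes of height one are therefore of two kinds (\<open>height_one_iff\<close>): those of the rays, whose local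
  rings are the valuation rings of the order \<open>min\<^sub>u \<langle>u, v\<rangle>\<close> over the exponents \<open>u\<close>, and those of the prime Laurent
  polynomials, whose local rings are the valuation rings of their multiplicity. Completeness makes every cone a face of a
  full-dimensional one (\<open>cone_representation\<close>), so that all charts are of this form and all prime divisors are known
  (\<open>prime_divisors_eq\<close>). A prime divisor of the second kind has one equation, so it is equivalent to an invariant
  divisor (\<open>toric_representative\<close>). For a local equation of an invariant divisor near the distinguished point of a
  full-dimensional cone, the complement of the neighbourhood is given by a function with constant term, and this forces the
  orders of the equation along the rays to be those of a character
  (\<open>orders_of_function_invertible_off_divisor\<close>, \<open>toric_cartier_iff\<close>).

  The rows of the weight matrix \<open>Q\<close> are a basis of the linear forms on the class group, that is, of the relations among the ray
  generators. As the ray generators generate the lattice, \<open>Q\<close> has a right inverse and its kernel consists of the divisors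
  of characters (\<open>Q_right_inverse\<close>), so \<open>Q\<close> identifies the class group with \<open>\<int>\<^sup>r\<close>. The right inverse
  forces the Hermite normal form of \<open>Q\<^sup>T\<close> to be the identity on top of zeros (\<open>U_Q\<close>): the upper rows of \<open>U\<close> have the unit
  vectors as degrees, and the lower ones form a basis of the divisors of characters. Subtracting the divisor of a character
  moves a divisor that is principal on the chart of a cone to one supported on the complementary rays, so its degree lies in the
  lattice of the columns of \<open>Q\<close> with these indices (\<open>locally_linear_iff\<close>). The Picard group is the intersection of these
  lattices. Each of them contains its determinant times \<open>\<int>\<^sup>r\<close>, which gives the multiple \<open>\<delta>\<close>, and its
  determinant divides that of any sublattice, in particular the index of the Picard group.\<close>

abbreviation "keys \<equiv> Poly_Mapping.keys"
abbreviation "lookup \<equiv> Poly_Mapping.lookup"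


section \<open>Factorial subrings and the Gauss lemma\<close>

text \<open>The rings in question (Laurent polynomials in \<open>n\<close> variables, semigroup algebras of cones, polynomials over
  these) are all subsets of ambient domain types, one ring inside another. Divisibility, units and primes therefore take
  the ring as an argument.\<close>

definition subdomain :: "'a::idom set \<Rightarrow> bool" where
  "subdomain A \<longleftrightarrow> 1 \<in> A \<and> (\<forall>a\<in>A. \<forall>b\<in>A. a + b \<in> A \<and> a * b \<in> A) \<and> (\<forall>a\<in>A. - a \<in> A)"

lemma subdomainD:
  assumes "subdomain A"
  shows "1 \<in> A" "0 \<in> A" "a \<in> A \<Longrightarrow> b \<in> A \<Longrightarrow> a + b \<in> A" "a \<in> A \<Longrightarrow> b \<in> A \<Longrightarrow> a * b \<in> A"
    "a \<in> A \<Longrightarrow> - a \<in> A" "a \<in> A \<Longrightarrow> b \<in> A \<Longrightarrow> a - b \<in> A"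
proof -
  show 1: "1 \<in> A" and p: "a \<in> A \<Longrightarrow> b \<in> A \<Longrightarrow> a + b \<in> A" "a \<in> A \<Longrightarrow> b \<in> A \<Longrightarrow> a * b \<in> A"
    "a \<in> A \<Longrightarrow> - a \<in> A"
    using assms unfolding subdomain_def by blast+
  have "1 + (- 1) \<in> A" using assms 1 unfolding subdomain_def by blast
  then show "0 \<in> A" by simp
  show "a \<in> A \<Longrightarrow> b \<in> A \<Longrightarrow> a - b \<in> A"
    using assms unfolding subdomain_def by (metis diff_conv_add_uminus)
qed

lemma subdomain_sum:
  assumes "subdomain A" "\<And>i. i \<in> I \<Longrightarrow> f i \<in> A"
  shows "sum f I \<in> A"
  using assms(2) by (induction I rule: infinite_finite_induct) (auto intro: subdomainD[OF assms(1)])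

lemma subdomain_power: "subdomain A \<Longrightarrow> a \<in> A \<Longrightarrow> a ^ k \<in> A"
  by (induction k) (auto intro: subdomainD)

definition dvd_in :: "'a::idom set \<Rightarrow> 'a \<Rightarrow> 'a \<Rightarrow> bool" where
  "dvd_in A a b \<longleftrightarrow> (\<exists>c\<in>A. b = a * c)"

definition unit_in :: "'a::idom set \<Rightarrow> 'a \<Rightarrow> bool" where
  "unit_in A u \<longleftrightarrow> u \<in> A \<and> (\<exists>v\<in>A. u * v = 1)"

definition prime_in :: "'a::idom set \<Rightarrow> 'a \<Rightarrow> bool" where
  "prime_in A p \<longleftrightarrow> p \<in> A \<and> p \<noteq> 0 \<and> \<not> unit_in A p \<and>
     (\<forall>a\<in>A. \<forall>b\<in>A. dvd_in A p (a * b) \<longrightarrow> dvd_in A p a \<or> dvd_in A p b)"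

definition prime_product :: "'a::idom set \<Rightarrow> 'a \<Rightarrow> bool" where
  "prime_product A a \<longleftrightarrow>
     (\<exists>u ps. unit_in A u \<and> (\<forall>p\<in>set ps. prime_in A p) \<and> a = u * prod_list ps)"

definition factorial_domain :: "'a::idom set \<Rightarrow> bool" where
  "factorial_domain A \<longleftrightarrow> subdomain A \<and> (\<forall>a\<in>A. a \<noteq> 0 \<longrightarrow> prime_product A a)"

lemma dvd_inI: "b = a * c \<Longrightarrow> c \<in> A \<Longrightarrow> dvd_in A a b"
  unfolding dvd_in_def by blast

lemma unit_in_one: "subdomain A \<Longrightarrow> unit_in A 1"
  unfolding unit_in_def by (auto intro: subdomainD)

lemma unit_in_mult:
  assumes "subdomain A" "unit_in A u" "unit_in A v"
  shows "unit_in A (u * v)"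
proof -
  obtain u' v' where *: "u \<in> A" "v \<in> A" "u' \<in> A" "v' \<in> A" "u * u' = 1" "v * v' = 1"
    using assms(2,3) unfolding unit_in_def by blast
  then have "(u * v) * (u' * v') = 1" by (simp add: algebra_simps)
  then show ?thesis unfolding unit_in_def using * subdomainD(4)[OF assms(1)] by blast
qed

lemma unit_in_nonzero: "unit_in A u \<Longrightarrow> u \<noteq> 0"
  unfolding unit_in_def by auto

lemma unit_in_factor:
  assumes "subdomain A" "unit_in A (a * b)" "a \<in> A" "b \<in> A"
  shows "unit_in A a"
proof -
  obtain v where "v \<in> A" "a * b * v = 1" using assms(2) unfolding unit_in_def by blast
  then show ?thesis unfolding unit_in_def using assms subdomainD(4)[OF assms(1)]
    by (metis mult.assoc)
qed

lemma prime_inD: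
  assumes "prime_in A p"
  shows "p \<in> A" "p \<noteq> 0" "\<not> unit_in A p"
    "a \<in> A \<Longrightarrow> b \<in> A \<Longrightarrow> dvd_in A p (a * b) \<Longrightarrow> dvd_in A p a \<or> dvd_in A p b"
  using assms unfolding prime_in_def by blast+

lemma primes_subset: "\<forall>p\<in>set ps. prime_in A p \<Longrightarrow> set ps \<subseteq> A"
  using prime_inD(1) by blast

lemma prime_not_dvd_unit:
  assumes "subdomain A" "prime_in A p" "unit_in A u"
  shows "\<not> dvd_in A p u"
proof
  assume "dvd_in A p u"
  then obtain c where "u = p * c" "c \<in> A" unfolding dvd_in_def by blast
  then have "unit_in A p" using unit_in_factor assms prime_inD(1) by blast
  then show False using prime_inD(3)[OF assms(2)] by blast
qed

lemma prod_list_in: "subdomain A \<Longrightarrow> set ps \<subseteq> A \<Longrightarrow> prod_list ps \<in> A"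
  by (induction ps) (auto intro: subdomainD)

lemma prime_dvd_prod_list:
  assumes "subdomain A" "prime_in A p" "set qs \<subseteq> A" "dvd_in A p (prod_list qs)"
  shows "\<exists>q\<in>set qs. dvd_in A p q"
  using assms(3,4)
proof (induction qs)
  case Nil
  then show ?case using prime_not_dvd_unit[OF assms(1,2) unit_in_one[OF assms(1)]] by simp
next
  case (Cons q qs)
  then show ?case using prime_inD(4)[OF assms(2), of q "prod_list qs"] prod_list_in[OF assms(1)] by auto
qed

text \<open>Two primes dividing one another are associated, as a prime is irreducible.\<close>

lemma prime_dvd_prime:
  assumes "subdomain A" "prime_in A p" "prime_in A q" "dvd_in A p q"
  obtains w where "unit_in A w" "q = p * w"
proof -
  obtain w where w: "w \<in> A" "q = p * w" using assms(4) unfolding dvd_in_def by blast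
  have "dvd_in A q (p * w)" using w subdomainD(1)[OF assms(1)] unfolding dvd_in_def by auto
  then consider "dvd_in A q p" | "dvd_in A q w"
    using prime_inD(4)[OF assms(3)] w prime_inD(1)[OF assms(2)] by blast
  then show ?thesis
  proof cases
    case 1
    then obtain c where c: "c \<in> A" "p = q * c" unfolding dvd_in_def by blast
    then have "p * (w * c) = p * 1" using w by (simp add: algebra_simps)
    then have "w * c = 1" using prime_inD(2)[OF assms(2)] by (metis mult_left_cancel)
    then show ?thesis using that w c unfolding unit_in_def by blast
  next
    case 2
    then obtain c where c: "c \<in> A" "w = q * c" unfolding dvd_in_def by blast
    then have "w * (p * c) = w * 1" using w by (simp add: algebra_simps)
    moreover have "w \<noteq> 0" using w prime_inD(2)[OF assms(3)] by auto
    ultimately have "p * c = 1" by (metis mult_left_cancel)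
    then have "unit_in A p" using c prime_inD(1)[OF assms(2)] unfolding unit_in_def by blast
    then show ?thesis using prime_inD(3)[OF assms(2)] by blast
  qed
qed

lemma prod_list_remove1: "x \<in> set xs \<Longrightarrow> prod_list xs = (x::'a::comm_monoid_mult) * prod_list (remove1 x xs)"
  by (induction xs) (auto simp: algebra_simps)

text \<open>The number of prime factors bounds the length of every chain of prime divisors; this is the
  termination argument for splitting off prime factors.\<close>

lemma prime_divisors_length:
  assumes "subdomain A" "\<forall>p\<in>set ps. prime_in A p" "unit_in A u"
    "\<forall>q\<in>set qs. prime_in A q" "x \<in> A" "prod_list qs * x = u * prod_list ps"
  shows "length qs \<le> length ps"
  using assms(2,4,5,6)
proof (induction ps arbitrary: qs x)
  case Nil
  show ?case
  proof (cases qs)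
    case (Cons q qs')
    then have q: "prime_in A q" "set qs' \<subseteq> A" using Nil prime_inD(1) by auto
    have "u = q * (prod_list qs' * x)" using Nil Cons by (simp add: algebra_simps)
    then have "dvd_in A q u" using q Nil prod_list_in[OF assms(1)] subdomainD(4)[OF assms(1)]
      unfolding dvd_in_def by blast
    then show ?thesis using prime_not_dvd_unit[OF assms(1) q(1) assms(3)] by blast
  qed simp
next
  case (Cons p ps)
  have p: "prime_in A p" and sub: "set qs \<subseteq> A" "set ps \<subseteq> A"
    using Cons.prems primes_subset[of _ A] by auto
  have u: "u \<in> A" using assms(3) unfolding unit_in_def by blast
  have "prod_list qs * x = p * (u * prod_list ps)" using Cons by (simp add: algebra_simps)
  then have "dvd_in A p (prod_list qs * x)"
    using prod_list_in[OF assms(1) sub(2)] subdomainD(4)[OF assms(1) u] unfolding dvd_in_def by blast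
  then consider "dvd_in A p x" | "dvd_in A p (prod_list qs)"
    using prime_inD(4)[OF p] prod_list_in[OF assms(1) sub(1)] Cons by blast
  then show ?case
  proof cases
    case 1
    then obtain y where y: "y \<in> A" "x = p * y" unfolding dvd_in_def by blast
    then have "p * (prod_list qs * y) = p * (u * prod_list ps)" using Cons by (simp add: algebra_simps)
    then have "prod_list qs * y = u * prod_list ps" using prime_inD(2)[OF p] by (metis mult_left_cancel)
    then show ?thesis using Cons.IH[of qs y] Cons.prems y by simp
  next
    case 2
    then obtain q where q: "q \<in> set qs" "dvd_in A p q"
      using prime_dvd_prod_list[OF assms(1) p sub(1)] by blast
    then obtain w where w: "unit_in A w" "q = p * w"
      using prime_dvd_prime[OF assms(1) p] Cons by blast
    have wA: "w \<in> A" using w unfolding unit_in_def by blast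
    have "p * (prod_list (remove1 q qs) * (w * x)) = p * (u * prod_list ps)"
      using Cons.prems(4) prod_list_remove1[OF q(1)] w by (simp add: algebra_simps)
    then have "prod_list (remove1 q qs) * (w * x) = u * prod_list ps"
      using prime_inD(2)[OF p] by (metis mult_left_cancel)
    moreover have "\<forall>r\<in>set (remove1 q qs). prime_in A r" using Cons.prems(2) notin_set_remove1 by fast
    ultimately have "length (remove1 q qs) \<le> length ps"
      using Cons.IH[of "remove1 q qs" "w * x"] Cons.prems subdomainD(4)[OF assms(1) wA] by auto
    then show ?thesis using q(1) by (simp add: length_remove1)
  qed
qed

lemma prime_product_mult:
  assumes "subdomain A" "prime_product A a" "prime_product A b"
  shows "prime_product A (a * b)"
proof -
  obtain u ps v qs where "unit_in A u" "\<forall>p\<in>set ps. prime_in A p" "a = u * prod_list ps"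
    "unit_in A v" "\<forall>p\<in>set qs. prime_in A p" "b = v * prod_list qs"
    using assms(2,3) unfolding prime_product_def by blast
  then show ?thesis unfolding prime_product_def
    by (intro exI[of _ "u * v"] exI[of _ "ps @ qs"])
      (auto intro: unit_in_mult[OF assms(1)] simp: algebra_simps)
qed

lemma prime_product_unit: "unit_in A u \<Longrightarrow> prime_product A u"
  unfolding prime_product_def by (intro exI[of _ u] exI[of _ "[]"]) auto

lemma prime_product_prime: "subdomain A \<Longrightarrow> prime_in A p \<Longrightarrow> prime_product A p"
  unfolding prime_product_def by (intro exI[of _ 1] exI[of _ "[p]"]) (auto intro: unit_in_one)

lemma prime_product_induct [consumes 2, case_names unit prime]:
  assumes "subdomain A" "prime_product A a"
    and unit: "\<And>u. unit_in A u \<Longrightarrow> P u"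
    and prime: "\<And>p b. prime_in A p \<Longrightarrow> prime_product A b \<Longrightarrow> b \<in> A \<Longrightarrow> b \<noteq> 0 \<Longrightarrow> P b \<Longrightarrow> P (p * b)"
  shows "P a"
proof -
  obtain u ps where u: "unit_in A u" and ps: "\<forall>p\<in>set ps. prime_in A p" and a: "a = u * prod_list ps"
    using assms(2) unfolding prime_product_def by blast
  have "P (u * prod_list ps)" using ps
  proof (induction ps)
    case (Cons p ps)
    let ?b = "u * prod_list ps"
    have 1: "prime_product A ?b" using Cons u unfolding prime_product_def by auto
    have "set ps \<subseteq> A" using Cons primes_subset[of ps A] by simp
    then have 2: "?b \<in> A" using u prod_list_in[OF assms(1)] subdomainD(4)[OF assms(1)]
      unfolding unit_in_def by blast
    have 3: "?b \<noteq> 0" using unit_in_nonzero[OF u] Cons prime_inD(2) by (force simp: prod_list_zero_iff)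
    have "P (p * ?b)" using prime[OF _ 1 2 3] Cons by simp
    then show ?case by (simp add: algebra_simps)
  qed (simp add: unit u)
  then show ?thesis using a by simp
qed


definition polys_over :: "'a::idom set \<Rightarrow> 'a poly set" where
  "polys_over A = {p. \<forall>i. coeff p i \<in> A}"

lemma polys_overI: "(\<And>i. coeff p i \<in> A) \<Longrightarrow> p \<in> polys_over A"
  and polys_overD: "p \<in> polys_over A \<Longrightarrow> coeff p i \<in> A"
  unfolding polys_over_def by auto

lemma subdomain_polys_over:
  assumes "subdomain A"
  shows "subdomain (polys_over A)"
  unfolding subdomain_def
proof (intro conjI ballI polys_overI)
  fix i show "coeff 1 i \<in> A" using subdomainD[OF assms] by (cases i) auto
next
  fix p q :: "'a poly" and i assume *: "p \<in> polys_over A" "q \<in> polys_over A"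
  show "coeff (p + q) i \<in> A" using subdomainD(3)[OF assms polys_overD polys_overD, OF *] by simp
  show "coeff (p * q) i \<in> A" unfolding coeff_mult
    using * polys_overD by (intro subdomain_sum[OF assms] subdomainD(4)[OF assms]) blast+
next
  fix p :: "'a poly" and i assume *: "p \<in> polys_over A"
  show "coeff (- p) i \<in> A" using subdomainD(5)[OF assms polys_overD, OF *] by simp
qed

lemma smult_in: "subdomain A \<Longrightarrow> c \<in> A \<Longrightarrow> p \<in> polys_over A \<Longrightarrow> smult c p \<in> polys_over A"
  unfolding polys_over_def by (auto intro: subdomainD)

lemma monom_in: "subdomain A \<Longrightarrow> c \<in> A \<Longrightarrow> monom c k \<in> polys_over A"
  unfolding polys_over_def by (auto intro: subdomainD)

lemma const_in: "subdomain A \<Longrightarrow> c \<in> A \<Longrightarrow> [:c:] \<in> polys_over A"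
  using monom_in[of A c 0] by (simp add: monom_0)

lemma dvd_in_const_iff:
  assumes "subdomain A" "p \<in> polys_over A" "c \<noteq> 0"
  shows "dvd_in (polys_over A) [:c:] p \<longleftrightarrow> (\<forall>i. dvd_in A c (coeff p i))"
proof
  assume "dvd_in (polys_over A) [:c:] p"
  then show "\<forall>i. dvd_in A c (coeff p i)" unfolding dvd_in_def using polys_overD by fastforce
next
  assume "\<forall>i. dvd_in A c (coeff p i)"
  then obtain f where f: "\<And>i. f i \<in> A" "\<And>i. coeff p i = c * f i" unfolding dvd_in_def by metis
  define q where "q = Abs_poly f"
  have "\<forall>\<^sub>\<infinity>i. f i = 0" using f(2) assms(3) MOST_coeff_eq_0[of p] by simp
  then have q: "coeff q = f" unfolding q_def by (simp add: Abs_poly_inverse)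
  then have "p = [:c:] * q" using f by (intro poly_eqI) simp
  moreover have "q \<in> polys_over A" using q f by (intro polys_overI) simp
  ultimately show "dvd_in (polys_over A) [:c:] p" unfolding dvd_in_def by blast
qed

text \<open>Gauss: in a product of two polynomials with lowest coefficients of indices \<open>i\<close> and \<open>j\<close> not
  divisible by \<open>c\<close>, the coefficient of index \<open>i + j\<close> is not divisible by \<open>c\<close>.\<close>

lemma prime_in_const:
  assumes A: "subdomain A" and c: "prime_in A c"
  shows "prime_in (polys_over A) [:c:]"
proof -
  note cD = prime_inD[OF c]
  have AX: "subdomain (polys_over A)" using A by (rule subdomain_polys_over)
  have "\<not> unit_in (polys_over A) [:c:]"
  proof
    assume "unit_in (polys_over A) [:c:]"
    then obtain q where q: "q \<in> polys_over A" "[:c:] * q = 1" unfolding unit_in_def by blast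
    then have "c * coeff q 0 = 1" by (metis coeff_smult mult_pCons_left mult_zero_left pCons_0_0 add.right_neutral one_poly_eq_simps(1) coeff_pCons_0)
    then show False using cD polys_overD[OF q(1)] unfolding unit_in_def by blast
  qed
  moreover have "dvd_in (polys_over A) [:c:] p \<or> dvd_in (polys_over A) [:c:] q"
    if pq: "p \<in> polys_over A" "q \<in> polys_over A" "dvd_in (polys_over A) [:c:] (p * q)" for p q
  proof (rule ccontr)
    assume "\<not> ?thesis"
    then have ex: "\<exists>i. \<not> dvd_in A c (coeff p i)" "\<exists>i. \<not> dvd_in A c (coeff q i)"
      using dvd_in_const_iff[OF A _ cD(2)] pq by blast+
    define i j where "i = (LEAST i. \<not> dvd_in A c (coeff p i))"
      and "j = (LEAST i. \<not> dvd_in A c (coeff q i))"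
    have i: "\<not> dvd_in A c (coeff p i)" "\<And>k. k < i \<Longrightarrow> dvd_in A c (coeff p k)"
      unfolding i_def using LeastI_ex[OF ex(1)] by (auto dest: not_less_Least)
    have j: "\<not> dvd_in A c (coeff q j)" "\<And>k. k < j \<Longrightarrow> dvd_in A c (coeff q k)"
      unfolding j_def using LeastI_ex[OF ex(2)] by (auto dest: not_less_Least)
    have rest: "dvd_in A c (\<Sum>k\<in>{..i+j}-{i}. coeff p k * coeff q (i + j - k))"
    proof -
      have "\<exists>d\<in>A. coeff p k * coeff q (i + j - k) = c * d" if "k \<in> {..i+j}-{i}" for k
      proof (cases "k < i")
        case True
        then obtain d where "d \<in> A" "coeff p k = c * d" using i(2) unfolding dvd_in_def by blast
        then show ?thesis using polys_overD[OF pq(2)] subdomainD(4)[OF A]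
          by (intro bexI[of _ "d * coeff q (i + j - k)"]) auto
      next
        case False
        then have "i + j - k < j" using that by auto
        then obtain d where "d \<in> A" "coeff q (i + j - k) = c * d" using j(2) unfolding dvd_in_def by blast
        then show ?thesis using polys_overD[OF pq(1)] subdomainD(4)[OF A]
          by (intro bexI[of _ "d * coeff p k"]) auto
      qed
      then obtain d where d: "\<And>k. k \<in> {..i+j}-{i} \<Longrightarrow> d k \<in> A"
        "\<And>k. k \<in> {..i+j}-{i} \<Longrightarrow> coeff p k * coeff q (i + j - k) = c * d k" by metis
      have "(\<Sum>k\<in>{..i+j}-{i}. coeff p k * coeff q (i + j - k)) = c * sum d ({..i+j}-{i})"
        using d(2) by (simp add: sum_distrib_left)
      moreover have "sum d ({..i+j}-{i}) \<in> A" using d(1) by (rule subdomain_sum[OF A])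
      ultimately show ?thesis by (rule dvd_inI)
    qed
    have "coeff (p * q) (i + j) = coeff p i * coeff q j + (\<Sum>k\<in>{..i+j}-{i}. coeff p k * coeff q (i + j - k))"
      unfolding coeff_mult by (subst sum.remove[of _ i]) auto
    moreover have "dvd_in A c (coeff (p * q) (i + j))"
      using dvd_in_const_iff[OF A subdomainD(4)[OF AX pq(1,2)] cD(2)] pq(3) by blast
    ultimately have "dvd_in A c (coeff p i * coeff q j)" using rest subdomainD(6)[OF A]
      unfolding dvd_in_def by (metis add_diff_cancel_right' right_diff_distrib)
    then show False using cD(4) polys_overD pq(1,2) i(1) j(1) by blast
  qed
  ultimately show ?thesis unfolding prime_in_def using cD const_in[OF A] by simp
qed

lemma unit_in_const: "subdomain A \<Longrightarrow> unit_in A u \<Longrightarrow> unit_in (polys_over A) [:u:]"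
  unfolding unit_in_def by (auto simp: one_pCons intro!: const_in bexI[of _ "[:_:]"])

text \<open>Division with remainder after clearing the leading coefficient of the divisor; over a ring the multiplier \<open>c\<close>
  cannot be avoided, and is removed afterwards by cancelling constants.\<close>

lemma pseudo_division:
  assumes A: "subdomain A" and d: "d \<in> polys_over A" "d \<noteq> 0" and g: "g \<in> polys_over A"
  obtains c q s where "c \<in> A" "c \<noteq> 0" "q \<in> polys_over A" "s \<in> polys_over A"
    "smult c g = q * d + s" "s = 0 \<or> degree s < degree d"
proof -
  note AX = subdomainD[OF subdomain_polys_over[OF A]]
  have "\<exists>c q s. c \<in> A \<and> c \<noteq> 0 \<and> q \<in> polys_over A \<and> s \<in> polys_over A \<and>
    smult c g = q * d + s \<and> (s = 0 \<or> degree s < degree d)"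
    using g
  proof (induction "degree g" arbitrary: g rule: less_induct)
    case less
    let ?c = "lead_coeff d"
    show ?case
    proof (cases "g = 0 \<or> degree g < degree d")
      case True
      then show ?thesis using less.prems AX(2) subdomainD(1)[OF A]
        by (intro exI[of _ 1] exI[of _ 0] exI[of _ g]) auto
    next
      case False
      define m where "m = monom (lead_coeff g) (degree g - degree d)"
      define h where "h = smult ?c g - m * d"
      have m: "m \<in> polys_over A" unfolding m_def using monom_in[OF A] polys_overD[OF less.prems] by blast
      have h: "h \<in> polys_over A" unfolding h_def
        by (intro AX(6) AX(4) m d(1) smult_in[OF A polys_overD[OF d(1)] less.prems])
      have dm: "degree (m * d) = degree g" "coeff (m * d) (degree g) = ?c * lead_coeff g"
        using False d(2) unfolding m_def by (auto simp: degree_mult_eq degree_monom_eq coeff_monom_mult)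
      have "degree h \<le> degree g" unfolding h_def
        using dm d(2) by (intro degree_diff_le) auto
      moreover have "coeff h (degree g) = 0" unfolding h_def using dm by simp
      ultimately have hd: "h = 0 \<or> degree h < degree g"
        by (metis leading_coeff_0_iff le_neq_implies_less)
      show ?thesis
      proof (cases "h = 0")
        case True
        then show ?thesis using m d AX(2) polys_overD[OF d(1)] unfolding h_def
          by (intro exI[of _ ?c] exI[of _ m] exI[of _ 0]) auto
      next
        case nz: False
        then obtain c q s where *: "c \<in> A" "c \<noteq> 0" "q \<in> polys_over A" "s \<in> polys_over A"
          "smult c h = q * d + s" "s = 0 \<or> degree s < degree d" using less.hyps[OF _ h] hd by blast
        have "smult (c * ?c) g = (smult c m + q) * d + s"
          using *(5) unfolding h_def by (simp add: algebra_simps smult_diff_right)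
        moreover have "smult c m + q \<in> polys_over A" by (intro AX(3) smult_in[OF A] * m)
        ultimately show ?thesis using * d(2) polys_overD[OF d(1)] subdomainD(4)[OF A]
          by (intro exI[of _ "c * ?c"] exI[of _ "smult c m + q"] exI[of _ s]) auto
      qed
    qed
  qed
  then show ?thesis using that by blast
qed

text \<open>Constants can be cancelled from a factorisation because their prime factors stay prime.\<close>

lemma cancel_constant:
  assumes A: "subdomain A" and c: "prime_product A c"
    and "g \<in> polys_over A" "q \<in> polys_over A" "d \<in> polys_over A" "smult c g = q * d"
  shows "\<exists>q'\<in>polys_over A. \<exists>d'\<in>polys_over A. \<exists>a\<in>A. \<exists>b\<in>A. a \<noteq> 0 \<and> b \<noteq> 0 \<and>
    q = smult a q' \<and> d = smult b d' \<and> g = q' * d'"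
  using A c assms(4-6)
proof (induction c arbitrary: q d rule: prime_product_induct)
  case (unit u)
  then obtain v where v: "v \<in> A" "u \<in> A" "v * u = 1" unfolding unit_in_def by (auto simp: mult.commute)
  then have "g = smult v (smult u g)" by simp
  also have "\<dots> = smult v q * d" using unit by simp
  finally have "g = smult v q * d" .
  moreover have "q = smult u (smult v q)" using v by (simp add: mult.commute)
  moreover have "u \<noteq> 0" using v by auto
  ultimately show ?case using smult_in[OF A v(1) unit(2)] unit v subdomainD(1)[OF A]
    by (intro bexI[of _ "smult v q"] bexI[of _ d] bexI[of _ u] bexI[of _ 1]) auto
next
  case (prime p b)
  note pD = prime_inD[OF prime(1)]
  have eq: "[:p:] * smult b g = q * d" using prime by (simp add: mult.commute)
  then have "dvd_in (polys_over A) [:p:] (q * d)"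
    using smult_in[OF A prime(3) assms(3)] by (intro dvd_inI[OF eq[symmetric]])
  then consider "dvd_in (polys_over A) [:p:] q" | "dvd_in (polys_over A) [:p:] d"
    using prime_inD(4)[OF prime_in_const[OF A prime(1)]] prime by blast
  then show ?case
  proof cases
    case 1
    then obtain q1 where q1: "q1 \<in> polys_over A" "q = [:p:] * q1" unfolding dvd_in_def by blast
    then have "[:p:] * smult b g = [:p:] * (q1 * d)" using eq by (simp only: mult.assoc)
    then have "smult b g = q1 * d" using pD(2) by (metis mult_left_cancel pCons_eq_0_iff)
    then obtain q' d' a e where *: "q' \<in> polys_over A" "d' \<in> polys_over A" "a \<in> A" "e \<in> A" "a \<noteq> 0" "e \<noteq> 0"
      "q1 = smult a q'" "d = smult e d'" "g = q' * d'" using prime.IH[OF q1(1) prime(7)] by blast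
    then have "q = smult (p * a) q'" using q1 by (simp add: mult.commute)
    then show ?thesis using * pD subdomainD(4)[OF A pD(1)] by (metis mult_eq_0_iff)
  next
    case 2
    then obtain q1 where q1: "q1 \<in> polys_over A" "d = [:p:] * q1" unfolding dvd_in_def by blast
    then have "[:p:] * smult b g = [:p:] * (q * q1)" using eq by (simp only: mult.left_commute)
    then have "smult b g = q * q1" using pD(2) by (metis mult_left_cancel pCons_eq_0_iff)
    then obtain q' d' a e where *: "q' \<in> polys_over A" "d' \<in> polys_over A" "a \<in> A" "e \<in> A" "a \<noteq> 0" "e \<noteq> 0"
      "q = smult a q'" "q1 = smult e d'" "g = q' * d'" using prime.IH[OF prime(6) q1(1)] by blast
    then have "d = smult (p * e) d'" using q1 by (simp add: mult.commute)
    then show ?thesis using * pD subdomainD(4)[OF A pD(1)] by (metis mult_eq_0_iff)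
  qed
qed

text \<open>Primitivity is tested on prime constants, so that the content can be split off one prime at a time.\<close>

definition primitive_over :: "'a::idom set \<Rightarrow> 'a poly \<Rightarrow> bool" where
  "primitive_over A g \<longleftrightarrow> (\<forall>p. prime_in A p \<longrightarrow> \<not> dvd_in (polys_over A) [:p:] g)"

lemma primitive_dvd_smult:
  assumes A: "subdomain A" and c: "prime_product A c"
    and "g \<in> polys_over A" "h \<in> polys_over A" "primitive_over A g" "dvd_in (polys_over A) g (smult c h)"
  shows "dvd_in (polys_over A) g h"
  using A c assms(6)
proof (induction c rule: prime_product_induct)
  case (unit u)
  then obtain v where v: "v \<in> A" "v * u = 1" unfolding unit_in_def by (auto simp: mult.commute)
  obtain z where z: "z \<in> polys_over A" "smult u h = g * z" using unit unfolding dvd_in_def by blast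
  have "h = smult v (smult u h)" using v by simp
  also have "\<dots> = g * smult v z" using z by simp
  finally show ?case using smult_in[OF A v(1) z(1)] by (rule dvd_inI)
next
  case (prime p b)
  note pD = prime_inD[OF prime(1)]
  obtain z where z: "z \<in> polys_over A" "smult (p * b) h = g * z" using prime unfolding dvd_in_def by blast
  have eq: "[:p:] * smult b h = g * z" using z by (simp add: mult.commute)
  have "dvd_in (polys_over A) [:p:] (g * z)"
    using smult_in[OF A prime(3) assms(4)] by (intro dvd_inI[OF eq[symmetric]])
  then have "dvd_in (polys_over A) [:p:] z"
    using prime_inD(4)[OF prime_in_const[OF A prime(1)] assms(3) z(1)] assms(5) prime(1)
    unfolding primitive_over_def by blast
  then obtain y where y: "y \<in> polys_over A" "z = [:p:] * y" unfolding dvd_in_def by blast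
  then have "[:p:] * smult b h = [:p:] * (g * y)" using eq by (simp only: mult.left_commute)
  then have "smult b h = g * y" using pD(2) by (metis mult_left_cancel pCons_eq_0_iff)
  then show ?case using prime.IH y(1) by (auto intro: dvd_inI)
qed

text \<open>A primitive polynomial without factors of smaller degree is prime: a nonzero element \<open>d\<close> of least
  degree in the ideal of \<open>g\<close> and \<open>h\<close> divides \<open>g\<close> up to a constant, so after cancelling the
  constant \<open>d\<close> is proportional to \<open>g\<close>, and \<open>g\<close> divides \<open>h\<close>, or \<open>d\<close> is constant, and \<open>g\<close> divides \<open>k\<close>
  as soon as it divides \<open>h k\<close>.\<close>

lemma primitive_irreducible_prime:
  assumes fact: "factorial_domain A" and g: "g \<in> polys_over A" "primitive_over A g" "0 < degree g"
    and irr: "\<And>a b. a \<in> polys_over A \<Longrightarrow> b \<in> polys_over A \<Longrightarrow> g = a * b \<Longrightarrow> degree a = 0 \<or> degree b = 0"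
  shows "prime_in (polys_over A) g"
proof -
  have A: "subdomain A" and fac: "\<And>a. a \<in> A \<Longrightarrow> a \<noteq> 0 \<Longrightarrow> prime_product A a"
    using fact unfolding factorial_domain_def by auto
  note AX = subdomainD[OF subdomain_polys_over[OF A]]
  have nu: "\<not> unit_in (polys_over A) g"
  proof
    assume "unit_in (polys_over A) g"
    then obtain v where "g * v = 1" unfolding unit_in_def by blast
    then have "g dvd 1" by (metis dvdI)
    then show False using g(3) by (metis degree_1 dvd_imp_degree_le le_zero_eq less_numeral_extra(3) one_neq_zero)
  qed
  have "dvd_in (polys_over A) g h \<or> dvd_in (polys_over A) g k"
    if hk: "h \<in> polys_over A" "k \<in> polys_over A" "dvd_in (polys_over A) g (h * k)" for h k
  proof -
    define J where "J = {s * g + t * h | s t. s \<in> polys_over A \<and> t \<in> polys_over A}"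
    have gJ: "g \<in> J" and hJ: "h \<in> J" unfolding J_def using AX(1,2)
      by (force intro: exI[of _ 1] exI[of _ 0])+
    have JA: "J \<subseteq> polys_over A" unfolding J_def using AX(3,4) g(1) hk(1) by blast
    have Jmod: "smult c x - q * y \<in> J" if "x \<in> J" "y \<in> J" "c \<in> A" "q \<in> polys_over A" for x y c q
    proof -
      obtain s t s' t' where *: "x = s * g + t * h" "y = s' * g + t' * h" "s \<in> polys_over A"
        "t \<in> polys_over A" "s' \<in> polys_over A" "t' \<in> polys_over A"
        using \<open>x \<in> J\<close> \<open>y \<in> J\<close> unfolding J_def by blast
      have "smult c x - q * y = (smult c s - q * s') * g + (smult c t - q * t') * h"
        unfolding * by (simp add: algebra_simps smult_add_right)
      then show ?thesis unfolding J_def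
        using AX(4,6) smult_in[OF A \<open>c \<in> A\<close>] * \<open>q \<in> polys_over A\<close> by blast
    qed
    have "\<exists>d. (d \<in> J \<and> d \<noteq> 0) \<and> (\<forall>e. e \<in> J \<and> e \<noteq> 0 \<longrightarrow> degree d \<le> degree e)"
      using gJ g(3) by (intro ex_has_least_nat[of _ g]) auto
    then obtain d where d: "d \<in> J" "d \<noteq> 0" "\<And>e. e \<in> J \<Longrightarrow> e \<noteq> 0 \<Longrightarrow> degree d \<le> degree e" by blast
    have dA: "d \<in> polys_over A" using d(1) JA by blast
    have divides: "\<exists>c q. c \<in> A \<and> c \<noteq> 0 \<and> q \<in> polys_over A \<and> smult c x = q * d" if x: "x \<in> J" for x
    proof -
      obtain c q s where *: "c \<in> A" "c \<noteq> 0" "q \<in> polys_over A" "s \<in> polys_over A"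
        "smult c x = q * d + s" "s = 0 \<or> degree s < degree d"
        using pseudo_division[OF A dA d(2), of x] x JA by blast
      have "s = smult c x - q * d" using * by simp
      then have "s \<in> J" using Jmod[OF x d(1) *(1,3)] by simp
      then have "s = 0" using *(6) d(3)[of s] by (meson leD)
      then show ?thesis using * by auto
    qed
    obtain c q where c: "c \<in> A" "c \<noteq> 0" "q \<in> polys_over A" "smult c g = q * d"
      using divides[OF gJ] by blast
    obtain q' d' a b where *: "q' \<in> polys_over A" "d' \<in> polys_over A" "a \<in> A" "b \<in> A" "a \<noteq> 0" "b \<noteq> 0"
      "q = smult a q'" "d = smult b d'" "g = q' * d'"
      using cancel_constant[OF A fac[OF c(1,2)] g(1) c(3) dA c(4)] by blast
    show ?thesis
    proof (cases "degree d' = 0")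
      case True
      then obtain e where e: "d' = [:e:]" by (metis degree_eq_zeroE)
      then have de: "d = [:b * e:]" using * by simp
      have eA: "e \<in> A" using polys_overD[OF *(2), of 0] e by simp
      obtain s t where st: "d = s * g + t * h" "s \<in> polys_over A" "t \<in> polys_over A"
        using d(1) unfolding J_def by blast
      obtain z where z: "z \<in> polys_over A" "h * k = g * z" using hk(3) unfolding dvd_in_def by blast
      have "smult (b * e) k = d * k" using de by simp
      also have "\<dots> = s * g * k + t * (h * k)" unfolding st(1) by (simp add: algebra_simps)
      also have "\<dots> = g * (s * k + t * z)" unfolding z(2) by (simp add: algebra_simps)
      finally have "dvd_in (polys_over A) g (smult (b * e) k)"
        using AX(3,4) st z hk by (blast intro: dvd_inI)
      moreover have "b * e \<noteq> 0" using de d(2) by auto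
      ultimately show ?thesis
        using primitive_dvd_smult[OF A fac g(1) hk(2) g(2)] subdomainD(4)[OF A *(4) eA] by blast
    next
      case False
      then have "degree q' = 0" using irr[OF *(1,2,9)] by simp
      then obtain e where e: "q' = [:e:]" by (metis degree_eq_zeroE)
      have eA: "e \<in> A" using polys_overD[OF *(1), of 0] e by simp
      have e0: "e \<noteq> 0" using e * g(3) by auto
      obtain c2 q2 where c2: "c2 \<in> A" "c2 \<noteq> 0" "q2 \<in> polys_over A" "smult c2 h = q2 * d"
        using divides[OF hJ] by blast
      have "smult (e * c2) h = smult e (q2 * d)" using c2 by (metis smult_smult)
      also have "\<dots> = g * smult b q2" using *(8,9) e by (simp add: algebra_simps)
      finally have "dvd_in (polys_over A) g (smult (e * c2) h)"
        using smult_in[OF A *(4) c2(3)] by (blast intro: dvd_inI)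
      then show ?thesis
        using primitive_dvd_smult[OF A fac g(1) hk(1) g(2)] subdomainD(4)[OF A eA c2(1)] e0 c2(2)
        by simp
    qed
  qed
  then show ?thesis unfolding prime_in_def using g nu by auto
qed

text \<open>Prime constants are split off as long as possible. Their number is bounded by the number of prime factors of the
  leading coefficient, so a maximal choice leaves a primitive cofactor.\<close>

lemma content_extraction:
  assumes fact: "factorial_domain A" and g: "g \<in> polys_over A" "g \<noteq> 0"
  obtains a h where "prime_product (polys_over A) a" "h \<in> polys_over A" "h \<noteq> 0" "primitive_over A h"
    "g = a * h" "degree h = degree g"
proof -
  have A: "subdomain A" and fac: "\<And>a. a \<in> A \<Longrightarrow> a \<noteq> 0 \<Longrightarrow> prime_product A a"
    using fact unfolding factorial_domain_def by auto
  have AX: "subdomain (polys_over A)" using subdomain_polys_over[OF A] .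
  define P where "P = (\<lambda>k. \<exists>ps h. length ps = k \<and> (\<forall>p\<in>set ps. prime_in A p) \<and> h \<in> polys_over A \<and>
    g = smult (prod_list ps) h)"
  have P0: "P 0" unfolding P_def using g by (intro exI[of _ "[]"] exI[of _ g]) auto
  obtain u ps0 where u: "unit_in A u" "\<forall>p\<in>set ps0. prime_in A p" "lead_coeff g = u * prod_list ps0"
    using fac[OF polys_overD[OF g(1)], of "degree g"] g(2) unfolding prime_product_def by auto
  have bound: "k \<le> length ps0" if "P k" for k
  proof -
    obtain ps h where *: "length ps = k" "\<forall>p\<in>set ps. prime_in A p" "h \<in> polys_over A"
      "g = smult (prod_list ps) h" using \<open>P k\<close> unfolding P_def by blast
    then have "prod_list ps * lead_coeff h = u * prod_list ps0" using u(3) by (metis lead_coeff_smult)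
    then show ?thesis using prime_divisors_length[OF A u(2,1) *(2) polys_overD[OF *(3)]] *(1) by blast
  qed
  obtain k where k: "P k" "\<And>j. P j \<Longrightarrow> j \<le> k"
    using P0 bound Nat.ex_has_greatest_nat[of P 0 "length ps0"] by blast
  obtain ps h where *: "length ps = k" "\<forall>p\<in>set ps. prime_in A p" "h \<in> polys_over A"
    "g = smult (prod_list ps) h" using \<open>P k\<close> unfolding P_def by blast
  have prim: "primitive_over A h" unfolding primitive_over_def
  proof (intro allI impI notI)
    fix p assume p: "prime_in A p" "dvd_in (polys_over A) [:p:] h"
    then obtain h' where "h' \<in> polys_over A" "h = [:p:] * h'" unfolding dvd_in_def by blast
    then have "P (Suc k)" unfolding P_def using * p
      by (intro exI[of _ "p # ps"] exI[of _ h']) (auto simp: mult.commute)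
    then show False using k(2) by fastforce
  qed
  have "prime_product (polys_over A) [:prod_list ps:]" using *(2)
  proof (induction ps)
    case Nil
    then show ?case using prime_product_unit[OF unit_in_one[OF AX]] by (simp add: one_pCons)
  next
    case (Cons p ps)
    have "prime_product (polys_over A) ([:p:] * [:prod_list ps:])"
      using Cons prime_product_mult[OF AX prime_product_prime[OF AX prime_in_const[OF A]],
          of p "[:prod_list ps:]"] by simp
    then show ?case by (simp add: mult.commute)
  qed
  moreover have "prod_list ps \<noteq> 0" using *(4) g(2) by auto
  ultimately show ?thesis using that[of "[:prod_list ps:]" h] * prim g(2) by auto
qed

text \<open>By induction on the degree: a primitive polynomial is a unit, or splits into factors of smaller degree, or is
  prime because it does not split.\<close>

theorem factorial_polys_over:
  assumes fact: "factorial_domain A"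
  shows "factorial_domain (polys_over A)"
proof -
  have A: "subdomain A" and fac: "\<And>a. a \<in> A \<Longrightarrow> a \<noteq> 0 \<Longrightarrow> prime_product A a"
    using fact unfolding factorial_domain_def by auto
  have AX: "subdomain (polys_over A)" using subdomain_polys_over[OF A] .
  have "prime_product (polys_over A) g" if "g \<in> polys_over A" "g \<noteq> 0" for g
    using that
  proof (induction "degree g" arbitrary: g rule: less_induct)
    case less
    obtain a h where h: "prime_product (polys_over A) a" "h \<in> polys_over A" "h \<noteq> 0" "primitive_over A h"
      "g = a * h" "degree h = degree g" using content_extraction[OF fact less.prems] by blast
    have "prime_product (polys_over A) h"
    proof (cases "degree h = 0")
      case True
      then obtain e where e: "h = [:e:]" by (metis degree_eq_zeroE)
      have eA: "e \<in> A" "e \<noteq> 0" using polys_overD[OF h(2), of 0] e h(3) by auto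
      obtain u ps where u: "unit_in A u" "\<forall>p\<in>set ps. prime_in A p" "e = u * prod_list ps"
        using fac[OF eA] unfolding prime_product_def by blast
      have "ps = []"
      proof (cases ps)
        case (Cons p qs)
        have "e = p * (u * prod_list qs)" unfolding u(3) Cons by simp
        then have "h = [:p:] * [:u * prod_list qs:]" using e by simp
        moreover have "u * prod_list qs \<in> A"
        proof (rule subdomainD(4)[OF A])
          show "u \<in> A" using u(1) unfolding unit_in_def by blast
          show "prod_list qs \<in> A" using u(2) Cons prod_list_in[OF A primes_subset[of qs A]] by simp
        qed
        ultimately have "dvd_in (polys_over A) [:p:] h" by (rule dvd_inI[OF _ const_in[OF A]])
        then show ?thesis using h(4) u(2) Cons unfolding primitive_over_def by auto
      qed
      then show ?thesis using u e prime_product_unit[OF unit_in_const[OF A]] by simp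
    next
      case pos: False
      show ?thesis
      proof (cases "\<exists>b c. b \<in> polys_over A \<and> c \<in> polys_over A \<and> h = b * c \<and> degree b \<noteq> 0 \<and> degree c \<noteq> 0")
        case True
        then obtain b c where bc: "b \<in> polys_over A" "c \<in> polys_over A" "h = b * c"
          "degree b \<noteq> 0" "degree c \<noteq> 0" by blast
        then have nz: "b \<noteq> 0" "c \<noteq> 0" using h(3) by auto
        then have "degree b < degree g" "degree c < degree g" using bc h(6) by (auto simp: degree_mult_eq)
        then have "prime_product (polys_over A) b" "prime_product (polys_over A) c"
          using less.hyps[OF _ bc(1) nz(1)] less.hyps[OF _ bc(2) nz(2)] by simp_all
        then show ?thesis unfolding bc(3) by (rule prime_product_mult[OF AX])
      next
        case False
        then have "prime_in (polys_over A) h"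
          using pos by (intro primitive_irreducible_prime[OF fact h(2,4)]) auto
        then show ?thesis by (rule prime_product_prime[OF AX])
      qed
    qed
    then show ?case unfolding h(5) by (rule prime_product_mult[OF AX h(1)])
  qed
  then show ?thesis unfolding factorial_domain_def using AX by blast
qed


section \<open>Laurent polynomials\<close>

text \<open>The character of \<open>u\<close>, a monomial.\<close>

definition chi :: "(nat \<Rightarrow>\<^sub>0 int) \<Rightarrow> laurent" where
  "chi u = Poly_Mapping.single u 1"

definition laurent_ring :: "nat \<Rightarrow> laurent set" where
  "laurent_ring n = {p. keys p \<subseteq> M_lattice n}"

lemma M_lattice_iff: "u \<in> M_lattice n \<longleftrightarrow> (\<forall>i\<ge>n. lookup u i = 0)"
  unfolding M_lattice_def by (auto simp: in_keys_iff subset_iff not_less[symmetric])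

lemma M_lattice_0 [simp]: "0 \<in> M_lattice n"
  and M_lattice_add: "u \<in> M_lattice n \<Longrightarrow> v \<in> M_lattice n \<Longrightarrow> u + v \<in> M_lattice n"
  and M_lattice_diff: "u \<in> M_lattice n \<Longrightarrow> v \<in> M_lattice n \<Longrightarrow> u - v \<in> M_lattice n"
  and M_lattice_uminus: "u \<in> M_lattice n \<Longrightarrow> - u \<in> M_lattice n"
  and M_lattice_cmul: "u \<in> M_lattice n \<Longrightarrow> frag_cmul k u \<in> M_lattice n"
  unfolding M_lattice_iff by (auto simp: lookup_add lookup_minus)

lemma M_lattice_sum: "(\<And>i. i \<in> I \<Longrightarrow> f i \<in> M_lattice n) \<Longrightarrow> sum f I \<in> M_lattice n"
  by (induction I rule: infinite_finite_induct) (auto intro: M_lattice_add)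

lemma chi_0 [simp]: "chi 0 = 1"
  by (simp add: chi_def)

lemma chi_add: "chi (u + v) = chi u * chi v"
  by (simp add: chi_def mult_single)

lemma chi_inverse [simp]: "chi u * chi (- u) = 1" "chi (- u) * chi u = 1"
  by (simp_all add: chi_add[symmetric])

lemma chi_nonzero [simp]: "chi u \<noteq> 0"
  by (metis chi_inverse(1) mult_zero_left zero_neq_one)

lemma keys_chi [simp]: "keys (chi u) = {u}"
  by (simp add: chi_def)

lemma lookup_mult_single:
  fixes q :: laurent
  shows "lookup (q * Poly_Mapping.single w c) v = lookup q (v - w) * c"
proof -
  have "lookup (q * Poly_Mapping.single w c) (l + w) = lookup q l * c" for l
  proof (induction q rule: update_induct)
    case (update f a b)
    have "Poly_Mapping.update a b f = f + Poly_Mapping.single a b"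
      using update(1) by (intro poly_mapping_eqI) (auto simp: lookup_update lookup_add lookup_single when_def in_keys_iff)
    then show ?case using update(3)
      by (simp add: distrib_right lookup_add mult_single lookup_single when_def)
  qed (simp)
  from this[of "v - w"] show ?thesis by simp
qed

lemma lookup_mult_chi: "lookup (q * chi w) v = lookup q (v - w)"
  unfolding chi_def by (simp add: lookup_mult_single)

lemma keys_mult_chi: "keys (q * chi w) = (\<lambda>u. u + w) ` keys q"
proof -
  have "v \<in> (\<lambda>u. u + w) ` keys q \<longleftrightarrow> v - w \<in> keys q" for v
    by (metis (no_types, lifting) add_diff_cancel diff_add_cancel image_iff)
  then show ?thesis by (auto simp: in_keys_iff lookup_mult_chi)
qed

lemma laurent_as_sum: "p = (\<Sum>u\<in>keys p. Poly_Mapping.single u (lookup p u))"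
  by (rule poly_mapping_eqI) (simp add: lookup_sum lookup_single when_def in_keys_iff)

lemma subdomain_laurent_ring: "subdomain (laurent_ring n)"
  unfolding subdomain_def
proof (intro conjI ballI)
  show "1 \<in> laurent_ring n" unfolding laurent_ring_def by simp
  fix p q assume *: "p \<in> laurent_ring n" "q \<in> laurent_ring n"
  then show "p + q \<in> laurent_ring n" unfolding laurent_ring_def using keys_add[of p q] by auto
  show "p * q \<in> laurent_ring n"
    using * keys_mult[of p q] M_lattice_add unfolding laurent_ring_def by blast
  show "- p \<in> laurent_ring n" using * unfolding laurent_ring_def by (auto simp: in_keys_iff subset_iff)
qed

lemmas laurent_ringD = subdomainD[OF subdomain_laurent_ring]

lemma chi_in [simp]: "chi u \<in> laurent_ring n \<longleftrightarrow> u \<in> M_lattice n"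
  unfolding laurent_ring_def by simp

lemma unit_in_chi: "u \<in> M_lattice n \<Longrightarrow> unit_in (laurent_ring n) (chi u)"
  unfolding unit_in_def by (auto intro!: bexI[of _ "chi (- u)"] M_lattice_uminus)

lemma laurent_ring_mono: "m \<le> n \<Longrightarrow> laurent_ring m \<subseteq> laurent_ring n"
  unfolding laurent_ring_def M_lattice_def by fastforce

context
  fixes n :: nat and X Y :: laurent and L L' :: "laurent set"
  defines "X \<equiv> chi (Poly_Mapping.single n 1)" and "Y \<equiv> chi (Poly_Mapping.single n (- 1))"
    and "L \<equiv> laurent_ring n" and "L' \<equiv> laurent_ring (Suc n)"
begin

private lemma XY: "X * Y = 1"
  unfolding X_def Y_def using chi_inverse(1)[of "Poly_Mapping.single n 1"] by (simp add: single_uminus)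

private lemma XY_in: "X \<in> L'" "Y \<in> L'"
  unfolding X_def Y_def L'_def by (auto simp: M_lattice_iff lookup_single when_def)

private lemma sub: "subdomain L" "subdomain L'" "subdomain (polys_over L)"
  unfolding L_def L'_def using subdomain_laurent_ring subdomain_polys_over by auto

private lemma L_sub: "L \<subseteq> L'"
  unfolding L_def L'_def by (rule laurent_ring_mono) simp

private lemma X_power: "X ^ k = chi (Poly_Mapping.single n (int k))"
  by (induction k) (simp_all add: X_def chi_add[symmetric] single_add[symmetric])

private lemma Y_power: "Y ^ k = chi (Poly_Mapping.single n (- int k))"
  by (induction k) (simp_all add: Y_def chi_add[symmetric] single_add[symmetric])

private lemma X_power_Y_power: "X ^ k * Y ^ k = 1"
  by (metis XY power_mult_distrib power_one)

private lemma poly_X_in: "P \<in> polys_over L \<Longrightarrow> poly P X \<in> L'"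
  unfolding poly_altdef using L_sub polys_overD[of P L] XY_in(1) subdomain_power[OF sub(2)]
  by (intro subdomain_sum[OF sub(2)] subdomainD(4)[OF sub(2)]) auto

private lemma lookup_poly_X:
  assumes P: "P \<in> polys_over L" and u: "u \<in> M_lattice n"
  shows "lookup (poly P X) (u + Poly_Mapping.single n (int i)) = lookup (coeff P i) u"
proof -
  have *: "lookup (coeff P j) (u + Poly_Mapping.single n (int i) - Poly_Mapping.single n (int j))
      = (if j = i then lookup (coeff P i) u else 0)" for j
  proof (cases "j = i")
    case False
    let ?w = "u + Poly_Mapping.single n (int i) - Poly_Mapping.single n (int j)"
    have "lookup ?w n \<noteq> 0" using u False unfolding M_lattice_iff by (simp add: lookup_add lookup_minus)
    then have "?w \<notin> M_lattice n" unfolding M_lattice_iff by auto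
    moreover have "coeff P j \<in> L" using P by (rule polys_overD)
    ultimately have "?w \<notin> keys (coeff P j)" unfolding L_def laurent_ring_def by blast
    then show ?thesis using False by (simp add: in_keys_iff)
  qed simp
  have "lookup (poly P X) (u + Poly_Mapping.single n (int i)) =
      (\<Sum>j\<le>degree P. if j = i then lookup (coeff P i) u else 0)"
    unfolding poly_altdef X_power lookup_sum lookup_mult_chi * ..
  also have "\<dots> = lookup (coeff P i) u"
    by (auto simp: coeff_eq_0)
  finally show ?thesis .
qed

private lemma poly_X_eq_0:
  assumes P: "P \<in> polys_over L" and 0: "poly P X = 0"
  shows "P = 0"
proof (rule poly_eqI)
  fix i
  have "lookup (coeff P i) u = 0" for u
  proof (cases "u \<in> M_lattice n")
    case True
    then show ?thesis using lookup_poly_X[OF P True, of i] 0 by simp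
  next
    case False
    then show ?thesis using polys_overD[OF P, of i] unfolding L_def laurent_ring_def by (auto simp: in_keys_iff)
  qed
  then show "coeff P i = coeff 0 i" by (simp add: poly_mapping_eqI)
qed

private lemma poly_X_inj:
  assumes "P \<in> polys_over L" "P' \<in> polys_over L" "poly P X = poly P' X"
  shows "P = P'"
  using poly_X_eq_0[of "P - P'"] subdomainD(6)[OF sub(3) assms(1,2)] assms(3) by simp

text \<open>With \<open>X\<close> the new variable and \<open>Y\<close> its inverse, \<open>L' = L[X, Y]\<close> consists of the elements \<open>Y\<^sup>k P(X)\<close>: these contain
  the monomials and are closed under addition.\<close>

private lemma clear_denominator:
  assumes "f \<in> L'"
  obtains k P where "P \<in> polys_over L" "f = Y ^ k * poly P X"
proof -
  define S where "S = {Y ^ k * poly P X | k P. P \<in> polys_over L}"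
  have 0: "0 \<in> S" unfolding S_def using subdomainD(2)[OF sub(3)] by (force intro: exI[of _ 0])
  have add: "f + g \<in> S" if fg: "f \<in> S" "g \<in> S" for f g
  proof -
    obtain k P l P' where *: "P \<in> polys_over L" "P' \<in> polys_over L" "f = Y ^ k * poly P X" "g = Y ^ l * poly P' X"
      using fg unfolding S_def by blast
    let ?P = "monom 1 l * P + monom 1 k * P'"
    have "?P \<in> polys_over L" using * monom_in[OF sub(1)] subdomainD[OF sub(1)] subdomainD[OF sub(3)] by simp
    moreover have "Y ^ (k + l) * poly ?P X = f + g"
    proof -
      have "Y ^ (k + l) * poly ?P X = Y ^ k * (X ^ l * Y ^ l) * poly P X + (X ^ k * Y ^ k) * Y ^ l * poly P' X"
        by (simp add: poly_monom power_add algebra_simps)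
      then show ?thesis using * by (simp add: X_power_Y_power)
    qed
    ultimately show ?thesis unfolding S_def by (metis (mono_tags, lifting) mem_Collect_eq)
  qed
  have single: "Poly_Mapping.single u c \<in> S" if u: "u \<in> M_lattice (Suc n)" for u c
  proof -
    let ?k = "lookup u n"
    let ?w = "u - Poly_Mapping.single n ?k"
    let ?c = "Poly_Mapping.single ?w c :: laurent"
    have w: "?w \<in> M_lattice n" using u unfolding M_lattice_iff
      by (auto simp: lookup_minus lookup_single when_def)
    then have cL: "?c \<in> L" unfolding L_def laurent_ring_def by simp
    show ?thesis
    proof (cases "?k \<ge> 0")
      case True
      have "monom ?c (nat ?k) \<in> polys_over L" using monom_in[OF sub(1) cL] .
      moreover have "Poly_Mapping.single u c = Y ^ 0 * poly (monom ?c (nat ?k)) X"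
        using True by (simp add: poly_monom X_power chi_def mult_single)
      ultimately show ?thesis unfolding S_def by blast
    next
      case False
      have "[:?c:] \<in> polys_over L" using const_in[OF sub(1) cL] .
      moreover have "Poly_Mapping.single u c = Y ^ nat (- ?k) * poly [:?c:] X"
        using False by (simp add: Y_power chi_def mult_single)
      ultimately show ?thesis unfolding S_def by blast
    qed
  qed
  have "(\<Sum>u\<in>K. Poly_Mapping.single u (lookup f u)) \<in> S" if "K \<subseteq> M_lattice (Suc n)" for K
    using that by (induction K rule: infinite_finite_induct) (auto intro: 0 add single)
  from this[of "keys f"] have "f \<in> S"
    using assms unfolding L'_def laurent_ring_def laurent_as_sum[of f, symmetric] by simp
  then show ?thesis using that unfolding S_def by blast
qed

text \<open>Inverting \<open>X\<close> keeps every prime of \<open>L[X]\<close> prime, except those associated to \<open>X\<close>.\<close>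

private lemma poly_X_prime:
  assumes p: "prime_in (polys_over L) p"
  shows "unit_in L' (poly p X) \<or> prime_in L' (poly p X)"
proof (rule disjCI)
  note pD = prime_inD[OF p]
  assume nonprime: "\<not> prime_in L' (poly p X)"
  show "unit_in L' (poly p X)"
  proof (rule ccontr)
    assume nu: "\<not> unit_in L' (poly p X)"
    have nX: "\<not> dvd_in (polys_over L) p (monom 1 k)" for k
    proof
      assume "dvd_in (polys_over L) p (monom 1 k)"
      then obtain q where q: "q \<in> polys_over L" "monom 1 k = p * q" unfolding dvd_in_def by blast
      then have "poly p X * poly q X = X ^ k" by (metis mult_1 poly_monom poly_mult)
      then have "poly p X * (poly q X * Y ^ k) = 1" by (metis X_power_Y_power mult.assoc)
      then have "unit_in L' (poly p X)" unfolding unit_in_def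
        using poly_X_in[OF pD(1)] poly_X_in[OF q(1)] subdomain_power[OF sub(2) XY_in(2)] subdomainD(4)[OF sub(2)]
        by blast
      then show False using nu by blast
    qed
    have "dvd_in L' (poly p X) f \<or> dvd_in L' (poly p X) g"
      if fg: "f \<in> L'" "g \<in> L'" "dvd_in L' (poly p X) (f * g)" for f g
    proof -
      obtain k F where F: "F \<in> polys_over L" "f = Y ^ k * poly F X" using clear_denominator[OF fg(1)] .
      obtain l G where G: "G \<in> polys_over L" "g = Y ^ l * poly G X" using clear_denominator[OF fg(2)] .
      obtain h where h: "h \<in> L'" "f * g = poly p X * h" using fg(3) unfolding dvd_in_def by blast
      obtain m H where H: "H \<in> polys_over L" "h = Y ^ m * poly H X" using clear_denominator[OF h(1)] .
      have "X ^ m * poly F X * poly G X = X ^ m * (X ^ k * X ^ l) * (f * g)"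
        unfolding F G using X_power_Y_power[of k] X_power_Y_power[of l]
        by (simp add: algebra_simps) (metis (no_types, lifting) mult.assoc mult.commute mult_1_right)
      also have "\<dots> = X ^ m * Y ^ m * (poly p X * (X ^ k * X ^ l) * poly H X)" unfolding h(2) H by (simp add: algebra_simps)
      finally have "poly (monom 1 m * (F * G)) X = poly (p * (monom 1 (k + l) * H)) X"
        by (simp add: X_power_Y_power poly_monom power_add algebra_simps)
      moreover have mo: "monom 1 j \<in> polys_over L" for j using monom_in[OF sub(1)] subdomainD(1)[OF sub(1)] by blast
      ultimately have "monom 1 m * (F * G) = p * (monom 1 (k + l) * H)"
        using poly_X_inj subdomainD(4)[OF sub(3)] F(1) G(1) H(1) pD(1) by presburger
      then have "dvd_in (polys_over L) p (monom 1 m * (F * G))"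
        using mo H(1) subdomainD(4)[OF sub(3)] unfolding dvd_in_def by blast
      then have "dvd_in (polys_over L) p F \<or> dvd_in (polys_over L) p G"
        using pD(4) mo F(1) G(1) subdomainD(4)[OF sub(3)] nX by meson
      moreover have "dvd_in L' (poly p X) (Y ^ j * poly E X)" if E: "dvd_in (polys_over L) p E" for j E
      proof -
        obtain q where q: "q \<in> polys_over L" "E = p * q" using E unfolding dvd_in_def by blast
        then have "Y ^ j * poly E X = poly p X * (Y ^ j * poly q X)" by (simp add: algebra_simps)
        then show ?thesis using poly_X_in[OF q(1)] subdomain_power[OF sub(2) XY_in(2)] subdomainD(4)[OF sub(2)]
          by (blast intro: dvd_inI)
      qed
      ultimately show ?thesis using F G by blast
    qed
    then have "prime_in L' (poly p X)" unfolding prime_in_def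
      using poly_X_in[OF pD(1)] nu pD(2) poly_X_eq_0[OF pD(1)] by blast
    then show False using nonprime by blast
  qed
qed

private lemma factorial_step:
  assumes "factorial_domain L"
  shows "factorial_domain L'"
  unfolding factorial_domain_def
proof (intro conjI ballI impI)
  show "subdomain L'" using sub by blast
  fix f assume f: "f \<in> L'" "f \<noteq> 0"
  obtain k P where P: "P \<in> polys_over L" "f = Y ^ k * poly P X" using clear_denominator[OF f(1)] .
  have "P \<noteq> 0" using P f by auto
  then have "prime_product (polys_over L) P"
    using factorial_polys_over[OF assms] P(1) unfolding factorial_domain_def by blast
  then have 1: "prime_product L' (poly P X)" using sub(3)
  proof (induction rule: prime_product_induct[OF sub(3), consumes 1])
    case (1 u)
    then obtain v where v: "u \<in> polys_over L" "v \<in> polys_over L" "u * v = 1" unfolding unit_in_def by blast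
    then have "poly u X * poly v X = 1" by (metis poly_1 poly_mult)
    then have "unit_in L' (poly u X)" unfolding unit_in_def using poly_X_in v by blast
    then show ?case by (rule prime_product_unit)
  next
    case (2 p b)
    then have "prime_product L' (poly p X)"
      using poly_X_prime prime_product_unit prime_product_prime[OF sub(2)] by blast
    then show ?case using 2 prime_product_mult[OF sub(2)] by simp
  qed
  have "X ^ k \<in> L'" "Y ^ k \<in> L'" using subdomain_power[OF sub(2)] XY_in by auto
  then have "unit_in L' (Y ^ k)" using X_power_Y_power[of k] unfolding unit_in_def by (auto simp: mult.commute)
  then show "prime_product L' f" unfolding P(2)
    using 1 prime_product_mult[OF sub(2)] prime_product_unit by blast
qed

lemmas factorial_laurent_ring_Suc = factorial_step[unfolded L_def L'_def]

end

text \<open>Adjoining one variable keeps factoriality by Gauss, and inverting it only turns the prime \<open>X\<close> into a unit.\<close>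

theorem factorial_laurent_ring: "factorial_domain (laurent_ring n)"
proof (induction n)
  case 0
  have "unit_in (laurent_ring 0) p" if p: "p \<in> laurent_ring 0" "p \<noteq> 0" for p
  proof -
    have "M_lattice 0 = {0}" unfolding M_lattice_def by auto
    then have "p = (\<Sum>u\<in>{0}. Poly_Mapping.single u (lookup p u))"
      using laurent_as_sum[of p] p by (simp add: laurent_ring_def subset_singleton_iff)
    then obtain c where c: "p = Poly_Mapping.single 0 c" by simp
    then have "c \<noteq> 0" using p by auto
    then have "p * Poly_Mapping.single 0 (1 / c) = 1" using c by (simp add: mult_single)
    moreover have "Poly_Mapping.single 0 (1 / c) \<in> laurent_ring 0" unfolding laurent_ring_def by simp
    ultimately show ?thesis unfolding unit_in_def using p by blast
  qed
  then show ?case unfolding factorial_domain_def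
    using subdomain_laurent_ring prime_product_unit by blast
qed (rule factorial_laurent_ring_Suc)


section \<open>Discrete valuations of the function field\<close>

lemma function_field_iff:
  "x \<in> function_field n \<longleftrightarrow> (\<exists>p\<in>laurent_ring n. \<exists>q\<in>laurent_ring n. q \<noteq> 0 \<and> x = Fract p q)"
  unfolding function_field_def laurent_ring_def by blast

lemma Fract_in [simp]:
  assumes "p \<in> laurent_ring n" "q \<in> laurent_ring n"
  shows "Fract p q \<in> function_field n"
proof (cases "q = 0")
  case True
  then have "Fract p q = Fract 0 1" by (simp add: eq_fract(2))
  then show ?thesis unfolding function_field_iff
    by (intro bexI[of _ 0] bexI[of _ 1]) (auto intro: laurent_ringD)
qed (use assms in \<open>auto simp: function_field_iff\<close>)

lemma Fract_eq_0: "q \<noteq> 0 \<Longrightarrow> Fract p q = 0 \<longleftrightarrow> p = 0"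
  by (simp add: Zero_fract_def eq_fract)

lemma function_field_nonzero:
  assumes "x \<in> function_field n" "x \<noteq> 0"
  obtains p q where "p \<in> laurent_ring n" "q \<in> laurent_ring n" "p \<noteq> 0" "q \<noteq> 0" "x = Fract p q"
  using assms unfolding function_field_iff by (metis Fract_eq_0)

lemma function_field_mult: "x \<in> function_field n \<Longrightarrow> y \<in> function_field n \<Longrightarrow> x * y \<in> function_field n"
  unfolding function_field_iff by (metis laurent_ringD(4) mult_eq_0_iff mult_fract)

lemma function_field_inverse: "x \<in> function_field n \<Longrightarrow> inverse x \<in> function_field n"
  unfolding function_field_iff
  by (metis Fract_eq_0 inverse_fract inverse_zero laurent_ringD(1,2) zero_neq_one)

lemma function_field_one: "1 \<in> function_field n"
  unfolding function_field_iff using laurent_ringD(1) by (metis One_fract_def zero_neq_one)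

lemma function_field_power: "x \<in> function_field n \<Longrightarrow> x ^ k \<in> function_field n"
  by (induction k) (auto intro: function_field_one function_field_mult)

lemma function_field_powi: "x \<in> function_field n \<Longrightarrow> x powi k \<in> function_field n"
  by (auto simp: power_int_def intro: function_field_power function_field_inverse)

text \<open>The group homomorphisms from the nonzero rational functions onto the integers; only the
  multiplicative structure matters for \<^const>\<open>ord_along\<close>.\<close>

definition valuation_on :: "nat \<Rightarrow> (ratfun \<Rightarrow> int) \<Rightarrow> bool" where
  "valuation_on n \<nu> \<longleftrightarrow>
     (\<forall>x\<in>function_field n. \<forall>y\<in>function_field n. x \<noteq> 0 \<longrightarrow> y \<noteq> 0 \<longrightarrow> \<nu> (x * y) = \<nu> x + \<nu> y) \<and>
     (\<exists>t\<in>function_field n. t \<noteq> 0 \<and> \<nu> t = 1)"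

definition val_ring :: "nat \<Rightarrow> (ratfun \<Rightarrow> int) \<Rightarrow> ratfun set" where
  "val_ring n \<nu> = {x \<in> function_field n. x = 0 \<or> 0 \<le> \<nu> x}"

lemma val_ring_iff: "x \<in> val_ring n \<nu> \<longleftrightarrow> x \<in> function_field n \<and> (x = 0 \<or> 0 \<le> \<nu> x)"
  unfolding val_ring_def by simp

context
  fixes n \<nu> assumes \<nu>: "valuation_on n \<nu>"
begin

lemma valuation_mult:
  "x \<in> function_field n \<Longrightarrow> y \<in> function_field n \<Longrightarrow> x \<noteq> 0 \<Longrightarrow> y \<noteq> 0 \<Longrightarrow> \<nu> (x * y) = \<nu> x + \<nu> y"
  using \<nu> unfolding valuation_on_def by blast

lemma valuation_one: "\<nu> 1 = 0"
  using valuation_mult[OF function_field_one function_field_one] by simp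

lemma valuation_inverse:
  assumes "x \<in> function_field n" "x \<noteq> 0"
  shows "\<nu> (inverse x) = - \<nu> x"
  using valuation_mult[OF assms(1) function_field_inverse[OF assms(1)] assms(2)] assms(2) valuation_one by simp

lemma valuation_power: "x \<in> function_field n \<Longrightarrow> x \<noteq> 0 \<Longrightarrow> \<nu> (x ^ k) = int k * \<nu> x"
  by (induction k) (auto simp: valuation_one valuation_mult function_field_power algebra_simps)

lemma valuation_powi: "x \<in> function_field n \<Longrightarrow> x \<noteq> 0 \<Longrightarrow> \<nu> (x powi k) = k * \<nu> x"
  by (auto simp: power_int_def valuation_power valuation_inverse function_field_inverse)

lemma ring_unit_val_ring: "ring_unit (val_ring n \<nu>) w \<longleftrightarrow> w \<in> function_field n \<and> w \<noteq> 0 \<and> \<nu> w = 0"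
  unfolding ring_unit_def val_ring_def by (auto simp: valuation_inverse function_field_inverse)

text \<open>The non-units of a valuation ring are the elements of positive value, and they are the multiples of \<open>t\<close> exactly
  when \<open>t\<close> has the least positive value.\<close>

lemma uniformizer_val_ring:
  "uniformizer (val_ring n \<nu>) t \<longleftrightarrow> t \<in> function_field n \<and> t \<noteq> 0 \<and> \<nu> t = 1"
proof
  assume u: "uniformizer (val_ring n \<nu>) t"
  then have t: "t \<in> function_field n" "t \<noteq> 0" "0 \<le> \<nu> t" unfolding uniformizer_def val_ring_def by auto
  obtain s where s: "s \<in> function_field n" "s \<noteq> 0" "\<nu> s = 1" using \<nu> unfolding valuation_on_def by blast
  have eq: "{x \<in> val_ring n \<nu>. \<not> ring_unit (val_ring n \<nu>) x} = {t * a | a. a \<in> val_ring n \<nu>}"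
    using u unfolding uniformizer_def by blast
  have "t * 1 \<in> {t * a | a. a \<in> val_ring n \<nu>}"
    using function_field_one valuation_one unfolding val_ring_def by force
  then have "\<nu> t \<noteq> 0" using eq t unfolding ring_unit_val_ring by auto
  have "s \<in> {x \<in> val_ring n \<nu>. \<not> ring_unit (val_ring n \<nu>) x}"
    using s unfolding ring_unit_val_ring val_ring_iff by auto
  then obtain a where "s = t * a" "a \<in> val_ring n \<nu>" using eq by blast
  then have "1 = \<nu> t + \<nu> a" "0 \<le> \<nu> a" using s t valuation_mult[of t a] unfolding val_ring_def by auto
  then show "t \<in> function_field n \<and> t \<noteq> 0 \<and> \<nu> t = 1" using t \<open>\<nu> t \<noteq> 0\<close> by auto
next
  assume t: "t \<in> function_field n \<and> t \<noteq> 0 \<and> \<nu> t = 1"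
  have "x \<in> {t * a | a. a \<in> val_ring n \<nu>}" if "x \<in> val_ring n \<nu>" "\<not> ring_unit (val_ring n \<nu>) x" for x
  proof -
    have "x * inverse t \<in> val_ring n \<nu>"
    proof (cases "x = 0")
      case True
      then show ?thesis using that(1) by simp
    next
      case False
      then have "1 \<le> \<nu> x" "x \<in> function_field n" using that unfolding ring_unit_val_ring val_ring_iff by auto
      then show ?thesis using t False
        by (auto simp: val_ring_def valuation_mult function_field_inverse valuation_inverse function_field_mult)
    qed
    moreover have "x = t * (x * inverse t)" using t by simp
    ultimately show ?thesis by blast
  qed
  moreover have "t * a \<in> val_ring n \<nu> \<and> \<not> ring_unit (val_ring n \<nu>) (t * a)" if "a \<in> val_ring n \<nu>" for a
    using that t unfolding ring_unit_val_ring val_ring_iff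
    by (cases "a = 0") (auto simp: valuation_mult function_field_mult)
  ultimately have "{x \<in> val_ring n \<nu>. \<not> ring_unit (val_ring n \<nu>) x} = {t * a | a. a \<in> val_ring n \<nu>}"
    by (intro equalityI subsetI) auto
  then show "uniformizer (val_ring n \<nu>) t" using t unfolding uniformizer_def val_ring_iff by simp
qed

lemma ord_along_val_ring:
  assumes f: "f \<in> function_field n" "f \<noteq> 0"
  shows "ord_along (val_ring n \<nu>) f = \<nu> f"
  unfolding ord_along_def uniformizer_val_ring ring_unit_val_ring
proof (rule the_equality)
  obtain t where t: "t \<in> function_field n" "t \<noteq> 0" "\<nu> t = 1" using \<nu> unfolding valuation_on_def by blast
  let ?w = "f * inverse (t powi \<nu> f)"
  have "f = ?w * t powi \<nu> f" using t by simp
  moreover have "?w \<in> function_field n" "?w \<noteq> 0" "\<nu> ?w = 0"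
    using t f by (auto simp: function_field_mult function_field_inverse function_field_powi
      valuation_mult valuation_inverse valuation_powi)
  ultimately show "\<exists>t w. (t \<in> function_field n \<and> t \<noteq> 0 \<and> \<nu> t = 1) \<and>
      (w \<in> function_field n \<and> w \<noteq> 0 \<and> \<nu> w = 0) \<and> f = w * t powi \<nu> f" using t by blast
next
  fix k assume "\<exists>t w. (t \<in> function_field n \<and> t \<noteq> 0 \<and> \<nu> t = 1) \<and>
      (w \<in> function_field n \<and> w \<noteq> 0 \<and> \<nu> w = 0) \<and> f = w * t powi k"
  then show "k = \<nu> f"
    by (auto simp: valuation_mult valuation_powi function_field_powi)
qed

end

definition additive_on :: "nat \<Rightarrow> (laurent \<Rightarrow> int) \<Rightarrow> bool" where
  "additive_on n \<mu> \<longleftrightarrow> (\<forall>p\<in>laurent_ring n. \<forall>q\<in>laurent_ring n. p \<noteq> 0 \<longrightarrow> q \<noteq> 0 \<longrightarrow> \<mu> (p * q) = \<mu> p + \<mu> q)"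

lemma additive_onD:
  "additive_on n \<mu> \<Longrightarrow> p \<in> laurent_ring n \<Longrightarrow> q \<in> laurent_ring n \<Longrightarrow> p \<noteq> 0 \<Longrightarrow> q \<noteq> 0 \<Longrightarrow> \<mu> (p * q) = \<mu> p + \<mu> q"
  unfolding additive_on_def by blast

text \<open>The extension of \<open>\<mu>\<close> to quotients by \<open>\<mu>(p / q) = \<mu>(p) - \<mu>(q)\<close>; it is independent of the representation
  when \<open>\<mu>\<close> turns products into sums.\<close>

definition fract_val :: "nat \<Rightarrow> (laurent \<Rightarrow> int) \<Rightarrow> ratfun \<Rightarrow> int" where
  "fract_val n \<mu> x = (THE k. \<exists>p\<in>laurent_ring n. \<exists>q\<in>laurent_ring n.
     p \<noteq> 0 \<and> q \<noteq> 0 \<and> x = Fract p q \<and> k = \<mu> p - \<mu> q)"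

lemma fract_val_Fract:
  assumes \<mu>: "additive_on n \<mu>" and pq: "p \<in> laurent_ring n" "q \<in> laurent_ring n" "p \<noteq> 0" "q \<noteq> 0"
  shows "fract_val n \<mu> (Fract p q) = \<mu> p - \<mu> q"
  unfolding fract_val_def
proof (rule the_equality)
  fix k assume "\<exists>p'\<in>laurent_ring n. \<exists>q'\<in>laurent_ring n.
    p' \<noteq> 0 \<and> q' \<noteq> 0 \<and> Fract p q = Fract p' q' \<and> k = \<mu> p' - \<mu> q'"
  then obtain p' q' where *: "p' \<in> laurent_ring n" "q' \<in> laurent_ring n" "p' \<noteq> 0" "q' \<noteq> 0"
    "p * q' = p' * q" "k = \<mu> p' - \<mu> q'" using pq by (auto simp: eq_fract)
  then have "\<mu> p + \<mu> q' = \<mu> p' + \<mu> q" using additive_onD[OF \<mu>] pq by metis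
  then show "k = \<mu> p - \<mu> q" using * by simp
qed (use pq in blast)

lemma valuation_fract_val:
  assumes \<mu>: "additive_on n \<mu>" and t: "t \<in> laurent_ring n" "t \<noteq> 0" "\<mu> t = 1"
  shows "valuation_on n (fract_val n \<mu>)"
  unfolding valuation_on_def
proof (intro conjI ballI impI)
  have "\<mu> (1 * 1) = \<mu> 1 + \<mu> 1" by (rule additive_onD[OF \<mu>]) (simp_all add: laurent_ringD(1))
  then have "fract_val n \<mu> (Fract t 1) = 1"
    using fract_val_Fract[OF \<mu> t(1) laurent_ringD(1) t(2)] t(3) by simp
  then show "\<exists>t\<in>function_field n. t \<noteq> 0 \<and> fract_val n \<mu> t = 1"
    using t laurent_ringD(1) by (intro bexI[of _ "Fract t 1"]) (auto simp: Fract_eq_0)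
next
  fix x y assume *: "x \<in> function_field n" "y \<in> function_field n" "x \<noteq> 0" "y \<noteq> 0"
  obtain p q where x: "p \<in> laurent_ring n" "q \<in> laurent_ring n" "p \<noteq> 0" "q \<noteq> 0" "x = Fract p q"
    using function_field_nonzero[OF *(1,3)] .
  obtain p' q' where y: "p' \<in> laurent_ring n" "q' \<in> laurent_ring n" "p' \<noteq> 0" "q' \<noteq> 0" "y = Fract p' q'"
    using function_field_nonzero[OF *(2,4)] .
  have "\<mu> (p * p') = \<mu> p + \<mu> p'" "\<mu> (q * q') = \<mu> q + \<mu> q'"
    using x y by (simp_all add: additive_onD[OF \<mu>])
  then show "fract_val n \<mu> (x * y) = fract_val n \<mu> x + fract_val n \<mu> y"
    using x y by (simp add: fract_val_Fract[OF \<mu>] laurent_ringD(4))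
qed

subsection \<open>Monomial valuations\<close>

text \<open>For the pairing \<open>l\<close> with a primitive vector of a ray this is the order along the divisor of the ray.\<close>

definition min_val :: "((nat \<Rightarrow>\<^sub>0 int) \<Rightarrow> int) \<Rightarrow> laurent \<Rightarrow> int" where
  "min_val l p = Min (l ` keys p)"

definition additive_form :: "((nat \<Rightarrow>\<^sub>0 int) \<Rightarrow> int) \<Rightarrow> bool" where
  "additive_form l \<longleftrightarrow> (\<forall>u v. l (u + v) = l u + l v)"

lemma additive_formD:
  assumes "additive_form l"
  shows "l (u + v) = l u + l v" "l 0 = 0" "l (- u) = - l u" "l (u - v) = l u - l v" "l (frag_cmul k u) = k * l u"
    "l (sum f I) = (\<Sum>i\<in>I. l (f i))"
proof -
  show add: "l (u + v) = l u + l v" for u v using assms unfolding additive_form_def by blast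
  show 0: "l 0 = 0" using add[of 0 0] by simp
  show neg: "l (- u) = - l u" for u using add[of u "- u"] 0 by simp
  show "l (u - v) = l u - l v" using add[of u "- v"] neg by simp
  have nat: "l (frag_cmul (int j) u) = int j * l u" for j
    by (induction j) (auto simp: add 0 frag_cmul_distrib algebra_simps)
  show "l (frag_cmul k u) = k * l u"
  proof (cases "0 \<le> k")
    case True
    then show ?thesis using nat[of "nat k"] by simp
  next
    case False
    then show ?thesis using nat[of "nat (- k)"] neg[of "frag_cmul (- k) u"] by simp
  qed
  show "l (sum f I) = (\<Sum>i\<in>I. l (f i))"
    by (induction I rule: infinite_finite_induct) (auto simp: add 0)
qed

lemma keys_empty_iff: "keys (p::laurent) = {} \<longleftrightarrow> p = 0"
  by (auto intro!: poly_mapping_eqI simp: in_keys_iff)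

lemma in_keys_multE:
  assumes "w \<in> keys (p * q)"
  obtains u v where "u \<in> keys p" "v \<in> keys q" "w = u + v"
  using keys_mult[of p q] assms by blast

lemma min_val_le: "u \<in> keys p \<Longrightarrow> min_val l p \<le> l u"
  unfolding min_val_def by simp

lemma min_val_attained: "p \<noteq> 0 \<Longrightarrow> \<exists>u\<in>keys p. min_val l p = l u"
  unfolding min_val_def using Min_in[of "l ` keys p"] keys_empty_iff[of p]
  by (auto simp: image_iff)

lemma min_val_ge_iff: "p \<noteq> 0 \<Longrightarrow> c \<le> min_val l p \<longleftrightarrow> (\<forall>u\<in>keys p. c \<le> l u)"
  unfolding min_val_def by (subst Min_ge_iff) (auto simp: keys_empty_iff)

lemma keys_mult_ge:
  assumes "additive_form l" "\<And>u. u \<in> keys p \<Longrightarrow> c \<le> l u" "\<And>u. u \<in> keys q \<Longrightarrow> d \<le> l u"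
    "w \<in> keys (p * q)"
  shows "c + d \<le> l w"
  using assms(4)
proof (rule in_keys_multE)
  fix u v assume "u \<in> keys p" "v \<in> keys q" "w = u + v"
  then show ?thesis using assms(2)[of u] assms(3)[of v] additive_formD(1)[OF assms(1), of u v] by simp
qed

text \<open>The initial forms of \<open>p\<close> and \<open>q\<close> multiply to a nonzero polynomial, so no cancellation occurs in
  the lowest weight of \<open>p q\<close>.\<close>

lemma min_val_mult:
  fixes p q :: laurent
  assumes l: "additive_form l" and pq: "p \<noteq> 0" "q \<noteq> 0"
  shows "min_val l (p * q) = min_val l p + min_val l q"
proof (rule antisym)
  have pq0: "p * q \<noteq> 0" using pq by simp
  have "\<forall>w\<in>keys (p * q). min_val l p + min_val l q \<le> l w"
    using keys_mult_ge[OF l] min_val_le by blast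
  then show "min_val l p + min_val l q \<le> min_val l (p * q)" using min_val_ge_iff[OF pq0] by blast
  define init where "init = (\<lambda>p::laurent. \<Sum>u\<in>{u\<in>keys p. l u = min_val l p}.
    Poly_Mapping.single u (lookup p u))"
  have lookup_init: "lookup (init f) u =
    (if l u = min_val l f then lookup f u else 0)" for f u
    unfolding init_def lookup_sum lookup_single when_def by (auto simp: in_keys_iff)
  have init: "init f \<noteq> 0" "\<And>u. u \<in> keys (init f) \<Longrightarrow> l u = min_val l f"
    "\<And>u. u \<in> keys (f - init f) \<Longrightarrow> min_val l f + 1 \<le> l u" if f: "f \<noteq> 0" for f
  proof -
    obtain u where "u \<in> keys f" "min_val l f = l u" using min_val_attained[OF f] by blast
    then have "lookup (init f) u \<noteq> 0" by (simp add: lookup_init in_keys_iff)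
    then show "init f \<noteq> 0" by auto
    show "l u = min_val l f" if "u \<in> keys (init f)" for u
      using that by (simp add: lookup_init in_keys_iff split: if_splits)
    show "min_val l f + 1 \<le> l u" if "u \<in> keys (f - init f)" for u
    proof -
      have "l u \<noteq> min_val l f" "u \<in> keys f"
        using that by (auto simp: lookup_init in_keys_iff lookup_minus split: if_splits)
      then show ?thesis using min_val_le[of u f l] by simp
    qed
  qed
  let ?p = "init p" and ?q = "init q"
  have split: "p * q = ?p * ?q + (?p * (q - ?q) + (p - ?p) * q)" by (simp add: algebra_simps)
  have "?p * ?q \<noteq> 0" using init(1) pq by simp
  then obtain w where w: "w \<in> keys (?p * ?q)" using keys_empty_iff by blast
  obtain u v where "u \<in> keys ?p" "v \<in> keys ?q" "w = u + v"
    using in_keys_multE[OF w] .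
  then have lw: "l w = min_val l p + min_val l q"
    using init(2)[OF pq(1)] init(2)[OF pq(2)] additive_formD(1)[OF l] by simp
  have "w \<notin> keys (?p * (q - ?q))"
    using keys_mult_ge[OF l, of ?p "min_val l p" "q - ?q" "min_val l q + 1" w]
      init(2)[OF pq(1)] init(3)[OF pq(2)] lw by auto
  moreover have "w \<notin> keys ((p - ?p) * q)"
    using keys_mult_ge[OF l, of "p - ?p" "min_val l p + 1" q "min_val l q" w]
      init(3)[OF pq(1)] lw min_val_le[of _ q l] by auto
  ultimately have "lookup (p * q) w = lookup (?p * ?q) w"
    unfolding split by (simp add: lookup_add in_keys_iff)
  then have "w \<in> keys (p * q)" using w by (simp add: in_keys_iff)
  then show "min_val l (p * q) \<le> min_val l p + min_val l q" using min_val_le[of w "p * q" l] lw by simp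
qed

lemma additive_on_min_val: "additive_form l \<Longrightarrow> additive_on n (min_val l)"
  unfolding additive_on_def using min_val_mult by blast

lemma min_val_chi [simp]: "min_val l (chi u) = l u"
  unfolding min_val_def by simp

definition ord_form :: "nat \<Rightarrow> ((nat \<Rightarrow>\<^sub>0 int) \<Rightarrow> int) \<Rightarrow> ratfun \<Rightarrow> int" where
  "ord_form n l = fract_val n (min_val l)"

lemma ord_form_Fract:
  "additive_form l \<Longrightarrow> p \<in> laurent_ring n \<Longrightarrow> q \<in> laurent_ring n \<Longrightarrow> p \<noteq> 0 \<Longrightarrow> q \<noteq> 0 \<Longrightarrow>
     ord_form n l (Fract p q) = min_val l p - min_val l q"
  unfolding ord_form_def by (rule fract_val_Fract[OF additive_on_min_val])

lemma valuation_ord_form: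
  assumes "additive_form l" "w \<in> M_lattice n" "l w = 1"
  shows "valuation_on n (ord_form n l)"
  unfolding ord_form_def
  by (rule valuation_fract_val[OF additive_on_min_val[OF assms(1)], of "chi w"]) (use assms in auto)

lemma ord_form_chi:
  assumes "additive_form l" "u \<in> M_lattice n"
  shows "ord_form n l (Fract (chi u) 1) = l u"
  using ord_form_Fract[OF assms(1), of "chi u" n 1] assms laurent_ringD(1)
    min_val_chi[of l 0] additive_formD(2)[OF assms(1)] by simp

subsection \<open>Valuations of primes of the Laurent polynomial ring\<close>

text \<open>The exponent of the prime \<open>\<pi>\<close> in \<open>p\<close>; it exists because \<open>p\<close> is a product of finitely many primes.\<close>

definition mult_of :: "nat \<Rightarrow> laurent \<Rightarrow> laurent \<Rightarrow> nat" where
  "mult_of n \<pi> p = (THE k. \<exists>p'\<in>laurent_ring n. p = \<pi> ^ k * p' \<and> \<not> dvd_in (laurent_ring n) \<pi> p')"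

lemma prime_product_laurent: "p \<in> laurent_ring n \<Longrightarrow> p \<noteq> 0 \<Longrightarrow> prime_product (laurent_ring n) p"
  using factorial_laurent_ring unfolding factorial_domain_def by blast

lemma mult_ofE:
  assumes \<pi>: "prime_in (laurent_ring n) \<pi>" and p: "p \<in> laurent_ring n" "p \<noteq> 0"
  obtains p' where "p' \<in> laurent_ring n" "p = \<pi> ^ mult_of n \<pi> p * p'" "\<not> dvd_in (laurent_ring n) \<pi> p'"
proof -
  let ?L = "laurent_ring n"
  define Q where "Q = (\<lambda>k. \<exists>p'\<in>?L. p = \<pi> ^ k * p' \<and> \<not> dvd_in ?L \<pi> p')"
  obtain u ps where u: "unit_in ?L u" "\<forall>q\<in>set ps. prime_in ?L q" "p = u * prod_list ps"
    using prime_product_laurent[OF p] unfolding prime_product_def by blast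
  define D where "D = (\<lambda>k. \<exists>p'\<in>?L. p = \<pi> ^ k * p')"
  have "k \<le> length ps" if Dk: "D k" for k
  proof -
    obtain p' where "p' \<in> ?L" "p = \<pi> ^ k * p'" using Dk unfolding D_def by blast
    then have "p' \<in> ?L" "prod_list (replicate k \<pi>) * p' = u * prod_list ps"
      using u(3) by (simp_all add: prod_list_replicate)
    then show ?thesis
      using prime_divisors_length[OF subdomain_laurent_ring u(2,1), of "replicate k \<pi>" p'] \<pi> by simp
  qed
  moreover have "D 0" using p unfolding D_def by auto
  ultimately obtain k where k: "D k" "\<And>j. D j \<Longrightarrow> j \<le> k"
    using Nat.ex_has_greatest_nat[of D 0 "length ps"] by blast
  obtain p' where p': "p' \<in> ?L" "p = \<pi> ^ k * p'" using k(1) unfolding D_def by blast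
  have "\<not> dvd_in ?L \<pi> p'"
  proof
    assume "dvd_in ?L \<pi> p'"
    then obtain c where "c \<in> ?L" "p' = \<pi> * c" unfolding dvd_in_def by blast
    then have "D (Suc k)" unfolding D_def using p' by (auto simp: algebra_simps)
    then show False using k(2) by fastforce
  qed
  then have Qk: "Q k" unfolding Q_def using p' by blast
  have "j = k" if "Q j" "Q k" for j k
  proof -
    have False if "Q j" "Q k" "j < k" for j k
    proof -
      obtain a b where ab: "a \<in> ?L" "p = \<pi> ^ j * a" "\<not> dvd_in ?L \<pi> a" "b \<in> ?L" "p = \<pi> ^ k * b"
        using \<open>Q j\<close> \<open>Q k\<close> unfolding Q_def by blast
      have "k = j + Suc (k - j - 1)" using \<open>j < k\<close> by simp
      then have "p = \<pi> ^ j * (\<pi> * (\<pi> ^ (k - j - 1) * b))"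
        using ab(5) by (metis mult.assoc power_Suc power_add)
      then have "\<pi> ^ j * a = \<pi> ^ j * (\<pi> * (\<pi> ^ (k - j - 1) * b))" using ab(2) by simp
      then have "a = \<pi> * (\<pi> ^ (k - j - 1) * b)" using prime_inD(2)[OF \<pi>] by simp
      then have "dvd_in ?L \<pi> a"
        by (rule dvd_inI) (intro laurent_ringD(4) ab(4) subdomain_power[OF subdomain_laurent_ring prime_inD(1)[OF \<pi>]])
      then show False using ab(3) by blast
    qed
    then show ?thesis using that by (metis nat_neq_iff)
  qed
  then have "Q (The Q)" using Qk by (blast intro: theI[of Q k])
  moreover have "The Q = mult_of n \<pi> p" unfolding mult_of_def Q_def ..
  ultimately show ?thesis using that unfolding Q_def by auto
qed

lemma mult_of_eq:
  assumes \<pi>: "prime_in (laurent_ring n) \<pi>" and p: "p \<in> laurent_ring n" "\<not> dvd_in (laurent_ring n) \<pi> p"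
  shows "mult_of n \<pi> (\<pi> ^ k * p) = k"
proof -
  let ?L = "laurent_ring n" let ?f = "\<pi> ^ k * p"
  have pow: "\<pi> ^ j \<in> ?L" for j using subdomain_power[OF subdomain_laurent_ring prime_inD(1)[OF \<pi>]] .
  have "p \<noteq> 0" using p laurent_ringD(2) unfolding dvd_in_def by force
  then have f: "?f \<in> ?L" "?f \<noteq> 0" using pow laurent_ringD(4) p prime_inD(2)[OF \<pi>] by auto
  obtain q where q: "q \<in> ?L" "?f = \<pi> ^ mult_of n \<pi> ?f * q" "\<not> dvd_in ?L \<pi> q" using mult_ofE[OF \<pi> f] .
  have aux: False if "\<pi> ^ j * a = \<pi> ^ i * b" "i < j" "\<not> dvd_in ?L \<pi> b" "a \<in> ?L" for i j a b
  proof -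
    have "\<pi> ^ i * (\<pi> ^ (j - i) * a) = \<pi> ^ i * b"
      using that by (metis le_add_diff_inverse less_imp_le mult.assoc power_add)
    then have "b = \<pi> ^ (j - i) * a" using prime_inD(2)[OF \<pi>] by simp
    also have "\<dots> = \<pi> * (\<pi> ^ (j - i - 1) * a)"
      using that(2) by (metis Suc_pred mult.assoc power_Suc zero_less_diff diff_Suc_eq_diff_pred One_nat_def)
    finally have "dvd_in ?L \<pi> b" by (rule dvd_inI) (intro laurent_ringD(4) pow that(4))
    then show False using that(3) by blast
  qed
  have "\<not> mult_of n \<pi> ?f < k" using aux[OF q(2) _ q(3) p(1)] by blast
  moreover have "\<not> k < mult_of n \<pi> ?f" using aux[OF q(2)[symmetric] _ p(2) q(1)] by blast
  ultimately show ?thesis by simp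
qed

lemma mult_of_mult:
  assumes \<pi>: "prime_in (laurent_ring n) \<pi>" and "p \<in> laurent_ring n" "p \<noteq> 0" "q \<in> laurent_ring n" "q \<noteq> 0"
  shows "mult_of n \<pi> (p * q) = mult_of n \<pi> p + mult_of n \<pi> q"
proof -
  obtain p' where p: "p' \<in> laurent_ring n" "p = \<pi> ^ mult_of n \<pi> p * p'" "\<not> dvd_in (laurent_ring n) \<pi> p'"
    using mult_ofE[OF \<pi> assms(2,3)] .
  obtain q' where q: "q' \<in> laurent_ring n" "q = \<pi> ^ mult_of n \<pi> q * q'" "\<not> dvd_in (laurent_ring n) \<pi> q'"
    using mult_ofE[OF \<pi> assms(4,5)] .
  have "\<not> dvd_in (laurent_ring n) \<pi> (p' * q')" using prime_inD(4)[OF \<pi>] p q by blast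
  moreover have "p * q = \<pi> ^ (mult_of n \<pi> p + mult_of n \<pi> q) * (p' * q')"
    by (subst p(2), subst q(2)) (simp add: power_add algebra_simps)
  ultimately show ?thesis using mult_of_eq[OF \<pi> laurent_ringD(4)[OF p(1) q(1)]] by metis
qed

lemma mult_of_not_dvd:
  "prime_in (laurent_ring n) \<pi> \<Longrightarrow> p \<in> laurent_ring n \<Longrightarrow> \<not> dvd_in (laurent_ring n) \<pi> p \<Longrightarrow> mult_of n \<pi> p = 0"
  using mult_of_eq[of n \<pi> p 0] by simp

lemma mult_of_self: "prime_in (laurent_ring n) \<pi> \<Longrightarrow> mult_of n \<pi> \<pi> = 1"
  using mult_of_eq[of n \<pi> 1 1] laurent_ringD(1)[of n]
    prime_not_dvd_unit[OF subdomain_laurent_ring _ unit_in_one[OF subdomain_laurent_ring]] by auto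

definition ord_prime :: "nat \<Rightarrow> laurent \<Rightarrow> ratfun \<Rightarrow> int" where
  "ord_prime n \<pi> = fract_val n (\<lambda>p. int (mult_of n \<pi> p))"

lemma additive_on_mult_of: "prime_in (laurent_ring n) \<pi> \<Longrightarrow> additive_on n (\<lambda>p. int (mult_of n \<pi> p))"
  unfolding additive_on_def by (simp add: mult_of_mult)

lemma ord_prime_Fract:
  "prime_in (laurent_ring n) \<pi> \<Longrightarrow> p \<in> laurent_ring n \<Longrightarrow> q \<in> laurent_ring n \<Longrightarrow> p \<noteq> 0 \<Longrightarrow> q \<noteq> 0 \<Longrightarrow>
     ord_prime n \<pi> (Fract p q) = int (mult_of n \<pi> p) - int (mult_of n \<pi> q)"
  unfolding ord_prime_def by (rule fract_val_Fract[OF additive_on_mult_of])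

lemma valuation_ord_prime: "prime_in (laurent_ring n) \<pi> \<Longrightarrow> valuation_on n (ord_prime n \<pi>)"
  unfolding ord_prime_def
  by (rule valuation_fract_val[OF additive_on_mult_of, of n \<pi> \<pi>]) (auto dest: prime_inD simp: mult_of_self)

lemma mult_of_unit: "prime_in (laurent_ring n) \<pi> \<Longrightarrow> unit_in (laurent_ring n) u \<Longrightarrow> mult_of n \<pi> u = 0"
  using prime_not_dvd_unit[OF subdomain_laurent_ring] mult_of_not_dvd unfolding unit_in_def by blast

lemma ord_prime_chi:
  assumes "prime_in (laurent_ring n) \<pi>" "u \<in> M_lattice n"
  shows "ord_prime n \<pi> (Fract (chi u) 1) = 0"
  using ord_prime_Fract[OF assms(1), of "chi u" 1] assms laurent_ringD(1)[of n] unit_in_chi[OF assms(2)]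
    unit_in_one[OF subdomain_laurent_ring[of n]] mult_of_unit[OF assms(1)] by simp


section \<open>Affine charts and their height one primes\<close>

text \<open>Prime ideals of a subset of any ambient domain. The same notion serves for the coordinate rings, as subsets of the
  function field, and for their preimages in the domain of Laurent polynomials, where exponents can be inspected.\<close>

definition prime_ideal_in :: "'a::idom set \<Rightarrow> 'a set \<Rightarrow> bool" where
  "prime_ideal_in A I \<longleftrightarrow> I \<subseteq> A \<and> 0 \<in> I \<and> (\<forall>a\<in>I. \<forall>b\<in>I. a + b \<in> I) \<and> (\<forall>a\<in>A. \<forall>b\<in>I. a * b \<in> I) \<and>
     1 \<notin> I \<and> (\<forall>a\<in>A. \<forall>b\<in>A. a * b \<in> I \<longrightarrow> a \<in> I \<or> b \<in> I)"

lemma prime_ideal_inD: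
  assumes "prime_ideal_in A I"
  shows "I \<subseteq> A" "0 \<in> I" "a \<in> I \<Longrightarrow> b \<in> I \<Longrightarrow> a + b \<in> I" "a \<in> A \<Longrightarrow> b \<in> I \<Longrightarrow> a * b \<in> I" "1 \<notin> I"
    "a \<in> A \<Longrightarrow> b \<in> A \<Longrightarrow> a * b \<in> I \<Longrightarrow> a \<in> I \<or> b \<in> I"
  using assms unfolding prime_ideal_in_def by blast+

definition height_one_in :: "'a::idom set \<Rightarrow> 'a set \<Rightarrow> bool" where
  "height_one_in A I \<longleftrightarrow> prime_ideal_in A I \<and> I \<noteq> {0} \<and>
     (\<forall>J. prime_ideal_in A J \<longrightarrow> J \<subseteq> I \<longrightarrow> J = {0} \<or> J = I)"

lemma cring_subring_of:
  assumes A: "subdomain A"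
  shows "cring (subring_of A)"
proof (rule cringI)
  show "abelian_group (subring_of A)"
  proof (rule abelian_groupI)
    fix x assume "x \<in> carrier (subring_of A)"
    then show "\<exists>y\<in>carrier (subring_of A). y \<oplus>\<^bsub>subring_of A\<^esub> x = \<zero>\<^bsub>subring_of A\<^esub>"
      using subdomainD(5)[OF A] by (intro bexI[of _ "- x"]) (auto simp: subring_of_def)
  qed (auto simp: subring_of_def subdomainD[OF A])
  show "comm_monoid (subring_of A)"
    by (rule comm_monoidI) (auto simp: subring_of_def subdomainD[OF A])
qed (auto simp: subring_of_def algebra_simps)

lemma primeideal_subring_of_iff:
  assumes A: "subdomain A"
  shows "primeideal I (subring_of A) \<longleftrightarrow> prime_ideal_in A I"
proof
  assume "primeideal I (subring_of A)"
  then interpret primeideal I "subring_of A" .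
  have c: "carrier (subring_of A) = A" "monoid.mult (subring_of A) = (*)"
    "ring.add (subring_of A) = (+)" "monoid.one (subring_of A) = 1" "ring.zero (subring_of A) = 0" by (auto simp: subring_of_def)
  have "1 \<notin> I"
  proof
    assume "1 \<in> I"
    then have "I = A" using I_r_closed[of 1] Icarr unfolding c by auto
    then show False using I_notcarr c by simp
  qed
  then show "prime_ideal_in A I" unfolding prime_ideal_in_def
    using Icarr additive_subgroup.a_closed[OF additive_subgroup_axioms] I_l_closed I_prime additive_subgroup.zero_closed[OF additive_subgroup_axioms]
    unfolding c by auto
next
  assume I: "prime_ideal_in A I"
  note D = prime_ideal_inD[OF I]
  have c: "carrier (subring_of A) = A" "monoid.mult (subring_of A) = (*)"
    "ring.add (subring_of A) = (+)" "monoid.one (subring_of A) = 1" "ring.zero (subring_of A) = 0" by (auto simp: subring_of_def)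
  interpret cring "subring_of A" using cring_subring_of[OF A] .
  have neg: "- a \<in> I" if "a \<in> I" for a
    using D(4)[OF subdomainD(5)[OF A subdomainD(1)[OF A]] that] by simp
  have "subgroup I (add_monoid (subring_of A))"
  proof (rule subgroup.intro)
    fix x assume x: "x \<in> I"
    have "\<ominus>\<^bsub>subring_of A\<^esub> x = - x"
      by (rule minus_equality) (use x D(1) neg[OF x] in \<open>auto simp: c\<close>)
    then show "inv\<^bsub>add_monoid (subring_of A)\<^esub> x \<in> I" using neg[OF x] by (simp add: a_inv_def)
  qed (use D in \<open>auto simp: c\<close>)
  moreover have "a * x \<in> I" if "a \<in> I" "x \<in> A" for a x using D(4)[OF that(2,1)] by (simp add: mult.commute)
  ultimately have "ideal I (subring_of A)"
    using D(4) by (intro idealI) (auto simp: c ring_axioms)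
  then show "primeideal I (subring_of A)"
    by (rule primeidealI) (use D subdomainD(1)[OF A] cring_axioms in \<open>auto simp: c\<close>)
qed

abbreviation emb :: "laurent \<Rightarrow> ratfun" where "emb p \<equiv> Fract p 1"

lemma emb_simps: "emb p + emb q = emb (p + q)" "emb p * emb q = emb (p * q)" "- emb p = emb (- p)"
  "emb p = emb q \<longleftrightarrow> p = q" "emb p = 0 \<longleftrightarrow> p = 0" "emb p = 1 \<longleftrightarrow> p = 1"
  by (simp_all add: Zero_fract_def One_fract_def eq_fract)

lemma emb_image_iff: "emb p \<in> emb ` B \<longleftrightarrow> p \<in> B"
  by (auto simp: emb_simps)

lemma subdomain_emb: "subdomain B \<Longrightarrow> subdomain (emb ` B)"
  unfolding subdomain_def by (auto simp: emb_simps One_fract_def)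

lemma prime_ideal_in_emb:
  "prime_ideal_in (emb ` B) (emb ` I) \<longleftrightarrow> prime_ideal_in B I"
proof -
  have "0 \<in> emb ` I \<longleftrightarrow> 0 \<in> I" using emb_image_iff[of 0 I] by (simp add: Zero_fract_def)
  moreover have "1 \<in> emb ` I \<longleftrightarrow> 1 \<in> I" using emb_image_iff[of 1 I] by (simp add: One_fract_def)
  moreover have "emb ` I \<subseteq> emb ` B \<longleftrightarrow> I \<subseteq> B"
    by (rule inj_image_subset_iff) (simp add: inj_def emb_simps)
  ultimately show ?thesis unfolding prime_ideal_in_def
    by (simp only: ball_simps emb_simps(1,2) emb_image_iff)
qed

lemma height_one_in_emb:
  "height_one_in (emb ` B) (emb ` I) \<longleftrightarrow> height_one_in B I"
proof -
  have inj: "inj emb" by (simp add: inj_def emb_simps)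
  have 2: "emb ` J = emb ` J' \<longleftrightarrow> J = J'" "emb ` J \<subseteq> emb ` J' \<longleftrightarrow> J \<subseteq> J'" for J J'
    by (rule inj_image_eq_iff[OF inj], rule inj_image_subset_iff[OF inj])
  have 1: "emb ` J = {0} \<longleftrightarrow> J = {0}" for J
    using 2(1)[of J "{0}"] by (simp add: Zero_fract_def)
  have 3: "\<exists>J'. J = emb ` J'" if "prime_ideal_in (emb ` B) J" for J
    using prime_ideal_inD(1)[OF that] by (auto simp: subset_image_iff)
  have "(\<forall>J. prime_ideal_in (emb ` B) J \<longrightarrow> J \<subseteq> emb ` I \<longrightarrow> J = {0} \<or> J = emb ` I) \<longleftrightarrow>
    (\<forall>J. prime_ideal_in B J \<longrightarrow> J \<subseteq> I \<longrightarrow> J = {0} \<or> J = I)" (is "?l \<longleftrightarrow> ?r")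
  proof
    assume l: ?l
    show ?r
    proof (intro allI impI)
      fix J assume "prime_ideal_in B J" "J \<subseteq> I"
      then show "J = {0} \<or> J = I" using l[rule_format, of "emb ` J"] unfolding 1 2 prime_ideal_in_emb by simp
    qed
  next
    assume r: ?r
    show ?l
    proof (intro allI impI)
      fix J assume J: "prime_ideal_in (emb ` B) J" "J \<subseteq> emb ` I"
      then obtain J' where J': "J = emb ` J'" using 3 by blast
      show "J = {0} \<or> J = emb ` I"
        using r[rule_format, of J'] J unfolding J' 1 2 prime_ideal_in_emb by simp
    qed
  qed
  then show ?thesis unfolding height_one_in_def prime_ideal_in_emb 1 by simp
qed

text \<open>The coordinate ring of a chart before its embedding into the function field.\<close>

definition chart_ring :: "nat \<Rightarrow> real vec set \<Rightarrow> laurent set" where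
  "chart_ring n \<sigma> = {p. keys p \<subseteq> dual_monoid n \<sigma>}"

lemma coord_ring_eq: "coord_ring n \<sigma> = emb ` chart_ring n \<sigma>"
  unfolding coord_ring_def chart_ring_def by blast

definition local_fractions :: "laurent set \<Rightarrow> laurent set \<Rightarrow> ratfun set" where
  "local_fractions A I = {Fract a b | a b. a \<in> A \<and> b \<in> A - I}"

lemma local_ring_emb: "local_ring (emb ` A) (emb ` I) = local_fractions A I"
proof -
  have "emb a / emb b = Fract a b" for a b by simp
  then show ?thesis unfolding local_ring_def local_fractions_def
    by (auto simp: emb_image_iff simp del: divide_fract) (metis emb_image_iff imageI)+
qed

lemma dual_monoid_add: "u \<in> dual_monoid n \<sigma> \<Longrightarrow> v \<in> dual_monoid n \<sigma> \<Longrightarrow> u + v \<in> dual_monoid n \<sigma>"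
  unfolding dual_monoid_def
  by (auto simp: M_lattice_add pairing_def lookup_add algebra_simps sum.distrib)

lemma subdomain_chart_ring: "subdomain (chart_ring n \<sigma>)"
  unfolding subdomain_def
proof (intro conjI ballI)
  show "1 \<in> chart_ring n \<sigma>" unfolding chart_ring_def dual_monoid_def by (simp add: pairing_def)
  fix p q assume *: "p \<in> chart_ring n \<sigma>" "q \<in> chart_ring n \<sigma>"
  then show "p + q \<in> chart_ring n \<sigma>" unfolding chart_ring_def using keys_add[of p q] by auto
  show "p * q \<in> chart_ring n \<sigma>"
    using * keys_mult[of p q] dual_monoid_add unfolding chart_ring_def by blast
  show "- p \<in> chart_ring n \<sigma>" using * unfolding chart_ring_def by (auto simp: in_keys_iff subset_iff)
qed

lemma prime_ideals_coord_ring: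
  "prime_ideals (coord_ring n \<sigma>) = (`) emb ` {I. prime_ideal_in (chart_ring n \<sigma>) I}"
proof -
  have "prime_ideals (coord_ring n \<sigma>) = {I. prime_ideal_in (emb ` chart_ring n \<sigma>) I}"
    unfolding prime_ideals_def coord_ring_eq
    using primeideal_subring_of_iff[OF subdomain_emb[OF subdomain_chart_ring]] by blast
  also have "\<dots> = (`) emb ` {I. prime_ideal_in (chart_ring n \<sigma>) I}"
  proof (intro equalityI subsetI)
    fix J assume J: "J \<in> {I. prime_ideal_in (emb ` chart_ring n \<sigma>) I}"
    then have "J \<subseteq> emb ` chart_ring n \<sigma>" using prime_ideal_inD(1) by blast
    then obtain I where "J = emb ` I" by (auto simp: subset_image_iff)
    then show "J \<in> (`) emb ` {I. prime_ideal_in (chart_ring n \<sigma>) I}" using J prime_ideal_in_emb by blast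
  qed (auto simp: prime_ideal_in_emb)
  finally show ?thesis .
qed

lemma height_one_primes_coord_ring:
  "height_one_primes (coord_ring n \<sigma>) = (`) emb ` {I. height_one_in (chart_ring n \<sigma>) I}"
proof -
  let ?A = "emb ` chart_ring n \<sigma>"
  have pr: "prime_ideals (coord_ring n \<sigma>) = {I. prime_ideal_in ?A I}"
    unfolding prime_ideals_def coord_ring_eq
    using primeideal_subring_of_iff[OF subdomain_emb[OF subdomain_chart_ring]] by blast
  have "height_one_primes (coord_ring n \<sigma>) = {I. height_one_in ?A I}"
    unfolding height_one_primes_def pr height_one_in_def by auto
  also have "\<dots> = (`) emb ` {I. height_one_in (chart_ring n \<sigma>) I}"
  proof (intro equalityI subsetI)
    fix J assume J: "J \<in> {I. height_one_in ?A I}"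
    then have "J \<subseteq> ?A" using prime_ideal_inD(1) unfolding height_one_in_def by blast
    then obtain I where "J = emb ` I" by (auto simp: subset_image_iff)
    then show "J \<in> (`) emb ` {I. height_one_in (chart_ring n \<sigma>) I}" using J height_one_in_emb by blast
  qed (auto simp: height_one_in_emb)
  finally show ?thesis .
qed


lemma keys_mult_chi': "keys (chi e * p) = (\<lambda>u. e + u) ` keys p"
  using keys_mult_chi[of p e] by (simp add: mult.commute add.commute)

lemma keys_prod_ge:
  fixes f :: "'i \<Rightarrow> laurent"
  assumes l: "additive_form l" and "\<And>i v. i \<in> I \<Longrightarrow> v \<in> keys (f i) \<Longrightarrow> c i \<le> l v"
  shows "v \<in> keys (prod f I) \<Longrightarrow> sum c I \<le> l v"
  using assms(2)
proof (induction I arbitrary: v rule: infinite_finite_induct)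
  case (insert i I)
  have "v \<in> keys (f i * prod f I)" using insert by simp
  then have "c i + sum c I \<le> l v"
    by (rule keys_mult_ge[OF l, rotated 2]) (use insert in auto)
  then show ?case using insert by simp
qed (use additive_formD(2)[OF l] in auto)

lemma keys_power_ge:
  fixes f :: laurent
  assumes l: "additive_form l" and "\<And>v. v \<in> keys f \<Longrightarrow> c \<le> l v"
  shows "v \<in> keys (f ^ j) \<Longrightarrow> int j * c \<le> l v"
  using keys_prod_ge[OF l, of "{..<j}" "\<lambda>_. f" "\<lambda>_. c" v] assms(2) by simp

text \<open>The chart of a simplicial cone: \<open>l k\<close> is the pairing with the primitive generator of the
  \<open>k\<close>-th ray, which is primitive as it takes the value 1 (at \<open>w k\<close>), and the generators are
  independent as the \<open>u k\<close> form a dual basis up to positive multiples.\<close>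

locale simplicial_chart =
  fixes n :: nat and \<sigma> :: "real vec set" and K :: "nat set"
    and l :: "nat \<Rightarrow> (nat \<Rightarrow>\<^sub>0 int) \<Rightarrow> int" and w u :: "nat \<Rightarrow> (nat \<Rightarrow>\<^sub>0 int)"
  assumes finite_K: "finite K"
    and form: "\<And>k. k \<in> K \<Longrightarrow> additive_form (l k)"
    and dual_monoid_iff: "\<And>m. m \<in> dual_monoid n \<sigma> \<longleftrightarrow> m \<in> M_lattice n \<and> (\<forall>k\<in>K. 0 \<le> l k m)"
    and prim: "\<And>k. k \<in> K \<Longrightarrow> w k \<in> M_lattice n" "\<And>k. k \<in> K \<Longrightarrow> l k (w k) = 1"
    and sep: "\<And>k. k \<in> K \<Longrightarrow> u k \<in> M_lattice n" "\<And>k. k \<in> K \<Longrightarrow> 0 < l k (u k)"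
      "\<And>k j. k \<in> K \<Longrightarrow> j \<in> K \<Longrightarrow> j \<noteq> k \<Longrightarrow> l j (u k) = 0"
begin

abbreviation "A \<equiv> chart_ring n \<sigma>"
abbreviation "L \<equiv> laurent_ring n"

lemmas AD = subdomainD[OF subdomain_chart_ring[of n \<sigma>]]

lemma chart_ring_iff: "p \<in> A \<longleftrightarrow> p \<in> L \<and> (\<forall>m\<in>keys p. \<forall>k\<in>K. 0 \<le> l k m)"
  unfolding chart_ring_def laurent_ring_def using dual_monoid_iff by blast

lemma chart_ring_sub: "p \<in> A \<Longrightarrow> p \<in> L"
  unfolding chart_ring_iff by blast

lemma chi_chart_iff: "chi m \<in> A \<longleftrightarrow> m \<in> M_lattice n \<and> (\<forall>k\<in>K. 0 \<le> l k m)"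
  unfolding chart_ring_iff by simp

text \<open>A large multiple of \<open>\<Sum>\<^sub>j u\<^sub>j\<close> (\<open>j \<in> J\<close>) is positive enough on the rays in \<open>J\<close> to absorb any finite set of
  exponents, and does not affect the other rays.\<close>

lemma dominating_monomial:
  assumes T: "finite T" and J: "J \<subseteq> K"
  obtains e where "e \<in> M_lattice n" "\<And>k. k \<in> K - J \<Longrightarrow> l k e = 0" "\<And>k. k \<in> J \<Longrightarrow> 0 \<le> l k e"
    "\<And>k m. k \<in> J \<Longrightarrow> m \<in> T \<Longrightarrow> 0 \<le> l k (e + m)"
proof -
  define N where "N = (\<Sum>m\<in>T. \<Sum>k\<in>K. \<bar>l k m\<bar>)"
  define e where "e = frag_cmul N (\<Sum>j\<in>J. u j)"
  have N0: "0 \<le> N" unfolding N_def by (intro sum_nonneg) auto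
  have finJ: "finite J" using J finite_K finite_subset by blast
  have eM: "e \<in> M_lattice n" unfolding e_def
    by (intro M_lattice_cmul M_lattice_sum) (use J sep(1) in blast)
  have le: "l k e = (if k \<in> J then N * l k (u k) else 0)" if k: "k \<in> K" for k
  proof -
    have "l k e = N * (\<Sum>j\<in>J. l k (u j))"
      unfolding e_def additive_formD(5,6)[OF form[OF k]] ..
    also have "(\<Sum>j\<in>J. l k (u j)) = (\<Sum>j\<in>J. if j = k then l k (u k) else 0)"
      using sep(3) J k by (intro sum.cong) auto
    finally show ?thesis using finJ by simp
  qed
  have ge: "N \<le> l k e" if "k \<in> J" for k
  proof -
    have k: "k \<in> K" using that J by blast
    have "N * 1 \<le> N * l k (u k)" using sep(2)[OF k] N0 by (intro mult_left_mono) auto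
    then show ?thesis using le[OF k] that by simp
  qed
  have dom: "0 \<le> l k (e + m)" if "k \<in> J" "m \<in> T" for k m
  proof -
    have k: "k \<in> K" using that J by blast
    have "\<bar>l k m\<bar> \<le> (\<Sum>k\<in>K. \<bar>l k m\<bar>)" using k finite_K by (intro member_le_sum) auto
    also have "\<dots> \<le> N" unfolding N_def using T that(2)
      by (intro member_le_sum[of m T "\<lambda>m. \<Sum>k\<in>K. \<bar>l k m\<bar>"]) (auto intro: sum_nonneg)
    finally show ?thesis using ge[OF that(1)] additive_formD(1)[OF form[OF k], of e m] by linarith
  qed
  show ?thesis using that[OF eM] le ge N0 dom J by (metis Diff_iff order_trans subsetD)
qed

lemma clear_denominators:
  assumes "p \<in> L" "q \<in> L" "m \<in> M_lattice n"
  obtains e where "chi e \<in> A" "chi (e + m) \<in> A" "chi e * p \<in> A" "chi e * q \<in> A"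
proof -
  obtain e where e: "e \<in> M_lattice n" "\<And>k. k \<in> K \<Longrightarrow> 0 \<le> l k e"
    "\<And>k v. k \<in> K \<Longrightarrow> v \<in> insert m (keys p \<union> keys q) \<Longrightarrow> 0 \<le> l k (e + v)"
    using dominating_monomial[of "insert m (keys p \<union> keys q)" K] by auto
  have "chi e \<in> A" "chi (e + m) \<in> A" using e assms(3) M_lattice_add unfolding chi_chart_iff by auto
  moreover have "chi e * p \<in> A" "chi e * q \<in> A" unfolding chart_ring_iff keys_mult_chi'
    using e assms laurent_ringD(4)[of "chi e" n] by auto
  ultimately show ?thesis using that by blast
qed

subsection \<open>The primes of the rays\<close>

text \<open>The ideal of the divisor of the \<open>k\<close>-th ray: the functions of positive order along it.\<close>

definition ray_prime :: "nat \<Rightarrow> laurent set" where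
  "ray_prime k = {p \<in> A. \<forall>m\<in>keys p. 0 < l k m}"

lemma not_in_ray_prime:
  assumes "k \<in> K" "p \<in> A" "p \<notin> ray_prime k"
  shows "p \<noteq> 0" "min_val (l k) p = 0"
proof -
  obtain m where m: "m \<in> keys p" "l k m \<le> 0" using assms unfolding ray_prime_def by force
  show p0: "p \<noteq> 0" using m by auto
  have "0 \<le> min_val (l k) p" using assms(1,2) min_val_ge_iff[OF p0] unfolding chart_ring_iff by blast
  then show "min_val (l k) p = 0" using min_val_le[OF m(1), of "l k"] m(2) by simp
qed

lemma in_ray_prime_pos:
  assumes "p \<in> ray_prime k" "p \<noteq> 0"
  shows "0 < min_val (l k) p"
  using min_val_attained[OF assms(2), of "l k"] assms(1) unfolding ray_prime_def by auto

text \<open>The order \<open>min_val (l k)\<close> is additive on products, so elements of order 0 are closed under multiplication.\<close>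

lemma prime_ray_prime:
  assumes k: "k \<in> K"
  shows "prime_ideal_in A (ray_prime k)"
  unfolding prime_ideal_in_def
proof (intro conjI ballI impI)
  show "ray_prime k \<subseteq> A" "0 \<in> ray_prime k" using AD(2) unfolding ray_prime_def by auto
  show "1 \<notin> ray_prime k" using additive_formD(2)[OF form[OF k]] unfolding ray_prime_def by simp
next
  fix a b assume "a \<in> ray_prime k" "b \<in> ray_prime k"
  then show "a + b \<in> ray_prime k" using AD(3)[of a b] keys_add[of a b] unfolding ray_prime_def by auto
next
  fix a b assume ab: "a \<in> A" "b \<in> ray_prime k"
  have "1 \<le> l k m" if m: "m \<in> keys (a * b)" for m
  proof -
    have "0 + 1 \<le> l k m" using m
      by (rule keys_mult_ge[OF form[OF k], rotated 2])
        (use ab k in \<open>auto simp: chart_ring_iff ray_prime_def dest!: bspec\<close>)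
    then show ?thesis by simp
  qed
  then show "a * b \<in> ray_prime k" using ab AD(4)[of a b] unfolding ray_prime_def by force
next
  fix a b assume ab: "a \<in> A" "b \<in> A" "a * b \<in> ray_prime k"
  show "a \<in> ray_prime k \<or> b \<in> ray_prime k"
  proof (rule ccontr)
    assume "\<not> ?thesis"
    then have *: "a \<noteq> 0" "b \<noteq> 0" "min_val (l k) a = 0" "min_val (l k) b = 0"
      using not_in_ray_prime[OF k] ab by auto
    then have "min_val (l k) (a * b) = 0" using min_val_mult[OF form[OF k]] by simp
    moreover have "0 < min_val (l k) (a * b)" using in_ray_prime_pos[OF ab(3)] * by simp
    ultimately show False by simp
  qed
qed

lemma chi_sep_in: "k \<in> K \<Longrightarrow> chi (u k) \<in> ray_prime k"
  unfolding ray_prime_def using sep by (auto simp: chi_chart_iff) (metis order.refl order.strict_implies_order)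

lemma prime_prod_in:
  assumes I: "prime_ideal_in A I" and f: "\<And>i. i \<in> J \<Longrightarrow> f i \<in> A" "\<And>i. i \<in> J \<Longrightarrow> f i \<notin> I"
  shows "prod f J \<in> A \<and> prod f J \<notin> I"
  using f
proof (induction J rule: infinite_finite_induct)
  case (insert i J)
  then show ?case using AD(4)[of "f i" "prod f J"] prime_ideal_inD(6)[OF I, of "f i" "prod f J"] by auto
qed (use AD(1) prime_ideal_inD(5)[OF I] in auto)

text \<open>A product of elements of the primes of the rays with the right multiplicities is divisible by
  the given monomial.\<close>

lemma monomial_in_prime:
  assumes I: "prime_ideal_in A I" and m: "chi m \<in> I"
  obtains k where "k \<in> K" "ray_prime k \<subseteq> I"
proof (rule ccontr)
  assume "\<not> thesis"
  then have "\<forall>k\<in>K. \<exists>f. f \<in> ray_prime k \<and> f \<notin> I" using that by blast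
  then obtain f where f: "\<And>k. k \<in> K \<Longrightarrow> f k \<in> ray_prime k" "\<And>k. k \<in> K \<Longrightarrow> f k \<notin> I" by metis
  have mA: "m \<in> M_lattice n" "\<And>k. k \<in> K \<Longrightarrow> 0 \<le> l k m"
    using m prime_ideal_inD(1)[OF I] chi_chart_iff by blast+
  have fA: "f k \<in> A" if "k \<in> K" for k using f(1)[OF that] unfolding ray_prime_def by blast
  define h where "h = (\<lambda>k. f k ^ nat (l k m))"
  have h: "h k \<in> A" "h k \<notin> I" if k: "k \<in> K" for k
    using prime_prod_in[OF I, of "{..<nat (l k m)}" "\<lambda>_. f k"] fA[OF k] f(2)[OF k] unfolding h_def by auto
  define g where "g = prod h K"
  have g: "g \<in> A" "g \<notin> I" using prime_prod_in[OF I h, of K "\<lambda>k. k"] unfolding g_def by auto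
  have keys: "l k m \<le> l k v" if k: "k \<in> K" and v: "v \<in> keys g" for k v
  proof -
    have "(\<Sum>j\<in>K. if j = k then l k m else 0) \<le> l k v"
    proof (rule keys_prod_ge[OF form[OF k] _ v[unfolded g_def]])
      fix j v assume j: "j \<in> K" "v \<in> keys (h j)"
      show "(if j = k then l k m else 0) \<le> l k v"
      proof (cases "j = k")
        case True
        have "1 \<le> l k x" if "x \<in> keys (f k)" for x
          using f(1)[OF k] that unfolding ray_prime_def by force
        moreover have "v \<in> keys (f k ^ nat (l k m))" using j True unfolding h_def by simp
        ultimately have "int (nat (l k m)) * 1 \<le> l k v" by (rule keys_power_ge[OF form[OF k]])
        then show ?thesis using mA(2)[OF k] True by simp
      next
        case False
        then show ?thesis using h(1)[OF j(1)] j k unfolding chart_ring_iff by auto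
      qed
    qed
    then show ?thesis using k finite_K by simp
  qed
  have "chi (- m) * g \<in> A" unfolding chart_ring_iff keys_mult_chi'
    using laurent_ringD(4)[of "chi (- m)" n g] M_lattice_uminus[OF mA(1)] chart_ring_sub[OF g(1)] keys
      additive_formD(4)[OF form, of _ _ m] by auto
  then have "(chi (- m) * g) * chi m \<in> I" using prime_ideal_inD(4)[OF I _ m] by blast
  moreover have "(chi (- m) * g) * chi m = g" using chi_inverse(2)[of m] by (simp add: mult.commute mult.left_commute)
  ultimately show False using g by simp
qed

lemma ray_prime_sub_iff: "j \<in> K \<Longrightarrow> k \<in> K \<Longrightarrow> ray_prime j \<subseteq> ray_prime k \<longleftrightarrow> j = k"
proof (intro iffI; (simp; fail)?)
  assume jk: "j \<in> K" "k \<in> K" "ray_prime j \<subseteq> ray_prime k"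
  then have "chi (u j) \<in> ray_prime k" using chi_sep_in by blast
  then have "0 < l k (u j)" unfolding ray_prime_def by simp
  then show "j = k" using sep(3)[OF jk(1,2)] by (metis order.irrefl)
qed

text \<open>Up to a factor outside the prime of a ray, every element is a monomial. So a nonzero prime inside
  it contains a monomial, hence the prime of a ray.\<close>

lemma height_one_ray_prime:
  assumes k: "k \<in> K"
  shows "height_one_in A (ray_prime k)"
  unfolding height_one_in_def
proof (intro conjI allI impI prime_ray_prime[OF k])
  show "ray_prime k \<noteq> {0}" using chi_sep_in[OF k] by (metis chi_nonzero singletonD)
  fix J assume J: "prime_ideal_in A J" "J \<subseteq> ray_prime k"
  show "J = {0} \<or> J = ray_prime k"
  proof (rule disjCI)
    assume "J \<noteq> ray_prime k"
    show "J = {0}"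
    proof (rule ccontr)
      assume "J \<noteq> {0}"
      then obtain f where f: "f \<in> J" "f \<noteq> 0" using prime_ideal_inD(2)[OF J(1)] by blast
      have fA: "f \<in> A" using f prime_ideal_inD(1)[OF J(1)] by blast
      define c where "c = min_val (l k) f"
      define m where "m = frag_cmul (- c) (w k)"
      have m: "m \<in> M_lattice n" "l k m = - c"
        unfolding m_def using M_lattice_cmul[OF prim(1)[OF k]] additive_formD(5)[OF form[OF k]] prim(2)[OF k] by auto
      have "c > 0" unfolding c_def using in_ray_prime_pos f J(2) by blast
      obtain e where e: "e \<in> M_lattice n" "\<And>j. j \<in> K - (K - {k}) \<Longrightarrow> l j e = 0" "\<And>j. j \<in> K - {k} \<Longrightarrow> 0 \<le> l j e"
        "\<And>j v. j \<in> K - {k} \<Longrightarrow> v \<in> insert (- m) ((\<lambda>v. m + v) ` keys f) \<Longrightarrow> 0 \<le> l j (e + v)"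
        using dominating_monomial[of "insert (- m) ((\<lambda>v. m + v) ` keys f)" "K - {k}"] by auto
      have ek: "l k e = 0" using e(2) k by blast
      have s1: "chi (e + m) * f \<in> A" unfolding chart_ring_iff keys_mult_chi'
      proof (intro conjI ballI)
        show "chi (e + m) * f \<in> L" using laurent_ringD(4) chart_ring_sub[OF fA] e(1) m(1) M_lattice_add by simp
        fix v j assume v: "v \<in> (\<lambda>u. e + m + u) ` keys f" and j: "j \<in> K"
        then obtain x where x: "x \<in> keys f" "v = e + (m + x)" by (auto simp: add.assoc)
        show "0 \<le> l j v"
        proof (cases "j = k")
          case True
          have "c \<le> l k x" unfolding c_def using min_val_le[OF x(1)] .
          then show ?thesis unfolding x True using additive_formD(1)[OF form[OF k]] ek m(2) by simp
        next
          case False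
          then show ?thesis using e(4)[of j "m + x"] x j by auto
        qed
      qed
      have "min_val (l k) (chi (e + m) * f) = 0"
        using min_val_mult[OF form[OF k], of "chi (e + m)" f] f(2) ek m(2)
          additive_formD(1)[OF form[OF k]] unfolding c_def by simp
      then have "chi (e + m) * f \<notin> ray_prime k" using in_ray_prime_pos[of "chi (e + m) * f" k] f(2) by auto
      then have nJ: "chi (e + m) * f \<notin> J" using J(2) by blast
      have s2: "chi (e - m) \<in> A"
      proof -
        have "0 \<le> l j (e - m)" if j: "j \<in> K" for j
          using e(4)[of j "- m"] j ek m(2) \<open>c > 0\<close> additive_formD(4)[OF form[OF k]]
          by (cases "j = k") auto
        then show ?thesis unfolding chi_chart_iff using e(1) m(1) M_lattice_diff by blast
      qed
      have s3: "chi (e + e) \<in> A"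
      proof -
        have "0 \<le> l j (e + e)" if j: "j \<in> K" for j
          unfolding additive_formD(1)[OF form[OF j]] using e(3)[of j] j ek by (cases "j = k") auto
        then show ?thesis unfolding chi_chart_iff using e(1) M_lattice_add by blast
      qed
      have eq: "chi (e - m) * (chi (e + m) * f) = chi (e + e) * f"
        by (simp add: mult.assoc[symmetric] chi_add[symmetric])
      have "chi (e - m) * (chi (e + m) * f) \<in> J"
        unfolding eq using prime_ideal_inD(4)[OF J(1) s3 f(1)] .
      then have "chi (e - m) \<in> J" using prime_ideal_inD(6)[OF J(1) s2 s1] nJ by blast
      then obtain j where j: "j \<in> K" "ray_prime j \<subseteq> J" using monomial_in_prime[OF J(1)] by blast
      then have "j = k" using ray_prime_sub_iff[OF j(1) k] J(2) by blast
      then show False using j J(2) \<open>J \<noteq> ray_prime k\<close> by blast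
    qed
  qed
qed

text \<open>An element of nonnegative order becomes a quotient of chart functions with denominator of order 0 after
  multiplication by a monomial that gives the denominator order 0 along the \<open>k\<close>-th ray and clears the exponents on the others.\<close>

lemma local_fractions_ray_prime:
  assumes k: "k \<in> K"
  shows "local_fractions A (ray_prime k) = val_ring n (ord_form n (l k))"
proof (intro equalityI subsetI)
  fix x assume "x \<in> local_fractions A (ray_prime k)"
  then obtain a b where ab: "a \<in> A" "b \<in> A" "b \<notin> ray_prime k" "x = Fract a b"
    unfolding local_fractions_def by blast
  have b: "b \<noteq> 0" "min_val (l k) b = 0" using not_in_ray_prime[OF k ab(2,3)] .
  have "0 \<le> ord_form n (l k) x" if "a \<noteq> 0"
    using ord_form_Fract[OF form[OF k] chart_ring_sub[OF ab(1)] chart_ring_sub[OF ab(2)] that b(1)] b(2)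
      min_val_ge_iff[OF that, of 0 "l k"] ab(1) k unfolding ab(4) chart_ring_iff by auto
  then show "x \<in> val_ring n (ord_form n (l k))"
    unfolding val_ring_iff ab(4) using Fract_in chart_ring_sub ab(1,2) Fract_eq_0[OF b(1)] by auto
next
  fix x assume x: "x \<in> val_ring n (ord_form n (l k))"
  show "x \<in> local_fractions A (ray_prime k)"
  proof (cases "x = 0")
    case True
    have "1 \<in> A - ray_prime k" using AD(1) prime_ideal_inD(5)[OF prime_ray_prime[OF k]] by blast
    then show ?thesis unfolding local_fractions_def True using AD(2) Zero_fract_def by blast
  next
    case False
    then obtain p q where pq: "p \<in> L" "q \<in> L" "p \<noteq> 0" "q \<noteq> 0" "x = Fract p q"
      using x function_field_nonzero unfolding val_ring_iff by blast
    define c where "c = min_val (l k) q"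
    have pc: "c \<le> min_val (l k) p" unfolding c_def
      using x False ord_form_Fract[OF form[OF k] pq(1-4)] unfolding val_ring_iff pq(5) by simp
    define m where "m = frag_cmul (- c) (w k)"
    have m: "m \<in> M_lattice n" "l k m = - c"
      unfolding m_def using M_lattice_cmul[OF prim(1)[OF k]] additive_formD(5)[OF form[OF k]] prim(2)[OF k] by auto
    let ?T = "(\<lambda>v. m + v) ` (keys p \<union> keys q)"
    obtain e where e: "e \<in> M_lattice n" "\<And>j. j \<in> K - (K - {k}) \<Longrightarrow> l j e = 0"
      "\<And>j. j \<in> K - {k} \<Longrightarrow> 0 \<le> l j e" "\<And>j v. j \<in> K - {k} \<Longrightarrow> v \<in> ?T \<Longrightarrow> 0 \<le> l j (e + v)"
      by (rule dominating_monomial[of ?T "K - {k}"]) auto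
    have ek: "l k e = 0" using e(2) k by blast
    have s: "chi (e + m) * f \<in> A" if f: "f \<in> L" "f \<noteq> 0" "c \<le> min_val (l k) f"
      "keys f \<subseteq> keys p \<union> keys q" for f
      unfolding chart_ring_iff keys_mult_chi'
    proof (intro conjI ballI)
      show "chi (e + m) * f \<in> L" using laurent_ringD(4) f(1) e(1) m(1) M_lattice_add by simp
      fix v j assume v: "v \<in> (\<lambda>u. e + m + u) ` keys f" and j: "j \<in> K"
      then obtain x where x: "x \<in> keys f" "v = e + (m + x)" by (auto simp: add.assoc)
      show "0 \<le> l j v"
      proof (cases "j = k")
        case True
        have "c \<le> l k x" using min_val_le[OF x(1), of "l k"] f(3) by simp
        then show ?thesis unfolding x True using additive_formD(1)[OF form[OF k]] ek m(2) by simp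
      next
        case False
        then show ?thesis using e(4)[of j "m + x"] x j f(4) by auto
      qed
    qed
    have "chi (e + m) * p \<in> A" "chi (e + m) * q \<in> A" using s pq pc unfolding c_def by auto
    moreover have "min_val (l k) (chi (e + m) * q) = 0"
      using min_val_mult[OF form[OF k], of "chi (e + m)" q] pq(4) ek m(2)
        additive_formD(1)[OF form[OF k]] unfolding c_def by simp
    then have "chi (e + m) * q \<notin> ray_prime k" using in_ray_prime_pos[of "chi (e + m) * q" k] pq(4) by auto
    moreover have "x = Fract (chi (e + m) * p) (chi (e + m) * q)"
      unfolding pq(5) by (simp add: mult_fract_cancel)
    ultimately show ?thesis unfolding local_fractions_def by blast
  qed
qed

subsection \<open>The primes that meet the torus\<close>

text \<open>The ideal of the closure in the chart of the divisor \<open>\<pi> = 0\<close> of the torus.\<close>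

definition torus_prime :: "laurent \<Rightarrow> laurent set" where
  "torus_prime \<pi> = {p \<in> A. dvd_in L \<pi> p}"

lemma dvd_chi_mult:
  assumes "m \<in> M_lattice n" "p \<in> L"
  shows "dvd_in L \<pi> (chi m * p) \<longleftrightarrow> dvd_in L \<pi> p"
proof
  assume "dvd_in L \<pi> (chi m * p)"
  then obtain c where c: "c \<in> L" "chi m * p = \<pi> * c" unfolding dvd_in_def by blast
  have "p = chi (- m) * (chi m * p)" by (simp add: mult.assoc[symmetric])
  also have "\<dots> = \<pi> * (chi (- m) * c)" unfolding c(2) by (rule mult.left_commute)
  finally show "dvd_in L \<pi> p"
    by (rule dvd_inI) (use c(1) assms(1) in \<open>auto intro!: laurent_ringD(4) M_lattice_uminus\<close>)
next
  assume "dvd_in L \<pi> p"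
  then obtain c where c: "c \<in> L" "p = \<pi> * c" unfolding dvd_in_def by blast
  then have "chi m * p = \<pi> * (chi m * c)" by (simp add: mult.left_commute)
  then show "dvd_in L \<pi> (chi m * p)"
    by (rule dvd_inI) (use c(1) assms(1) in \<open>auto intro!: laurent_ringD(4)\<close>)
qed

lemma chi_not_in_torus_prime:
  assumes "prime_in L \<pi>"
  shows "chi m \<notin> torus_prime \<pi>"
proof
  assume "chi m \<in> torus_prime \<pi>"
  then have "m \<in> M_lattice n" "dvd_in L \<pi> (chi m)" unfolding torus_prime_def using chi_chart_iff by blast+
  then show False using prime_not_dvd_unit[OF subdomain_laurent_ring assms unit_in_chi] by blast
qed

lemma prime_torus_prime:
  assumes \<pi>: "prime_in L \<pi>"
  shows "prime_ideal_in A (torus_prime \<pi>)"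
  unfolding prime_ideal_in_def
proof (intro conjI ballI impI)
  show "torus_prime \<pi> \<subseteq> A" unfolding torus_prime_def by blast
  show "0 \<in> torus_prime \<pi>" unfolding torus_prime_def dvd_in_def using AD(2) laurent_ringD(2) by force
  show "1 \<notin> torus_prime \<pi>" using chi_not_in_torus_prime[OF \<pi>, of 0] by simp
next
  fix a b assume "a \<in> torus_prime \<pi>" "b \<in> torus_prime \<pi>"
  then obtain c d where *: "a \<in> A" "b \<in> A" "c \<in> L" "d \<in> L" "a = \<pi> * c" "b = \<pi> * d"
    unfolding torus_prime_def dvd_in_def by blast
  then have "a + b = \<pi> * (c + d)" by (simp add: distrib_left)
  then show "a + b \<in> torus_prime \<pi>" unfolding torus_prime_def
    using dvd_inI[of "a + b" \<pi> "c + d"] laurent_ringD(3)[OF *(3,4)] AD(3)[OF *(1,2)] by blast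
next
  fix a b assume a: "a \<in> A" and "b \<in> torus_prime \<pi>"
  then obtain d where *: "b \<in> A" "d \<in> L" "b = \<pi> * d" unfolding torus_prime_def dvd_in_def by blast
  then have "a * b = \<pi> * (a * d)" by simp
  then show "a * b \<in> torus_prime \<pi>" unfolding torus_prime_def
    using dvd_inI[of "a * b" \<pi> "a * d"] laurent_ringD(4)[OF chart_ring_sub[OF a] *(2)] AD(4)[OF a *(1)] by blast
next
  fix a b assume "a \<in> A" "b \<in> A" "a * b \<in> torus_prime \<pi>"
  then show "a \<in> torus_prime \<pi> \<or> b \<in> torus_prime \<pi>"
    using prime_inD(4)[OF \<pi>, of a b] chart_ring_sub unfolding torus_prime_def by blast
qed

text \<open>Contraction to the chart loses nothing up to monomials: a monomial multiple of \<open>\<pi>\<close> lies in the chart.\<close>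

lemma torus_prime_witness:
  assumes "\<pi> \<in> L" "\<pi> \<noteq> 0"
  obtains e where "e \<in> M_lattice n" "chi e * \<pi> \<in> torus_prime \<pi>" "chi e * \<pi> \<noteq> 0"
proof -
  obtain e where e: "chi e \<in> A" "chi e * \<pi> \<in> A" using clear_denominators[OF assms(1) assms(1) M_lattice_0] by blast
  have "e \<in> M_lattice n" using e(1) chi_chart_iff by blast
  moreover have "dvd_in L \<pi> (chi e * \<pi>)" by (rule dvd_inI[OF _ chart_ring_sub[OF e(1)]]) (simp add: mult.commute)
  ultimately show ?thesis using that e(2) assms(2) unfolding torus_prime_def by simp
qed

text \<open>A nonzero prime without monomials contains, up to a monomial, one of the prime factors in the
  Laurent polynomial ring of any of its elements.\<close>

lemma torus_prime_in_prime:
  assumes I: "prime_ideal_in A I" "I \<noteq> {0}" and no: "\<And>m. chi m \<notin> I"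
  obtains \<pi> where "prime_in L \<pi>" "torus_prime \<pi> \<subseteq> I"
proof -
  obtain a where a: "a \<in> I" "a \<noteq> 0" using I prime_ideal_inD(2)[OF I(1)] by blast
  have aL: "a \<in> L" using a prime_ideal_inD(1)[OF I(1)] chart_ring_sub by blast
  have "\<exists>\<pi>. prime_in L \<pi> \<and> torus_prime \<pi> \<subseteq> I" if "m \<in> M_lattice n" "chi m * b \<in> I" "prime_product L b" for m b
    using subdomain_laurent_ring that(3,1,2)
  proof (induction b arbitrary: m rule: prime_product_induct)
    case (unit v)
    obtain v' where v': "v \<in> L" "v' \<in> L" "v * v' = 1" using unit(1) unfolding unit_in_def by blast
    obtain e where e: "chi e * v' \<in> A" using clear_denominators[OF v'(2) v'(2) M_lattice_0] by blast
    have "(chi e * v') * (chi m * v) = chi (e + m) * (v * v')" by (simp add: chi_add mult_ac)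
    then have "chi (e + m) \<in> I" using prime_ideal_inD(4)[OF I(1) e unit(3)] v'(3) by simp
    then show ?case using no by blast
  next
    case (prime \<pi> b)
    have \<pi>L: "\<pi> \<in> L" using prime_inD(1)[OF prime(1)] .
    obtain e1 where e1: "chi e1 \<in> A" "chi (e1 + - m) \<in> A" "chi e1 * \<pi> \<in> A"
      using clear_denominators[OF \<pi>L \<pi>L M_lattice_uminus[OF prime(6)]] by blast
    obtain e2 where e2: "chi e2 \<in> A" "chi e2 * b \<in> A"
      using clear_denominators[OF prime(3) prime(3) M_lattice_0] by blast
    have eq: "(chi e1 * \<pi>) * (chi e2 * b) = (chi (e1 + - m) * chi e2) * (chi m * (\<pi> * b))"
    proof -
      have "chi e1 = chi (e1 + - m) * chi m" by (simp add: chi_add[symmetric])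
      then show ?thesis by (simp only: mult_ac)
    qed
    have "(chi e1 * \<pi>) * (chi e2 * b) \<in> I"
      unfolding eq using prime_ideal_inD(4)[OF I(1) AD(4)[OF e1(2) e2(1)] prime(7)] .
    then consider "chi e1 * \<pi> \<in> I" | "chi e2 * b \<in> I" using prime_ideal_inD(6)[OF I(1) e1(3) e2(2)] by blast
    then show ?case
    proof cases
      case 1
      have "p \<in> I" if p: "p \<in> torus_prime \<pi>" for p
      proof -
        obtain c where c: "p \<in> A" "c \<in> L" "p = \<pi> * c" using p unfolding torus_prime_def dvd_in_def by blast
        obtain t where t: "chi t \<in> A" "chi t * c \<in> A" using clear_denominators[OF c(2) c(2) M_lattice_0] by blast
        have eq: "(chi t * c) * (chi e1 * \<pi>) = (chi t * chi e1) * p" unfolding c(3) by (simp add: mult_ac)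
        have "(chi t * chi e1) * p \<in> I" using prime_ideal_inD(4)[OF I(1) t(2) 1] unfolding eq .
        moreover have "chi t * chi e1 \<notin> I" using no[of "t + e1"] by (simp add: chi_add)
        ultimately show ?thesis using prime_ideal_inD(6)[OF I(1) AD(4)[OF t(1) e1(1)] c(1)] by blast
      qed
      then show ?thesis using prime(1) by blast
    next
      case 2
      then show ?thesis using prime.IH[of e2] e2(1) chi_chart_iff by blast
    qed
  qed
  from this[of 0 a] show ?thesis using that a prime_product_laurent[OF aL a(2)] by auto
qed

text \<open>The witness of \<open>\<pi>'\<close> shows that \<open>\<pi>\<close> divides \<open>\<pi>'\<close> up to a monomial, that is, up to a unit of the Laurent
  polynomial ring; so there are no inclusions among these primes except equalities.\<close>

lemma torus_prime_associated:
  assumes \<pi>: "prime_in L \<pi>" "prime_in L \<pi>'" and sub: "torus_prime \<pi>' \<subseteq> torus_prime \<pi>"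
  obtains v where "unit_in L v" "\<pi>' = \<pi> * v" "torus_prime \<pi>' = torus_prime \<pi>"
proof -
  have \<pi>L: "\<pi> \<in> L" "\<pi>' \<in> L" "\<pi>' \<noteq> 0" using prime_inD \<pi> by auto
  obtain e where e: "e \<in> M_lattice n" "chi e * \<pi>' \<in> torus_prime \<pi>'" using torus_prime_witness[OF \<pi>L(2,3)] by blast
  then have "dvd_in L \<pi> (chi e * \<pi>')" using sub unfolding torus_prime_def by blast
  then have "dvd_in L \<pi> \<pi>'" using dvd_chi_mult[OF e(1) \<pi>L(2)] by blast
  then obtain v where v: "unit_in L v" "\<pi>' = \<pi> * v"
    using prime_dvd_prime[OF subdomain_laurent_ring \<pi>] by blast
  obtain v' where v': "v' \<in> L" "v * v' = 1" using v(1) unfolding unit_in_def by blast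
  have "p \<in> torus_prime \<pi>'" if p: "p \<in> torus_prime \<pi>" for p
  proof -
    obtain c where c: "p \<in> A" "c \<in> L" "p = \<pi> * c" using p unfolding torus_prime_def dvd_in_def by blast
    have "p = \<pi> * (v * v') * c" using c v' by simp
    then have "p = \<pi>' * (v' * c)" unfolding v(2) by (simp add: mult.assoc)
    then have "dvd_in L \<pi>' p" by (rule dvd_inI) (rule laurent_ringD(4)[OF v'(1) c(2)])
    then show ?thesis using c(1) unfolding torus_prime_def by blast
  qed
  then show ?thesis using that[OF v] sub by blast
qed

text \<open>The codimension one points of a chart: a nonzero prime either contains a monomial, and then the prime of a ray, or
  contains none, and then the prime of a divisor of the torus. All of these are minimal.\<close>

lemma height_one_iff:
  "height_one_in A I \<longleftrightarrow> (\<exists>k\<in>K. I = ray_prime k) \<or> (\<exists>\<pi>. prime_in L \<pi> \<and> I = torus_prime \<pi>)"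
proof
  assume "height_one_in A I"
  then have I: "prime_ideal_in A I" "I \<noteq> {0}"
    "\<And>J. prime_ideal_in A J \<Longrightarrow> J \<subseteq> I \<Longrightarrow> J = {0} \<or> J = I" unfolding height_one_in_def by blast+
  show "(\<exists>k\<in>K. I = ray_prime k) \<or> (\<exists>\<pi>. prime_in L \<pi> \<and> I = torus_prime \<pi>)"
  proof (cases "\<exists>m. chi m \<in> I")
    case True
    then obtain k where k: "k \<in> K" "ray_prime k \<subseteq> I" using monomial_in_prime[OF I(1)] by blast
    have "ray_prime k \<noteq> {0}" using height_one_ray_prime[OF k(1)] unfolding height_one_in_def by blast
    then show ?thesis using I(3)[OF prime_ray_prime[OF k(1)] k(2)] k(1) by blast
  next
    case False
    then obtain \<pi> where \<pi>: "prime_in L \<pi>" "torus_prime \<pi> \<subseteq> I" using torus_prime_in_prime[OF I(1,2)] by blast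
    have "torus_prime \<pi> \<noteq> {0}" using torus_prime_witness[of \<pi>] prime_inD(1,2)[OF \<pi>(1)] by blast
    then show ?thesis using I(3)[OF prime_torus_prime[OF \<pi>(1)] \<pi>(2)] \<pi>(1) by blast
  qed
next
  assume "(\<exists>k\<in>K. I = ray_prime k) \<or> (\<exists>\<pi>. prime_in L \<pi> \<and> I = torus_prime \<pi>)"
  then consider k where "k \<in> K" "I = ray_prime k" | \<pi> where "prime_in L \<pi>" "I = torus_prime \<pi>" by blast
  then show "height_one_in A I"
  proof cases
    case 1
    then show ?thesis using height_one_ray_prime by blast
  next
    case 2
    show ?thesis unfolding height_one_in_def
    proof (intro conjI allI impI)
      show "prime_ideal_in A I" using prime_torus_prime 2 by blast
      show "I \<noteq> {0}" using torus_prime_witness[of \<pi>] prime_inD(1,2)[OF 2(1)] 2(2) by blast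
      fix J assume J: "prime_ideal_in A J" "J \<subseteq> I"
      show "J = {0} \<or> J = I"
      proof (rule disjCI)
        assume "J \<noteq> I"
        show "J = {0}"
        proof (rule ccontr)
          assume "J \<noteq> {0}"
          then obtain \<pi>' where \<pi>': "prime_in L \<pi>'" "torus_prime \<pi>' \<subseteq> J"
            using torus_prime_in_prime[OF J(1)] J(2) chi_not_in_torus_prime[OF 2(1)] 2(2) by blast
          then have "torus_prime \<pi>' = torus_prime \<pi>"
            using torus_prime_associated[OF 2(1) \<pi>'(1)] J(2) 2(2) by blast
          then show False using \<pi>' J(2) 2(2) \<open>J \<noteq> I\<close> by blast
        qed
      qed
    qed
  qed
qed

lemma local_fractions_torus_prime:
  assumes \<pi>: "prime_in L \<pi>"
  shows "local_fractions A (torus_prime \<pi>) = val_ring n (ord_prime n \<pi>)"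
proof (intro equalityI subsetI)
  fix x assume "x \<in> local_fractions A (torus_prime \<pi>)"
  then obtain a b where ab: "a \<in> A" "b \<in> A" "b \<notin> torus_prime \<pi>" "x = Fract a b"
    unfolding local_fractions_def by blast
  have b: "b \<noteq> 0" "\<not> dvd_in L \<pi> b" using ab prime_ideal_inD(2)[OF prime_torus_prime[OF \<pi>]]
    unfolding torus_prime_def by auto
  have "0 \<le> ord_prime n \<pi> x" if "a \<noteq> 0"
    using ord_prime_Fract[OF \<pi> chart_ring_sub[OF ab(1)] chart_ring_sub[OF ab(2)] that b(1)]
      mult_of_not_dvd[OF \<pi> chart_ring_sub[OF ab(2)] b(2)] unfolding ab(4) by simp
  then show "x \<in> val_ring n (ord_prime n \<pi>)"
    unfolding val_ring_iff ab(4) using Fract_in chart_ring_sub ab(1,2) Fract_eq_0[OF b(1)] by auto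
next
  fix x assume x: "x \<in> val_ring n (ord_prime n \<pi>)"
  show "x \<in> local_fractions A (torus_prime \<pi>)"
  proof (cases "x = 0")
    case True
    have "1 \<in> A - torus_prime \<pi>" using AD(1) prime_ideal_inD(5)[OF prime_torus_prime[OF \<pi>]] by blast
    then show ?thesis unfolding local_fractions_def True using AD(2) Zero_fract_def by blast
  next
    case False
    then obtain p q where pq: "p \<in> L" "q \<in> L" "p \<noteq> 0" "q \<noteq> 0" "x = Fract p q"
      using x function_field_nonzero unfolding val_ring_iff by blast
    let ?i = "mult_of n \<pi> p" and ?j = "mult_of n \<pi> q"
    have ij: "?j \<le> ?i" using x False ord_prime_Fract[OF \<pi> pq(1-4)] unfolding val_ring_iff pq(5) by simp
    obtain p' where p': "p' \<in> L" "p = \<pi> ^ ?i * p'" "\<not> dvd_in L \<pi> p'" using mult_ofE[OF \<pi> pq(1,3)] .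
    obtain q' where q': "q' \<in> L" "q = \<pi> ^ ?j * q'" "\<not> dvd_in L \<pi> q'" using mult_ofE[OF \<pi> pq(2,4)] .
    let ?p = "\<pi> ^ (?i - ?j) * p'"
    have pL: "?p \<in> L" using p'(1) subdomain_power[OF subdomain_laurent_ring prime_inD(1)[OF \<pi>]] laurent_ringD(4) by blast
    have "p = \<pi> ^ ?j * ?p" using ij by (subst p'(2)) (metis le_add_diff_inverse mult.assoc power_add)
    then have x': "x = Fract ?p q'" unfolding pq(5) using q'(2) prime_inD(2)[OF \<pi>]
      by (metis mult_fract_cancel power_not_zero)
    obtain e where e: "chi e \<in> A" "chi e * ?p \<in> A" "chi e * q' \<in> A" using clear_denominators[OF pL q'(1) M_lattice_0] by blast
    have "chi e * q' \<notin> torus_prime \<pi>"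
      using dvd_chi_mult[OF _ q'(1), of e \<pi>] q'(3) e(1) chi_chart_iff unfolding torus_prime_def by blast
    moreover have "x = Fract (chi e * ?p) (chi e * q')" unfolding x' by (simp add: mult_fract_cancel)
    ultimately show ?thesis unfolding local_fractions_def using e by blast
  qed
qed

end


subsection \<open>Rational functions whose zeros and poles avoid the distinguished point\<close>

section \<open>Functions that are invertible off a divisor\<close>

text \<open>Along the rays in \<open>J\<close> the function has the same orders as one character. For a local equation of an
  invariant divisor this says that the divisor agrees there with that of a character.\<close>

definition monomial_orders :: "nat \<Rightarrow> nat set \<Rightarrow> (nat \<Rightarrow> (nat \<Rightarrow>\<^sub>0 int) \<Rightarrow> int) \<Rightarrow> ratfun \<Rightarrow> bool" where
  "monomial_orders n J l x \<longleftrightarrow> (\<exists>m\<in>M_lattice n. \<forall>k\<in>J. ord_form n (l k) x = l k m)"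

text \<open>Write the exponent \<open>0\<close> of \<open>p h\<close> as \<open>a + b\<close> with exponents \<open>a\<close> of \<open>p\<close> and \<open>b\<close> of \<open>h\<close>. All orders of
  \<open>p h\<close> vanish, and orders are additive, so \<open>a\<close> and \<open>b\<close> attain the minimum of every \<open>l k\<close> simultaneously.\<close>

lemma divisor_with_constant_term:
  fixes p h :: laurent
  assumes J: "\<And>k. k \<in> J \<Longrightarrow> additive_form (l k)"
    and g: "0 \<in> keys (p * h)" "\<And>m k. m \<in> keys (p * h) \<Longrightarrow> k \<in> J \<Longrightarrow> 0 \<le> l k m"
  obtains a where "a \<in> keys p" "\<forall>k\<in>J. min_val (l k) p = l k a"
proof -
  obtain a b where ab: "a \<in> keys p" "b \<in> keys h" "0 = a + b"
    using in_keys_multE[OF g(1)] .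
  have nz: "p \<noteq> 0" "h \<noteq> 0" using ab by auto
  have "min_val (l k) p = l k a" if k: "k \<in> J" for k
  proof -
    have "0 \<le> min_val (l k) (p * h)" using min_val_ge_iff[of "p * h" 0 "l k"] nz g(2) k by auto
    moreover have "min_val (l k) (p * h) = min_val (l k) p + min_val (l k) h" using min_val_mult[OF J[OF k] nz] .
    moreover have "l k a + l k b = 0" using ab(3) additive_formD(1,2)[OF J[OF k]] by metis
    ultimately show ?thesis using min_val_le[OF ab(1), of "l k"] min_val_le[OF ab(2), of "l k"] by linarith
  qed
  then show ?thesis using that ab(1) by blast
qed

context
  fixes n :: nat and J :: "nat set" and l :: "nat \<Rightarrow> (nat \<Rightarrow>\<^sub>0 int) \<Rightarrow> int" and g :: laurent
  assumes forms: "\<And>k. k \<in> J \<Longrightarrow> additive_form (l k)"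
    and g: "g \<in> laurent_ring n" "0 \<in> keys g"
      "\<And>m k. m \<in> keys g \<Longrightarrow> k \<in> J \<Longrightarrow> 0 \<le> l k m"
begin

private abbreviation "L \<equiv> laurent_ring n"

private lemma orders_divisor:
  assumes p: "p \<in> L" "dvd_in L p g"
  obtains m where "m \<in> M_lattice n" "\<forall>k\<in>J. min_val (l k) p = l k m"
proof -
  obtain h where h: "g = p * h" using p(2) unfolding dvd_in_def by blast
  obtain a where a: "a \<in> keys p" "\<forall>k\<in>J. min_val (l k) p = l k a"
    by (rule divisor_with_constant_term[of J l p h, OF forms g(2,3)[unfolded h]])
  have "a \<in> M_lattice n" using p(1) a(1) unfolding laurent_ring_def by blast
  then show ?thesis using a(2) by (rule that)
qed

private lemma orders_mult_divisor:
  assumes \<pi>: "\<pi> \<in> L" "\<pi> \<noteq> 0" "dvd_in L \<pi> g" and pq: "p \<in> L" "q \<in> L" "p \<noteq> 0" "q \<noteq> 0"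
    and x: "monomial_orders n J l (Fract p q)"
  shows "monomial_orders n J l (Fract (\<pi> * p) q)" "monomial_orders n J l (Fract p (\<pi> * q))"
proof -
  obtain m where m: "m \<in> M_lattice n" "\<forall>k\<in>J. min_val (l k) \<pi> = l k m"
    using orders_divisor[OF \<pi>(1,3)] .
  obtain m' where m': "m' \<in> M_lattice n" "\<forall>k\<in>J. min_val (l k) p - min_val (l k) q = l k m'"
    using x ord_form_Fract[OF forms pq] unfolding monomial_orders_def by auto
  have 1: "ord_form n (l k) (Fract (\<pi> * p) q) = l k (m + m')" if k: "k \<in> J" for k
    using ord_form_Fract[OF forms[OF k] laurent_ringD(4)[OF \<pi>(1) pq(1)] pq(2) _ pq(4)] \<pi>(2) pq(3)
      min_val_mult[OF forms[OF k] \<pi>(2) pq(3)] bspec[OF m(2) k] bspec[OF m'(2) k] additive_formD(1)[OF forms[OF k]] by simp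
  have 2: "ord_form n (l k) (Fract p (\<pi> * q)) = l k (m' - m)" if k: "k \<in> J" for k
    using ord_form_Fract[OF forms[OF k] pq(1) laurent_ringD(4)[OF \<pi>(1) pq(2)] pq(3)] \<pi>(2) pq(4)
      min_val_mult[OF forms[OF k] \<pi>(2) pq(4)] bspec[OF m(2) k] bspec[OF m'(2) k] additive_formD(4)[OF forms[OF k]] by simp
  show "monomial_orders n J l (Fract (\<pi> * p) q)"
    unfolding monomial_orders_def using 1 M_lattice_add[OF m(1) m'(1)] by blast
  show "monomial_orders n J l (Fract p (\<pi> * q))"
    unfolding monomial_orders_def using 2 M_lattice_diff[OF m'(1) m(1)] by blast
qed

private lemma orders_one: "monomial_orders n J l (Fract 1 1)"
  unfolding monomial_orders_def
  using ord_form_Fract[OF forms, of _ 1 n 1] laurent_ringD(1) additive_formD(2)[OF forms]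
  by (intro bexI[of _ 0]) auto

private lemma unit_dvd: "unit_in L v \<Longrightarrow> v \<in> L \<and> v \<noteq> 0 \<and> dvd_in L v g"
proof (intro conjI)
  assume v: "unit_in L v"
  then obtain v' where v': "v \<in> L" "v' \<in> L" "v * v' = 1" unfolding unit_in_def by blast
  then have "g = v * (v' * g)" by (simp add: mult.assoc[symmetric])
  then show "dvd_in L v g" by (rule dvd_inI) (rule laurent_ringD(4)[OF v'(2) g(1)])
  show "v \<in> L" "v \<noteq> 0" using v' by auto
qed

private lemma mult_of_prime_divisor:
  assumes "prime_in L \<pi>" "dvd_in L \<pi> g" "prime_in L \<pi>'" "\<not> dvd_in L \<pi>' g"
  shows "mult_of n \<pi>' \<pi> = 0"
proof -
  have "\<not> dvd_in L \<pi>' \<pi>"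
  proof
    assume "dvd_in L \<pi>' \<pi>"
    then obtain c d where *: "\<pi> = \<pi>' * c" "c \<in> L" "g = \<pi> * d" "d \<in> L" using assms(2) unfolding dvd_in_def by blast
    then have "g = \<pi>' * (c * d)" by (simp add: mult.assoc)
    then have "dvd_in L \<pi>' g" by (rule dvd_inI) (rule laurent_ringD(4)[OF *(2,4)])
    then show False using assms(4) by blast
  qed
  then show ?thesis using mult_of_not_dvd[OF assms(3) prime_inD(1)[OF assms(1)]] by blast
qed

private lemma orders_denominator:
  assumes "prime_product L q" "\<And>\<pi>. prime_in L \<pi> \<Longrightarrow> \<not> dvd_in L \<pi> g \<Longrightarrow> mult_of n \<pi> q = 0"
  shows "monomial_orders n J l (Fract 1 q)"
  using subdomain_laurent_ring assms
proof (induction q rule: prime_product_induct)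
  case (unit u)
  then show ?case using orders_mult_divisor(2)[OF _ _ _ _ _ _ _ orders_one, of u] unit_dvd laurent_ringD(1) by simp
next
  case (prime \<pi> b)
  note \<pi> = prime_inD[OF prime(1)]
  have \<pi>g: "dvd_in L \<pi> g"
  proof (rule ccontr)
    assume "\<not> dvd_in L \<pi> g"
    then have "mult_of n \<pi> (\<pi> * b) = 0" using prime.prems prime(1) by blast
    then show False using mult_of_mult[OF prime(1) \<pi>(1,2) prime(3,4)] mult_of_self[OF prime(1)] by simp
  qed
  have "mult_of n \<pi>' b = 0" if "prime_in L \<pi>'" "\<not> dvd_in L \<pi>' g" for \<pi>'
    using prime.prems[OF that] mult_of_mult[OF that(1) \<pi>(1,2) prime(3,4)] by simp
  then have "monomial_orders n J l (Fract 1 b)" using prime.IH by blast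
  then show ?case using orders_mult_divisor(2)[OF \<pi>(1,2) \<pi>g laurent_ringD(1) prime(3) one_neq_zero prime(4)] by blast
qed

text \<open>A rational function that is invertible where \<open>g\<close> does not vanish is, up to units, a product of
  powers of divisors of \<open>g\<close>; the constant term of \<open>g\<close> makes their orders those of a monomial.\<close>

theorem orders_of_function_invertible_off_divisor:
  assumes f: "f \<in> function_field n" "f \<noteq> 0"
    and ord: "\<And>\<pi>. prime_in L \<pi> \<Longrightarrow> \<not> dvd_in L \<pi> g \<Longrightarrow> ord_prime n \<pi> f = 0"
  shows "monomial_orders n J l f"
proof -
  obtain p q where pq: "p \<in> L" "q \<in> L" "p \<noteq> 0" "q \<noteq> 0" "f = Fract p q" using function_field_nonzero[OF f] .
  have ord': "mult_of n \<pi> p = mult_of n \<pi> q" if "prime_in L \<pi>" "\<not> dvd_in L \<pi> g" for \<pi>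
    using ord[OF that] ord_prime_Fract[OF that(1) pq(1-4)] unfolding pq(5) by simp
  have "monomial_orders n J l (Fract p q)"
    using subdomain_laurent_ring prime_product_laurent[OF pq(1,3)] pq(2,4) ord'
  proof (induction p arbitrary: q rule: prime_product_induct)
    case (unit u)
    have "mult_of n \<pi> q = 0" if "prime_in L \<pi>" "\<not> dvd_in L \<pi> g" for \<pi>
      using unit(4)[OF that] mult_of_unit[OF that(1) unit(1)] by simp
    then have "monomial_orders n J l (Fract 1 q)"
      using orders_denominator[OF prime_product_laurent[OF unit(2,3)]] by blast
    then show ?case using orders_mult_divisor(1)[OF _ _ _ laurent_ringD(1) unit(2) one_neq_zero unit(3), of u]
        unit_dvd[OF unit(1)] by simp
  next
    case (prime \<pi> b)
    note \<pi> = prime_inD[OF prime(1)]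
    show ?case
    proof (cases "dvd_in L \<pi> g")
      case True
      have "mult_of n \<pi>' b = mult_of n \<pi>' q" if "prime_in L \<pi>'" "\<not> dvd_in L \<pi>' g" for \<pi>'
        using prime.prems(3)[OF that] mult_of_mult[OF that(1) \<pi>(1,2) prime(3,4)]
          mult_of_prime_divisor[OF prime(1) True that] by simp
      then have "monomial_orders n J l (Fract b q)" using prime.IH[OF prime.prems(1,2)] by blast
      then show ?thesis using orders_mult_divisor(1)[OF \<pi>(1,2) True prime(3) prime.prems(1) prime(4) prime.prems(2)] by blast
    next
      case False
      have "mult_of n \<pi> q \<noteq> 0"
        using prime.prems(3)[OF prime(1) False] mult_of_mult[OF prime(1) \<pi>(1,2) prime(3,4)]
          mult_of_self[OF prime(1)] by simp
      then have "dvd_in L \<pi> q" using mult_of_not_dvd[OF prime(1) prime.prems(1)] by auto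
      then obtain q' where q': "q' \<in> L" "q = \<pi> * q'" unfolding dvd_in_def by blast
      have q0: "q' \<noteq> 0" using prime.prems(2) q'(2) by auto
      have "mult_of n \<pi>' b = mult_of n \<pi>' q'" if "prime_in L \<pi>'" "\<not> dvd_in L \<pi>' g" for \<pi>'
        using prime.prems(3)[OF that] mult_of_mult[OF that(1) \<pi>(1,2) prime(3,4)]
          mult_of_mult[OF that(1) \<pi>(1,2) q'(1) q0] q'(2) by simp
      then have "monomial_orders n J l (Fract b q')" using prime.IH[OF q'(1) q0] by blast
      then show ?thesis unfolding q'(2) using \<pi>(2) by (simp add: mult_fract_cancel)
    qed
  qed
  then show ?thesis using pq(5) by simp
qed

end

section \<open>The orbit divisor of a ray\<close>

text \<open>Independence of characters: rescaling one coordinate by 2 separates two exponents.\<close>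

lemma laurent_vanishing_on_torus:
  assumes "finite K" "K \<subseteq> M_lattice n"
    and "\<And>t :: nat \<Rightarrow> complex. \<forall>i<n. t i \<noteq> 0 \<Longrightarrow> (\<Sum>u\<in>K. c u * (\<Prod>i<n. t i powi lookup u i)) = 0"
    and "v \<in> K"
  shows "c v = 0"
  using assms
proof (induction K arbitrary: c v rule: finite_induct)
  case (insert y K)
  have c0: "c x = 0" if x: "x \<in> K" for x
  proof -
    have "x \<noteq> y" using x insert(2) by blast
    then obtain i where i: "lookup x i \<noteq> lookup y i" by (meson poly_mapping_eqI)
    have "i < n" using i x insert.prems(1) unfolding M_lattice_iff[abs_def] by (metis M_lattice_iff insert_subset not_le subsetD)
    define d where "d = (\<lambda>u. c u * (2 powi lookup u i - 2 powi lookup y i :: complex))"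
    have "(\<Sum>u\<in>K. d u * (\<Prod>i<n. t i powi lookup u i)) = 0" if t: "\<forall>i<n. t i \<noteq> 0" for t
    proof -
      let ?t = "t(i := 2 * t i)"
      have scale: "(\<Prod>j<n. ?t j powi lookup u j) =
          2 powi lookup u i * (\<Prod>j<n. t j powi lookup u j)" for u
      proof -
        have "(\<Prod>j<n. ?t j powi lookup u j) =
          (?t i powi lookup u i) * (\<Prod>j\<in>{..<n} - {i}. t j powi lookup u j)"
          using \<open>i < n\<close> by (subst prod.remove[of _ i]) (auto intro!: prod.cong)
        also have "\<dots> = 2 powi lookup u i * (t i powi lookup u i *
          (\<Prod>j\<in>{..<n} - {i}. t j powi lookup u j))"
          by (simp add: power_int_mult_distrib)
        also have "t i powi lookup u i * (\<Prod>j\<in>{..<n} - {i}. t j powi lookup u j) =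
          (\<Prod>j<n. t j powi lookup u j)" using \<open>i < n\<close> by (subst prod.remove[of _ i]) auto
        finally show ?thesis .
      qed
      have 1: "(\<Sum>u\<in>insert y K. c u * (\<Prod>j<n. t j powi lookup u j)) = 0"
        using insert.prems(2)[OF t] .
      have 2: "(\<Sum>u\<in>insert y K. c u * (2 powi lookup u i * (\<Prod>j<n. t j powi lookup u j))) = 0"
        using insert.prems(2)[of ?t] t unfolding scale by simp
      have "0 = (\<Sum>u\<in>insert y K. c u * (2 powi lookup u i * (\<Prod>j<n. t j powi lookup u j)))
          - 2 powi lookup y i * (\<Sum>u\<in>insert y K. c u * (\<Prod>j<n. t j powi lookup u j))"
        unfolding 1 2 by simp
      also have "\<dots> = (\<Sum>u\<in>insert y K. d u * (\<Prod>j<n. t j powi lookup u j))"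
        unfolding sum_distrib_left sum_subtractf[symmetric] d_def by (rule sum.cong) (auto simp: algebra_simps)
      also have "\<dots> = (\<Sum>u\<in>K. d u * (\<Prod>j<n. t j powi lookup u j))"
        using insert(1,2) by (simp add: d_def)
      finally show ?thesis by simp
    qed
    then have "d x = 0" using insert.IH[of d x] insert.prems(1) x by blast
    moreover have "(2::complex) powi lookup x i \<noteq> 2 powi lookup y i"
    proof
      assume "(2::complex) powi lookup x i = 2 powi lookup y i"
      then have "(2::real) powi lookup x i = 2 powi lookup y i"
        by (metis norm_power_int norm_numeral)
      then show False using i by (metis less_irrefl linorder_neqE one_less_numeral_iff power_int_strict_increasing semiring_norm(76))
    qed
    ultimately show ?thesis unfolding d_def by simp
  qed
  have "(\<Sum>u\<in>insert y K. c u * (\<Prod>i<n. 1 powi lookup u i)) = 0"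
    using insert.prems(2)[of "\<lambda>_. 1"] by simp
  then have "c y = 0" using insert(1,2) c0 by simp
  then show ?case using c0 insert.prems(3) by blast
qed simp

text \<open>A function on the chart of a ray vanishes on the closed orbit exactly if its terms of exponent orthogonal to the
  ray vanish on the torus, hence have coefficient zero; what remains has positive order.\<close>

lemma (in simplicial_chart) orbit_divisor_eq:
  assumes K: "K = {k}" and perp: "\<And>m. m \<in> perp n \<sigma> \<longleftrightarrow> m \<in> M_lattice n \<and> l k m = 0"
  shows "orbit_divisor n \<sigma> = val_ring n (ord_form n (l k))"
proof -
  have "(\<forall>\<gamma>\<in>torus_orbit n \<sigma>. eval_at p \<gamma> = 0) \<longleftrightarrow> (\<forall>m\<in>keys p. 0 < l k m)"
    if p: "p \<in> A" for p
  proof -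
    have pM: "m \<in> M_lattice n" "0 \<le> l k m" if "m \<in> keys p" for m
      using p that K unfolding chart_ring_iff laurent_ring_def by auto
    have eval: "eval_at p (\<lambda>u. if u \<in> perp n \<sigma> then e u else 0) =
      (\<Sum>u\<in>{u\<in>keys p. l k u = 0}. lookup p u * e u)" for e
      unfolding eval_at_def by (rule sum.mono_neutral_cong_right) (auto simp: perp pM)
    show ?thesis
    proof
      assume van: "\<forall>\<gamma>\<in>torus_orbit n \<sigma>. eval_at p \<gamma> = 0"
      show "\<forall>m\<in>keys p. 0 < l k m"
      proof (intro ballI, rule ccontr)
        fix m assume m: "m \<in> keys p" "\<not> 0 < l k m"
        have "lookup p m = 0"
        proof (rule laurent_vanishing_on_torus[of "{u\<in>keys p. l k u = 0}" n])
          fix t :: "nat \<Rightarrow> complex" assume "\<forall>i<n. t i \<noteq> 0"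
          then have "(\<lambda>u. if u \<in> perp n \<sigma> then \<Prod>i<n. t i powi lookup u i else 0) \<in> torus_orbit n \<sigma>"
            unfolding torus_orbit_def by auto
          then show "(\<Sum>u\<in>{u\<in>keys p. l k u = 0}.
              lookup p u * (\<Prod>i<n. t i powi lookup u i)) = 0"
            using van eval[of "\<lambda>u. \<Prod>i<n. t i powi lookup u i"] by simp
        qed (use m pM[OF m(1)] pM(1) in auto)
        then show False using m(1) by (simp add: in_keys_iff)
      qed
    next
      assume "\<forall>m\<in>keys p. 0 < l k m"
      then have empty: "{u\<in>keys p. l k u = 0} = {}" by fastforce
      have "eval_at p (\<lambda>u. if u \<in> perp n \<sigma> then e u else 0) = 0" for e unfolding eval empty by simp
      then show "\<forall>\<gamma>\<in>torus_orbit n \<sigma>. eval_at p \<gamma> = 0" unfolding torus_orbit_def by auto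
    qed
  qed
  then have "orbit_ideal n \<sigma> = emb ` ray_prime k"
    unfolding orbit_ideal_def ray_prime_def chart_ring_def[symmetric] by (auto simp: chart_ring_def)
  then show ?thesis unfolding orbit_divisor_def coord_ring_eq
    using local_ring_emb local_fractions_ray_prime K by simp
qed


section \<open>Simplicial cones\<close>

text \<open>Combinations of a family of vectors over an arbitrary finite index set: the generators of a cone are later indexed
  by a set of rays and not by an initial segment of the natural numbers.\<close>

definition comb :: "nat \<Rightarrow> (nat \<Rightarrow> real vec) \<Rightarrow> nat set \<Rightarrow> (nat \<Rightarrow> real) \<Rightarrow> real vec" where
  "comb n g K c = vec n (\<lambda>i. \<Sum>k\<in>K. c k * g k $ i)"

definition cone_of :: "nat \<Rightarrow> (nat \<Rightarrow> real vec) \<Rightarrow> nat set \<Rightarrow> real vec set" where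
  "cone_of n g K = {comb n g K c | c. \<forall>k\<in>K. 0 \<le> c k}"

definition indep :: "nat \<Rightarrow> (nat \<Rightarrow> real vec) \<Rightarrow> nat set \<Rightarrow> bool" where
  "indep n g K \<longleftrightarrow> (\<forall>c. comb n g K c = 0\<^sub>v n \<longrightarrow> (\<forall>k\<in>K. c k = 0))"

lemma comb_carrier [simp]: "comb n g K c \<in> carrier_vec n"
  unfolding comb_def by simp

lemma scalar_prod_comb:
  assumes "u \<in> carrier_vec n" "\<And>k. k \<in> K \<Longrightarrow> g k \<in> carrier_vec n"
  shows "u \<bullet> comb n g K c = (\<Sum>k\<in>K. c k * (u \<bullet> g k))"
proof -
  have "u \<bullet> comb n g K c = (\<Sum>i<n. \<Sum>k\<in>K. u $ i * (c k * g k $ i))"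
    unfolding scalar_prod_def comb_def by (simp add: sum_distrib_left lessThan_atLeast0)
  also have "\<dots> = (\<Sum>k\<in>K. \<Sum>i<n. u $ i * (c k * g k $ i))" by (rule sum.swap)
  also have "\<dots> = (\<Sum>k\<in>K. c k * (u \<bullet> g k))"
  proof (rule sum.cong[OF refl])
    fix k assume "k \<in> K"
    then have "dim_vec (g k) = n" using assms(2)[of k] by auto
    then show "(\<Sum>i<n. u $ i * (c k * g k $ i)) = c k * (u \<bullet> g k)"
      unfolding scalar_prod_def by (simp add: sum_distrib_left lessThan_atLeast0 algebra_simps)
  qed
  finally show ?thesis .
qed

lemma comb_cong: "(\<And>k. k \<in> K \<Longrightarrow> c k = d k) \<Longrightarrow> comb n g K c = comb n g K d"
  unfolding comb_def by (intro eq_vecI) (auto intro!: sum.cong)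

lemma comb_mono:
  assumes "finite J" "K \<subseteq> J" "\<And>k. k \<in> J - K \<Longrightarrow> c k = 0"
  shows "comb n g J c = comb n g K c"
  unfolding comb_def using assms by (intro eq_vecI) (auto intro!: sum.mono_neutral_right)

lemma comb_unit:
  assumes "finite K" "k \<in> K" "g k \<in> carrier_vec n"
  shows "comb n g K (\<lambda>j. if j = k then 1 else 0) = g k"
proof -
  have "comb n g K (\<lambda>j. if j = k then 1 else 0) = comb n g {k} (\<lambda>j. if j = k then 1 else 0)"
    using assms by (intro comb_mono) auto
  also have "\<dots> = g k" using assms(3) unfolding comb_def by (intro eq_vecI) auto
  finally show ?thesis .
qed

lemma comb_single: "g k \<in> carrier_vec n \<Longrightarrow> comb n g {k} c = c k \<cdot>\<^sub>v g k"
  unfolding comb_def by (intro eq_vecI) auto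

lemma gen_in_cone: "finite K \<Longrightarrow> k \<in> K \<Longrightarrow> g k \<in> carrier_vec n \<Longrightarrow> g k \<in> cone_of n g K"
  unfolding cone_of_def using comb_unit[of K k g n] by (auto intro!: exI[of _ "\<lambda>j. if j = k then 1 else 0"])

lemma cone_of_mono:
  assumes "finite J" "K \<subseteq> J"
  shows "cone_of n g K \<subseteq> cone_of n g J"
proof
  fix x assume "x \<in> cone_of n g K"
  then obtain c where c: "\<forall>k\<in>K. 0 \<le> c k" "x = comb n g K c" unfolding cone_of_def by blast
  let ?d = "\<lambda>k. if k \<in> K then c k else 0"
  have "x = comb n g K ?d" unfolding c(2) by (rule comb_cong) simp
  also have "\<dots> = comb n g J ?d" by (rule comb_mono[symmetric]) (use assms in auto)
  finally show "x \<in> cone_of n g J" unfolding cone_of_def using c(1) by auto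
qed

lemma mult_mat_vec_comb:
  assumes "A \<in> carrier_mat n k" "c \<in> carrier_vec k"
  shows "A *\<^sub>v c = comb n (col A) {..<k} (\<lambda>j. c $ j)"
  using assms unfolding comb_def
  by (intro eq_vecI) (auto simp: scalar_prod_def lessThan_atLeast0 mult.commute intro!: sum.cong)

lemma comb_mult_mat_vec:
  assumes "A \<in> carrier_mat n k"
  shows "comb n (col A) {..<k} c = A *\<^sub>v vec k c"
  unfolding mult_mat_vec_comb[OF assms vec_carrier] by (rule comb_cong) simp

lemma mat_cone_eq:
  assumes A: "A \<in> carrier_mat n k"
  shows "mat_cone A = cone_of n (col A) {..<k}"
proof (intro equalityI subsetI)
  fix x assume "x \<in> mat_cone A"
  then show "x \<in> cone_of n (col A) {..<k}"
    using A mult_mat_vec_comb[OF A] unfolding mat_cone_def cone_of_def by auto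
next
  fix x assume "x \<in> cone_of n (col A) {..<k}"
  then obtain c where c: "\<forall>j\<in>{..<k}. 0 \<le> c j" "x = comb n (col A) {..<k} c" unfolding cone_of_def by blast
  then show "x \<in> mat_cone A" using A unfolding mat_cone_def comb_mult_mat_vec[OF A]
    by (auto intro!: exI[of _ "vec k c"])
qed

lemma cols_independent_iff:
  assumes A: "A \<in> carrier_mat n k"
  shows "cols_independent A \<longleftrightarrow> indep n (col A) {..<k}"
proof
  assume i: "cols_independent A"
  show "indep n (col A) {..<k}" unfolding indep_def comb_mult_mat_vec[OF A]
  proof (intro allI impI ballI)
    fix c j assume "A *\<^sub>v vec k c = 0\<^sub>v n" "j \<in> {..<k}"
    then have "vec k c = 0\<^sub>v k" using i A unfolding cols_independent_def by auto
    then have "vec k c $ j = 0" using \<open>j \<in> {..<k}\<close> by simp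
    then show "c j = 0" using \<open>j \<in> {..<k}\<close> by simp
  qed
next
  assume i: "indep n (col A) {..<k}"
  show "cols_independent A" unfolding cols_independent_def
    using i A mult_mat_vec_comb[OF A] unfolding indep_def by (auto intro!: eq_vecI)
qed

lemma simplicial_cone_ex:
  assumes "simplicial_cone n \<sigma>"
  shows "\<exists>k g. (\<forall>j. g j \<in> carrier_vec n) \<and> indep n g {..<k} \<and> \<sigma> = cone_of n g {..<k}"
proof -
  obtain k A where A: "A \<in> carrier_mat n k" "cols_independent A" "\<sigma> = mat_cone A"
    using assms unfolding simplicial_cone_def by blast
  have "\<forall>j. col A j \<in> carrier_vec n" using A(1) by (metis carrier_matD(1) col_dim)
  then show ?thesis using A(2,3) cols_independent_iff[OF A(1)] mat_cone_eq[OF A(1)] by blast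
qed

subsection \<open>Bases and dimension\<close>

lemma square_matrix_singular_iff:
  fixes A :: "real mat"
  assumes "A \<in> carrier_mat n n"
  shows "det A = 0 \<longleftrightarrow> \<not> indep n (col A) {..<n}"
  using det_0_iff_vec_prod_zero_field[OF assms] cols_independent_iff[OF assms] assms
  unfolding cols_independent_def by auto

text \<open>Fewer than \<open>n\<close> vectors are orthogonal to some nonzero vector: pad with zero vectors.\<close>

lemma common_normal:
  assumes g: "\<And>j. j < k \<Longrightarrow> g j \<in> carrier_vec n" and k: "k < n"
  obtains u where "u \<in> carrier_vec n" "u \<noteq> 0\<^sub>v n" "\<And>j. j < k \<Longrightarrow> u \<bullet> g j = (0::real)"
proof -
  define A where "A = mat n n (\<lambda>(i, j). if i < k then g i $ j else 0)"
  have A: "A \<in> carrier_mat n n" unfolding A_def by simp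
  have "A\<^sup>T *\<^sub>v unit_vec n (n - 1) = 0\<^sub>v n"
    using k unfolding A_def by (intro eq_vecI) auto
  moreover have "unit_vec n (n - 1) \<noteq> (0\<^sub>v n :: real vec)" using k by simp
  ultimately have "det (A\<^sup>T) = 0"
    using det_0_iff_vec_prod_zero_field[of "A\<^sup>T" n] A by (metis transpose_carrier_mat unit_vec_carrier)
  then have "det A = 0" using det_transpose[OF A] by simp
  then obtain u where u: "u \<in> carrier_vec n" "u \<noteq> 0\<^sub>v n" "A *\<^sub>v u = 0\<^sub>v n"
    using det_0_iff_vec_prod_zero_field[OF A] by blast
  have "u \<bullet> g j = 0" if j: "j < k" for j
  proof -
    have "row A j = g j" using g[OF j] j k unfolding A_def by (intro eq_vecI) auto
    moreover have "(A *\<^sub>v u) $ j = row A j \<bullet> u" using A j k by simp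
    ultimately show ?thesis using u(3) j k g[OF j] u(1) by (simp add: comm_scalar_prod[of u n])
  qed
  then show ?thesis using that u by blast
qed

lemma indep_card_le:
  assumes g: "\<And>j. j < k \<Longrightarrow> g j \<in> carrier_vec n" and i: "indep n g {..<k}"
  shows "k \<le> n"
proof (rule ccontr)
  assume "\<not> k \<le> n"
  then have k: "n < k" by simp
  have "vec k (\<lambda>j. g j $ i) \<in> carrier_vec k" for i by simp
  then obtain u where u: "u \<in> carrier_vec k" "u \<noteq> 0\<^sub>v k" "\<And>i. i < n \<Longrightarrow> u \<bullet> vec k (\<lambda>j. g j $ i) = 0"
    using common_normal[of n "\<lambda>i. vec k (\<lambda>j. g j $ i)" k] k by blast
  have "comb n g {..<k} (\<lambda>j. u $ j) = 0\<^sub>v n"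
    using u(3) unfolding comb_def by (intro eq_vecI) (auto simp: scalar_prod_def lessThan_atLeast0)
  then have "\<forall>j<k. u $ j = 0" using i unfolding indep_def by blast
  then have "u = 0\<^sub>v k" using u(1) by (intro eq_vecI) auto
  then show False using u(2) by blast
qed

text \<open>The rows of the inverse of the matrix with columns \<open>g\<close>.\<close>

lemma dual_basis:
  assumes g: "\<And>j. j < n \<Longrightarrow> g j \<in> carrier_vec n" and i: "indep n g {..<n}"
  obtains b where "\<And>i. b i \<in> carrier_vec n" "\<And>i j. i < n \<Longrightarrow> j < n \<Longrightarrow> b i \<bullet> g j = (if i = j then 1 else 0)"
    "\<And>x. x \<in> carrier_vec n \<Longrightarrow> x = comb n g {..<n} (\<lambda>i. b i \<bullet> x)"
proof -
  define A where "A = mat_of_cols n (map g [0..<n])"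
  have A: "A \<in> carrier_mat n n" unfolding A_def by (intro carrier_matI) auto
  have col: "col A j = g j" if "j < n" for j unfolding A_def using g[OF that] that by simp
  have "comb n (col A) {..<n} c = comb n g {..<n} c" for c unfolding comb_def using col by (auto intro!: eq_vecI sum.cong)
  then have "indep n (col A) {..<n}" using i unfolding indep_def by simp
  then have d: "det A \<noteq> 0" using square_matrix_singular_iff[OF A] by blast
  define B where "B = inverse (det A) \<cdot>\<^sub>m adj_mat A"
  have B: "B \<in> carrier_mat n n" "B * A = 1\<^sub>m n" "A * B = 1\<^sub>m n"
    unfolding B_def using adj_mat[OF A] d mult_smult_assoc_mat[OF adj_mat(1)[OF A] A]
      mult_smult_distrib[OF A adj_mat(1)[OF A]] by (auto intro!: eq_matI)
  define b where "b = (\<lambda>i. if i < n then row B i else 0\<^sub>v n)"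
  have 1: "b i \<bullet> g j = (if i = j then 1 else 0)" if "i < n" "j < n" for i j
  proof -
    have "b i \<bullet> g j = (B * A) $$ (i, j)" unfolding b_def using that A B(1) col by simp
    then show ?thesis unfolding B(2) using that by simp
  qed
  have 2: "x = comb n g {..<n} (\<lambda>i. b i \<bullet> x)" if x: "x \<in> carrier_vec n" for x
  proof -
    have "x = A *\<^sub>v (B *\<^sub>v x)" using x B(3) assoc_mult_mat_vec[OF A B(1) x] by simp
    also have "\<dots> = comb n (col A) {..<n} (\<lambda>j. (B *\<^sub>v x) $ j)" by (rule mult_mat_vec_comb[OF A]) (use B x in auto)
    also have "\<dots> = comb n g {..<n} (\<lambda>i. b i \<bullet> x)"
      unfolding comb_def b_def using col B(1) x by (auto intro!: eq_vecI sum.cong)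
    finally show ?thesis .
  qed
  show ?thesis by (rule that[of b]) (use 1 2 B(1) in \<open>auto simp: b_def\<close>)
qed

text \<open>With fewer than \<open>n\<close> generators there is a nonzero vector orthogonal to all of them, hence to \<open>n\<close> independent vectors
  of the cone.\<close>

lemma has_dim_full_iff:
  assumes g: "\<And>j. g j \<in> carrier_vec n" and i: "indep n g {..<k}"
  shows "has_dim n (cone_of n g {..<k}) n \<longleftrightarrow> k = n"
proof
  assume "has_dim n (cone_of n g {..<k}) n"
  then obtain A where A: "A \<in> carrier_mat n n" "cols_independent A" "set (cols A) \<subseteq> cone_of n g {..<k}"
    unfolding has_dim_def by blast
  show "k = n"
  proof (rule ccontr)
    assume "k \<noteq> n"
    then have "k < n" using indep_card_le[OF g i] by simp
    then obtain u where u: "u \<in> carrier_vec n" "u \<noteq> 0\<^sub>v n" "\<And>j. j < k \<Longrightarrow> u \<bullet> g j = 0"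
      using common_normal[of k g n] g by blast
    have "col A j \<bullet> u = 0" if j: "j < n" for j
    proof -
      have "col A j \<in> cone_of n g {..<k}" using A(1,3) j unfolding cols_def by auto
      then obtain c where "col A j = comb n g {..<k} c" unfolding cone_of_def by blast
      then have "u \<bullet> col A j = 0" using scalar_prod_comb[OF u(1) g] u(3) by simp
      then show ?thesis using comm_scalar_prod[OF u(1), of "col A j"] A(1) j by simp
    qed
    then have "A\<^sup>T *\<^sub>v u = 0\<^sub>v n" using A(1) by (intro eq_vecI) auto
    then have "det (A\<^sup>T) = 0" using det_0_iff_vec_prod_zero_field[of "A\<^sup>T" n] A(1) u by auto
    then have "det A = 0" using det_transpose[OF A(1)] by simp
    then show False using square_matrix_singular_iff[OF A(1)] cols_independent_iff[OF A(1)] A(2) by blast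
  qed
next
  assume k: "k = n"
  define A where "A = mat_of_cols n (map g [0..<n])"
  have A: "A \<in> carrier_mat n n" unfolding A_def by (intro carrier_matI) auto
  have col: "col A j = g j" if "j < n" for j unfolding A_def using g that by simp
  have eq: "comb n (col A) {..<n} c = comb n g {..<n} c" for c unfolding comb_def using col by (auto intro!: eq_vecI sum.cong)
  have "cols_independent A" unfolding cols_independent_iff[OF A] using i k eq unfolding indep_def by simp
  moreover have "set (cols A) \<subseteq> cone_of n g {..<n}"
    using col gen_in_cone[of "{..<n}" _ g n] g A unfolding cols_def by auto
  moreover have "\<forall>x\<in>cone_of n g {..<n}. \<exists>c\<in>carrier_vec n. x = A *\<^sub>v c"
    using comb_mult_mat_vec[OF A] eq unfolding cone_of_def by auto
  ultimately show "has_dim n (cone_of n g {..<k}) n" unfolding has_dim_def k using A by blast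
qed

lemma has_dim_one_single:
  assumes "g k \<in> carrier_vec n" "g k \<noteq> 0\<^sub>v n"
  shows "has_dim n (cone_of n g {k}) 1"
proof -
  define A where "A = mat_of_cols n [g k]"
  have A: "A \<in> carrier_mat n 1" unfolding A_def by (intro carrier_matI) auto
  have col: "col A 0 = g k" unfolding A_def using assms by simp
  have mul: "A *\<^sub>v c = c $ 0 \<cdot>\<^sub>v g k" if "c \<in> carrier_vec 1" for c
    using mult_mat_vec_comb[OF A that] comb_single[of "col A" 0 n "\<lambda>j. c $ j"] col assms by (simp add: lessThan_Suc)
  have "c = 0\<^sub>v 1" if "c \<in> carrier_vec 1" "A *\<^sub>v c = 0\<^sub>v n" for c
  proof -
    obtain i where i: "i < n" "g k $ i \<noteq> 0" using assms by (metis carrier_vecD eq_vecI index_zero_vec)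
    have "(c $ 0 \<cdot>\<^sub>v g k) $ i = 0" using that mul[OF that(1)] i by simp
    then have "c $ 0 = 0" using i assms(1) by simp
    then show ?thesis using that(1) by (intro eq_vecI) auto
  qed
  then have "cols_independent A" unfolding cols_independent_def using A by auto
  moreover have "set (cols A) \<subseteq> cone_of n g {k}" using gen_in_cone[of "{k}" k g n] assms unfolding A_def by simp
  moreover have "\<forall>x\<in>cone_of n g {k}. \<exists>c\<in>carrier_vec 1. x = A *\<^sub>v c"
  proof
    fix x assume "x \<in> cone_of n g {k}"
    then obtain c where "x = c k \<cdot>\<^sub>v g k" unfolding cone_of_def using comb_single[of g k n] assms(1) by auto
    then have "x = A *\<^sub>v vec 1 (\<lambda>_. c k)" using mul[of "vec 1 (\<lambda>_. c k)"] by simp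
    then show "\<exists>c\<in>carrier_vec 1. x = A *\<^sub>v c" by (metis vec_carrier)
  qed
  ultimately show ?thesis unfolding has_dim_def using A by blast
qed

lemma has_dim_one_cone:
  assumes g: "\<And>j. g j \<in> carrier_vec n" and i: "indep n g {..<k}" and d: "has_dim n (cone_of n g {..<k}) 1"
  shows "k = 1"
proof -
  obtain A where A: "A \<in> carrier_mat n 1" "cols_independent A" "set (cols A) \<subseteq> cone_of n g {..<k}"
    "\<forall>x\<in>cone_of n g {..<k}. \<exists>c\<in>carrier_vec 1. x = A *\<^sub>v c" using d unfolding has_dim_def by blast
  have "k \<noteq> 0"
  proof
    assume "k = 0"
    have "col A 0 \<in> cone_of n g {..<k}" using A(1,3) unfolding cols_def by auto
    then have "col A 0 = 0\<^sub>v n" unfolding cone_of_def comb_def \<open>k = 0\<close> by (auto intro!: eq_vecI)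
    then have "comb n (col A) {..<1} (\<lambda>_. 1) = 0\<^sub>v n" unfolding comb_def by (intro eq_vecI) auto
    then have "\<forall>j\<in>{..<1::nat}. (1::real) = 0"
      using A(2) unfolding cols_independent_iff[OF A(1)] indep_def by blast
    then show False by simp
  qed
  moreover have "\<not> 1 < k"
  proof
    assume k: "1 < k"
    have ex: "\<exists>s. g j = s \<cdot>\<^sub>v col A 0" if "j < k" for j
    proof -
      have "g j \<in> cone_of n g {..<k}" using gen_in_cone[of "{..<k}" j g n] g that by auto
      then obtain c where c: "c \<in> carrier_vec 1" "g j = A *\<^sub>v c" using A(4) by blast
      then have "g j = comb n (col A) {..<1} (\<lambda>j. c $ j)" using mult_mat_vec_comb[OF A(1)] by simp
      also have "\<dots> = c $ 0 \<cdot>\<^sub>v col A 0"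
        using comb_single[of "col A" 0 n "\<lambda>j. c $ j"] col_carrier_vec[of 0 1 A n] A(1) by (simp add: lessThan_Suc)
      finally show ?thesis by blast
    qed
    obtain s t where st: "g 0 = s \<cdot>\<^sub>v col A 0" "g 1 = t \<cdot>\<^sub>v col A 0" using ex[of 0] ex[of 1] k by auto
    define c where "c = (\<lambda>j::nat. if j = 0 then t else if j = 1 then - s else 0)"
    have "comb n g {..<k} c = comb n g {0, 1} c" by (rule comb_mono) (use k in \<open>auto simp: c_def\<close>)
    also have "\<dots> = 0\<^sub>v n" unfolding comb_def c_def using st A(1) by (intro eq_vecI) auto
    finally have "\<forall>j\<in>{..<k}. c j = 0" using i unfolding indep_def by blast
    then have "c 0 = 0" "c 1 = 0" using k by auto
    then have "t = 0" "s = 0" unfolding c_def by auto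
    then have "comb n g {..<k} (\<lambda>j. if j = 0 then 1 else 0) = 0\<^sub>v n"
      using comb_unit[of "{..<k}" 0 g n] k g st(1) A(1) by (auto intro!: eq_vecI)
    then have "\<forall>j\<in>{..<k}. (if j = 0 then 1 else 0 :: real) = 0" using i unfolding indep_def by blast
    then show False using k by (auto dest: bspec[of _ _ 0])
  qed
  ultimately show ?thesis by simp
qed


section \<open>Complete simplicial fans\<close>

lemma dual_basis_on:
  assumes fin: "finite J" and card: "card J = n" and g: "\<And>j. j \<in> J \<Longrightarrow> g j \<in> carrier_vec n" and i: "indep n g J"
  obtains b where "\<And>i. b i \<in> carrier_vec n" "\<And>i j. i \<in> J \<Longrightarrow> j \<in> J \<Longrightarrow> b i \<bullet> g j = (if i = j then 1 else 0)"
    "\<And>x. x \<in> carrier_vec n \<Longrightarrow> x = comb n g J (\<lambda>i. b i \<bullet> x)"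
proof -
  obtain p where p: "bij_betw p {..<n} J" using ex_bij_betw_nat_finite[OF fin] card by (metis lessThan_atLeast0)
  define q where "q = inv_into {..<n} p"
  have q: "q (p i) = i" if "i < n" for i
    unfolding q_def using p that by (simp add: bij_betw_inv_into_left)
  have pq: "q j < n" "p (q j) = j" if "j \<in> J" for j
    unfolding q_def using p that
    by (auto simp: bij_betw_inv_into_right dest: bij_betw_inv_into bij_betwE)
  have pJ: "p i \<in> J" if "i < n" for i using p that by (auto dest: bij_betwE)
  have eq: "comb n (g \<circ> p) {..<n} c = comb n g J (c \<circ> q)" for c
    unfolding comb_def sum.reindex_bij_betw[OF p, symmetric] using q by (auto intro!: eq_vecI sum.cong)
  have "indep n (g \<circ> p) {..<n}" unfolding indep_def
  proof (intro allI impI ballI)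
    fix c k assume "comb n (g \<circ> p) {..<n} c = 0\<^sub>v n" and k: "k \<in> {..<n}"
    then have "comb n g J (c \<circ> q) = 0\<^sub>v n" by (simp add: eq)
    then have "\<forall>j\<in>J. (c \<circ> q) j = 0" using i unfolding indep_def by blast
    then show "c k = 0" using pJ[of k] q[of k] k by auto
  qed
  then obtain b where b: "\<And>i. b i \<in> carrier_vec n" "\<And>i j. i < n \<Longrightarrow> j < n \<Longrightarrow> b i \<bullet> (g \<circ> p) j = (if i = j then 1 else 0)"
    "\<And>x. x \<in> carrier_vec n \<Longrightarrow> x = comb n (g \<circ> p) {..<n} (\<lambda>i. b i \<bullet> x)"
    using dual_basis[of n "g \<circ> p"] g pJ by auto
  show ?thesis
  proof (rule that[of "b \<circ> q"])
    show "(b \<circ> q) i \<bullet> g j = (if i = j then 1 else 0)" if "i \<in> J" "j \<in> J" for i j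
    proof -
      have "(b \<circ> q) i \<bullet> g j = b (q i) \<bullet> (g \<circ> p) (q j)" using pq(2)[OF that(2)] by simp
      also have "\<dots> = (if q i = q j then 1 else 0)" by (rule b(2)[OF pq(1)[OF that(1)] pq(1)[OF that(2)]])
      also have "q i = q j \<longleftrightarrow> i = j" using pq(2)[OF that(1)] pq(2)[OF that(2)] by metis
      finally show ?thesis .
    qed
    show "x = comb n g J (\<lambda>i. (b \<circ> q) i \<bullet> x)" if "x \<in> carrier_vec n" for x
      using b(3)[OF that] unfolding eq by (simp add: comp_def)
  qed (use b(1) in auto)
qed

text \<open>The face of a simplicial cone cut out by \<open>u\<close> is generated by the generators orthogonal to \<open>u\<close>.\<close>

lemma face_cone_of:
  assumes fin: "finite J" and g: "\<And>j. j \<in> J \<Longrightarrow> g j \<in> carrier_vec n" and u: "u \<in> carrier_vec n"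
    and nonneg: "\<And>j. j \<in> J \<Longrightarrow> 0 \<le> u \<bullet> g j"
  shows "{x \<in> cone_of n g J. u \<bullet> x = 0} = cone_of n g {j\<in>J. u \<bullet> g j = 0}"
proof (intro equalityI subsetI)
  fix x assume "x \<in> {x \<in> cone_of n g J. u \<bullet> x = 0}"
  then obtain c where c: "\<forall>j\<in>J. 0 \<le> c j" "x = comb n g J c" "u \<bullet> x = 0" unfolding cone_of_def by blast
  have "(\<Sum>j\<in>J. c j * (u \<bullet> g j)) = 0" using c(2,3) scalar_prod_comb[OF u g] by simp
  then have "\<forall>j\<in>J. c j * (u \<bullet> g j) = 0"
    using fin c(1) nonneg by (subst (asm) sum_nonneg_eq_0_iff) auto
  then have "x = comb n g {j\<in>J. u \<bullet> g j = 0} c" unfolding c(2) by (intro comb_mono fin) auto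
  then show "x \<in> cone_of n g {j\<in>J. u \<bullet> g j = 0}" unfolding cone_of_def using c(1) by auto
next
  fix x assume x: "x \<in> cone_of n g {j\<in>J. u \<bullet> g j = 0}"
  then obtain c where c: "x = comb n g {j\<in>J. u \<bullet> g j = 0} c" unfolding cone_of_def by blast
  have "u \<bullet> x = (\<Sum>j\<in>{j\<in>J. u \<bullet> g j = 0}. c j * (u \<bullet> g j))" unfolding c by (rule scalar_prod_comb) (use u g in auto)
  also have "\<dots> = 0" by simp
  finally show "x \<in> {x \<in> cone_of n g J. u \<bullet> x = 0}" using x cone_of_mono[OF fin, of "{j\<in>J. u \<bullet> g j = 0}" n g] by blast
qed

lemma cone_of_nonneg:
  assumes "u \<in> carrier_vec n" "\<And>j. j \<in> J \<Longrightarrow> g j \<in> carrier_vec n" "\<And>j. j \<in> J \<Longrightarrow> 0 \<le> u \<bullet> g j" "x \<in> cone_of n g J"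
  shows "0 \<le> u \<bullet> x"
proof -
  obtain c where c: "\<forall>j\<in>J. 0 \<le> c j" "x = comb n g J c" using assms(4) unfolding cone_of_def by blast
  have "u \<bullet> x = (\<Sum>j\<in>J. c j * (u \<bullet> g j))" unfolding c(2) by (rule scalar_prod_comb[OF assms(1,2)])
  also have "\<dots> \<ge> 0" using c(1) assms(3) by (intro sum_nonneg) auto
  finally show ?thesis .
qed

text \<open>Cones do not change when their generators are rescaled by positive factors or renumbered.\<close>

lemma cone_of_rescale:
  assumes p: "inj_on p S" and s: "\<And>i. i \<in> S \<Longrightarrow> (0::real) < s i \<and> g i = s i \<cdot>\<^sub>v h (p i)"
    and h: "\<And>i. i \<in> S \<Longrightarrow> h (p i) \<in> carrier_vec n"
  shows "cone_of n g S = cone_of n h (p ` S)" "indep n g S \<Longrightarrow> indep n h (p ` S)"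
proof -
  have 1: "comb n h (p ` S) c = comb n g S (\<lambda>i. c (p i) / s i)" for c
    unfolding comb_def sum.reindex[OF p] using s h by (force intro!: eq_vecI sum.cong)
  have 2: "comb n g S c = comb n h (p ` S) (\<lambda>k. c (inv_into S p k) * s (inv_into S p k))" for c
    unfolding 1 using p s by (intro comb_cong) (force simp: inv_into_f_f)
  show "cone_of n g S = cone_of n h (p ` S)"
  proof (intro equalityI subsetI)
    fix x assume "x \<in> cone_of n g S"
    then obtain c where c: "\<forall>j\<in>S. 0 \<le> c j" "x = comb n g S c" unfolding cone_of_def by blast
    have "\<forall>k\<in>p ` S. 0 \<le> c (inv_into S p k) * s (inv_into S p k)"
      using c(1) s p by (auto simp: inv_into_f_f less_imp_le intro!: mult_nonneg_nonneg)
    then show "x \<in> cone_of n h (p ` S)" unfolding c(2) 2 cone_of_def by blast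
  next
    fix x assume "x \<in> cone_of n h (p ` S)"
    then obtain c where c: "\<forall>j\<in>p ` S. 0 \<le> c j" "x = comb n h (p ` S) c" unfolding cone_of_def by blast
    have "\<forall>i\<in>S. 0 \<le> c (p i) / s i" using c(1) s by (auto simp: less_imp_le intro!: divide_nonneg_nonneg)
    then show "x \<in> cone_of n g S" unfolding c(2) 1 cone_of_def by blast
  qed
  show "indep n h (p ` S)" if "indep n g S"
    unfolding indep_def 1
  proof (intro allI impI ballI)
    fix c k assume "comb n g S (\<lambda>i. c (p i) / s i) = 0\<^sub>v n" "k \<in> p ` S"
    then have "\<forall>i\<in>S. c (p i) / s i = 0" using that unfolding indep_def by blast
    then show "c k = 0" using s \<open>k \<in> p ` S\<close> by fastforce
  qed
qed

subsection \<open>Primitive generators of rays\<close>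

text \<open>The least positive value \<open>d\<close> at \<open>z\<close> of an integral linear form divides all entries of \<open>z\<close>, by division with remainder.\<close>

lemma primitive_multiple:
  fixes z :: "int vec"
  assumes z: "z \<in> carrier_vec n" "z \<noteq> 0\<^sub>v n"
  obtains d v y where "0 < d" "v \<in> carrier_vec n" "y \<in> carrier_vec n" "y \<bullet> v = 1" "z = d \<cdot>\<^sub>v v"
proof -
  define P where "P = (\<lambda>k::nat. 0 < k \<and> (\<exists>y\<in>carrier_vec n. y \<bullet> z = int k))"
  obtain i where i: "i < n" "z $ i \<noteq> 0" using z by (metis carrier_vecD eq_vecI index_zero_vec)
  have "(sgn (z $ i) \<cdot>\<^sub>v unit_vec n i) \<bullet> z = \<bar>z $ i\<bar>"
    using z i by (simp add: scalar_prod_left_unit abs_sgn mult.commute)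
  then have "P (nat \<bar>z $ i\<bar>)" unfolding P_def using i by (auto intro!: bexI[of _ "sgn (z $ i) \<cdot>\<^sub>v unit_vec n i"])
  then have PL: "P (Least P)" and min: "\<And>k. P k \<Longrightarrow> Least P \<le> k" by (auto intro: LeastI Least_le)
  define d where "d = int (Least P)"
  obtain y where y: "y \<in> carrier_vec n" "y \<bullet> z = d" and d: "0 < d" using PL unfolding P_def d_def by auto
  have dvd: "d dvd z $ j" if j: "j < n" for j
  proof -
    have "(unit_vec n j - (z $ j div d) \<cdot>\<^sub>v y) \<bullet> z = z $ j mod d"
      using z y j by (simp add: minus_scalar_prod_distrib[of _ n] minus_div_mult_eq_mod[symmetric])
    then have "\<not> 0 < z $ j mod d"
    proof (intro notI)
      assume eq: "(unit_vec n j - (z $ j div d) \<cdot>\<^sub>v y) \<bullet> z = z $ j mod d" and pos: "0 < z $ j mod d"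
      then have "P (nat (z $ j mod d))" unfolding P_def using y
        by (auto intro!: bexI[of _ "unit_vec n j - (z $ j div d) \<cdot>\<^sub>v y"])
      then have "d \<le> z $ j mod d" using min[of "nat (z $ j mod d)"] pos unfolding d_def by linarith
      then show False using pos_mod_bound[OF d, of "z $ j"] by simp
    qed
    then show ?thesis using pos_mod_sign[OF d, of "z $ j"] by (simp add: dvd_eq_mod_eq_0)
  qed
  define v where "v = vec n (\<lambda>j. z $ j div d)"
  have zv: "z = d \<cdot>\<^sub>v v" unfolding v_def using z dvd by (intro eq_vecI) auto
  have v: "v \<in> carrier_vec n" unfolding v_def by simp
  have "d * (y \<bullet> v) = d" using y(2) zv y(1) v by simp
  then have "y \<bullet> v = 1" using d by simp
  then show ?thesis using that d v y(1) zv by blast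
qed

lemma scalar_prod_real_vec:
  assumes "x \<in> carrier_vec n" "y \<in> carrier_vec n"
  shows "real_vec x \<bullet> real_vec y = real_of_int (x \<bullet> y)"
  using assms unfolding scalar_prod_def by simp

lemma real_vec_inj: "real_vec x = real_vec y \<longleftrightarrow> x = y"
proof
  assume eq: "real_vec x = real_vec y"
  have d: "dim_vec x = dim_vec y" using arg_cong[OF eq, of dim_vec] by simp
  show "x = y"
  proof (rule eq_vecI[OF _ d])
    fix i assume "i < dim_vec y"
    then show "x $ i = y $ i" using arg_cong[OF eq, of "\<lambda>v. v $ i"] d by simp
  qed
qed simp

lemma ray_gen_eqI:
  assumes v: "v \<in> carrier_vec n" "y \<in> carrier_vec n" "y \<bullet> v = 1"
    and \<tau>: "\<tau> = {t \<cdot>\<^sub>v real_vec v | t. 0 \<le> t}"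
  shows "ray_gen n \<tau> = v"
proof -
  have mon: "{x \<in> carrier_vec n. real_vec x \<in> \<tau>} = {int k \<cdot>\<^sub>v v | k. True}"
  proof (intro equalityI subsetI)
    fix x assume "x \<in> {x \<in> carrier_vec n. real_vec x \<in> \<tau>}"
    then obtain t where t: "x \<in> carrier_vec n" "0 \<le> t" "real_vec x = t \<cdot>\<^sub>v real_vec v" unfolding \<tau> by blast
    have "real_of_int (y \<bullet> x) = real_vec y \<bullet> (t \<cdot>\<^sub>v real_vec v)"
      using scalar_prod_real_vec[OF v(2) t(1)] t(3) by simp
    also have "\<dots> = t" using scalar_prod_real_vec[OF v(2,1)] v by simp
    finally have "t = real_of_int (y \<bullet> x)" by simp
    then have "real_vec x = real_vec (int (nat (y \<bullet> x)) \<cdot>\<^sub>v v)" using t by (auto intro!: eq_vecI)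
    then show "x \<in> {int k \<cdot>\<^sub>v v | k. True}" unfolding real_vec_inj by blast
  next
    fix x assume "x \<in> {int k \<cdot>\<^sub>v v | k. True}"
    then obtain k where k: "x = int k \<cdot>\<^sub>v v" by blast
    have "real_vec x = real k \<cdot>\<^sub>v real_vec v" unfolding k by (intro eq_vecI) auto
    then show "x \<in> {x \<in> carrier_vec n. real_vec x \<in> \<tau>}" using k v(1) unfolding \<tau> by (auto intro!: exI[of _ "real k"])
  qed
  show ?thesis unfolding ray_gen_def
  proof (rule the_equality)
    fix v' assume v': "v' \<in> carrier_vec n \<and> {x \<in> carrier_vec n. real_vec x \<in> \<tau>} = {int k \<cdot>\<^sub>v v' | k. True}"
    have self: "x \<in> {int k \<cdot>\<^sub>v x | k. True}" for x :: "int vec" by (auto intro!: exI[of _ 1])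
    have eq: "{int k \<cdot>\<^sub>v v' | k. True} = {int k \<cdot>\<^sub>v v | k. True}" using mon v' by simp
    have "v' \<in> {int k \<cdot>\<^sub>v v | k. True}" "v \<in> {int k \<cdot>\<^sub>v v' | k. True}"
      using self[of v'] self[of v] unfolding eq by auto
    then obtain a b where ab: "v' = int a \<cdot>\<^sub>v v" "v = int b \<cdot>\<^sub>v v'" by blast
    have "y \<bullet> v = int b * (y \<bullet> v')" using arg_cong[OF ab(2), of "\<lambda>x. y \<bullet> x"] v(2) v' by simp
    moreover have "y \<bullet> v' = int a * (y \<bullet> v)" using arg_cong[OF ab(1), of "\<lambda>x. y \<bullet> x"] v(1,2) by simp
    ultimately have "int b * int a = 1" using v(3) by simp
    then have "a = 1" by (simp add: zmult_eq_1_iff)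
    then show "v' = v" using ab(1) by simp
  qed (rule conjI[OF v(1) mon])
qed

text \<open>The linear form with value 1 on the generator is what makes the order along a ray a surjective, hence discrete
  normalised, valuation.\<close>

lemma ray_gen_props:
  assumes simp: "simplicial_cone n \<tau>" and rat: "rational_cone n \<tau>" and dim: "has_dim n \<tau> 1"
  obtains y where "ray_gen n \<tau> \<in> carrier_vec n" "y \<in> carrier_vec n" "y \<bullet> ray_gen n \<tau> = 1"
    "\<tau> = {t \<cdot>\<^sub>v real_vec (ray_gen n \<tau>) | t. 0 \<le> t}"
proof -
  obtain k g where "(\<forall>j. g j \<in> carrier_vec n) \<and> indep n g {..<k} \<and> \<tau> = cone_of n g {..<k}"
    using simplicial_cone_ex[OF simp] by blast
  then have g: "\<And>j. g j \<in> carrier_vec n" "indep n g {..<k}" "\<tau> = cone_of n g {..<k}" by auto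
  have k: "k = 1" using has_dim_one_cone[OF g(1,2)] dim g(3) by simp
  have \<tau>: "\<tau> = {t \<cdot>\<^sub>v g 0 | t. 0 \<le> t}"
  proof -
    have "comb n g {..<1} c = c 0 \<cdot>\<^sub>v g 0" for c using comb_single[of g 0 n c] g(1) by (simp add: lessThan_Suc)
    then have *: "cone_of n g {..<1} = {c 0 \<cdot>\<^sub>v g 0 | c. 0 \<le> c (0::nat)}" unfolding cone_of_def by (simp add: lessThan_Suc)
    show ?thesis unfolding g(3) k *
    proof (intro equalityI subsetI)
      fix x assume "x \<in> {t \<cdot>\<^sub>v g 0 | t. 0 \<le> t}"
      then obtain t where "0 \<le> t" "x = t \<cdot>\<^sub>v g 0" by blast
      then show "x \<in> {c 0 \<cdot>\<^sub>v g 0 | c. 0 \<le> c (0::nat)}" by (auto intro!: exI[of _ "\<lambda>_. t"])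
    qed blast
  qed
  have g0: "g 0 \<noteq> 0\<^sub>v n"
  proof
    assume "g 0 = 0\<^sub>v n"
    then have "comb n g {..<1} (\<lambda>_. 1) = 0\<^sub>v n" unfolding comb_def by (intro eq_vecI) auto
    then have "\<forall>j\<in>{..<1::nat}. (1::real) = 0" using g(2) unfolding k indep_def by blast
    then show False by simp
  qed
  obtain m A where A: "A \<in> carrier_mat n m" "\<tau> = mat_cone (real_mat A)" using rat unfolding rational_cone_def by blast
  have rA: "real_mat A \<in> carrier_mat n m" using A(1) by simp
  have "\<exists>j<m. col A j \<noteq> 0\<^sub>v n"
  proof (rule ccontr)
    assume no: "\<not> ?thesis"
    have "col (real_mat A) j $ i = 0" if "i < n" "j < m" for i j
    proof -
      have "A $$ (i, j) = col A j $ i" using that A(1) by simp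
      also have "\<dots> = 0" using no that by auto
      finally show ?thesis using that A(1) by simp
    qed
    then have "x = 0\<^sub>v n" if "x \<in> \<tau>" for x
      using that unfolding A(2) mat_cone_eq[OF rA] cone_of_def comb_def by (auto intro!: eq_vecI sum.neutral)
    moreover have "g 0 \<in> \<tau>" unfolding \<tau> by (auto intro!: exI[of _ 1])
    ultimately show False using g0 by blast
  qed
  then obtain j where j: "j < m" "col A j \<noteq> 0\<^sub>v n" by blast
  have colA: "col A j \<in> carrier_vec n" using A(1) j by simp
  obtain d v y where v: "0 < d" "v \<in> carrier_vec n" "y \<in> carrier_vec n" "y \<bullet> v = 1" "col A j = d \<cdot>\<^sub>v v"
    using primitive_multiple[OF colA j(2)] .
  have "real_vec (col A j) = col (real_mat A) j" using A(1) j by (intro eq_vecI) auto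
  then have "real_vec (col A j) \<in> \<tau>"
    unfolding A(2) mat_cone_eq[OF rA] using gen_in_cone[of "{..<m}" j "col (real_mat A)" n] j(1) rA by simp
  then obtain s where s: "0 \<le> s" "real_vec (col A j) = s \<cdot>\<^sub>v g 0" unfolding \<tau> by blast
  have rv: "real_vec (col A j) = real_of_int d \<cdot>\<^sub>v real_vec v" unfolding v(5) by (intro eq_vecI) auto
  have "s \<noteq> 0"
  proof
    assume "s = 0"
    then have "real_vec (col A j) = real_vec (0\<^sub>v n)" using s(2) g(1)[of 0] by (auto intro!: eq_vecI)
    then show False unfolding real_vec_inj using j(2) by blast
  qed
  then have s0: "0 < s" using s(1) by simp
  have g_eq: "g 0 = (real_of_int d / s) \<cdot>\<^sub>v real_vec v"
  proof -
    have "g 0 = (1 / s) \<cdot>\<^sub>v (s \<cdot>\<^sub>v g 0)" using s0 g(1)[of 0] by (intro eq_vecI) auto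
    also have "\<dots> = (1 / s) \<cdot>\<^sub>v (real_of_int d \<cdot>\<^sub>v real_vec v)" using s(2) rv by simp
    finally show ?thesis using v(2) by (auto intro!: eq_vecI)
  qed
  have "\<tau> = {t \<cdot>\<^sub>v real_vec v | t. 0 \<le> t}"
  proof (intro equalityI subsetI)
    fix x assume "x \<in> \<tau>"
    then obtain t where t: "0 \<le> t" "x = t \<cdot>\<^sub>v g 0" unfolding \<tau> by blast
    have "x = (t * (real_of_int d / s)) \<cdot>\<^sub>v real_vec v" unfolding t(2) g_eq by (simp add: smult_smult_assoc)
    then show "x \<in> {t \<cdot>\<^sub>v real_vec v | t. 0 \<le> t}" using t(1) v(1) s0 by (auto intro!: exI[of _ "t * (real_of_int d / s)"])
  next
    fix x assume "x \<in> {t \<cdot>\<^sub>v real_vec v | t. 0 \<le> t}"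
    then obtain t where t: "0 \<le> t" "x = t \<cdot>\<^sub>v real_vec v" by blast
    have "x = (t * (s / real_of_int d)) \<cdot>\<^sub>v g 0" unfolding t(2) g_eq using v(1) s0 by (simp add: smult_smult_assoc)
    then show "x \<in> \<tau>" unfolding \<tau> using t(1) v(1) s0 by (auto intro!: exI[of _ "t * (s / real_of_int d)"])
  qed
  moreover from this have "ray_gen n \<tau> = v" by (rule ray_gen_eqI[OF v(2,3,4)])
  ultimately show ?thesis using that[of y] v by simp
qed


locale complete_simplicial_fan =
  fixes n N :: nat and \<Sigma> :: "real vec set set" and \<rho> :: "nat \<Rightarrow> real vec set"
  assumes fan: "fan n \<Sigma>" and simplicial: "\<forall>\<sigma>\<in>\<Sigma>. simplicial_cone n \<sigma>"
    and complete: "complete_fan n \<Sigma>" and bij: "bij_betw \<rho> {..<N} (cones n \<Sigma> 1)"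
begin

abbreviation v :: "nat \<Rightarrow> int vec" where "v j \<equiv> ray_gen n (\<rho> j)"
abbreviation rv :: "nat \<Rightarrow> real vec" where "rv j \<equiv> real_vec (v j)"

text \<open>A full-dimensional cone of the fan, represented by the set of its rays.\<close>

definition max_cone :: "nat set \<Rightarrow> bool" where
  "max_cone J \<longleftrightarrow> J \<subseteq> {..<N} \<and> card J = n \<and> indep n rv J \<and> cone_of n rv J \<in> \<Sigma>"

lemma finite_fan: "finite \<Sigma>" and fan_rational: "\<sigma> \<in> \<Sigma> \<Longrightarrow> rational_cone n \<sigma>"
  and fan_face: "\<sigma> \<in> \<Sigma> \<Longrightarrow> face n \<tau> \<sigma> \<Longrightarrow> \<tau> \<in> \<Sigma>"
  and fan_inter: "\<sigma> \<in> \<Sigma> \<Longrightarrow> \<tau> \<in> \<Sigma> \<Longrightarrow> face n (\<sigma> \<inter> \<tau>) \<sigma>" "\<sigma> \<in> \<Sigma> \<Longrightarrow> \<tau> \<in> \<Sigma> \<Longrightarrow> face n (\<sigma> \<inter> \<tau>) \<tau>"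
  using fan unfolding fan_def by auto

lemma ray_mem: "j < N \<Longrightarrow> \<rho> j \<in> \<Sigma>" "j < N \<Longrightarrow> has_dim n (\<rho> j) 1"
  using bij unfolding cones_def by (auto dest!: bij_betwE)

lemma ray_inj: "i < N \<Longrightarrow> j < N \<Longrightarrow> \<rho> i = \<rho> j \<Longrightarrow> i = j"
  using bij_betw_imp_inj_on[OF bij] by (auto dest: inj_onD)

lemma ray_ex:
  assumes "\<tau> \<in> \<Sigma>" "has_dim n \<tau> 1"
  obtains j where "j < N" "\<rho> j = \<tau>"
proof -
  have "\<tau> \<in> \<rho> ` {..<N}" using assms bij_betw_imp_surj_on[OF bij] unfolding cones_def by blast
  then show ?thesis using that by blast
qed

lemma ray_props:
  assumes j: "j < N"
  shows "\<exists>y\<in>carrier_vec n. y \<bullet> v j = 1" "v j \<in> carrier_vec n" "\<rho> j = {t \<cdot>\<^sub>v rv j | t. 0 \<le> t}"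
proof -
  have s: "simplicial_cone n (\<rho> j)" using ray_mem(1)[OF j] simplicial by blast
  obtain y where y: "ray_gen n (\<rho> j) \<in> carrier_vec n" "y \<in> carrier_vec n" "y \<bullet> ray_gen n (\<rho> j) = 1"
    "\<rho> j = {t \<cdot>\<^sub>v real_vec (ray_gen n (\<rho> j)) | t. 0 \<le> t}"
    by (rule ray_gen_props[OF s fan_rational[OF ray_mem(1)[OF j]] ray_mem(2)[OF j]])
  show "\<exists>y\<in>carrier_vec n. y \<bullet> v j = 1" using y(2,3) by (rule bexI[rotated])
  show "v j \<in> carrier_vec n" by (rule y(1))
  show "\<rho> j = {t \<cdot>\<^sub>v rv j | t. 0 \<le> t}" by (rule y(4))
qed

lemmas v_carrier = ray_props(2)

lemma ray_iff:
  assumes "j < N"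
  shows "x \<in> \<rho> j \<longleftrightarrow> (\<exists>t\<ge>0. x = t \<cdot>\<^sub>v rv j)"
  by (subst ray_props(3)[OF assms]) blast

lemma rv_carrier: "j < N \<Longrightarrow> rv j \<in> carrier_vec n"
  using v_carrier by simp

lemma rv_nonzero:
  assumes "j < N"
  shows "rv j \<noteq> 0\<^sub>v n"
proof
  assume "rv j = 0\<^sub>v n"
  then have "real_vec (v j) = real_vec (0\<^sub>v n)" by (auto intro!: eq_vecI)
  then have "v j = 0\<^sub>v n" unfolding real_vec_inj .
  then show False using ray_props(1)[OF assms] by auto
qed

lemma ray_eq_cone_of:
  assumes j: "j < N"
  shows "\<rho> j = cone_of n rv {j}"
proof (intro equalityI subsetI)
  fix x assume "x \<in> \<rho> j"
  then obtain t where t: "0 \<le> t" "x = t \<cdot>\<^sub>v rv j" unfolding ray_iff[OF j] by blast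
  have "x = comb n rv {j} (\<lambda>_. t)" unfolding t(2) by (rule comb_single[symmetric]) (rule rv_carrier[OF j])
  then show "x \<in> cone_of n rv {j}" unfolding cone_of_def using t(1) by auto
next
  fix x assume "x \<in> cone_of n rv {j}"
  then obtain c where c: "0 \<le> c j" "x = comb n rv {j} c" unfolding cone_of_def by auto
  have "x = c j \<cdot>\<^sub>v rv j" unfolding c(2) by (rule comb_single) (rule rv_carrier[OF j])
  then show "x \<in> \<rho> j" unfolding ray_iff[OF j] using c(1) by blast
qed

lemma rv_in_ray: "j < N \<Longrightarrow> rv j \<in> \<rho> j"
  using gen_in_cone[of "{j}" j rv n] rv_carrier ray_eq_cone_of by simp

lemma ray_determined:
  assumes i: "i < N" and j: "j < N" and eq: "rv i = t \<cdot>\<^sub>v rv j" and t: "0 \<le> t"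
  shows "i = j"
proof -
  have "t \<noteq> 0"
  proof
    assume "t = 0"
    then have "rv i = 0\<^sub>v n" using eq v_carrier[OF j] by (auto intro!: eq_vecI)
    then show False using rv_nonzero[OF i] by blast
  qed
  then have t0: "0 < t" using t by simp
  have "\<rho> i = \<rho> j"
  proof (intro equalityI subsetI)
    fix x assume "x \<in> \<rho> i"
    then obtain s where s: "0 \<le> s" "x = s \<cdot>\<^sub>v rv i" unfolding ray_iff[OF i] by blast
    have "x = (s * t) \<cdot>\<^sub>v rv j" unfolding s(2) eq by (simp add: smult_smult_assoc)
    then show "x \<in> \<rho> j" unfolding ray_iff[OF j] using s(1) t0 by (auto intro!: exI[of _ "s * t"])
  next
    fix x assume "x \<in> \<rho> j"
    then obtain s where s: "0 \<le> s" "x = s \<cdot>\<^sub>v rv j" unfolding ray_iff[OF j] by blast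
    have "x = (s / t) \<cdot>\<^sub>v rv i" unfolding s(2) eq using t0 by (simp add: smult_smult_assoc)
    then show "x \<in> \<rho> i" unfolding ray_iff[OF i] using s(1) t0 by (auto intro!: exI[of _ "s / t"])
  qed
  then show ?thesis using ray_inj[OF i j] by blast
qed

text \<open>A cone of the fan contains a ray generator only if it is one of its own generators: the ray is
  then a face, so every generator that contributes to it lies on the same ray.\<close>

lemma generator_in_cone:
  assumes K: "K \<subseteq> {..<N}" "cone_of n rv K \<in> \<Sigma>" and j: "j < N" "rv j \<in> cone_of n rv K"
  shows "j \<in> K"
proof -
  let ?\<sigma> = "cone_of n rv K"
  have finK: "finite K" using K(1) finite_subset by blast
  have g: "rv k \<in> carrier_vec n" if "k \<in> K" for k using that K(1) by (intro rv_carrier) auto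
  obtain u where u: "u \<in> carrier_vec n" "\<forall>x\<in>\<rho> j. 0 \<le> u \<bullet> x" "?\<sigma> \<inter> \<rho> j = {x \<in> \<rho> j. u \<bullet> x = 0}"
    using fan_inter(2)[OF K(2) ray_mem(1)[OF j(1)]] unfolding face_def by blast
  have "u \<bullet> rv j = 0" using rv_in_ray[OF j(1)] j(2) u(3) by blast
  then have "u \<bullet> x = 0" if "x \<in> \<rho> j" for x
    using that rv_carrier[OF j(1)] u(1) unfolding ray_iff[OF j(1)] by auto
  then have inter: "?\<sigma> \<inter> \<rho> j = \<rho> j" using u(3) by auto
  obtain w where w: "w \<in> carrier_vec n" "\<forall>x\<in>?\<sigma>. 0 \<le> w \<bullet> x" "\<rho> j = {x \<in> ?\<sigma>. w \<bullet> x = 0}"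
    using fan_inter(1)[OF K(2) ray_mem(1)[OF j(1)]] unfolding face_def inter by blast
  have nonneg: "0 \<le> w \<bullet> rv k" if "k \<in> K" for k using w(2) gen_in_cone[of K k rv n] finK that g[OF that] by blast
  have mem: "x \<in> \<rho> j \<longleftrightarrow> x \<in> ?\<sigma> \<and> w \<bullet> x = 0" for x by (subst w(3)) simp
  have "rv j \<in> {x \<in> ?\<sigma>. w \<bullet> x = 0}" using rv_in_ray[OF j(1)] unfolding mem by simp
  moreover have "{x \<in> ?\<sigma>. w \<bullet> x = 0} = cone_of n rv {k\<in>K. w \<bullet> rv k = 0}"
    by (rule face_cone_of[OF finK]) (use g w(1) nonneg in auto)
  ultimately have "rv j \<in> cone_of n rv {k\<in>K. w \<bullet> rv k = 0}" by (rule subst[rotated])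
  moreover have "x = 0\<^sub>v n" if "x \<in> cone_of n rv {}" for x
    using that unfolding cone_of_def comb_def by (auto intro!: eq_vecI)
  ultimately have "{k\<in>K. w \<bullet> rv k = 0} \<noteq> {}" using rv_nonzero[OF j(1)] by metis
  then obtain k where k: "k \<in> K" "w \<bullet> rv k = 0" by blast
  then have "rv k \<in> \<rho> j" unfolding mem using gen_in_cone[of K k rv n] finK g by blast
  then obtain t where "0 \<le> t" "rv k = t \<cdot>\<^sub>v rv j" unfolding ray_iff[OF j(1)] by blast
  then have "k = j" using ray_determined[of k j t] k(1) K(1) j(1) by auto
  then show ?thesis using k(1) by simp
qed

text \<open>The sum of the dual basis vectors other than the \<open>i\<close>-th cuts out the \<open>i\<close>-th edge as a face, which is a ray of the
  fan.\<close>

lemma full_cone_rays: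
  assumes \<sigma>: "cone_of n g {..<n} \<in> \<Sigma>" and g: "\<And>j. g j \<in> carrier_vec n" and i: "indep n g {..<n}"
  obtains p where "inj_on p {..<n}" "p ` {..<n} \<subseteq> {..<N}" "\<And>S. S \<subseteq> {..<n} \<Longrightarrow> cone_of n g S = cone_of n rv (p ` S)"
    "indep n rv (p ` {..<n})"
proof -
  obtain b where b: "\<And>i. b i \<in> carrier_vec n" "\<And>i j. i < n \<Longrightarrow> j < n \<Longrightarrow> b i \<bullet> g j = (if i = j then 1 else 0)"
    using dual_basis[of n g] g i by metis
  have ex: "\<exists>j s. j < N \<and> 0 < s \<and> g i = s \<cdot>\<^sub>v rv j" if i: "i < n" for i
  proof -
    define u where "u = comb n b ({..<n} - {i}) (\<lambda>_. 1)"
    have u: "u \<in> carrier_vec n" unfolding u_def by simp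
    have ug: "u \<bullet> g j = (if j = i then 0 else 1)" if j: "j < n" for j
    proof -
      have "u \<bullet> g j = g j \<bullet> u" using comm_scalar_prod[OF u g] .
      also have "\<dots> = (\<Sum>m\<in>{..<n} - {i}. 1 * (g j \<bullet> b m))" unfolding u_def by (rule scalar_prod_comb[OF g b(1)])
      also have "\<dots> = (\<Sum>m\<in>{..<n} - {i}. if m = j then 1 else 0)"
        using b(2) j comm_scalar_prod[OF g b(1)] by (intro sum.cong) auto
      finally show ?thesis using j by (simp add: sum.delta)
    qed
    have eq: "{j\<in>{..<n}. u \<bullet> g j = 0} = {i}" using ug i by (auto split: if_splits)
    have nonneg: "\<And>j. j \<in> {..<n} \<Longrightarrow> 0 \<le> u \<bullet> g j" using ug by auto
    have "face n (cone_of n g {i}) (cone_of n g {..<n})" unfolding face_def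
      using u cone_of_nonneg[of u n "{..<n}" g] g nonneg face_cone_of[of "{..<n}" g n u] eq
      by (intro bexI[of _ u]) auto
    then have "cone_of n g {i} \<in> \<Sigma>" using fan_face[OF \<sigma>] by blast
    moreover have "g i \<noteq> 0\<^sub>v n" using b(2)[OF i i] b(1)[of i] by auto
    then have "has_dim n (cone_of n g {i}) 1" using has_dim_one_single g by blast
    ultimately obtain j where j: "j < N" "\<rho> j = cone_of n g {i}" using ray_ex by blast
    have "g i \<in> \<rho> j" using gen_in_cone[of "{i}" i g n] g unfolding j(2) by simp
    then obtain s where s: "0 \<le> s" "g i = s \<cdot>\<^sub>v rv j" unfolding ray_iff[OF j(1)] by blast
    have "s \<noteq> 0" using \<open>g i \<noteq> 0\<^sub>v n\<close> s(2) v_carrier[OF j(1)] by auto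
    then show ?thesis using s j(1) by (intro exI[of _ j] exI[of _ s]) auto
  qed
  then obtain p s where ps: "\<And>i. i < n \<Longrightarrow> p i < N" "\<And>i. i < n \<Longrightarrow> 0 < s i \<and> g i = s i \<cdot>\<^sub>v rv (p i)" by metis
  have inj: "inj_on p {..<n}"
  proof (rule inj_onI, rule ccontr)
    fix i j assume ij: "i \<in> {..<n}" "j \<in> {..<n}" "p i = p j" "i \<noteq> j"
    then have c: "rv (p i) \<in> carrier_vec n" "rv (p j) \<in> carrier_vec n" using ps(1) rv_carrier by auto
    have "b i \<bullet> g i = s i * (b i \<bullet> rv (p i))" "b i \<bullet> g j = s j * (b i \<bullet> rv (p j))"
      using ps(2)[of i] ps(2)[of j] ij b(1)[of i] c by simp_all
    then show False using b(2)[of i i] b(2)[of i j] ij ps(2)[of j] by auto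
  qed
  show ?thesis
  proof (rule that[OF inj])
    show "p ` {..<n} \<subseteq> {..<N}" using ps(1) by auto
    show "cone_of n g S = cone_of n rv (p ` S)" if "S \<subseteq> {..<n}" for S
      using that ps rv_carrier by (intro cone_of_rescale(1)[of p S s] inj_on_subset[OF inj]) auto
    show "indep n rv (p ` {..<n})"
      using ps rv_carrier i by (intro cone_of_rescale(2)[OF inj, of s g]) auto
  qed
qed

text \<open>Completeness: move from a relative interior point of a cone in a generic direction, given by a
  point of the moment curve; infinitely many of the points \<open>x + w / m\<close> lie in the same cone, which
  must be full-dimensional and closed, so it contains the first cone as a face.\<close>

lemma face_of_full_cone:
  assumes \<sigma>: "\<sigma> \<in> \<Sigma>"
  obtains g where "\<And>j. g j \<in> carrier_vec n" "indep n g {..<n}" "cone_of n g {..<n} \<in> \<Sigma>"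
    "face n \<sigma> (cone_of n g {..<n})"
proof -
  define flat where "flat = (\<lambda>\<tau> :: real vec set. \<exists>u. u \<in> carrier_vec n \<and> u \<noteq> 0\<^sub>v n \<and> (\<forall>x\<in>\<tau>. u \<bullet> x = 0))"
  have full: "\<exists>g. (\<forall>j. g j \<in> carrier_vec n) \<and> indep n g {..<n} \<and> \<tau> = cone_of n g {..<n}"
    if \<tau>: "\<tau> \<in> \<Sigma>" "\<not> flat \<tau>" for \<tau>
  proof -
    have "simplicial_cone n \<tau>" using \<tau>(1) simplicial by blast
    then obtain k g where "(\<forall>j. g j \<in> carrier_vec n) \<and> indep n g {..<k} \<and> \<tau> = cone_of n g {..<k}"
      using simplicial_cone_ex by blast
    then have g: "\<And>j. g j \<in> carrier_vec n" "indep n g {..<k}" "\<tau> = cone_of n g {..<k}" by auto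
    have "\<not> k < n"
    proof
      assume "k < n"
      then obtain u where u: "u \<in> carrier_vec n" "u \<noteq> 0\<^sub>v n" "\<And>j. j < k \<Longrightarrow> u \<bullet> g j = 0"
        using common_normal[of k g n] g(1) by blast
      have "u \<bullet> x = 0" if "x \<in> \<tau>" for x
        using that scalar_prod_comb[OF u(1) g(1)] u(3) unfolding g(3) cone_of_def by auto
      then show False using \<tau>(2) u(1,2) unfolding flat_def by blast
    qed
    then have "k = n" using indep_card_le[OF g(1,2)] by simp
    then show ?thesis using g by blast
  qed
  define U where "U = (\<lambda>\<tau> :: real vec set. SOME u. u \<in> carrier_vec n \<and> u \<noteq> 0\<^sub>v n \<and> (\<forall>x\<in>\<tau>. u \<bullet> x = 0))"
  have U: "U \<tau> \<in> carrier_vec n \<and> U \<tau> \<noteq> 0\<^sub>v n \<and> (\<forall>x\<in>\<tau>. U \<tau> \<bullet> x = 0)" if "flat \<tau>" for \<tau>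
    unfolding U_def by (rule someI_ex) (use that in \<open>simp add: flat_def\<close>)
  \<comment> \<open>The direction \<open>w\<close> is a point of the moment curve that avoids, for each lower-dimensional cone, a hyperplane containing it.\<close>
  define P where "P = (\<lambda>\<tau>. \<Sum>i<n. monom (U \<tau> $ i) i)"
  have coeff_P: "coeff (P \<tau>) i = (if i < n then U \<tau> $ i else 0)" for \<tau> i
    unfolding P_def by (simp add: coeff_sum)
  have "P \<tau> \<noteq> 0" if "flat \<tau>" for \<tau>
  proof
    assume "P \<tau> = 0"
    then have "U \<tau> $ i = 0" if "i < n" for i using coeff_P[of \<tau> i] that by simp
    then have "U \<tau> = 0\<^sub>v n" using U[OF \<open>flat \<tau>\<close>] by (intro eq_vecI) auto
    then show False using U[OF \<open>flat \<tau>\<close>] by blast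
  qed
  then have "finite (\<Union>\<tau>\<in>{\<tau>\<in>\<Sigma>. flat \<tau>}. {t. poly (P \<tau>) t = 0})" using finite_fan poly_roots_finite by auto
  then obtain t where t: "t \<notin> (\<Union>\<tau>\<in>{\<tau>\<in>\<Sigma>. flat \<tau>}. {t. poly (P \<tau>) t = 0})"
    using ex_new_if_finite[OF infinite_UNIV_char_0] by blast
  define w where "w = vec n (\<lambda>i. t ^ i)"
  have w: "w \<in> carrier_vec n" unfolding w_def by simp
  have Uw: "U \<tau> \<bullet> w \<noteq> 0" if "\<tau> \<in> \<Sigma>" "flat \<tau>" for \<tau>
  proof -
    have "U \<tau> \<bullet> w = poly (P \<tau>) t"
      unfolding w_def P_def scalar_prod_def by (simp add: poly_sum poly_monom lessThan_atLeast0)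
    then show ?thesis using t that by auto
  qed
  have "simplicial_cone n \<sigma>" using \<sigma> simplicial by blast
  then obtain k h where h: "\<And>j. h j \<in> carrier_vec n" "\<sigma> = cone_of n h {..<k}" using simplicial_cone_ex by metis
  define x where "x = comb n h {..<k} (\<lambda>_. 1)"
  have x: "x \<in> carrier_vec n" "x \<in> \<sigma>" unfolding x_def h(2) cone_of_def by auto
  define y where "y = (\<lambda>m::nat. x + (1 / real (Suc m)) \<cdot>\<^sub>v w)"
  have "\<exists>\<tau>\<in>\<Sigma>. y m \<in> \<tau>" for m
  proof -
    have "y m \<in> carrier_vec n" unfolding y_def using x w by simp
    then show ?thesis using complete unfolding complete_fan_def by blast
  qed
  then obtain f where f: "\<And>m. f m \<in> \<Sigma>" "\<And>m. y m \<in> f m" by metis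
  have "finite (f ` UNIV)" using f(1) finite_fan finite_subset[of "f ` UNIV" \<Sigma>] by blast
  then obtain m0 where inf: "infinite {m. f m = f m0}" using pigeonhole_infinite[of UNIV f] by auto
  let ?\<tau> = "f m0"
  have inf': "\<exists>m>M. y m \<in> ?\<tau>" for M
  proof -
    have "\<exists>m\<in>{m. f m = f m0}. M < m" using inf infinite_nat_iff_unbounded by (metis (no_types, lifting))
    then show ?thesis using f(2) by (metis (mono_tags, lifting) mem_Collect_eq)
  qed
  have dot: "u \<bullet> y m = u \<bullet> x + (u \<bullet> w) / real (Suc m)" if "u \<in> carrier_vec n" for u m
    unfolding y_def using that x(1) w by (simp add: scalar_prod_add_distrib[of _ n])
  have "\<not> flat ?\<tau>"
  proof
    assume fl: "flat ?\<tau>"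
    obtain m1 where m1: "y m1 \<in> ?\<tau>" using inf'[of 0] by blast
    obtain m2 where m2: "m1 < m2" "y m2 \<in> ?\<tau>" using inf'[of m1] by blast
    have u: "U ?\<tau> \<in> carrier_vec n" using U[OF fl] by blast
    have "U ?\<tau> \<bullet> y m1 = 0" "U ?\<tau> \<bullet> y m2 = 0" using U[OF fl] m1 m2 by auto
    then have "(U ?\<tau> \<bullet> w) / real (Suc m1) = (U ?\<tau> \<bullet> w) / real (Suc m2)" unfolding dot[OF u] by linarith
    then show False using Uw[OF f(1) fl] m2(1) by (simp add: field_simps)
  qed
  then obtain g where g: "\<And>j. g j \<in> carrier_vec n" "indep n g {..<n}" "?\<tau> = cone_of n g {..<n}"
    using full[OF f(1)] by blast
  obtain b where b: "\<And>i. b i \<in> carrier_vec n" "\<And>i j. i < n \<Longrightarrow> j < n \<Longrightarrow> b i \<bullet> g j = (if i = j then 1 else 0)"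
    "\<And>x. x \<in> carrier_vec n \<Longrightarrow> x = comb n g {..<n} (\<lambda>i. b i \<bullet> x)"
    using dual_basis[of n g] g by blast
  have bpos: "0 \<le> b i \<bullet> y m" if "y m \<in> ?\<tau>" "i < n" for m i
    using that cone_of_nonneg[of "b i" n "{..<n}" g "y m"] b(1,2) g(1) unfolding g(3) by auto
  have "0 \<le> b i \<bullet> x" if i: "i < n" for i
  proof (rule ccontr)
    assume neg: "\<not> 0 \<le> b i \<bullet> x"
    define a where "a = b i \<bullet> x"
    have a: "a < 0" using neg unfolding a_def by simp
    obtain M where M: "\<bar>b i \<bullet> w\<bar> / (- a) < real M" using reals_Archimedean2 by blast
    obtain m where m: "M < m" "y m \<in> ?\<tau>" using inf' by blast
    have "\<bar>b i \<bullet> w\<bar> < real M * (- a)" using M a by (simp add: field_simps)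
    also have "\<dots> \<le> real (Suc m) * (- a)" using m(1) a by (intro mult_right_mono) auto
    finally have "(b i \<bullet> w) / real (Suc m) < - a" by (simp add: field_simps)
    then show False using bpos[OF m(2) i] dot[OF b(1)] unfolding a_def by fastforce
  qed
  then have x\<tau>: "x \<in> ?\<tau>" unfolding g(3) cone_of_def using b(3)[OF x(1)] by auto
  obtain u where u: "u \<in> carrier_vec n" "\<forall>z\<in>\<sigma>. 0 \<le> u \<bullet> z" "\<sigma> \<inter> ?\<tau> = {z \<in> \<sigma>. u \<bullet> z = 0}"
    using fan_inter(1)[OF \<sigma> f(1)] unfolding face_def by blast
  have "u \<bullet> x = 0" using x\<tau> x(2) u(3) by blast
  then have "(\<Sum>j<k. 1 * (u \<bullet> h j)) = 0" unfolding x_def using scalar_prod_comb[OF u(1) h(1)] by simp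
  moreover have "\<And>j. j < k \<Longrightarrow> 0 \<le> u \<bullet> h j" using u(2) gen_in_cone[of "{..<k}" _ h n] h by auto
  ultimately have uh: "\<And>j. j < k \<Longrightarrow> u \<bullet> h j = 0" using sum_nonneg_eq_0_iff[of "{..<k}" "\<lambda>j. u \<bullet> h j"] by auto
  have "u \<bullet> z = 0" if "z \<in> \<sigma>" for z
    using that scalar_prod_comb[OF u(1) h(1)] uh unfolding h(2) cone_of_def by auto
  then have "\<sigma> \<inter> ?\<tau> = \<sigma>" using u(3) by auto
  then have "face n \<sigma> ?\<tau>" using fan_inter(2)[OF \<sigma> f(1)[of m0]] by simp
  then show ?thesis using that g f(1) by metis
qed

text \<open>Every cone is a face of a full-dimensional one, and faces of simplicial cones are generated by subsets of the
  generators. So each chart has simplicial form, with the rays of the fan as coordinates.\<close>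

theorem cone_representation:
  assumes "\<sigma> \<in> \<Sigma>"
  obtains J K where "max_cone J" "K \<subseteq> J" "\<sigma> = cone_of n rv K"
proof -
  obtain g where g: "\<And>j. g j \<in> carrier_vec n" "indep n g {..<n}" "cone_of n g {..<n} \<in> \<Sigma>"
    "face n \<sigma> (cone_of n g {..<n})" using face_of_full_cone[OF assms] by blast
  obtain p where p: "inj_on p {..<n}" "p ` {..<n} \<subseteq> {..<N}"
    "\<And>S. S \<subseteq> {..<n} \<Longrightarrow> cone_of n g S = cone_of n rv (p ` S)" "indep n rv (p ` {..<n})"
    using full_cone_rays[OF g(3,1,2)] by blast
  have J: "max_cone (p ` {..<n})" unfolding max_cone_def using p g(3) by (simp add: card_image)
  obtain u where u: "u \<in> carrier_vec n" "\<forall>x\<in>cone_of n g {..<n}. 0 \<le> u \<bullet> x" "\<sigma> = {x\<in>cone_of n g {..<n}. u \<bullet> x = 0}"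
    using g(4) unfolding face_def by blast
  have "0 \<le> u \<bullet> g j" if "j \<in> {..<n}" for j using u(2) gen_in_cone[of "{..<n}" j g n] that g(1) by blast
  then have "\<sigma> = cone_of n g {j\<in>{..<n}. u \<bullet> g j = 0}" unfolding u(3) using g(1) u(1) by (intro face_cone_of) auto
  also have "\<dots> = cone_of n rv (p ` {j\<in>{..<n}. u \<bullet> g j = 0})" by (rule p(3)) auto
  finally show ?thesis using J by (intro that[of "p ` {..<n}" "p ` {j\<in>{..<n}. u \<bullet> g j = 0}"]) auto
qed

lemma max_cone_ex: obtains J where "max_cone J"
proof -
  have "0\<^sub>v n \<in> \<Union> \<Sigma>" using complete unfolding complete_fan_def by simp
  then show ?thesis using cone_representation that by blast
qed

lemma max_cone_finite: "max_cone J \<Longrightarrow> finite J"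
  and max_cone_carrier: "max_cone J \<Longrightarrow> j \<in> J \<Longrightarrow> rv j \<in> carrier_vec n"
  unfolding max_cone_def using rv_carrier finite_subset[of J "{..<N}"] by auto

text \<open>The set of rays is determined by the cone, since a cone of the fan contains no other ray generators.\<close>

lemma max_cone_unique:
  assumes J: "J \<subseteq> {..<N}"
  shows "max_cone J \<longleftrightarrow> cone_of n rv J \<in> cones n \<Sigma> n"
proof
  assume J': "max_cone J"
  obtain p where p: "bij_betw p {..<n} J"
    using ex_bij_betw_nat_finite[OF max_cone_finite[OF J']] J' unfolding max_cone_def by (metis lessThan_atLeast0)
  define g where "g = (\<lambda>i. if i < n then rv (p i) else 0\<^sub>v n)"
  have pJ: "p i \<in> J" if "i < n" for i using p that by (auto dest: bij_betwE)
  have g: "g i \<in> carrier_vec n" for i unfolding g_def using pJ max_cone_carrier[OF J'] by auto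
  have comb: "comb n rv J c = comb n g {..<n} (\<lambda>i. c (p i))" for c
    unfolding comb_def sum.reindex_bij_betw[OF p, symmetric] g_def by (auto intro!: eq_vecI sum.cong)
  have cone: "cone_of n rv J = cone_of n g {..<n}"
  proof -
    have im: "p ` {..<n} = J" using p by (rule bij_betw_imp_surj_on)
    have "cone_of n g {..<n} = cone_of n rv (p ` {..<n})"
      by (rule cone_of_rescale(1)[of _ _ "\<lambda>_. 1"])
        (use bij_betw_imp_inj_on[OF p] pJ max_cone_carrier[OF J'] in \<open>auto simp: g_def\<close>)
    then show ?thesis unfolding im by simp
  qed
  have "indep n g {..<n}" unfolding indep_def
  proof (intro allI impI ballI)
    fix c i assume c: "comb n g {..<n} c = 0\<^sub>v n" and i: "i \<in> {..<n}"
    have "comb n rv J (\<lambda>j. c (inv_into {..<n} p j)) = comb n g {..<n} c" unfolding comb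
      by (rule comb_cong) (use p in \<open>simp add: bij_betw_inv_into_left\<close>)
    then have "\<forall>j\<in>J. c (inv_into {..<n} p j) = 0" using J' c unfolding max_cone_def indep_def by metis
    then show "c i = 0" using pJ[of i] i p by (auto simp: bij_betw_inv_into_left)
  qed
  then have "has_dim n (cone_of n rv J) n" unfolding cone using has_dim_full_iff[of g n n] g by blast
  then show "cone_of n rv J \<in> cones n \<Sigma> n" unfolding cones_def using J' unfolding max_cone_def by blast
next
  assume "cone_of n rv J \<in> cones n \<Sigma> n"
  then have \<sigma>: "cone_of n rv J \<in> \<Sigma>" "has_dim n (cone_of n rv J) n" unfolding cones_def by auto
  have "simplicial_cone n (cone_of n rv J)" using \<sigma>(1) simplicial by blast
  then obtain k g where "(\<forall>j. g j \<in> carrier_vec n) \<and> indep n g {..<k} \<and> cone_of n rv J = cone_of n g {..<k}"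
    using simplicial_cone_ex by blast
  then have g: "\<And>j. g j \<in> carrier_vec n" "indep n g {..<k}" "cone_of n rv J = cone_of n g {..<k}" by auto
  have k: "k = n" using \<sigma>(2) has_dim_full_iff[OF g(1,2)] unfolding g(3) by blast
  have \<sigma>': "cone_of n g {..<n} \<in> \<Sigma>" using \<sigma>(1) unfolding g(3) k .
  obtain p where p: "inj_on p {..<n}" "p ` {..<n} \<subseteq> {..<N}"
    "\<And>S. S \<subseteq> {..<n} \<Longrightarrow> cone_of n g S = cone_of n rv (p ` S)" "indep n rv (p ` {..<n})"
    using full_cone_rays[OF \<sigma>' g(1) g(2)[unfolded k]] by blast
  let ?J = "p ` {..<n}"
  have eq: "cone_of n rv J = cone_of n rv ?J" using p(3)[of "{..<n}"] g(3) k by simp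
  have J': "max_cone ?J" unfolding max_cone_def using p \<sigma>(1) eq by (simp add: card_image)
  have "j \<in> ?J" if "j \<in> J" for j
    using generator_in_cone[of ?J j] gen_in_cone[of J j rv n] that J p(2) \<sigma>(1) rv_carrier[of j] finite_subset[OF J]
    unfolding eq by auto
  moreover have "j \<in> J" if "j \<in> ?J" for j
    using generator_in_cone[of J j] gen_in_cone[of ?J j rv n] that J p(2) \<sigma>(1) rv_carrier[of j]
    unfolding eq by auto
  ultimately have "J = ?J" by blast
  then show "max_cone J" using J' by simp
qed

end


section \<open>Divisors on a complete simplicial toric variety\<close>

lemma (in simplicial_chart) height_one_primes_eq:
  "height_one_primes (coord_ring n \<sigma>) =
     (\<lambda>k. emb ` ray_prime k) ` K \<union> (\<lambda>\<pi>. emb ` torus_prime \<pi>) ` {\<pi>. prime_in L \<pi>}"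
  unfolding height_one_primes_coord_ring using height_one_iff by auto

lemma (in simplicial_chart) local_ring_ray: "k \<in> K \<Longrightarrow>
    local_ring (coord_ring n \<sigma>) (emb ` ray_prime k) = val_ring n (ord_form n (l k))"
  unfolding coord_ring_eq local_ring_emb by (rule local_fractions_ray_prime)

lemma (in simplicial_chart) local_ring_torus: "prime_in L \<pi> \<Longrightarrow>
    local_ring (coord_ring n \<sigma>) (emb ` torus_prime \<pi>) = val_ring n (ord_prime n \<pi>)"
  unfolding coord_ring_eq local_ring_emb by (rule local_fractions_torus_prime)

text \<open>A row vector as an exponent.\<close>

definition M_of :: "nat \<Rightarrow> int vec \<Rightarrow> (nat \<Rightarrow>\<^sub>0 int)" where
  "M_of n y = (\<Sum>i<n. Poly_Mapping.single i (y $ i))"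

lemma lookup_M_of: "lookup (M_of n y) i = (if i < n then y $ i else 0)"
  unfolding M_of_def lookup_sum lookup_single when_def by simp

lemma M_of_in [simp]: "M_of n y \<in> M_lattice n"
  unfolding M_lattice_iff lookup_M_of by simp

context complete_simplicial_fan
begin

text \<open>The pairing with the \<open>j\<close>-th ray generator, with integer values.\<close>

definition l :: "nat \<Rightarrow> (nat \<Rightarrow>\<^sub>0 int) \<Rightarrow> int" where
  "l j m = (\<Sum>i<n. lookup m i * v j $ i)"

abbreviation "L \<equiv> laurent_ring n"

lemma form_l: "additive_form (l j)"
  unfolding additive_form_def l_def by (simp add: lookup_add distrib_right sum.distrib)

lemma l_M_of: "j < N \<Longrightarrow> l j (M_of n y) = y \<bullet> v j"
  using v_carrier[of j] unfolding l_def lookup_M_of scalar_prod_def by (simp add: lessThan_atLeast0 carrier_vecD)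

lemma l_as_scalar_prod: "j < N \<Longrightarrow> l j m = vec n (lookup m) \<bullet> v j"
  using v_carrier[of j] unfolding l_def scalar_prod_def by (simp add: lessThan_atLeast0 carrier_vecD)

lemma pairing_comb:
  assumes "K \<subseteq> {..<N}"
  shows "pairing n m (comb n rv K c) = (\<Sum>k\<in>K. c k * real_of_int (l k m))"
proof -
  have "pairing n m (comb n rv K c) = (\<Sum>i<n. \<Sum>k\<in>K. real_of_int (lookup m i) * (c k * rv k $ i))"
    unfolding pairing_def comb_def by (simp add: sum_distrib_left)
  also have "\<dots> = (\<Sum>k\<in>K. \<Sum>i<n. real_of_int (lookup m i) * (c k * rv k $ i))" by (rule sum.swap)
  also have "\<dots> = (\<Sum>k\<in>K. c k * real_of_int (l k m))"
  proof (rule sum.cong[OF refl])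
    fix k assume "k \<in> K"
    then have "dim_vec (v k) = n" using v_carrier[of k] assms by auto
    then show "(\<Sum>i<n. real_of_int (lookup m i) * (c k * rv k $ i)) = c k * real_of_int (l k m)"
      unfolding l_def by (simp add: sum_distrib_left algebra_simps)
  qed
  finally show ?thesis .
qed

lemma dual_monoid_cone:
  assumes K: "K \<subseteq> {..<N}"
  shows "m \<in> dual_monoid n (cone_of n rv K) \<longleftrightarrow> m \<in> M_lattice n \<and> (\<forall>k\<in>K. 0 \<le> l k m)"
proof -
  have fin: "finite K" using K finite_subset by blast
  have "(\<forall>x\<in>cone_of n rv K. 0 \<le> pairing n m x) \<longleftrightarrow> (\<forall>k\<in>K. 0 \<le> l k m)"
  proof
    assume a: "\<forall>x\<in>cone_of n rv K. 0 \<le> pairing n m x"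
    show "\<forall>k\<in>K. 0 \<le> l k m"
    proof
      fix k assume k: "k \<in> K"
      let ?c = "\<lambda>j. if j = k then 1 else (0::real)"
      have "comb n rv K ?c \<in> cone_of n rv K" unfolding cone_of_def by auto
      then have "0 \<le> (\<Sum>j\<in>K. ?c j * real_of_int (l j m))" using a pairing_comb[OF K] by metis
      also have "\<dots> = (\<Sum>j\<in>K. if j = k then real_of_int (l k m) else 0)" by (intro sum.cong) auto
      also have "\<dots> = real_of_int (l k m)" using k fin by simp
      finally show "0 \<le> l k m" by simp
    qed
  next
    assume "\<forall>k\<in>K. 0 \<le> l k m"
    then show "\<forall>x\<in>cone_of n rv K. 0 \<le> pairing n m x"
      unfolding cone_of_def using pairing_comb[OF K] by (auto intro!: sum_nonneg)
  qed
  then show ?thesis unfolding dual_monoid_def by blast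
qed

lemma primitive_ex: "j < N \<Longrightarrow> \<exists>m\<in>M_lattice n. l j m = 1"
  using ray_props(1)[of j] l_M_of[of j] M_of_in by metis

text \<open>The adjugate matrix is an integral inverse up to the determinant, whose sign is corrected.\<close>

lemma integral_dual:
  assumes J: "max_cone J" and k: "k \<in> J"
  shows "\<exists>m\<in>M_lattice n. 0 < l k m \<and> (\<forall>j\<in>J. j \<noteq> k \<longrightarrow> l j m = 0)"
proof -
  have JN: "J \<subseteq> {..<N}" and ind: "indep n rv J" and card: "card J = n" using J unfolding max_cone_def by auto
  obtain p where p: "bij_betw p {..<n} J"
    using ex_bij_betw_nat_finite[OF max_cone_finite[OF J]] card by (metis lessThan_atLeast0)
  define q where "q = inv_into {..<n} p"
  have q: "q (p i) = i" if "i < n" for i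
    unfolding q_def using p that by (simp add: bij_betw_inv_into_left)
  have pJ: "p i \<in> J" if "i < n" for i using p that by (auto dest: bij_betwE)
  define A where "A = mat n n (\<lambda>(i, j). v (p j) $ i)"
  have A: "A \<in> carrier_mat n n" unfolding A_def by simp
  have col: "col A j = v (p j)" if "j < n" for j
    unfolding A_def using v_carrier[of "p j"] pJ[OF that] JN that by (intro eq_vecI) auto
  have "det A \<noteq> 0"
  proof
    assume "det A = 0"
    then obtain c where c: "c \<in> carrier_vec n" "c \<noteq> 0\<^sub>v n" "A *\<^sub>v c = 0\<^sub>v n" using det_0_iff_vec_prod_zero[OF A] by blast
    have "comb n rv J (\<lambda>j. real_of_int (c $ q j)) = 0\<^sub>v n"
    proof (rule eq_vecI)
      fix i assume "i < dim_vec (0\<^sub>v n :: real vec)"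
      then have i: "i < n" by simp
      have "comb n rv J (\<lambda>j. real_of_int (c $ q j)) $ i = (\<Sum>j<n. real_of_int (c $ j) * rv (p j) $ i)"
        unfolding comb_def sum.reindex_bij_betw[OF p, symmetric] using i q by simp
      also have "\<dots> = (\<Sum>j<n. real_of_int (c $ j * v (p j) $ i))"
      proof (rule sum.cong[OF refl])
        fix j assume "j \<in> {..<n}"
        then have "v (p j) \<in> carrier_vec n" using pJ[of j] JN by (intro v_carrier) auto
        then show "real_of_int (c $ j) * rv (p j) $ i = real_of_int (c $ j * v (p j) $ i)" using i by simp
      qed
      also have "\<dots> = real_of_int ((A *\<^sub>v c) $ i)"
        using i c(1) unfolding A_def by (simp add: scalar_prod_def lessThan_atLeast0 mult.commute)
      finally show "comb n rv J (\<lambda>j. real_of_int (c $ q j)) $ i = 0\<^sub>v n $ i" using c(3) i by simp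
    qed (simp add: comb_def)
    then have "\<forall>j\<in>J. real_of_int (c $ q j) = 0" using ind unfolding indep_def by blast
    then have "real_of_int (c $ q (p i)) = 0" if "i < n" for i using pJ[OF that] by simp
    then have "c $ i = 0" if "i < n" for i using q that by simp
    then have "c = 0\<^sub>v n" using c(1) by (intro eq_vecI) auto
    then show False using c(2) by blast
  qed
  define B where "B = adj_mat A"
  have B: "B \<in> carrier_mat n n" "B * A = det A \<cdot>\<^sub>m 1\<^sub>m n" unfolding B_def using adj_mat[OF A] by auto
  have Bv: "row B i \<bullet> v (p j) = (if i = j then det A else 0)" if "i < n" "j < n" for i j
  proof -
    have "row B i \<bullet> v (p j) = (B * A) $$ (i, j)" using that A B(1) col by simp
    then show ?thesis unfolding B(2) using that by simp
  qed
  have surj: "\<exists>i<n. p i = j" if "j \<in> J" for j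
    using that unfolding bij_betw_imp_surj_on[OF p, symmetric] by auto
  obtain i where i: "i < n" "p i = k" using surj[OF k] by blast
  define m where "m = frag_cmul (sgn (det A)) (M_of n (row B i))"
  have lm: "l (p j) m = sgn (det A) * (if i = j then det A else 0)" if "j < n" for j
    unfolding m_def additive_formD(5)[OF form_l] using l_M_of[of "p j"] pJ[OF that] JN Bv[OF i(1) that] by auto
  have "l k m = \<bar>det A\<bar>" using lm[OF i(1)] i(2) by (simp add: abs_sgn mult.commute)
  moreover have "l j m = 0" if j: "j \<in> J" "j \<noteq> k" for j
  proof -
    obtain j' where "j' < n" "p j' = j" using surj[OF j(1)] by blast
    then show ?thesis using lm[of j'] j(2) i(2) by auto
  qed
  moreover have "m \<in> M_lattice n" unfolding m_def by (intro M_lattice_cmul M_of_in)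
  ultimately show ?thesis using \<open>det A \<noteq> 0\<close> by (intro bexI[of _ m]) auto
qed

lemma chart_of_cone:
  assumes J: "max_cone J" and K: "K \<subseteq> J"
  shows "\<exists>w u. simplicial_chart n (cone_of n rv K) K l w u"
proof -
  have JN: "J \<subseteq> {..<N}" using J unfolding max_cone_def by auto
  have "\<forall>k\<in>K. \<exists>m. m \<in> M_lattice n \<and> l k m = 1" using primitive_ex JN K by blast
  then obtain w where w: "\<forall>k\<in>K. w k \<in> M_lattice n \<and> l k (w k) = 1" by metis
  have "\<forall>k\<in>K. \<exists>m. m \<in> M_lattice n \<and> 0 < l k m \<and> (\<forall>j\<in>J. j \<noteq> k \<longrightarrow> l j m = 0)" using integral_dual[OF J] K by blast
  then obtain u where u: "\<forall>k\<in>K. u k \<in> M_lattice n \<and> 0 < l k (u k) \<and> (\<forall>j\<in>J. j \<noteq> k \<longrightarrow> l j (u k) = 0)" by metis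
  have "simplicial_chart n (cone_of n rv K) K l w u"
  proof
    show "finite K" using K max_cone_finite[OF J] finite_subset by blast
    show "m \<in> dual_monoid n (cone_of n rv K) \<longleftrightarrow> m \<in> M_lattice n \<and> (\<forall>k\<in>K. 0 \<le> l k m)" for m
      by (rule dual_monoid_cone) (use K JN in blast)
  qed (use w u K form_l in \<open>auto\<close>)
  then show ?thesis by blast
qed

text \<open>\<open>D j\<close> is the divisor of the \<open>j\<close>-th ray, \<open>T \<pi>\<close> the closure of the divisor of the torus that is
  defined by the prime \<open>\<pi>\<close>.\<close>

definition D :: "nat \<Rightarrow> ratfun set" where "D j = val_ring n (ord_form n (l j))"
definition T :: "laurent \<Rightarrow> ratfun set" where "T \<pi> = val_ring n (ord_prime n \<pi>)"

lemma ray_chart: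
  assumes j: "j < N"
  shows "\<exists>w u. simplicial_chart n (\<rho> j) {j} l w u"
proof -
  obtain m where m: "m \<in> M_lattice n" "l j m = 1" using primitive_ex[OF j] by blast
  have "simplicial_chart n (cone_of n rv {j}) {j} l (\<lambda>_. m) (\<lambda>_. m)"
  proof
    show "x \<in> dual_monoid n (cone_of n rv {j}) \<longleftrightarrow> x \<in> M_lattice n \<and> (\<forall>k\<in>{j}. 0 \<le> l k x)" for x
      by (rule dual_monoid_cone) (use j in simp)
  qed (use m form_l in auto)
  then show ?thesis unfolding ray_eq_cone_of[OF j] by blast
qed

lemma orbit_divisor_ray:
  assumes j: "j < N"
  shows "orbit_divisor n (\<rho> j) = D j"
proof -
  obtain w u where chart: "simplicial_chart n (\<rho> j) {j} l w u" using ray_chart[OF j] by blast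
  have perp: "m \<in> perp n (\<rho> j) \<longleftrightarrow> m \<in> M_lattice n \<and> l j m = 0" for m
  proof -
    have p: "pairing n m (comb n rv {j} c) = c j * real_of_int (l j m)" for c
      using pairing_comb[of "{j}" m c] j by simp
    have "(\<forall>x\<in>cone_of n rv {j}. pairing n m x = 0) \<longleftrightarrow> l j m = 0"
    proof
      assume a: "\<forall>x\<in>cone_of n rv {j}. pairing n m x = 0"
      have "comb n rv {j} (\<lambda>_. 1) \<in> cone_of n rv {j}" unfolding cone_of_def by auto
      then show "l j m = 0" using a p[of "\<lambda>_. 1"] by simp
    next
      assume "l j m = 0"
      then show "\<forall>x\<in>cone_of n rv {j}. pairing n m x = 0" unfolding cone_of_def using p by auto
    qed
    then show ?thesis unfolding perp_def ray_eq_cone_of[OF j] by blast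
  qed
  show ?thesis unfolding D_def by (rule simplicial_chart.orbit_divisor_eq[OF chart refl perp])
qed

lemma valuation_D: "j < N \<Longrightarrow> valuation_on n (ord_form n (l j))"
  using primitive_ex[of j] valuation_ord_form[OF form_l] by blast

lemma ord_along_D: "j < N \<Longrightarrow> f \<in> function_field n \<Longrightarrow> f \<noteq> 0 \<Longrightarrow> ord_along (D j) f = ord_form n (l j) f"
  unfolding D_def by (rule ord_along_val_ring[OF valuation_D])

lemma ord_along_T: "prime_in L \<pi> \<Longrightarrow> f \<in> function_field n \<Longrightarrow> f \<noteq> 0 \<Longrightarrow> ord_along (T \<pi>) f = ord_prime n \<pi> f"
  unfolding T_def by (rule ord_along_val_ring[OF valuation_ord_prime])

lemma emb_in: "p \<in> L \<Longrightarrow> emb p \<in> function_field n"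
  using Fract_in laurent_ringD(1) by blast

lemma ord_D_chi: "j < N \<Longrightarrow> m \<in> M_lattice n \<Longrightarrow> ord_along (D j) (emb (chi m)) = l j m"
  using ord_along_D[of j "emb (chi m)"] ord_form_chi[OF form_l] emb_in by (simp add: emb_simps)

lemma ord_T_chi: "prime_in L \<pi> \<Longrightarrow> m \<in> M_lattice n \<Longrightarrow> ord_along (T \<pi>) (emb (chi m)) = 0"
  using ord_along_T[of \<pi> "emb (chi m)"] ord_prime_chi emb_in by (simp add: emb_simps)

lemma D_inj:
  assumes "i < N" "j < N" "D i = D j"
  shows "i = j"
proof -
  have "v i $ k = v j $ k" if "k < n" for k
  proof -
    have "l i (M_of n (unit_vec n k)) = l j (M_of n (unit_vec n k))"
      using ord_D_chi[OF assms(1) M_of_in] ord_D_chi[OF assms(2) M_of_in] assms(3) by metis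
    then show ?thesis using l_M_of[OF assms(1)] l_M_of[OF assms(2)] v_carrier[OF assms(1)] v_carrier[OF assms(2)] that by simp
  qed
  then have "v i = v j" using v_carrier[OF assms(1)] v_carrier[OF assms(2)] by (intro eq_vecI) auto
  then have "rv i = 1 \<cdot>\<^sub>v rv j" by simp
  then show ?thesis by (rule ray_determined[OF assms(1,2)]) simp
qed

lemma D_not_T:
  assumes "j < N" "prime_in L \<pi>"
  shows "D j \<noteq> T \<pi>"
proof
  assume eq: "D j = T \<pi>"
  obtain m where "m \<in> M_lattice n" "l j m = 1" using primitive_ex[OF assms(1)] by blast
  then show False using ord_D_chi[OF assms(1)] ord_T_chi[OF assms(2)] eq by simp
qed

text \<open>Primes dividing each other are associated, so they define the same order.\<close>

lemma T_eq_of_dvd: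
  assumes \<pi>: "prime_in L \<pi>" "prime_in L \<pi>'" "dvd_in L \<pi>' \<pi>"
  shows "T \<pi>' = T \<pi>"
proof -
  obtain J where J: "max_cone J" using max_cone_ex by blast
  obtain w u where "simplicial_chart n (cone_of n rv J) J l w u" using chart_of_cone[OF J subset_refl] by blast
  then interpret ch: simplicial_chart n "cone_of n rv J" J l w u .
  have "p \<in> ch.torus_prime \<pi>'" if p: "p \<in> ch.torus_prime \<pi>" for p
  proof -
    obtain a b where ab: "p \<in> ch.A" "a \<in> L" "p = \<pi> * a" "b \<in> L" "\<pi> = \<pi>' * b"
      using p \<pi>(3) unfolding ch.torus_prime_def dvd_in_def by blast
    have "p = \<pi>' * (b * a)" using ab(3,5) by (simp add: mult.assoc)
    then have "dvd_in L \<pi>' p" by (rule dvd_inI) (rule laurent_ringD(4)[OF ab(4,2)])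
    then show ?thesis using ab(1) unfolding ch.torus_prime_def by blast
  qed
  then have sub: "ch.torus_prime \<pi> \<subseteq> ch.torus_prime \<pi>'" by blast
  have "ch.torus_prime \<pi> = ch.torus_prime \<pi>'" by (rule ch.torus_prime_associated[OF \<pi>(2,1) sub])
  then show ?thesis
    unfolding T_def ch.local_fractions_torus_prime[OF \<pi>(1), symmetric]
      ch.local_fractions_torus_prime[OF \<pi>(2), symmetric] by simp
qed

text \<open>The prime divisors of all the charts: since the local rings depend only on the valuation, charts that share a ray or
  meet the same divisor of the torus yield the same subset of the function field.\<close>

lemma prime_divisors_eq: "prime_divisors n \<Sigma> = D ` {..<N} \<union> T ` {\<pi>. prime_in L \<pi>}"
proof -
  have img: "local_ring (coord_ring n \<sigma>) ` height_one_primes (coord_ring n \<sigma>) = D ` K \<union> T ` {\<pi>. prime_in L \<pi>}"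
    if "simplicial_chart n \<sigma> K l w u" for \<sigma> K w u
  proof -
    interpret ch: simplicial_chart n \<sigma> K l w u by (rule that)
    show ?thesis unfolding ch.height_one_primes_eq image_Un image_image D_def T_def
      using ch.local_ring_ray ch.local_ring_torus by (intro arg_cong2[of _ _ _ _ "(\<union>)"] image_cong) auto
  qed
  show ?thesis
  proof (intro equalityI subsetI)
    fix Y assume "Y \<in> prime_divisors n \<Sigma>"
    then obtain \<sigma> where \<sigma>: "\<sigma> \<in> \<Sigma>" "Y \<in> local_ring (coord_ring n \<sigma>) ` height_one_primes (coord_ring n \<sigma>)"
      unfolding prime_divisors_def by (rule UN_E)
    obtain J K where J: "max_cone J" "K \<subseteq> J" "\<sigma> = cone_of n rv K" using cone_representation[OF \<sigma>(1)] .
    obtain w u where chart: "simplicial_chart n \<sigma> K l w u" using chart_of_cone[OF J(1,2)] unfolding J(3) by metis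
    have "Y \<in> D ` K \<union> T ` {\<pi>. prime_in L \<pi>}" using \<sigma>(2) unfolding img[OF chart] .
    moreover have "K \<subseteq> {..<N}" using J(1,2) unfolding max_cone_def by auto
    ultimately show "Y \<in> D ` {..<N} \<union> T ` {\<pi>. prime_in L \<pi>}" using image_mono[of K "{..<N}" D] by (metis Un_iff subsetD)
  next
    fix Y assume "Y \<in> D ` {..<N} \<union> T ` {\<pi>. prime_in L \<pi>}"
    moreover have "Y \<in> prime_divisors n \<Sigma>" if Y: "Y \<in> D ` {..<N}"
    proof -
      obtain j where j: "j < N" "Y = D j" using Y by auto
      obtain w u where chart: "simplicial_chart n (\<rho> j) {j} l w u" using ray_chart[OF j(1)] by metis
      have "Y \<in> local_ring (coord_ring n (\<rho> j)) ` height_one_primes (coord_ring n (\<rho> j))"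
        unfolding img[OF chart] j(2) by simp
      with ray_mem(1)[OF j(1)] show ?thesis unfolding prime_divisors_def by (rule UN_I)
    qed
    moreover have "Y \<in> prime_divisors n \<Sigma>" if "Y \<in> T ` {\<pi>. prime_in L \<pi>}"
    proof -
      obtain J where J: "max_cone J" using max_cone_ex by blast
      obtain w u where chart: "simplicial_chart n (cone_of n rv J) J l w u" using chart_of_cone[OF J subset_refl] by metis
      have "Y \<in> local_ring (coord_ring n (cone_of n rv J)) ` height_one_primes (coord_ring n (cone_of n rv J))"
        unfolding img[OF chart] using that by (rule UnI2)
      moreover have "cone_of n rv J \<in> \<Sigma>" using J unfolding max_cone_def by blast
      ultimately show ?thesis unfolding prime_divisors_def by (rule UN_I[rotated])
    qed
    ultimately show "Y \<in> prime_divisors n \<Sigma>" by (metis Un_iff)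
  qed
qed

lemma T_in: "prime_in L \<pi> \<Longrightarrow> T \<pi> \<in> prime_divisors n \<Sigma>" and D_in: "j < N \<Longrightarrow> D j \<in> prime_divisors n \<Sigma>"
  unfolding prime_divisors_eq by auto

definition toric :: "int vec \<Rightarrow> divisor" where
  "toric a = toric_divisor n \<rho> a"

lemma lookup_toric_D:
  assumes "a \<in> carrier_vec N" "k < N"
  shows "lookup (toric a) (D k) = a $ k"
proof -
  have "lookup (toric a) (D k) = (\<Sum>j<N. if j = k then a $ k else 0)"
    unfolding toric_def toric_divisor_def lookup_sum lookup_single when_def using assms orbit_divisor_ray D_inj
    by (intro sum.cong) auto
  then show ?thesis using assms(2) by simp
qed

lemma lookup_toric_other:
  assumes "a \<in> carrier_vec N" "\<And>k. k < N \<Longrightarrow> D k \<noteq> Y"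
  shows "lookup (toric a) Y = 0"
  unfolding toric_def toric_divisor_def lookup_sum lookup_single when_def using assms orbit_divisor_ray
  by (intro sum.neutral) auto

lemma keys_toric: "a \<in> carrier_vec N \<Longrightarrow> keys (toric a) \<subseteq> D ` {..<N}"
proof (intro subsetI, rule ccontr)
  fix Y assume Y: "a \<in> carrier_vec N" "Y \<in> keys (toric a)" "Y \<notin> D ` {..<N}"
  then have "lookup (toric a) Y = 0" by (intro lookup_toric_other) auto
  then show False using Y(2) by (simp add: in_keys_iff)
qed

lemma toric_add:
  assumes "a \<in> carrier_vec N" "b \<in> carrier_vec N"
  shows "toric (a + b) = toric a + toric b"
proof -
  have "dim_vec a = N" "dim_vec b = N" using assms by auto
  then show ?thesis unfolding toric_def toric_divisor_def by (simp add: single_add sum.distrib)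
qed

lemma toric_diff:
  assumes "a \<in> carrier_vec N" "b \<in> carrier_vec N"
  shows "toric (a - b) = toric a - toric b"
proof -
  have "dim_vec a = N" "dim_vec b = N" using assms by auto
  then show ?thesis unfolding toric_def toric_divisor_def by (simp add: single_diff sum_subtractf)
qed

lemma toric_zero: "toric (0\<^sub>v N) = 0"
  unfolding toric_def toric_divisor_def by simp

lemma toric_inj:
  assumes "a \<in> carrier_vec N" "b \<in> carrier_vec N" "toric a = toric b"
  shows "a = b"
  using assms lookup_toric_D[OF assms(1)] lookup_toric_D[OF assms(2)] by (intro eq_vecI) auto

lemma toric_surj:
  assumes E: "keys E \<subseteq> D ` {..<N}"
  obtains a where "a \<in> carrier_vec N" "E = toric a"
proof
  let ?a = "vec N (\<lambda>j. lookup E (D j))"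
  show "?a \<in> carrier_vec N" by simp
  show "E = toric ?a"
  proof (rule poly_mapping_eqI)
    fix Y
    show "lookup E Y = lookup (toric ?a) Y"
    proof (cases "Y \<in> D ` {..<N}")
      case True
      then show ?thesis using lookup_toric_D[of ?a] by auto
    next
      case False
      then have "lookup (toric ?a) Y = 0" by (intro lookup_toric_other) auto
      then show ?thesis using False E by (auto simp: in_keys_iff)
    qed
  qed
qed

end


context complete_simplicial_fan
begin

section \<open>Divisor classes\<close>

lemma weil_carrier_iff: "E \<in> carrier (weil n \<Sigma>) \<longleftrightarrow> keys E \<subseteq> prime_divisors n \<Sigma>"
  unfolding weil_def by simp

lemma ord_along_mult:
  assumes Y: "Y \<in> prime_divisors n \<Sigma>" and f: "f \<in> function_field n" "f \<noteq> 0" "g \<in> function_field n" "g \<noteq> 0"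
  shows "ord_along Y (f * g) = ord_along Y f + ord_along Y g"
proof -
  have fg: "f * g \<in> function_field n" "f * g \<noteq> 0" using f function_field_mult by auto
  consider j where "j < N" "Y = D j" | \<pi> where "prime_in L \<pi>" "Y = T \<pi>"
    using Y unfolding prime_divisors_eq by blast
  then show ?thesis
  proof cases
    case 1
    then show ?thesis using ord_along_D[OF 1(1)] fg f valuation_mult[OF valuation_D[OF 1(1)] f(1,3,2,4)] by simp
  next
    case 2
    then show ?thesis using ord_along_T[OF 2(1)] fg f valuation_mult[OF valuation_ord_prime[OF 2(1)] f(1,3,2,4)] by simp
  qed
qed

definition div_of :: "ratfun \<Rightarrow> divisor \<Rightarrow> bool" where
  "div_of f E \<longleftrightarrow> f \<in> function_field n \<and> f \<noteq> 0 \<and>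
     (\<forall>Y\<in>prime_divisors n \<Sigma>. lookup E Y = ord_along Y f)"

lemma principal_iff: "E \<in> principal n \<Sigma> \<longleftrightarrow> keys E \<subseteq> prime_divisors n \<Sigma> \<and> (\<exists>f. div_of f E)"
  unfolding principal_def weil_def div_of_def by auto

lemma div_of_mult: "div_of f E \<Longrightarrow> div_of g E' \<Longrightarrow> div_of (f * g) (E + E')"
  unfolding div_of_def by (auto simp: lookup_add ord_along_mult function_field_mult)

lemma div_of_one: "div_of 1 0"
proof -
  have "ord_along Y 1 = 0" if "Y \<in> prime_divisors n \<Sigma>" for Y
    using ord_along_mult[OF that function_field_one _ function_field_one] by simp
  then show ?thesis unfolding div_of_def using function_field_one by simp
qed

lemma div_of_inverse:
  assumes "div_of f E"
  shows "div_of (inverse f) (- E)"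
proof -
  have f: "f \<in> function_field n" "f \<noteq> 0" "inverse f \<in> function_field n" "inverse f \<noteq> 0"
    using assms function_field_inverse unfolding div_of_def by auto
  have "ord_along Y (inverse f) = - ord_along Y f" if Y: "Y \<in> prime_divisors n \<Sigma>" for Y
    using ord_along_mult[OF Y f] div_of_one Y f(2) unfolding div_of_def by simp
  then show ?thesis using assms f unfolding div_of_def by simp
qed

lemma keys_plus_sub:
  "keys (E :: divisor) \<subseteq> S \<Longrightarrow> keys E' \<subseteq> S \<Longrightarrow> keys (E + E') \<subseteq> S"
  using keys_add[of E E'] by blast

lemma principal_add: "E \<in> principal n \<Sigma> \<Longrightarrow> E' \<in> principal n \<Sigma> \<Longrightarrow> E + E' \<in> principal n \<Sigma>"
  unfolding principal_iff by (metis keys_plus_sub div_of_mult)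

lemma principal_zero: "0 \<in> principal n \<Sigma>"
  unfolding principal_iff using div_of_one by auto

lemma principal_uminus: "E \<in> principal n \<Sigma> \<Longrightarrow> - E \<in> principal n \<Sigma>"
  unfolding principal_iff using div_of_inverse by auto

lemma principal_diff: "E \<in> principal n \<Sigma> \<Longrightarrow> E' \<in> principal n \<Sigma> \<Longrightarrow> E - E' \<in> principal n \<Sigma>"
  using principal_add[of E "- E'"] principal_uminus[of E'] by simp

lemma subgroup_principal: "subgroup (principal n \<Sigma>) (weil n \<Sigma>)"
proof (rule subgroup.intro)
  show "principal n \<Sigma> \<subseteq> carrier (weil n \<Sigma>)" unfolding principal_def by blast
  show "inv\<^bsub>weil n \<Sigma>\<^esub> x \<in> principal n \<Sigma>" if "x \<in> principal n \<Sigma>" for x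
    using principal_uminus[OF that] that unfolding weil_def principal_iff by simp
qed (auto simp: weil_def principal_add principal_zero)

lemma comm_group_weil: "comm_group (weil n \<Sigma>)"
  unfolding weil_def by (rule abelian_free_Abelian_group)

lemma normal_principal: "principal n \<Sigma> \<lhd> weil n \<Sigma>"
  using comm_group.subgroup_imp_normal[OF comm_group_weil subgroup_principal] .

lemma comm_group_Cl: "comm_group (Cl n \<Sigma>)"
  unfolding Cl_def by (rule comm_group.abelian_FactGroup[OF comm_group_weil subgroup_principal])

lemma div_class_eq_iff: "div_class n \<Sigma> E = div_class n \<Sigma> E' \<longleftrightarrow> E - E' \<in> principal n \<Sigma>"
proof -
  have cl: "X \<in> div_class n \<Sigma> E \<longleftrightarrow> X - E \<in> principal n \<Sigma>" for X E
  proof -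
    have "X \<in> div_class n \<Sigma> E \<longleftrightarrow> (\<exists>h\<in>principal n \<Sigma>. X = h + E)"
      unfolding div_class_def r_coset_def weil_def by auto
    also have "\<dots> \<longleftrightarrow> X - E \<in> principal n \<Sigma>"
    proof
      assume "X - E \<in> principal n \<Sigma>"
      then show "\<exists>h\<in>principal n \<Sigma>. X = h + E" by (intro bexI[of _ "X - E"]) auto
    qed auto
    finally show ?thesis .
  qed
  show ?thesis
  proof
    assume "div_class n \<Sigma> E = div_class n \<Sigma> E'"
    moreover have "E \<in> div_class n \<Sigma> E" unfolding cl using principal_zero by simp
    ultimately show "E - E' \<in> principal n \<Sigma>" using cl by metis
  next
    assume d: "E - E' \<in> principal n \<Sigma>"
    show "div_class n \<Sigma> E = div_class n \<Sigma> E'"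
    proof (intro equalityI subsetI)
      fix X assume "X \<in> div_class n \<Sigma> E"
      then have "(X - E) + (E - E') \<in> principal n \<Sigma>" unfolding cl using principal_add d by blast
      then show "X \<in> div_class n \<Sigma> E'" unfolding cl by simp
    next
      fix X assume "X \<in> div_class n \<Sigma> E'"
      then have "(X - E') - (E - E') \<in> principal n \<Sigma>" unfolding cl using principal_diff d by blast
      then show "X \<in> div_class n \<Sigma> E" unfolding cl by simp
    qed
  qed
qed

lemma carrier_Cl: "carrier (Cl n \<Sigma>) = div_class n \<Sigma> ` carrier (weil n \<Sigma>)"
  unfolding Cl_def FactGroup_def RCOSETS_def div_class_def by auto

lemma div_class_add:
  assumes "E \<in> carrier (weil n \<Sigma>)" "E' \<in> carrier (weil n \<Sigma>)"
  shows "div_class n \<Sigma> (E + E') = div_class n \<Sigma> E \<otimes>\<^bsub>Cl n \<Sigma>\<^esub> div_class n \<Sigma> E'"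
proof -
  have "E \<otimes>\<^bsub>weil n \<Sigma>\<^esub> E' = E + E'" unfolding weil_def by simp
  then show ?thesis using normal.rcos_sum[OF normal_principal assms] unfolding Cl_def FactGroup_def div_class_def by simp
qed

subsection \<open>Principal divisors\<close>

lemma toric_carrier: "a \<in> carrier_vec N \<Longrightarrow> toric a \<in> carrier (weil n \<Sigma>)"
  unfolding weil_carrier_iff using keys_toric[of a] prime_divisors_eq by blast

text \<open>A prime divisor of the torus is defined by one equation, as the Laurent polynomial ring is
  factorial, so it is equivalent to an invariant divisor.\<close>

lemma toric_representative:
  assumes "E \<in> carrier (weil n \<Sigma>)"
  shows "\<exists>a\<in>carrier_vec N. E - toric a \<in> principal n \<Sigma>"
proof -
  let ?P = "\<lambda>E. \<exists>a\<in>carrier_vec N. E - toric a \<in> principal n \<Sigma>"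
  have "?P E"
  proof (rule frag_induction[of E "prime_divisors n \<Sigma>" ?P])
    show "keys E \<subseteq> prime_divisors n \<Sigma>" using assms weil_carrier_iff by blast
    show "?P 0" using toric_zero principal_zero by (intro bexI[of _ "0\<^sub>v N"]) auto
    fix Y assume Y: "Y \<in> prime_divisors n \<Sigma>"
    show "?P (frag_of Y)"
    proof (cases "Y \<in> D ` {..<N}")
      case True
      then have "keys (frag_of Y) \<subseteq> D ` {..<N}" by simp
      then obtain a where "a \<in> carrier_vec N" "frag_of Y = toric a" using toric_surj by blast
      then show ?thesis using principal_zero by (intro bexI[of _ a]) auto
    next
      case False
      then obtain \<pi> where \<pi>: "prime_in L \<pi>" "Y = T \<pi>" using Y unfolding prime_divisors_eq by blast
      note \<pi>D = prime_inD[OF \<pi>(1)]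
      define a where "a = vec N (\<lambda>j. - min_val (l j) \<pi>)"
      have a: "a \<in> carrier_vec N" unfolding a_def by simp
      have f: "emb \<pi> \<in> function_field n" "emb \<pi> \<noteq> 0" using emb_in[OF \<pi>D(1)] \<pi>D(2) by (auto simp: emb_simps)
      have "lookup (frag_of Y - toric a) Z = ord_along Z (emb \<pi>)" if Z: "Z \<in> prime_divisors n \<Sigma>" for Z
      proof -
        consider j where "j < N" "Z = D j" | \<pi>' where "prime_in L \<pi>'" "Z = T \<pi>'"
          using Z unfolding prime_divisors_eq by blast
        then show ?thesis
        proof cases
          case 1
          have "ord_form n (l j) (emb \<pi>) = min_val (l j) \<pi> - min_val (l j) 1"
            using ord_form_Fract[OF form_l \<pi>D(1) laurent_ringD(1) \<pi>D(2)] by simp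
          also have "min_val (l j) 1 = 0" using min_val_chi[of "l j" 0] additive_formD(2)[OF form_l] by simp
          finally have "ord_along Z (emb \<pi>) = min_val (l j) \<pi>" using ord_along_D[OF 1(1) f] 1(2) by simp
          moreover have "lookup (frag_of Y) Z = 0" using False 1 by auto
          ultimately show ?thesis using lookup_toric_D[OF a 1(1)] 1 by (simp add: lookup_minus a_def)
        next
          case 2
          have t0: "lookup (toric a) Z = 0"
            using lookup_toric_other[OF a] D_not_T[OF _ 2(1)] 2(2) by blast
          have o: "ord_along Z (emb \<pi>) = int (mult_of n \<pi>' \<pi>)"
            using ord_along_T[OF 2(1) f] ord_prime_Fract[OF 2(1) \<pi>D(1) laurent_ringD(1) \<pi>D(2)]
              mult_of_unit[OF 2(1) unit_in_one[OF subdomain_laurent_ring]] 2(2) by simp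
          show ?thesis
          proof (cases "Z = Y")
            case True
            have "ord_along Z (emb \<pi>) = ord_prime n \<pi> (emb \<pi>)" using True \<pi>(2) ord_along_T[OF \<pi>(1) f] by simp
            also have "\<dots> = 1" using ord_prime_Fract[OF \<pi>(1) \<pi>D(1) laurent_ringD(1) \<pi>D(2)]
              mult_of_unit[OF \<pi>(1) unit_in_one[OF subdomain_laurent_ring]] mult_of_self[OF \<pi>(1)] by simp
            finally show ?thesis using True t0 by (simp add: lookup_minus)
          next
            case ne: False
            have "\<not> dvd_in L \<pi>' \<pi>" using T_eq_of_dvd[OF \<pi>(1) 2(1)] ne 2(2) \<pi>(2) by auto
            then have "mult_of n \<pi>' \<pi> = 0" by (rule mult_of_not_dvd[OF 2(1) \<pi>D(1)])
            then show ?thesis using o t0 ne by (simp add: lookup_minus)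
          qed
        qed
      qed
      then have "div_of (emb \<pi>) (frag_of Y - toric a)" unfolding div_of_def using f by blast
      moreover have "keys (frag_of Y - toric a) \<subseteq> prime_divisors n \<Sigma>"
        using keys_diff[of "frag_of Y" "toric a"] Y toric_carrier[OF a] unfolding weil_carrier_iff by auto
      ultimately show ?thesis using a unfolding principal_iff by blast
    qed
  next
    fix E E' assume "?P E" "?P E'"
    then obtain a b where ab: "a \<in> carrier_vec N" "E - toric a \<in> principal n \<Sigma>"
      "b \<in> carrier_vec N" "E' - toric b \<in> principal n \<Sigma>" by blast
    have eq: "E - E' - toric (a - b) = (E - toric a) - (E' - toric b)" using toric_diff[OF ab(1,3)] by simp
    have "E - E' - toric (a - b) \<in> principal n \<Sigma>" unfolding eq by (rule principal_diff[OF ab(2,4)])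
    then show "?P (E - E')" using ab(1,3) by (intro bexI[of _ "a - b"]) auto
  qed
  then show ?thesis .
qed

text \<open>A function without zeros and poles on the torus has the orders of a character: this is
  \<open>orders_of_function_invertible_off_divisor\<close> for the empty divisor \<open>1 = 0\<close>.\<close>

lemma toric_principal_iff:
  assumes a: "a \<in> carrier_vec N"
  shows "toric a \<in> principal n \<Sigma> \<longleftrightarrow> (\<exists>m\<in>M_lattice n. \<forall>j<N. a $ j = l j m)"
proof
  assume "toric a \<in> principal n \<Sigma>"
  then obtain f where f: "f \<in> function_field n" "f \<noteq> 0"
    "\<forall>Y\<in>prime_divisors n \<Sigma>. lookup (toric a) Y = ord_along Y f"
    unfolding principal_iff div_of_def by blast
  have "ord_prime n \<pi> f = 0" if \<pi>: "prime_in L \<pi>" for \<pi>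
    using f(3) T_in[OF \<pi>] lookup_toric_other[OF a, of "T \<pi>"] D_not_T[OF _ \<pi>] ord_along_T[OF \<pi> f(1,2)] by auto
  moreover have "0 \<in> keys (1::laurent)" "\<And>m k. m \<in> keys (1::laurent) \<Longrightarrow> 0 \<le> l k m"
    using additive_formD(2)[OF form_l] by auto
  ultimately have "monomial_orders n {..<N} l f"
    by (intro orders_of_function_invertible_off_divisor[of _ _ 1] form_l laurent_ringD(1) f(1,2))
  then obtain m where m: "m \<in> M_lattice n" "\<forall>k\<in>{..<N}. ord_form n (l k) f = l k m" unfolding monomial_orders_def by blast
  have "a $ j = l j m" if j: "j < N" for j
    using f(3) D_in[OF j] lookup_toric_D[OF a j] ord_along_D[OF j f(1,2)] m(2) j by auto
  then show "\<exists>m\<in>M_lattice n. \<forall>j<N. a $ j = l j m" using m(1) by blast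
next
  assume "\<exists>m\<in>M_lattice n. \<forall>j<N. a $ j = l j m"
  then obtain m where m: "m \<in> M_lattice n" "\<forall>j<N. a $ j = l j m" by blast
  have "lookup (toric a) Y = ord_along Y (emb (chi m))" if Y: "Y \<in> prime_divisors n \<Sigma>" for Y
  proof -
    consider j where "j < N" "Y = D j" | \<pi> where "prime_in L \<pi>" "Y = T \<pi>" using Y unfolding prime_divisors_eq by blast
    then show ?thesis
    proof cases
      case 1
      then show ?thesis using lookup_toric_D[OF a 1(1)] ord_D_chi[OF 1(1) m(1)] m(2) by simp
    next
      case 2
      then show ?thesis using lookup_toric_other[OF a, of Y] D_not_T[OF _ 2(1)] ord_T_chi[OF 2(1) m(1)] by simp
    qed
  qed
  then have "div_of (emb (chi m)) (toric a)" unfolding div_of_def using emb_in[of "chi m"] m(1) by (simp add: emb_simps)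
  then show "toric a \<in> principal n \<Sigma>" unfolding principal_iff using toric_carrier[OF a] weil_carrier_iff by blast
qed

subsection \<open>Cartier divisors\<close>

lemma local_ring_in:
  assumes "\<sigma> \<in> \<Sigma>" "P \<in> height_one_primes (coord_ring n \<sigma>)"
  shows "local_ring (coord_ring n \<sigma>) P \<in> prime_divisors n \<Sigma>"
  using assms unfolding prime_divisors_def by blast

definition local_equation :: "divisor \<Rightarrow> real vec set \<Rightarrow> ratfun set \<Rightarrow> bool" where
  "local_equation E \<sigma> P \<longleftrightarrow> (\<exists>g\<in>coord_ring n \<sigma> - P. \<exists>f\<in>function_field n. f \<noteq> 0 \<and>
         (\<forall>P'\<in>height_one_primes (coord_ring n \<sigma>). g \<notin> P' \<longrightarrow>
            lookup E (local_ring (coord_ring n \<sigma>) P') =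
            ord_along (local_ring (coord_ring n \<sigma>) P') f))"

lemma cartier_iff: "E \<in> cartier n \<Sigma> \<longleftrightarrow>
    E \<in> carrier (weil n \<Sigma>) \<and> (\<forall>\<sigma>\<in>\<Sigma>. \<forall>P\<in>prime_ideals (coord_ring n \<sigma>). local_equation E \<sigma> P)"
  by (simp only: cartier_def mem_Collect_eq local_equation_def)

lemma local_equationE:
  assumes "local_equation E \<sigma> P"
  obtains g f where "g \<in> coord_ring n \<sigma>" "g \<notin> P" "f \<in> function_field n" "f \<noteq> 0"
    "\<forall>P'\<in>height_one_primes (coord_ring n \<sigma>). g \<notin> P' \<longrightarrow>
       lookup E (local_ring (coord_ring n \<sigma>) P') = ord_along (local_ring (coord_ring n \<sigma>) P') f"
  using assms unfolding local_equation_def by (elim bexE conjE DiffE)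

lemma local_equationI:
  assumes "g \<in> coord_ring n \<sigma>" "g \<notin> P" "f \<in> function_field n" "f \<noteq> 0"
    "\<forall>P'\<in>height_one_primes (coord_ring n \<sigma>). g \<notin> P' \<longrightarrow>
       lookup E (local_ring (coord_ring n \<sigma>) P') = ord_along (local_ring (coord_ring n \<sigma>) P') f"
  shows "local_equation E \<sigma> P"
  unfolding local_equation_def
  by (intro bexI[of _ g] bexI[of _ f] conjI assms(3-5) DiffI assms(1,2))

lemma cartier_add_principal:
  assumes E: "E \<in> cartier n \<Sigma>" and E': "E' \<in> principal n \<Sigma>"
  shows "E + E' \<in> cartier n \<Sigma>"
  unfolding cartier_iff
proof (intro conjI ballI)
  show "E + E' \<in> carrier (weil n \<Sigma>)"
    using E E' keys_plus_sub unfolding cartier_iff weil_carrier_iff principal_iff by metis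
  obtain h where h: "h \<in> function_field n" "h \<noteq> 0"
    "\<forall>Y\<in>prime_divisors n \<Sigma>. lookup E' Y = ord_along Y h"
    using E' unfolding principal_iff div_of_def by metis
  fix \<sigma> P assume \<sigma>: "\<sigma> \<in> \<Sigma>" "P \<in> prime_ideals (coord_ring n \<sigma>)"
  have "local_equation E \<sigma> P" using E \<sigma> unfolding cartier_iff by simp
  then obtain g f where gf: "g \<in> coord_ring n \<sigma>" "g \<notin> P" "f \<in> function_field n" "f \<noteq> 0"
    "\<forall>P'\<in>height_one_primes (coord_ring n \<sigma>). g \<notin> P' \<longrightarrow>
       lookup E (local_ring (coord_ring n \<sigma>) P') = ord_along (local_ring (coord_ring n \<sigma>) P') f"
    by (rule local_equationE)
  show "local_equation (E + E') \<sigma> P"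
  proof (rule local_equationI[OF gf(1,2) function_field_mult[OF gf(3) h(1)]])
    show "f * h \<noteq> 0" using gf(4) h(2) by simp
    show "\<forall>P'\<in>height_one_primes (coord_ring n \<sigma>). g \<notin> P' \<longrightarrow>
      lookup (E + E') (local_ring (coord_ring n \<sigma>) P') = ord_along (local_ring (coord_ring n \<sigma>) P') (f * h)"
    proof (intro ballI impI)
      fix P' assume P': "P' \<in> height_one_primes (coord_ring n \<sigma>)" "g \<notin> P'"
      note Y = local_ring_in[OF \<sigma>(1) P'(1)]
      show "lookup (E + E') (local_ring (coord_ring n \<sigma>) P') = ord_along (local_ring (coord_ring n \<sigma>) P') (f * h)"
        using bspec[OF gf(5) P'(1)] P'(2) bspec[OF h(3) Y] ord_along_mult[OF Y gf(3,4) h(1,2)] by (simp add: lookup_add)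
    qed
  qed
qed

lemma forms_separate:
  assumes J: "max_cone J" and m: "m \<in> M_lattice n" and 0: "\<And>k. k \<in> J \<Longrightarrow> l k m = 0"
  shows "m = 0"
proof -
  have JN: "J \<subseteq> {..<N}" "card J = n" "indep n rv J" using J unfolding max_cone_def by auto
  obtain b where b: "\<And>x. x \<in> carrier_vec n \<Longrightarrow> x = comb n rv J (\<lambda>i. b i \<bullet> x)"
    using dual_basis_on[OF max_cone_finite[OF J] JN(2) max_cone_carrier[OF J] JN(3)] by metis
  have "lookup m i = 0" for i
  proof (cases "i < n")
    case True
    have "pairing n m (unit_vec n i) = (\<Sum>j<n. if j = i then real_of_int (lookup m i) else 0)"
      unfolding pairing_def by (intro sum.cong) (auto simp: unit_vec_def)
    also have "\<dots> = real_of_int (lookup m i)" using True by simp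
    finally have p: "pairing n m (unit_vec n i) = real_of_int (lookup m i)" .
    have "pairing n m (unit_vec n i) = pairing n m (comb n rv J (\<lambda>k. b k \<bullet> unit_vec n i))" using b[of "unit_vec n i"] by simp
    also have "\<dots> = 0" unfolding pairing_comb[OF JN(1)] using 0 by simp
    finally show ?thesis using p by simp
  next
    case False
    then show ?thesis using m unfolding M_lattice_iff by simp
  qed
  then show ?thesis by (simp add: poly_mapping_eqI)
qed

text \<open>The data \<open>a\<close> is a piecewise linear function on the fan that is integral on each cone, given by its values on the ray
  generators.\<close>

definition locally_linear :: "int vec \<Rightarrow> bool" where
  "locally_linear a \<longleftrightarrow> (\<forall>J. max_cone J \<longrightarrow> (\<exists>m\<in>M_lattice n. \<forall>j\<in>J. a $ j = l j m))"

text \<open>The functions that vanish at the distinguished point of a full-dimensional cone are those without constant term: the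
  sum of all the \<open>l k\<close> is positive on every other exponent, so the constant term is multiplicative.\<close>

lemma prime_distinguished_point:
  assumes J: "max_cone J"
  defines "A \<equiv> chart_ring n (cone_of n rv J)"
  shows "prime_ideal_in A {p \<in> A. 0 \<notin> keys p}"
proof -
  have JN: "J \<subseteq> {..<N}" using J unfolding max_cone_def by blast
  have AD: "subdomain A" unfolding A_def by (rule subdomain_chart_ring)
  have keysA: "m \<in> M_lattice n" "\<And>k. k \<in> J \<Longrightarrow> 0 \<le> l k m" if "p \<in> A" "m \<in> keys p" for p m
    using that dual_monoid_cone[OF JN] unfolding A_def chart_ring_def by auto
  define s where "s = (\<lambda>m. \<Sum>k\<in>J. l k m)"
  have s: "additive_form s" unfolding additive_form_def s_def using additive_formD(1)[OF form_l] by (simp add: sum.distrib)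
  have s0: "0 \<le> s m" "s m = 0 \<Longrightarrow> m = 0" if "p \<in> A" "m \<in> keys p" for p m
  proof -
    show "0 \<le> s m" unfolding s_def using keysA(2)[OF that] by (intro sum_nonneg)
    assume "s m = 0"
    then have "\<forall>k\<in>J. l k m = 0" unfolding s_def
      using sum_nonneg_eq_0_iff[of J "\<lambda>k. l k m"] max_cone_finite[OF J] keysA(2)[OF that] by simp
    then show "m = 0" using forms_separate[OF J keysA(1)[OF that]] by blast
  qed
  have zero: "0 \<in> keys p" if p: "p \<in> A" "p \<noteq> 0" "min_val s p = 0" for p
  proof -
    obtain m where "m \<in> keys p" "min_val s p = s m" using min_val_attained[OF p(2), of s] by blast
    then show ?thesis using s0(2)[OF p(1)] p(3) by metis
  qed
  have min0: "min_val s p = 0" if p: "p \<in> A" "0 \<in> keys p" for p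
  proof (rule antisym)
    show "min_val s p \<le> 0" using min_val_le[OF p(2), of s] additive_formD(2)[OF s] by simp
    have "p \<noteq> 0" using p(2) by auto
    then show "0 \<le> min_val s p" using min_val_ge_iff[of p 0 s] s0(1)[OF p(1)] by blast
  qed
  show ?thesis unfolding prime_ideal_in_def
  proof (intro conjI ballI impI)
    show "0 \<in> {p \<in> A. 0 \<notin> keys p}" using subdomainD(2)[OF AD] by simp
    fix a b assume "a \<in> {p \<in> A. 0 \<notin> keys p}" "b \<in> {p \<in> A. 0 \<notin> keys p}"
    then show "a + b \<in> {p \<in> A. 0 \<notin> keys p}" using subdomainD(3)[OF AD, of a b] keys_add[of a b] by auto
  next
    fix a b assume ab: "a \<in> A" "b \<in> {p \<in> A. 0 \<notin> keys p}"
    have "0 \<notin> keys (a * b)"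
    proof
      assume "0 \<in> keys (a * b)"
      then obtain x y where xy: "x \<in> keys a" "y \<in> keys b" "0 = x + y" by (rule in_keys_multE)
      have "s x + s y = 0" using xy(3) additive_formD(1,2)[OF s] by metis
      then have "s y = 0" using s0(1)[OF ab(1) xy(1)] s0(1)[of b y] ab(2) xy(2) by simp
      then show False using s0(2)[of b y] ab(2) xy(2) by auto
    qed
    then show "a * b \<in> {p \<in> A. 0 \<notin> keys p}" using subdomainD(4)[OF AD ab(1), of b] ab(2) by auto
  next
    fix a b assume ab: "a \<in> A" "b \<in> A" "a * b \<in> {p \<in> A. 0 \<notin> keys p}"
    show "a \<in> {p \<in> A. 0 \<notin> keys p} \<or> b \<in> {p \<in> A. 0 \<notin> keys p}"
    proof (rule ccontr)
      assume "\<not> ?thesis"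
      then have k: "0 \<in> keys a" "0 \<in> keys b" using ab by auto
      then have nz: "a \<noteq> 0" "b \<noteq> 0" by auto
      have "min_val s (a * b) = 0" using min_val_mult[OF s nz] min0[OF ab(1) k(1)] min0[OF ab(2) k(2)] by simp
      then have "0 \<in> keys (a * b)" using zero[of "a * b"] nz ab(3) by simp
      then show False using ab(3) by simp
    qed
  qed auto
qed

text \<open>Near the distinguished point of a full-dimensional cone a local equation of an invariant
  divisor has the orders of a monomial. Conversely that monomial is an equation on the whole chart.\<close>

lemma toric_cartier_iff:
  assumes a: "a \<in> carrier_vec N"
  shows "toric a \<in> cartier n \<Sigma> \<longleftrightarrow> locally_linear a"
proof
  assume "toric a \<in> cartier n \<Sigma>"
  then have loc: "\<forall>\<sigma>\<in>\<Sigma>. \<forall>P\<in>prime_ideals (coord_ring n \<sigma>). local_equation (toric a) \<sigma> P"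
    unfolding cartier_iff by simp
  show "locally_linear a" unfolding locally_linear_def
  proof (intro allI impI)
    fix J assume J: "max_cone J"
    let ?\<sigma> = "cone_of n rv J"
    have JN: "J \<subseteq> {..<N}" "?\<sigma> \<in> \<Sigma>" using J unfolding max_cone_def by auto
    obtain w u where "simplicial_chart n ?\<sigma> J l w u" using chart_of_cone[OF J subset_refl] by blast
    then interpret ch: simplicial_chart n ?\<sigma> J l w u .
    \<comment> \<open>A neighbourhood of the distinguished point meets every invariant divisor of the chart.\<close>
    define I where "I = {p \<in> ch.A. 0 \<notin> keys p}"
    have "emb ` I \<in> prime_ideals (coord_ring n ?\<sigma>)"
      unfolding prime_ideals_coord_ring I_def using prime_distinguished_point[OF J] by blast
    then have "local_equation (toric a) ?\<sigma> (emb ` I)" using loc JN(2) by simp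
    then obtain g f where gf0: "g \<in> coord_ring n ?\<sigma>" "g \<notin> emb ` I" and gf: "f \<in> function_field n" "f \<noteq> 0"
      "\<forall>P'\<in>height_one_primes (coord_ring n ?\<sigma>). g \<notin> P' \<longrightarrow>
            lookup (toric a) (local_ring (coord_ring n ?\<sigma>) P') = ord_along (local_ring (coord_ring n ?\<sigma>) P') f"
      by (rule local_equationE)
    obtain g0 where g0: "g0 \<in> ch.A" "g = emb g0" using gf0(1) unfolding coord_ring_eq by (rule imageE)
    have k0: "0 \<in> keys g0" using gf0(2) g0(1) unfolding g0(2) emb_image_iff I_def by simp
    have ray: "a $ k = ord_form n (l k) f" if k: "k \<in> J" for k
    proof -
      have kN: "k < N" using k JN by auto
      have "g0 \<notin> ch.ray_prime k" using k0 additive_formD(2)[OF form_l] unfolding ch.ray_prime_def by (auto intro!: bexI[of _ 0])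
      then have "g \<notin> emb ` ch.ray_prime k" unfolding g0(2) emb_image_iff .
      moreover have "emb ` ch.ray_prime k \<in> height_one_primes (coord_ring n ?\<sigma>)"
        unfolding ch.height_one_primes_eq using k by blast
      ultimately have "lookup (toric a) (D k) = ord_along (D k) f"
        using gf(3) ch.local_ring_ray[OF k] unfolding D_def by metis
      then show ?thesis using lookup_toric_D[OF a kN] ord_along_D[OF kN gf(1,2)] by simp
    qed
    have tor: "ord_prime n \<pi> f = 0" if \<pi>: "prime_in L \<pi>" "\<not> dvd_in L \<pi> g0" for \<pi>
    proof -
      have "g \<notin> emb ` ch.torus_prime \<pi>" unfolding g0(2) emb_image_iff ch.torus_prime_def using \<pi>(2) by blast
      moreover have "emb ` ch.torus_prime \<pi> \<in> height_one_primes (coord_ring n ?\<sigma>)"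
        unfolding ch.height_one_primes_eq using \<pi>(1) by blast
      ultimately have "lookup (toric a) (T \<pi>) = ord_along (T \<pi>) f"
        using gf(3) ch.local_ring_torus[OF \<pi>(1)] unfolding T_def by metis
      moreover have "lookup (toric a) (T \<pi>) = 0"
        using lookup_toric_other[OF a] D_not_T[OF _ \<pi>(1)] by blast
      ultimately show ?thesis using ord_along_T[OF \<pi>(1) gf(1,2)] by simp
    qed
    have "monomial_orders n J l f"
      by (rule orders_of_function_invertible_off_divisor[OF form_l ch.chart_ring_sub[OF g0(1)] k0 _ gf(1,2) tor])
        (use g0(1) in \<open>auto simp: ch.chart_ring_iff\<close>)
    then show "\<exists>m\<in>M_lattice n. \<forall>j\<in>J. a $ j = l j m" unfolding monomial_orders_def using ray by auto
  qed
next
  assume ll: "locally_linear a"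
  have "local_equation (toric a) \<sigma> P" if \<sigma>: "\<sigma> \<in> \<Sigma>" "P \<in> prime_ideals (coord_ring n \<sigma>)" for \<sigma> P
  proof -
    obtain J K where J: "max_cone J" "K \<subseteq> J" "\<sigma> = cone_of n rv K" using cone_representation[OF \<sigma>(1)] .
    obtain w u where "simplicial_chart n \<sigma> K l w u" using chart_of_cone[OF J(1,2)] J(3) by blast
    then interpret ch: simplicial_chart n \<sigma> K l w u .
    obtain m where m: "m \<in> M_lattice n" "\<forall>j\<in>J. a $ j = l j m" using ll J(1) unfolding locally_linear_def by blast
    obtain I where I: "prime_ideal_in ch.A I" "P = emb ` I" using \<sigma>(2) unfolding prime_ideals_coord_ring by blast
    have one: "emb 1 \<in> coord_ring n \<sigma> - P"
      unfolding I(2) coord_ring_eq Diff_iff emb_image_iff using prime_ideal_inD(5)[OF I(1)] ch.AD(1) by blast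
    have ray: "lookup (toric a) (D k) = ord_along (D k) (emb (chi m))" if k: "k \<in> K" for k
    proof -
      have kN: "k < N" "k \<in> J" using k J unfolding max_cone_def by auto
      show ?thesis using lookup_toric_D[OF a kN(1)] ord_D_chi[OF kN(1) m(1)] m(2) kN(2) by simp
    qed
    have tor: "lookup (toric a) (T \<pi>) = ord_along (T \<pi>) (emb (chi m))" if \<pi>: "prime_in L \<pi>" for \<pi>
      using lookup_toric_other[OF a, of "T \<pi>"] D_not_T[OF _ \<pi>] ord_T_chi[OF \<pi> m(1)] by simp
    have "\<forall>P'\<in>height_one_primes (coord_ring n \<sigma>).
            lookup (toric a) (local_ring (coord_ring n \<sigma>) P') =
            ord_along (local_ring (coord_ring n \<sigma>) P') (emb (chi m))"
    proof
      fix P' assume "P' \<in> height_one_primes (coord_ring n \<sigma>)"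
      then consider k where "k \<in> K" "P' = emb ` ch.ray_prime k" | \<pi> where "prime_in L \<pi>" "P' = emb ` ch.torus_prime \<pi>"
        unfolding ch.height_one_primes_eq by blast
      then show "lookup (toric a) (local_ring (coord_ring n \<sigma>) P') =
            ord_along (local_ring (coord_ring n \<sigma>) P') (emb (chi m))"
      proof cases
        case 1
        then show ?thesis using ray ch.local_ring_ray unfolding D_def by simp
      next
        case 2
        then show ?thesis using tor ch.local_ring_torus unfolding T_def by simp
      qed
    qed
    then show ?thesis using one emb_in[of "chi m"] m(1)
      by (intro local_equationI[of "emb 1" _ _ "emb (chi m)"]) (auto simp: emb_simps)
  qed
  then show "toric a \<in> cartier n \<Sigma>" unfolding cartier_iff using toric_carrier[OF a] by simp
qed

end


section \<open>Integer lattices\<close>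

subsection \<open>Full sublattices and their index\<close>

definition lattice :: "nat \<Rightarrow> int vec set \<Rightarrow> bool" where
  "lattice k H \<longleftrightarrow> H \<subseteq> carrier_vec k \<and> 0\<^sub>v k \<in> H \<and> (\<forall>x\<in>H. \<forall>y\<in>H. x - y \<in> H)"

lemma latticeD:
  assumes "lattice k H"
  shows "H \<subseteq> carrier_vec k" "0\<^sub>v k \<in> H" "x \<in> H \<Longrightarrow> y \<in> H \<Longrightarrow> x - y \<in> H" "x \<in> H \<Longrightarrow> - x \<in> H"
    "x \<in> H \<Longrightarrow> y \<in> H \<Longrightarrow> x + y \<in> H" "x \<in> H \<Longrightarrow> c \<cdot>\<^sub>v x \<in> H"
proof -
  show sub: "H \<subseteq> carrier_vec k" and 0: "0\<^sub>v k \<in> H" and diff: "\<And>x y. x \<in> H \<Longrightarrow> y \<in> H \<Longrightarrow> x - y \<in> H"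
    using assms unfolding lattice_def by auto
  show neg: "- x \<in> H" if "x \<in> H" for x
  proof -
    have "0\<^sub>v k - x = - x" using that sub by (intro eq_vecI) auto
    then show ?thesis using diff[OF 0 that] by simp
  qed
  show add: "x + y \<in> H" if "x \<in> H" "y \<in> H" for x y
  proof -
    have "x - (- y) = x + y" using that sub by (intro eq_vecI) auto
    then show ?thesis using diff[OF that(1) neg[OF that(2)]] by simp
  qed
  have nat: "int m \<cdot>\<^sub>v x \<in> H" if "x \<in> H" for m x
  proof (induction m)
    case 0
    have "int 0 \<cdot>\<^sub>v x = 0\<^sub>v k" using that sub by (intro eq_vecI) auto
    then show ?case using \<open>0\<^sub>v k \<in> H\<close> by simp
  next
    case (Suc m)
    have "int (Suc m) \<cdot>\<^sub>v x = int m \<cdot>\<^sub>v x + x" by (intro eq_vecI) (auto simp: algebra_simps)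
    then show ?case using add[OF Suc that] by simp
  qed
  show "c \<cdot>\<^sub>v x \<in> H" if "x \<in> H"
  proof (cases "0 \<le> c")
    case True
    then show ?thesis using nat[OF that, of "nat c"] by simp
  next
    case False
    have eq: "c \<cdot>\<^sub>v x = - (int (nat (- c)) \<cdot>\<^sub>v x)" using False by (intro eq_vecI) auto
    show ?thesis unfolding eq by (rule neg[OF nat[OF that]])
  qed
qed

lemma vec_split: "x \<in> carrier_vec (Suc k) \<Longrightarrow> \<exists>a y. y \<in> carrier_vec k \<and> x = vCons a y"
  by (cases x rule: vec_cases) auto

lemma vCons_diff: "y \<in> carrier_vec k \<Longrightarrow> z \<in> carrier_vec k \<Longrightarrow> vCons a y - vCons b z = vCons (a - b) (y - z)"
  by (intro eq_vecI) (auto simp: vec_index_vCons)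

lemma vCons_smult: "c \<cdot>\<^sub>v vCons a y = vCons (c * a) (c \<cdot>\<^sub>v y)" for c :: int
  by (intro eq_vecI) (auto simp: vec_index_vCons)

text \<open>A sublattice containing a multiple of everything has a triangular basis, split off one coordinate
  at a time; the index is the product of the diagonal, with the obvious box of representatives.\<close>

lemma lattice_basis_index:
  assumes "lattice k H" "0 < m" "\<And>x. x \<in> carrier_vec k \<Longrightarrow> m \<cdot>\<^sub>v x \<in> H"
  shows "\<exists>B R. B \<in> carrier_mat k k \<and> H = col_lattice B \<and> 0 < det B \<and> finite R \<and> int (card R) = det B \<and>
    R \<subseteq> carrier_vec k \<and> (\<forall>x\<in>carrier_vec k. \<exists>!y. y \<in> R \<and> x - y \<in> H)"
  using assms
proof (induction k arbitrary: H)
  case 0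
  have c0: "x = 0\<^sub>v 0" if "x \<in> carrier_vec 0" for x :: "int vec" using that by (intro eq_vecI) auto
  have H: "H = {0\<^sub>v 0}" using latticeD(1,2)[OF 0(1)] c0 by blast
  have "(1\<^sub>m 0 :: int mat) *\<^sub>v c \<in> carrier_vec 0" for c by (rule carrier_vecI) simp
  then have "col_lattice (1\<^sub>m 0) \<subseteq> {0\<^sub>v 0}" "0\<^sub>v 0 \<in> col_lattice (1\<^sub>m 0)"
    unfolding col_lattice_def using c0 by (auto intro!: exI[of _ "0\<^sub>v 0"])
  then have cl: "H = col_lattice (1\<^sub>m 0)" using H by auto
  have "\<exists>!y. y \<in> {0\<^sub>v 0} \<and> x - y \<in> H" if "x \<in> carrier_vec 0" for x
    using H c0[OF that] by (intro ex1I[of _ "0\<^sub>v 0"]) auto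
  then show ?case using cl by (intro exI[of _ "1\<^sub>m 0"] exI[of _ "{0\<^sub>v 0}"]) auto
next
  case (Suc k)
  note D = latticeD[OF Suc.prems(1)]
  define P where "P = (\<lambda>a::nat. 0 < a \<and> (\<exists>y. vCons (int a) y \<in> H))"
  have "m \<cdot>\<^sub>v vCons 1 (0\<^sub>v k) \<in> H" using Suc.prems(3) by simp
  then have "P (nat m)" unfolding P_def vCons_smult using Suc.prems(2) by auto
  then have PL: "P (Least P)" and min: "\<And>a. P a \<Longrightarrow> Least P \<le> a" by (auto intro: LeastI Least_le)
  define g where "g = int (Least P)"
  obtain t where t: "vCons g t \<in> H" and g: "0 < g" using PL unfolding P_def g_def by auto
  have tk: "t \<in> carrier_vec k" using t D(1) by auto
  define H' where "H' = {y. vCons 0 y \<in> H}"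
  have H'c: "H' \<subseteq> carrier_vec k" unfolding H'_def using D(1) by auto
  have gdvd: "vCons a y \<in> H \<longleftrightarrow> g dvd a \<and> y - (a div g) \<cdot>\<^sub>v t \<in> H'" if y: "y \<in> carrier_vec k" for a y
  proof -
    have eq: "vCons a y - (a div g) \<cdot>\<^sub>v vCons g t = vCons (a mod g) (y - (a div g) \<cdot>\<^sub>v t)"
      unfolding vCons_smult using y tk by (subst vCons_diff[of _ k]) (auto simp: minus_div_mult_eq_mod)
    show ?thesis
    proof
      assume "vCons a y \<in> H"
      then have h: "vCons (a mod g) (y - (a div g) \<cdot>\<^sub>v t) \<in> H" using D(3)[OF _ D(6)[OF t]] unfolding eq[symmetric] by blast
      have "a mod g = 0"
      proof (rule ccontr)
        assume "a mod g \<noteq> 0"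
        then have pos: "0 < a mod g" using pos_mod_sign[OF g, of a] by simp
        then have "P (nat (a mod g))" unfolding P_def using h by auto
        then have "g \<le> a mod g" using min[of "nat (a mod g)"] pos unfolding g_def by linarith
        then show False using pos_mod_bound[OF g, of a] by simp
      qed
      then show "g dvd a \<and> y - (a div g) \<cdot>\<^sub>v t \<in> H'" using h unfolding H'_def by auto
    next
      assume r: "g dvd a \<and> y - (a div g) \<cdot>\<^sub>v t \<in> H'"
      then have "vCons a y - (a div g) \<cdot>\<^sub>v vCons g t \<in> H" unfolding eq H'_def by simp
      then have "vCons a y - (a div g) \<cdot>\<^sub>v vCons g t + (a div g) \<cdot>\<^sub>v vCons g t \<in> H" using D(5) D(6)[OF t] by blast
      moreover have "vCons a y - (a div g) \<cdot>\<^sub>v vCons g t + (a div g) \<cdot>\<^sub>v vCons g t = vCons a y"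
        using y tk by (intro eq_vecI) auto
      ultimately show "vCons a y \<in> H" by simp
    qed
  qed
  have lat': "lattice k H'" unfolding lattice_def
  proof (intro conjI ballI)
    show "0\<^sub>v k \<in> H'" using D(2) unfolding H'_def zero_vec_Suc by simp
    fix x y assume xy: "x \<in> H'" "y \<in> H'"
    then have "vCons 0 x - vCons 0 y \<in> H" using D(3) unfolding H'_def by blast
    moreover have "x \<in> carrier_vec k" "y \<in> carrier_vec k" using xy H'c by blast+
    ultimately show "x - y \<in> H'" using vCons_diff[of x k y 0 0] unfolding H'_def by simp
  qed (rule H'c)
  have "m \<cdot>\<^sub>v x \<in> H'" if "x \<in> carrier_vec k" for x
    using Suc.prems(3)[of "vCons 0 x"] that unfolding H'_def vCons_smult by simp
  then obtain B' R' where IH: "B' \<in> carrier_mat k k" "H' = col_lattice B'" "0 < det B'" "finite R'"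
    "int (card R') = det B'" "R' \<subseteq> carrier_vec k" "\<forall>x\<in>carrier_vec k. \<exists>!y. y \<in> R' \<and> x - y \<in> H'"
    using Suc.IH[OF lat' Suc.prems(2)] by blast
  define G where "G = mat 1 1 (\<lambda>_. g)"
  define B where "B = four_block_mat G (0\<^sub>m 1 k) (mat k 1 (\<lambda>(i, j). t $ i)) B'"
  have Gc: "G \<in> carrier_mat 1 1" unfolding G_def by simp
  have B: "B \<in> carrier_mat (Suc k) (Suc k)" unfolding B_def using four_block_carrier_mat[OF Gc IH(1)] by simp
  have "det G = g" unfolding G_def by (subst det_single) auto
  then have detB: "det B = g * det B'" unfolding B_def
    using det_four_block_mat_upper_right_zero[OF Gc refl _ IH(1), of "mat k 1 (\<lambda>(i, j). t $ i)"] by simp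
  have mulB: "B *\<^sub>v vCons a c = vCons (g * a) (a \<cdot>\<^sub>v t + B' *\<^sub>v c)" if c: "c \<in> carrier_vec k" for a c
  proof (rule eq_vecI)
    fix i assume "i < dim_vec (vCons (g * a) (a \<cdot>\<^sub>v t + B' *\<^sub>v c))"
    then have i: "i < Suc k" using IH(1) by simp
    have dim: "dim_row B = Suc k" "dim_col B = Suc k" using B by auto
    have r0: "row B 0 = vCons g (0\<^sub>v k)"
      using B IH(1) unfolding B_def G_def by (intro eq_vecI) (auto simp: vec_index_vCons)
    have rS: "row B (Suc j) = vCons (t $ j) (row B' j)" if "j < k" for j
      using B IH(1) that unfolding B_def G_def by (intro eq_vecI) (auto simp: vec_index_vCons)
    show "(B *\<^sub>v vCons a c) $ i = vCons (g * a) (a \<cdot>\<^sub>v t + B' *\<^sub>v c) $ i"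
    proof (cases i)
      case 0
      then show ?thesis using r0 dim c by simp
    next
      case (Suc j)
      then show ?thesis using rS[of j] i dim c IH(1) tk by simp
    qed
  qed (use B IH(1) in auto)
  have HB: "H = col_lattice B"
  proof (intro equalityI subsetI)
    fix x assume x: "x \<in> H"
    then obtain a y where y: "y \<in> carrier_vec k" "x = vCons a y" using vec_split[of x k] D(1) by blast
    have d: "g dvd a" "y - (a div g) \<cdot>\<^sub>v t \<in> H'" using gdvd[OF y(1)] x unfolding y(2) by auto
    then obtain c where c: "c \<in> carrier_vec k" "y - (a div g) \<cdot>\<^sub>v t = B' *\<^sub>v c"
      using IH(1) unfolding IH(2) col_lattice_def by auto
    have "y = (a div g) \<cdot>\<^sub>v t + (y - (a div g) \<cdot>\<^sub>v t)" using y(1) tk by (intro eq_vecI) auto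
    then have "x = B *\<^sub>v vCons (a div g) c" unfolding mulB[OF c(1)] y(2) c(2)[symmetric] using d(1) by simp
    then show "x \<in> col_lattice B" unfolding col_lattice_def using B c(1) by auto
  next
    fix x assume "x \<in> col_lattice B"
    then obtain c where c: "c \<in> carrier_vec (Suc k)" "x = B *\<^sub>v c" using B unfolding col_lattice_def by auto
    obtain a y where y: "y \<in> carrier_vec k" "c = vCons a y" using vec_split[OF c(1)] by blast
    have B'y: "B' *\<^sub>v y \<in> H'" unfolding IH(2) col_lattice_def using y(1) IH(1) by auto
    have x: "x = vCons (g * a) (a \<cdot>\<^sub>v t + B' *\<^sub>v y)" unfolding c(2) y(2) by (rule mulB[OF y(1)])
    have car: "a \<cdot>\<^sub>v t + B' *\<^sub>v y \<in> carrier_vec k" using tk IH(1) y(1) by auto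
    have "(a \<cdot>\<^sub>v t + B' *\<^sub>v y) - ((g * a) div g) \<cdot>\<^sub>v t = B' *\<^sub>v y" using g tk IH(1) y(1) by (intro eq_vecI) auto
    then show "x \<in> H" unfolding x gdvd[OF car] using B'y by simp
  qed
  define R where "R = (\<lambda>(a, y). vCons a y) ` ({0..<g} \<times> R')"
  have inj: "inj_on (\<lambda>(a, y). vCons a y) ({0..<g} \<times> R')" by (rule inj_onI) auto
  have "card R = card ({0..<g} \<times> R')" unfolding R_def by (rule card_image[OF inj])
  then have cardR: "int (card R) = det B" unfolding detB using g IH(5) by (simp add: card_cartesian_product)
  have uniq: "\<exists>!z. z \<in> R \<and> x - z \<in> H" if x: "x \<in> carrier_vec (Suc k)" for x
  proof -
    obtain a y where y: "y \<in> carrier_vec k" "x = vCons a y" using vec_split[OF x] by blast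
    have mem: "x - vCons b z \<in> H \<longleftrightarrow> b = a mod g \<and> (y - (a div g) \<cdot>\<^sub>v t) - z \<in> H'"
      if b: "0 \<le> b" "b < g" and z: "z \<in> carrier_vec k" for b z
    proof -
      have 1: "g dvd a - b \<longleftrightarrow> b = a mod g" using b by (metis mod_eq_dvd_iff mod_pos_pos_trivial)
      have "(y - z) - ((a - b) div g) \<cdot>\<^sub>v t = (y - (a div g) \<cdot>\<^sub>v t) - z" if "b = a mod g"
      proof -
        have "(a - b) div g = a div g" unfolding that using g by (simp add: minus_mod_eq_mult_div)
        then show ?thesis using y(1) z tk by (intro eq_vecI) auto
      qed
      then show ?thesis unfolding y(2) vCons_diff[OF y(1) z] using gdvd[of "y - z" "a - b"] y(1) z 1 by auto
    qed
    have yc: "y - (a div g) \<cdot>\<^sub>v t \<in> carrier_vec k" using y(1) tk by auto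
    obtain z where z: "z \<in> R'" "(y - (a div g) \<cdot>\<^sub>v t) - z \<in> H'"
      "\<And>z'. z' \<in> R' \<Longrightarrow> (y - (a div g) \<cdot>\<^sub>v t) - z' \<in> H' \<Longrightarrow> z' = z" using bspec[OF IH(7) yc] by (metis (no_types, lifting))
    show ?thesis
    proof (rule ex1I[of _ "vCons (a mod g) z"])
      show "vCons (a mod g) z \<in> R \<and> x - vCons (a mod g) z \<in> H"
        using z(1,2) g IH(6) mem[of "a mod g" z] unfolding R_def by (auto simp: image_iff)
      fix z' assume z': "z' \<in> R \<and> x - z' \<in> H"
      then obtain b w where bw: "0 \<le> b" "b < g" "w \<in> R'" "z' = vCons b w" unfolding R_def by auto
      then have "b = a mod g" "(y - (a div g) \<cdot>\<^sub>v t) - w \<in> H'" using mem[of b w] z' IH(6) by auto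
      then show "z' = vCons (a mod g) z" using z(3)[OF bw(3)] bw(4) by simp
    qed
  qed
  have "R \<subseteq> carrier_vec (Suc k)" "finite R" unfolding R_def using IH(4,6) by auto
  then show ?case using B HB detB g IH(3) cardR uniq by (intro exI[of _ B] exI[of _ R]) auto
qed

lemma lattice_col_lattice:
  assumes B: "B \<in> carrier_mat k m"
  shows "lattice k (col_lattice B)"
  unfolding lattice_def
proof (intro conjI ballI)
  show "col_lattice B \<subseteq> carrier_vec k" unfolding col_lattice_def using B by auto
  have "B *\<^sub>v 0\<^sub>v m = 0\<^sub>v k" using B by (intro eq_vecI) auto
  then show "0\<^sub>v k \<in> col_lattice B" unfolding col_lattice_def using B by (metis (mono_tags, lifting) carrier_matD(2) mem_Collect_eq zero_carrier_vec)
  fix x y assume "x \<in> col_lattice B" "y \<in> col_lattice B"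
  then obtain c d where "c \<in> carrier_vec m" "d \<in> carrier_vec m" "x = B *\<^sub>v c" "y = B *\<^sub>v d"
    unfolding col_lattice_def using B by auto
  then have "x - y = B *\<^sub>v (c - d)" "c - d \<in> carrier_vec m" using mult_minus_distrib_mat_vec[OF B] by auto
  then show "x - y \<in> col_lattice B" unfolding col_lattice_def using B by auto
qed

text \<open>Cramer: the adjugate solves \<open>A y = det A x\<close>.\<close>

lemma det_smult_in_col_lattice:
  assumes A: "A \<in> carrier_mat k k" and x: "x \<in> carrier_vec k" and d: "det A dvd d"
  shows "d \<cdot>\<^sub>v x \<in> col_lattice A"
proof -
  obtain e where e: "d = det A * e" using d by blast
  let ?B = "adj_mat A"
  have B: "?B \<in> carrier_mat k k" "A * ?B = det A \<cdot>\<^sub>m 1\<^sub>m k" using adj_mat[OF A] by auto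
  have "A *\<^sub>v (?B *\<^sub>v (e \<cdot>\<^sub>v x)) = (A * ?B) *\<^sub>v (e \<cdot>\<^sub>v x)" using assoc_mult_mat_vec[OF A B(1), of "e \<cdot>\<^sub>v x"] x by simp
  also have "\<dots> = d \<cdot>\<^sub>v x" unfolding B(2) e using x by (intro eq_vecI) (auto simp: row_smult smult_scalar_prod_distrib)
  finally show ?thesis unfolding col_lattice_def using A B(1) x by (auto intro!: exI[of _ "?B *\<^sub>v (e \<cdot>\<^sub>v x)"])
qed

text \<open>The inclusion of lattices is a factorisation of matrices.\<close>

lemma det_dvd_of_sublattice:
  assumes A: "A \<in> carrier_mat k k" and B: "B \<in> carrier_mat k k" and sub: "col_lattice B \<subseteq> col_lattice A"
  shows "det A dvd det B"
proof -
  have "\<exists>c\<in>carrier_vec k. col B j = A *\<^sub>v c" if j: "j < k" for j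
  proof -
    have "col B j = B *\<^sub>v unit_vec k j" using B j by (intro eq_vecI) auto
    then have "col B j \<in> col_lattice B" unfolding col_lattice_def using B by auto
    then show ?thesis using sub A unfolding col_lattice_def by auto
  qed
  then obtain c where c: "\<And>j. j < k \<Longrightarrow> c j \<in> carrier_vec k" "\<And>j. j < k \<Longrightarrow> col B j = A *\<^sub>v c j" by metis
  define X where "X = mat_of_cols k (map c [0..<k])"
  have X: "X \<in> carrier_mat k k" unfolding X_def by (intro carrier_matI) auto
  have colX: "col X j = c j" if "j < k" for j unfolding X_def using c(1)[OF that] that by simp
  have "B = A * X"
  proof (rule mat_col_eqI)
    fix j assume "j < dim_col (A * X)"
    then have j: "j < k" using X by simp
    show "col B j = col (A * X) j" using c(2)[OF j] colX[OF j] col_mult2[OF A X j] by simp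
  qed (use A B X in auto)
  then show ?thesis using det_mult[OF A X] by simp
qed

subsection \<open>The Hermite normal form of a primitive basis\<close>

text \<open>If the columns of a matrix in Hermite normal form generate a direct summand, its diagonal entries are
  units, hence 1, and the entries above them are reduced modulo 1.\<close>

lemma hermite_normal_form_left_invertible:
  assumes H: "H \<in> carrier_mat (r + n) r" and hnf: "hermite_normal_form H"
    and X: "X \<in> carrier_mat r (r + n)" "X * H = 1\<^sub>m r"
    and ij: "i < r + n" "j < r"
  shows "H $$ (i, j) = (if i = j then 1 else 0)"
proof -
  obtain s f where sf: "s \<le> r + n" "strict_mono_on {..<s} f" "f ` {..<s} \<subseteq> {..<r}"
    "\<And>i. i < s \<Longrightarrow> 1 \<le> H $$ (i, f i)" "\<And>i j. i < s \<Longrightarrow> j < f i \<Longrightarrow> H $$ (i, j) = 0"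
    "\<And>i k. i < k \<Longrightarrow> k < s \<Longrightarrow> 0 \<le> H $$ (i, f k) \<and> H $$ (i, f k) < H $$ (k, f k)"
    "\<And>i j. s \<le> i \<Longrightarrow> i < r + n \<Longrightarrow> j < r \<Longrightarrow> H $$ (i, j) = 0"
    using hnf H unfolding hermite_normal_form_def by auto
  have inj: "inj_on f {..<s}" using sf(2) strict_mono_on_imp_inj_on by blast
  have sr: "s \<le> r" using card_inj_on_le[OF inj sf(3)] by simp
  define A where "A = mat r r (\<lambda>(i, j). H $$ (i, j))"
  define Y where "Y = mat r r (\<lambda>(i, j). X $$ (i, j))"
  have A: "A \<in> carrier_mat r r" and Y: "Y \<in> carrier_mat r r" unfolding A_def Y_def by auto
  have "Y * A = 1\<^sub>m r"
  proof (rule eq_matI)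
    fix i j assume "i < dim_row (1\<^sub>m r :: int mat)" "j < dim_col (1\<^sub>m r :: int mat)"
    then have ij: "i < r" "j < r" by auto
    have "(X * H) $$ (i, j) = (\<Sum>k<r + n. X $$ (i, k) * H $$ (k, j))"
      using X(1) H ij by (simp add: scalar_prod_def lessThan_atLeast0)
    also have "\<dots> = (\<Sum>k<r. X $$ (i, k) * H $$ (k, j))"
      using sf(7) sr ij by (intro sum.mono_neutral_right) auto
    also have "\<dots> = (Y * A) $$ (i, j)" unfolding A_def Y_def using ij by (simp add: scalar_prod_def lessThan_atLeast0)
    finally show "(Y * A) $$ (i, j) = 1\<^sub>m r $$ (i, j)" using X(2) by simp
  qed (auto simp: A_def Y_def)
  then have "det Y * det A = 1" using det_mult[OF Y A] by simp
  then have unit: "\<bar>det A\<bar> = 1" using abs_zmult_eq_1[of "det A" "det Y"] by (simp add: mult.commute)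
  have "s = r"
  proof (rule ccontr)
    assume "s \<noteq> r"
    then have "s < r" using sr by simp
    have "A\<^sup>T *\<^sub>v unit_vec r s = 0\<^sub>v r"
      using \<open>s < r\<close> sf(7) unfolding A_def by (intro eq_vecI) auto
    moreover have "unit_vec r s \<noteq> (0\<^sub>v r :: int vec)" using \<open>s < r\<close> by simp
    ultimately have "det (A\<^sup>T) = 0"
      using det_0_iff_vec_prod_zero[of "A\<^sup>T" r] A by (metis transpose_carrier_mat unit_vec_carrier)
    then show False using det_transpose[OF A] unit by simp
  qed
  have fid: "f i = i" if "i < r" for i
  proof -
    have ge: "k \<le> f k" if "k < s" for k using that
    proof (induction k)
      case (Suc k)
      then have "f k < f (Suc k)" using sf(2) unfolding strict_mono_on_def by auto
      then show ?case using Suc by simp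
    qed simp
    have le: "f (r - 1 - k) \<le> r - 1 - k" if "k < r" for k using that
    proof (induction k)
      case 0
      then have "f (r - 1) \<in> f ` {..<s}" using \<open>s = r\<close> by auto
      then show ?case using sf(3) by auto
    next
      case (Suc k)
      have "r - 1 - Suc k < r - 1 - k" using Suc.prems by simp
      then have "f (r - 1 - Suc k) < f (r - 1 - k)" using sf(2) \<open>s = r\<close> Suc.prems unfolding strict_mono_on_def by auto
      then show ?case using Suc by simp
    qed
    show ?thesis using ge[of i] le[of "r - 1 - i"] that \<open>s = r\<close> by simp
  qed
  have diag: "1 \<le> H $$ (i, i)" if "i < r" for i using sf(4)[of i] fid[OF that] that \<open>s = r\<close> by simp
  have low: "H $$ (i, j) = 0" if "j < i" "i < r" for i j using sf(5)[of i j] fid[of i] that \<open>s = r\<close> by simp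
  have ut: "upper_triangular A" unfolding upper_triangular_def A_def using low by auto
  have "det A = (\<Prod>i<r. H $$ (i, i))"
    using det_upper_triangular[OF ut A] unfolding diag_mat_def A_def
    by (simp add: prod.list_conv_set_nth lessThan_atLeast0)
  then have prod1: "(\<Prod>i<r. H $$ (i, i)) = 1"
    using unit prod_nonneg[of "{..<r}" "\<lambda>i. H $$ (i, i)"] diag by fastforce
  have one: "H $$ (i, i) = 1" if i: "i < r" for i
  proof -
    have "H $$ (i, i) dvd 1" using prod1 i by (metis dvd_prodI finite_lessThan lessThan_iff)
    then show ?thesis using diag[OF i] by simp
  qed
  consider "r \<le> i" | "i < r" "j < i" | "i < r" "i = j" | "i < r" "i < j" by linarith
  then show ?thesis
  proof cases
    case 1
    then show ?thesis using sf(7)[of i j] ij \<open>s = r\<close> by simp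
  next
    case 2
    then show ?thesis using low by simp
  next
    case 3
    then show ?thesis using one by simp
  next
    case 4
    then show ?thesis using sf(6)[of i j] fid[OF ij(2)] one[OF ij(2)] ij \<open>s = r\<close> by simp
  qed
qed


section \<open>Integral combinations\<close>

lemma Z_comb_Suc:
  assumes "comm_group G" "\<And>i. i < Suc k \<Longrightarrow> x i \<in> carrier G"
  shows "Z_comb G (Suc k) x c = (x k [^]\<^bsub>G\<^esub> (c $ k)) \<otimes>\<^bsub>G\<^esub> Z_comb G k x c"
proof -
  interpret comm_group G by fact
  show ?thesis unfolding Z_comb_def lessThan_Suc
    using assms(2) by (subst finprod_insert) (auto simp: int_pow_closed)
qed

lemma Z_comb_0: "comm_group G \<Longrightarrow> Z_comb G 0 x c = \<one>\<^bsub>G\<^esub>"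
  unfolding Z_comb_def by (simp add: comm_monoid.finprod_empty comm_group.axioms(1))

lemma Z_comb_closed:
  assumes "comm_group G" "\<And>i. i < k \<Longrightarrow> x i \<in> carrier G"
  shows "Z_comb G k x c \<in> carrier G"
proof -
  interpret comm_group G by fact
  show ?thesis unfolding Z_comb_def using assms(2) by (intro finprod_closed) auto
qed

lemma Z_comb_hom:
  assumes G: "comm_group G" and H: "comm_group H" and h: "h \<in> hom G H" and x: "\<And>i. i < k \<Longrightarrow> x i \<in> carrier G"
  shows "h (Z_comb G k x c) = Z_comb H k (\<lambda>i. h (x i)) c"
proof -
  interpret G: comm_group G by (rule G)
  interpret H: comm_group H by (rule H)
  interpret group_hom G H h by standard (rule h)
  show ?thesis using x
  proof (induction k)
    case 0
    then show ?case by (simp add: Z_comb_0 G H)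
  next
    case (Suc k)
    have car: "x k [^]\<^bsub>G\<^esub> (c $ k) \<in> carrier G" "Z_comb G k x c \<in> carrier G"
      using Suc.prems by (auto intro!: Z_comb_closed[OF G] G.int_pow_closed)
    have "h (Z_comb G (Suc k) x c) = h (x k [^]\<^bsub>G\<^esub> (c $ k) \<otimes>\<^bsub>G\<^esub> Z_comb G k x c)"
      by (rule arg_cong[of _ _ h], rule Z_comb_Suc[OF G]) (use Suc.prems in auto)
    also have "\<dots> = h (x k [^]\<^bsub>G\<^esub> (c $ k)) \<otimes>\<^bsub>H\<^esub> h (Z_comb G k x c)" by (rule Group.hom_mult[OF h car])
    also have "\<dots> = (h (x k) [^]\<^bsub>H\<^esub> (c $ k)) \<otimes>\<^bsub>H\<^esub> Z_comb H k (\<lambda>i. h (x i)) c"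
      using Suc by (simp add: hom_int_pow)
    also have "\<dots> = Z_comb H (Suc k) (\<lambda>i. h (x i)) c"
      by (rule Z_comb_Suc[symmetric, OF H]) (use Suc.prems in auto)
    finally show ?case .
  qed
qed

lemma Z_comb_integer_group: "Z_comb integer_group k x c = (\<Sum>i<k. c $ i * x i)"
proof (induction k)
  case (Suc k)
  show ?case by (subst Z_comb_Suc) (simp_all add: Suc abelian_integer_group)
qed (simp add: Z_comb_0 abelian_integer_group)

lemma comm_group_int_vec: "comm_group (int_vec_group m)"
proof (rule comm_groupI)
  fix x assume x: "x \<in> carrier (int_vec_group m)"
  then have "- x + x = 0\<^sub>v m" by (auto simp: int_vec_group_def)
  then show "\<exists>y\<in>carrier (int_vec_group m). y \<otimes>\<^bsub>int_vec_group m\<^esub> x = \<one>\<^bsub>int_vec_group m\<^esub>"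
    using x by (intro bexI[of _ "- x"]) (auto simp: int_vec_group_def)
qed (auto simp: int_vec_group_def assoc_add_vec comm_add_vec)

lemma Z_comb_int_vec:
  assumes x: "\<And>i. i < k \<Longrightarrow> x i \<in> carrier_vec m"
  shows "Z_comb (int_vec_group m) k x c = vec m (\<lambda>j. \<Sum>i<k. c $ i * x i $ j)"
proof (rule eq_vecI)
  have x': "x i \<in> carrier (int_vec_group m)" if "i < k" for i using x[OF that] by (simp add: int_vec_group_def)
  have car: "Z_comb (int_vec_group m) k x c \<in> carrier_vec m"
    using Z_comb_closed[OF comm_group_int_vec x'] by (simp add: int_vec_group_def)
  show "dim_vec (Z_comb (int_vec_group m) k x c) = dim_vec (vec m (\<lambda>j. \<Sum>i<k. c $ i * x i $ j))" using car by simp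
  fix j assume "j < dim_vec (vec m (\<lambda>j. \<Sum>i<k. c $ i * x i $ j))"
  then have j: "j < m" by simp
  have h: "(\<lambda>y. y $ j) \<in> hom (int_vec_group m) integer_group"
    using j by (intro homI) (auto simp: int_vec_group_def)
  show "Z_comb (int_vec_group m) k x c $ j = vec m (\<lambda>j. \<Sum>i<k. c $ i * x i $ j) $ j"
    using Z_comb_hom[OF comm_group_int_vec abelian_integer_group h x'] j by (simp add: Z_comb_integer_group)
qed

lemma Z_comb_cols: "A \<in> carrier_mat m k \<Longrightarrow> c \<in> carrier_vec k \<Longrightarrow> Z_comb (int_vec_group m) k (col A) c = A *\<^sub>v c"
  by (subst Z_comb_int_vec) (auto intro!: eq_vecI sum.cong simp: scalar_prod_def lessThan_atLeast0)

lemma Z_comb_rows: "A \<in> carrier_mat k m \<Longrightarrow> c \<in> carrier_vec k \<Longrightarrow>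
    Z_comb (int_vec_group m) k (row A) c = A\<^sup>T *\<^sub>v c"
  by (subst Z_comb_int_vec) (auto intro!: eq_vecI sum.cong simp: scalar_prod_def lessThan_atLeast0)

lemma comm_group_dual: "group G \<Longrightarrow> comm_group (dual_group G)"
proof (rule comm_groupI)
  assume "group G"
  then interpret group G .
  have add: "(\<lambda>x\<in>carrier G. \<phi> x + \<psi> x) \<in> carrier (dual_group G)"
    if "\<phi> \<in> carrier (dual_group G)" "\<psi> \<in> carrier (dual_group G)" for \<phi> \<psi>
    using that by (auto simp: dual_group_def hom_def)
  then show "\<phi> \<otimes>\<^bsub>dual_group G\<^esub> \<psi> \<in> carrier (dual_group G)"
    if "\<phi> \<in> carrier (dual_group G)" "\<psi> \<in> carrier (dual_group G)" for \<phi> \<psi>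
    using that by (simp add: dual_group_def)
  show "\<one>\<^bsub>dual_group G\<^esub> \<in> carrier (dual_group G)" by (auto simp: dual_group_def hom_def)
  fix \<phi> assume p: "\<phi> \<in> carrier (dual_group G)"
  show "\<one>\<^bsub>dual_group G\<^esub> \<otimes>\<^bsub>dual_group G\<^esub> \<phi> = \<phi>"
    using p by (intro extensionalityI[of _ "carrier G"]) (auto simp: dual_group_def)
  have "(\<lambda>x\<in>carrier G. - \<phi> x) \<in> carrier (dual_group G)" using p by (auto simp: dual_group_def hom_def)
  then show "\<exists>\<psi>\<in>carrier (dual_group G). \<psi> \<otimes>\<^bsub>dual_group G\<^esub> \<phi> = \<one>\<^bsub>dual_group G\<^esub>"
    by (intro bexI[of _ "\<lambda>x\<in>carrier G. - \<phi> x"]) (auto simp: dual_group_def)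
qed (auto simp: dual_group_def algebra_simps intro!: restrict_ext)

lemma Z_comb_dual:
  assumes G: "group G" and \<phi>: "\<And>i. i < k \<Longrightarrow> \<phi> i \<in> carrier (dual_group G)" and x: "x \<in> carrier G"
  shows "Z_comb (dual_group G) k \<phi> c x = (\<Sum>i<k. c $ i * \<phi> i x)"
proof -
  have "(\<lambda>\<psi>. \<psi> x) \<in> hom (dual_group G) integer_group" using x by (intro homI) (auto simp: dual_group_def)
  from Z_comb_hom[OF comm_group_dual[OF G] abelian_integer_group this \<phi>, where c = c] show ?thesis
    by (simp add: Z_comb_integer_group)
qed

text \<open>Bases of a subgroup can be tested in the ambient group.\<close>

lemma Z_comb_subgroup:
  assumes G: "comm_group G" and H: "subgroup H G" and x: "\<And>i. i < k \<Longrightarrow> x i \<in> H"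
  shows "Z_comb (G\<lparr>carrier := H\<rparr>) k x c = Z_comb G k x c"
proof -
  interpret comm_group G by (rule G)
  have "comm_group (G\<lparr>carrier := H\<rparr>)"
    by (rule group.group_comm_groupI[OF subgroup.subgroup_is_group[OF H is_group]])
      (use subgroup.subset[OF H] m_comm in auto)
  moreover have "(\<lambda>y. y) \<in> hom (G\<lparr>carrier := H\<rparr>) G" using subgroup.subset[OF H] by (auto simp: hom_def)
  ultimately show ?thesis using Z_comb_hom[OF _ G, of "G\<lparr>carrier := H\<rparr>" "\<lambda>y. y" k x c] x by simp
qed

text \<open>The surjection \<open>\<chi>\<close> induces a bijection from the cosets of the preimage of \<open>\<Lambda>\<close> to those of \<open>\<Lambda>\<close>, so both are counted
  by the same set of representatives.\<close>

lemma rcosets_of_preimage: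
  assumes G: "group G" and \<chi>: "\<And>x. x \<in> carrier G \<Longrightarrow> \<chi> x \<in> carrier_vec k"
    "\<And>x y. x \<in> carrier G \<Longrightarrow> y \<in> carrier G \<Longrightarrow> \<chi> (x \<otimes>\<^bsub>G\<^esub> y) = \<chi> x + \<chi> y"
    "\<And>z. z \<in> carrier_vec k \<Longrightarrow> \<exists>x\<in>carrier G. \<chi> x = (z :: int vec)"
    and P: "P = {x \<in> carrier G. \<chi> x \<in> \<Lambda>}" and \<Lambda>: "lattice k \<Lambda>"
    and R: "finite R" "R \<subseteq> carrier_vec k" "\<forall>x\<in>carrier_vec k. \<exists>!y. y \<in> R \<and> x - y \<in> \<Lambda>"
  shows "finite (rcosets\<^bsub>G\<^esub> P)" "card (rcosets\<^bsub>G\<^esub> P) = card R"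
proof -
  interpret group G by (rule G)
  note LD = latticeD[OF \<Lambda>]
  define C where "C = (\<lambda>y. {x \<in> carrier G. \<chi> x - y \<in> \<Lambda>})"
  have inv: "\<chi> (inv\<^bsub>G\<^esub> x) = - \<chi> x" if x: "x \<in> carrier G" for x
  proof -
    have "\<chi> \<one>\<^bsub>G\<^esub> + \<chi> \<one>\<^bsub>G\<^esub> = \<chi> \<one>\<^bsub>G\<^esub>" using \<chi>(2)[of "\<one>\<^bsub>G\<^esub>" "\<one>\<^bsub>G\<^esub>"] by simp
    then have one: "\<chi> \<one>\<^bsub>G\<^esub> = 0\<^sub>v k" using \<chi>(1)[OF one_closed] by (metis add_inv_exists_vec comm_add_vec minus_add_uminus_vec minus_cancel_vec right_zero_vec uminus_r_inv_vec assoc_add_vec uminus_carrier_vec)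
    have "\<chi> x + \<chi> (inv\<^bsub>G\<^esub> x) = 0\<^sub>v k" using \<chi>(2)[OF x inv_closed[OF x]] x one by simp
    then have "\<chi> x $ i + \<chi> (inv\<^bsub>G\<^esub> x) $ i = 0" if "i < k" for i
      using \<chi>(1)[OF x] \<chi>(1)[OF inv_closed[OF x]] that by (metis carrier_vecD index_add_vec(1) index_zero_vec(1))
    then show ?thesis using \<chi>(1)[OF x] \<chi>(1)[OF inv_closed[OF x]] by (intro eq_vecI) (auto simp: eq_neg_iff_add_eq_0 add.commute)
  qed
  have coset: "P #>\<^bsub>G\<^esub> a = C (\<chi> a)" if a: "a \<in> carrier G" for a
  proof (intro equalityI subsetI)
    fix x assume "x \<in> P #>\<^bsub>G\<^esub> a"
    then obtain p where p: "p \<in> carrier G" "\<chi> p \<in> \<Lambda>" "x = p \<otimes>\<^bsub>G\<^esub> a" unfolding P r_coset_def by blast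
    have "\<chi> x - \<chi> a = \<chi> p" unfolding p(3) \<chi>(2)[OF p(1) a] using \<chi>(1)[OF p(1)] \<chi>(1)[OF a] by (intro eq_vecI) auto
    then show "x \<in> C (\<chi> a)" unfolding C_def using p a by simp
  next
    fix x assume "x \<in> C (\<chi> a)"
    then have x: "x \<in> carrier G" "\<chi> x - \<chi> a \<in> \<Lambda>" unfolding C_def by auto
    have "\<chi> (x \<otimes>\<^bsub>G\<^esub> inv\<^bsub>G\<^esub> a) = \<chi> x - \<chi> a"
      using \<chi>(2)[OF x(1) inv_closed[OF a]] inv[OF a] \<chi>(1)[OF x(1)] \<chi>(1)[OF a] by (auto intro!: eq_vecI)
    then have "x \<otimes>\<^bsub>G\<^esub> inv\<^bsub>G\<^esub> a \<in> P" unfolding P using x a by simp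
    moreover have "x = (x \<otimes>\<^bsub>G\<^esub> inv\<^bsub>G\<^esub> a) \<otimes>\<^bsub>G\<^esub> a" using x(1) a by (simp add: m_assoc)
    ultimately show "x \<in> P #>\<^bsub>G\<^esub> a" unfolding r_coset_def by blast
  qed
  have same: "C z = C y" if zy: "z \<in> carrier_vec k" "y \<in> carrier_vec k" "z - y \<in> \<Lambda>" for z y
  proof -
    have "\<chi> x - z \<in> \<Lambda> \<longleftrightarrow> \<chi> x - y \<in> \<Lambda>" if x: "x \<in> carrier G" for x
    proof -
      have 1: "(\<chi> x - z) + (z - y) = \<chi> x - y" and 2: "(\<chi> x - y) - (z - y) = \<chi> x - z"
        using zy \<chi>(1)[OF x] by (auto intro!: eq_vecI)
      show ?thesis using LD(5)[OF _ zy(3), of "\<chi> x - z"] LD(3)[OF _ zy(3), of "\<chi> x - y"] unfolding 1 2 by blast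
    qed
    then show ?thesis unfolding C_def by blast
  qed
  have img: "rcosets\<^bsub>G\<^esub> P = C ` R"
  proof (intro equalityI subsetI)
    fix X assume "X \<in> rcosets\<^bsub>G\<^esub> P"
    then obtain a where a: "a \<in> carrier G" "X = P #>\<^bsub>G\<^esub> a" unfolding RCOSETS_def by blast
    obtain y where y: "y \<in> R" "\<chi> a - y \<in> \<Lambda>" using bspec[OF R(3) \<chi>(1)[OF a(1)]] by (metis (no_types, lifting))
    then have "X = C y" using a coset same[OF \<chi>(1)[OF a(1)] _ y(2)] R(2) by auto
    then show "X \<in> C ` R" using y(1) by simp
  next
    fix X assume "X \<in> C ` R"
    then obtain y where y: "y \<in> R" "X = C y" by blast
    then obtain a where a: "a \<in> carrier G" "\<chi> a = y" using \<chi>(3) R(2) by (metis subsetD)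
    then have "X = P #>\<^bsub>G\<^esub> a" using coset y(2) by simp
    then show "X \<in> rcosets\<^bsub>G\<^esub> P" unfolding RCOSETS_def using a(1) by blast
  qed
  have "inj_on C R"
  proof (rule inj_onI)
    fix y z assume yz: "y \<in> R" "z \<in> R" "C y = C z"
    obtain a where a: "a \<in> carrier G" "\<chi> a = y" using \<chi>(3) yz(1) R(2) by (metis subsetD)
    have yc: "y \<in> carrier_vec k" using yz(1) R(2) by blast
    have "y - y = 0\<^sub>v k" using yc by simp
    then have "a \<in> C y" unfolding C_def using a LD(2) by simp
    then have "y - z \<in> \<Lambda>" "y - y \<in> \<Lambda>" using yz(3) a(2) \<open>y - y = 0\<^sub>v k\<close> LD(2) unfolding C_def by auto
    then show "y = z" using bspec[OF R(3) yc] yz(1,2) by (metis (no_types, lifting))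
  qed
  then show "card (rcosets\<^bsub>G\<^esub> P) = card R" unfolding img by (rule card_image)
  show "finite (rcosets\<^bsub>G\<^esub> P)" unfolding img using R(1) by simp
qed


section \<open>Classes of invariant divisors in terms of the weight matrix\<close>

locale weighted_fan =
  fixes n r :: nat and \<Sigma> :: "real vec set set" and \<rho> :: "nat \<Rightarrow> real vec set" and Q :: "int mat"
  assumes pws: "poly_weighted_space n r \<Sigma> \<rho>" and weight: "weight_matrix n r \<Sigma> \<rho> Q"

sublocale weighted_fan \<subseteq> complete_simplicial_fan n "n + r" \<Sigma> \<rho>
  by standard (use pws in \<open>auto simp: poly_weighted_space_def\<close>)

context weighted_fan
begin

abbreviation "N \<equiv> n + r"

lemma toric_eq: "toric_divisor n \<rho> a = toric a"
  unfolding toric_def ..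

text \<open>The fan matrix for the standard basis of the lattice.\<close>

definition V0 :: "int mat" where "V0 = mat n N (\<lambda>(i, j). v j $ i)"

lemma V0: "V0 \<in> carrier_mat n N"
  unfolding V0_def by simp

lemma V0_T_carrier: "V0\<^sup>T *\<^sub>v y \<in> carrier_vec N"
  using V0 by (intro carrier_vecI) simp

lemma col_V0: "j < N \<Longrightarrow> col V0 j = v j"
  unfolding V0_def using v_carrier[of j] by (intro eq_vecI) auto

lemma V0_T_mult:
  assumes "y \<in> carrier_vec n" "j < N"
  shows "(V0\<^sup>T *\<^sub>v y) $ j = l j (M_of n y)"
  using assms V0 col_V0[OF assms(2)] v_carrier[OF assms(2)]
  by (simp add: l_M_of[OF assms(2)] comm_scalar_prod[of _ n])

text \<open>The divisor class of the invariant divisor \<open>\<Sum>\<^sub>j a\<^sub>j D\<^sub>j\<close>.\<close>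

definition cls :: "int vec \<Rightarrow> divisor set" where "cls a = div_class n \<Sigma> (toric a)"

lemma cls_carrier: "a \<in> carrier_vec N \<Longrightarrow> cls a \<in> carrier (Cl n \<Sigma>)"
  unfolding cls_def carrier_Cl using toric_carrier by blast

lemma cls_surj:
  assumes "y \<in> carrier (Cl n \<Sigma>)"
  obtains a where "a \<in> carrier_vec N" "y = cls a"
proof -
  obtain E where E: "E \<in> carrier (weil n \<Sigma>)" "y = div_class n \<Sigma> E" using assms unfolding carrier_Cl by blast
  then show ?thesis using toric_representative[OF E(1)] that unfolding cls_def by (metis div_class_eq_iff)
qed

lemma cls_add: "a \<in> carrier_vec N \<Longrightarrow> b \<in> carrier_vec N \<Longrightarrow> cls (a + b) = cls a \<otimes>\<^bsub>Cl n \<Sigma>\<^esub> cls b"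
  unfolding cls_def by (simp add: toric_add div_class_add toric_carrier)

lemma cls_hom: "cls \<in> hom (int_vec_group N) (Cl n \<Sigma>)"
  by (intro homI) (auto simp: int_vec_group_def cls_carrier cls_add)

text \<open>The relations among the classes are the divisors of characters, the rows of \<open>V\<^sub>0\<close>.\<close>

lemma cls_eq_iff:
  assumes ab: "a \<in> carrier_vec N" "b \<in> carrier_vec N"
  shows "cls a = cls b \<longleftrightarrow> (\<exists>y\<in>carrier_vec n. a - b = V0\<^sup>T *\<^sub>v y)"
proof -
  have "cls a = cls b \<longleftrightarrow> toric (a - b) \<in> principal n \<Sigma>"
    unfolding cls_def div_class_eq_iff toric_diff[OF ab] ..
  also have "\<dots> \<longleftrightarrow> (\<exists>m\<in>M_lattice n. \<forall>j<N. (a - b) $ j = l j m)" by (rule toric_principal_iff) (use ab in simp)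
  also have "\<dots> \<longleftrightarrow> (\<exists>y\<in>carrier_vec n. a - b = V0\<^sup>T *\<^sub>v y)"
  proof
    assume "\<exists>m\<in>M_lattice n. \<forall>j<N. (a - b) $ j = l j m"
    then obtain m where m: "\<forall>j<N. (a - b) $ j = l j m" by blast
    let ?y = "vec n (lookup m)"
    have "a - b = V0\<^sup>T *\<^sub>v ?y"
    proof (rule eq_vecI)
      fix j assume "j < dim_vec (V0\<^sup>T *\<^sub>v ?y)"
      then have j: "j < N" using V0 by simp
      then show "(a - b) $ j = (V0\<^sup>T *\<^sub>v ?y) $ j"
        using m V0_T_mult[OF vec_carrier j] l_M_of[OF j] l_as_scalar_prod[OF j] by simp
    qed (use ab V0 in auto)
    then show "\<exists>y\<in>carrier_vec n. a - b = V0\<^sup>T *\<^sub>v y" by (intro bexI[of _ ?y]) auto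
  next
    assume "\<exists>y\<in>carrier_vec n. a - b = V0\<^sup>T *\<^sub>v y"
    then obtain y where "y \<in> carrier_vec n" "a - b = V0\<^sup>T *\<^sub>v y" by blast
    then show "\<exists>m\<in>M_lattice n. \<forall>j<N. (a - b) $ j = l j m"
      using V0_T_mult by (intro bexI[of _ "M_of n y"]) auto
  qed
  finally show ?thesis .
qed

lemma cls_Pic_iff:
  assumes a: "a \<in> carrier_vec N"
  shows "cls a \<in> Pic n \<Sigma> \<longleftrightarrow> locally_linear a"
proof
  assume "cls a \<in> Pic n \<Sigma>"
  then obtain E where E: "E \<in> cartier n \<Sigma>" "cls a = div_class n \<Sigma> E" unfolding Pic_def by blast
  then have "toric a - E \<in> principal n \<Sigma>" unfolding cls_def div_class_eq_iff by blast
  then have "E + (toric a - E) \<in> cartier n \<Sigma>" by (rule cartier_add_principal[OF E(1)])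
  then show "locally_linear a" using toric_cartier_iff[OF a] by simp
next
  assume "locally_linear a"
  then show "cls a \<in> Pic n \<Sigma>" using toric_cartier_iff[OF a] unfolding Pic_def cls_def by blast
qed

text \<open>The hypothesis that the ray generators generate the lattice enters here.\<close>

lemma V0_right_inverse: obtains R where "R \<in> carrier_mat N n" "V0 * R = 1\<^sub>m n"
proof -
  have "\<exists>c\<in>carrier_vec N. unit_vec n i = V0 *\<^sub>v c" for i
  proof -
    obtain c where c: "c \<in> carrier_vec N" "unit_vec n i = Z_comb (int_vec_group n) N v c"
      using pws unfolding poly_weighted_space_def by (metis unit_vec_carrier)
    have "Z_comb (int_vec_group n) N v c = V0 *\<^sub>v c"
      by (subst Z_comb_int_vec) (use v_carrier V0 c(1) in \<open>auto intro!: eq_vecI sum.cong simp: V0_def scalar_prod_def lessThan_atLeast0\<close>)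
    then show ?thesis using c by auto
  qed
  then obtain c where c: "\<And>i. c i \<in> carrier_vec N" "\<And>i. unit_vec n i = V0 *\<^sub>v c i" by metis
  define R where "R = mat_of_cols N (map c [0..<n])"
  have R: "R \<in> carrier_mat N n" unfolding R_def by (intro carrier_matI) auto
  have "V0 * R = 1\<^sub>m n"
  proof (rule mat_col_eqI)
    fix i assume "i < dim_col (1\<^sub>m n :: int mat)"
    then have i: "i < n" by simp
    have "col R i = c i" unfolding R_def using c(1) i by simp
    then show "col (V0 * R) i = col (1\<^sub>m n) i" using col_mult2[OF V0 R i] c(2)[of i] i by simp
  qed (use V0 R in auto)
  then show ?thesis using that R by blast
qed

lemma Q: "Q \<in> carrier_mat r N"
  using weight unfolding weight_matrix_def by blast

text \<open>The rows of the weight matrix, applied to invariant divisors, are the basis of linear forms on the class group.\<close>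

lemma Q_dual_basis:
  obtains \<phi> where "Z_basis (dual_group (Cl n \<Sigma>)) r \<phi>" "\<And>i a. i < r \<Longrightarrow> a \<in> carrier_vec N \<Longrightarrow> (Q *\<^sub>v a) $ i = \<phi> i (cls a)"
proof -
  obtain \<phi> where \<phi>: "Z_basis (dual_group (Cl n \<Sigma>)) r \<phi>"
    "\<And>i j. i < r \<Longrightarrow> j < N \<Longrightarrow> Q $$ (i, j) = \<phi> i (div_class n \<Sigma> (Poly_Mapping.single (orbit_divisor n (\<rho> j)) 1))"
    using weight unfolding weight_matrix_def by blast
  have unit: "toric (unit_vec N j) = Poly_Mapping.single (orbit_divisor n (\<rho> j)) 1" if j: "j < N" for j
  proof -
    have "toric (unit_vec N j) = (\<Sum>i<N. if i = j then Poly_Mapping.single (orbit_divisor n (\<rho> i)) 1 else 0)"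
      unfolding toric_def toric_divisor_def
    proof (rule sum.cong)
      fix i assume "i \<in> {..<N}"
      then show "Poly_Mapping.single (orbit_divisor n (\<rho> i)) (unit_vec N j $ i)
          = (if i = j then Poly_Mapping.single (orbit_divisor n (\<rho> i)) 1 else 0)"
        using j by (cases "i = j") auto
    qed simp
    then show ?thesis using j by simp
  qed
  have "(Q *\<^sub>v a) $ i = \<phi> i (cls a)" if i: "i < r" and a: "a \<in> carrier_vec N" for i a
  proof -
    have "\<phi> i \<in> hom (Cl n \<Sigma>) integer_group" using \<phi>(1) i unfolding Z_basis_def dual_group_def by auto
    then have h: "(\<lambda>x. \<phi> i (cls x)) \<in> hom (int_vec_group N) integer_group"
      using cls_hom unfolding hom_def by (auto simp: Pi_iff)
    have a_eq: "a = Z_comb (int_vec_group N) N (unit_vec N) a"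
      by (subst Z_comb_int_vec) (use a in \<open>auto intro!: eq_vecI simp: unit_vec_def if_distrib cong: if_cong\<close>)
    have "\<phi> i (cls a) = \<phi> i (cls (Z_comb (int_vec_group N) N (unit_vec N) a))" using a_eq by simp
    also have "\<dots> = Z_comb integer_group N (\<lambda>j. \<phi> i (cls (unit_vec N j))) a"
      by (rule Z_comb_hom[OF comm_group_int_vec abelian_integer_group h]) (simp add: int_vec_group_def)
    also have "\<dots> = (\<Sum>j<N. a $ j * Q $$ (i, j))"
      unfolding Z_comb_integer_group using \<phi>(2)[OF i] unit unfolding cls_def by (intro sum.cong) auto
    also have "\<dots> = (Q *\<^sub>v a) $ i"
      using Q i a by (simp add: scalar_prod_def lessThan_atLeast0 mult.commute)
    finally show ?thesis by simp
  qed
  then show ?thesis using that \<phi>(1) by blast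
qed

lemma Q_cls_eq:
  assumes "a \<in> carrier_vec N" "b \<in> carrier_vec N" "cls a = cls b"
  shows "Q *\<^sub>v a = Q *\<^sub>v b"
proof -
  obtain \<phi> where "\<And>i a. i < r \<Longrightarrow> a \<in> carrier_vec N \<Longrightarrow> (Q *\<^sub>v a) $ i = \<phi> i (cls a)" using Q_dual_basis by blast
  then show ?thesis using assms Q by (intro eq_vecI) auto
qed

lemma Q_V0: "y \<in> carrier_vec n \<Longrightarrow> Q *\<^sub>v (V0\<^sup>T *\<^sub>v y) = 0\<^sub>v r"
proof -
  assume y: "y \<in> carrier_vec n"
  have car: "V0\<^sup>T *\<^sub>v y \<in> carrier_vec N" by (rule V0_T_carrier)
  have "cls (V0\<^sup>T *\<^sub>v y) = cls (0\<^sub>v N)" using cls_eq_iff[OF car zero_carrier_vec] y car by (auto intro!: bexI[of _ y])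
  then have "Q *\<^sub>v (V0\<^sup>T *\<^sub>v y) = Q *\<^sub>v 0\<^sub>v N" by (rule Q_cls_eq[OF car zero_carrier_vec])
  then show ?thesis using Q by (auto intro!: eq_vecI)
qed

text \<open>The integral linear relations among the ray generators are the linear forms on the class group, so the rows of the
  weight matrix form a basis of them.\<close>

lemma relations_basis:
  assumes q: "q \<in> carrier_vec N" "V0 *\<^sub>v q = 0\<^sub>v n"
  shows "\<exists>!s. s \<in> carrier_vec r \<and> q = Q\<^sup>T *\<^sub>v s"
proof -
  obtain \<phi> where \<phi>: "Z_basis (dual_group (Cl n \<Sigma>)) r \<phi>" "\<And>i a. i < r \<Longrightarrow> a \<in> carrier_vec N \<Longrightarrow> (Q *\<^sub>v a) $ i = \<phi> i (cls a)"
    using Q_dual_basis by blast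
  have gCl: "group (Cl n \<Sigma>)" using comm_group_Cl by (rule comm_group.axioms(2))
  define \<psi> where "\<psi> = (\<lambda>x\<in>carrier (Cl n \<Sigma>). q \<bullet> (SOME a. a \<in> carrier_vec N \<and> x = cls a))"
  have \<psi>: "\<psi> (cls a) = q \<bullet> a" if a: "a \<in> carrier_vec N" for a
  proof -
    define b where "b = (SOME b. b \<in> carrier_vec N \<and> cls a = cls b)"
    have b: "b \<in> carrier_vec N" "cls a = cls b"
      unfolding b_def using someI[of "\<lambda>b. b \<in> carrier_vec N \<and> cls a = cls b" a] a by auto
    then obtain y where y: "y \<in> carrier_vec n" "a - b = V0\<^sup>T *\<^sub>v y" using cls_eq_iff[OF a b(1)] by blast
    have "q \<bullet> (a - b) = y \<bullet> (V0 *\<^sub>v q)"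
      unfolding y(2) using transpose_vec_mult_scalar[OF V0 q(1) y(1)] V0 q(1) y(1)
      by (metis comm_scalar_prod mult_mat_vec_carrier transpose_carrier_mat)
    then have "q \<bullet> a = q \<bullet> b" using q y(1) a b(1) by (simp add: scalar_prod_minus_distrib[of _ N])
    moreover have "\<psi> (cls a) = q \<bullet> b" unfolding \<psi>_def b_def using cls_carrier[OF a] by simp
    ultimately show ?thesis by simp
  qed
  have "\<psi> \<in> carrier (dual_group (Cl n \<Sigma>))"
    unfolding dual_group_def
  proof (simp, intro conjI)
    show "\<psi> \<in> hom (Cl n \<Sigma>) integer_group"
    proof (rule homI)
      fix x y assume "x \<in> carrier (Cl n \<Sigma>)" "y \<in> carrier (Cl n \<Sigma>)"
      then obtain a b where "a \<in> carrier_vec N" "x = cls a" "b \<in> carrier_vec N" "y = cls b" using cls_surj by metis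
      then show "\<psi> (x \<otimes>\<^bsub>Cl n \<Sigma>\<^esub> y) = \<psi> x \<otimes>\<^bsub>integer_group\<^esub> \<psi> y"
        using \<psi> q(1) by (simp add: cls_add[symmetric] scalar_prod_add_distrib[of _ N])
    qed simp
    show "\<psi> \<in> extensional (carrier (Cl n \<Sigma>))" unfolding \<psi>_def by simp
  qed
  then have uniq: "\<exists>!s. s \<in> carrier_vec r \<and> \<psi> = Z_comb (dual_group (Cl n \<Sigma>)) r \<phi> s"
    using \<phi>(1) unfolding Z_basis_def by blast
  have \<phi>c: "\<phi> i \<in> carrier (dual_group (Cl n \<Sigma>))" if "i < r" for i using \<phi>(1) that unfolding Z_basis_def by blast
  have Qij: "Q $$ (i, j) = \<phi> i (cls (unit_vec N j))" if "i < r" "j < N" for i j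
    using \<phi>(2)[OF that(1), of "unit_vec N j"] Q that by simp
  have "\<psi> = Z_comb (dual_group (Cl n \<Sigma>)) r \<phi> s \<longleftrightarrow> q = Q\<^sup>T *\<^sub>v s" if s: "s \<in> carrier_vec r" for s
  proof -
    have ev: "Z_comb (dual_group (Cl n \<Sigma>)) r \<phi> s (cls a) = (Q\<^sup>T *\<^sub>v s) \<bullet> a" if a: "a \<in> carrier_vec N" for a
    proof -
      have "Z_comb (dual_group (Cl n \<Sigma>)) r \<phi> s (cls a) = (\<Sum>i<r. s $ i * \<phi> i (cls a))"
        by (rule Z_comb_dual[OF gCl \<phi>c cls_carrier[OF a]])
      also have "\<dots> = s \<bullet> (Q *\<^sub>v a)" using \<phi>(2)[OF _ a] Q s by (simp add: scalar_prod_def[of s] lessThan_atLeast0)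
      also have "\<dots> = (Q\<^sup>T *\<^sub>v s) \<bullet> a" using transpose_vec_mult_scalar[OF Q a s] by simp
      finally show ?thesis .
    qed
    show ?thesis
    proof
      assume eq: "\<psi> = Z_comb (dual_group (Cl n \<Sigma>)) r \<phi> s"
      have "q $ j = (Q\<^sup>T *\<^sub>v s) $ j" if j: "j < N" for j
      proof -
        have "q $ j = q \<bullet> unit_vec N j" using q(1) j by simp
        also have "\<dots> = (Q\<^sup>T *\<^sub>v s) \<bullet> unit_vec N j"
          using \<psi>[of "unit_vec N j"] ev[of "unit_vec N j"] eq by simp
        also have "\<dots> = (Q\<^sup>T *\<^sub>v s) $ j" using Q s j by (intro scalar_prod_right_unit) auto
        finally show ?thesis .
      qed
      then show "q = Q\<^sup>T *\<^sub>v s" using q(1) Q by (intro eq_vecI) auto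
    next
      assume eq: "q = Q\<^sup>T *\<^sub>v s"
      have Zc: "Z_comb (dual_group (Cl n \<Sigma>)) r \<phi> s \<in> carrier (dual_group (Cl n \<Sigma>))"
        by (rule Z_comb_closed[OF comm_group_dual[OF gCl] \<phi>c])
      show "\<psi> = Z_comb (dual_group (Cl n \<Sigma>)) r \<phi> s"
      proof (rule extensionalityI)
        show "\<psi> \<in> extensional (carrier (Cl n \<Sigma>))" unfolding \<psi>_def by simp
        show "Z_comb (dual_group (Cl n \<Sigma>)) r \<phi> s \<in> extensional (carrier (Cl n \<Sigma>))"
          using Zc unfolding dual_group_def by simp
        fix x assume "x \<in> carrier (Cl n \<Sigma>)"
        then obtain a where "a \<in> carrier_vec N" "x = cls a" by (rule cls_surj)
        then show "\<psi> x = Z_comb (dual_group (Cl n \<Sigma>)) r \<phi> s x" using \<psi> ev eq by simp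
      qed
    qed
  qed
  then show ?thesis using uniq by (metis (no_types, lifting))
qed

text \<open>A right inverse \<open>R\<close> of \<open>V\<^sub>0\<close> gives the projection \<open>P = 1 - R V\<^sub>0\<close> of \<open>\<int>\<^sup>N\<close> onto the relations among the ray generators. Its
  columns are relations, so \<open>P = Q\<^sup>T S\<^sup>T\<close>; as \<open>P\<close> fixes the columns of \<open>Q\<^sup>T\<close> and these are independent, \<open>Q S = 1\<close>. Transposed,
  \<open>1 - V\<^sub>0\<^sup>T R\<^sup>T = S Q\<close> shows that the kernel of \<open>Q\<close> consists of divisors of characters.\<close>

lemma Q_right_inverse:
  obtains S where "S \<in> carrier_mat N r" "Q * S = 1\<^sub>m r" "\<forall>a\<in>carrier_vec N. Q *\<^sub>v a = 0\<^sub>v r \<longrightarrow> cls a = cls (0\<^sub>v N)"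
proof -
  obtain R where R: "R \<in> carrier_mat N n" "V0 * R = 1\<^sub>m n" using V0_right_inverse .
  define P where "P = 1\<^sub>m N - R * V0"
  have P: "P \<in> carrier_mat N N" unfolding P_def using R(1) V0 by auto
  have VP: "V0 * P = 0\<^sub>m n N"
  proof -
    have "V0 * P = V0 * 1\<^sub>m N - V0 * (R * V0)" unfolding P_def by (rule mult_minus_distrib_mat) (use V0 R in auto)
    also have "V0 * (R * V0) = V0" using assoc_mult_mat[OF V0 R(1) V0] R(2) V0 by simp
    finally show ?thesis using V0 by simp
  qed
  have "\<exists>s. s \<in> carrier_vec r \<and> col P j = Q\<^sup>T *\<^sub>v s" if j: "j < N" for j
  proof -
    have "V0 *\<^sub>v col P j = 0\<^sub>v n" using col_mult2[OF V0 P j] VP j by simp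
    moreover have "col P j \<in> carrier_vec N" using P j by simp
    ultimately show ?thesis using relations_basis by blast
  qed
  then obtain s where s: "\<And>j. j < N \<Longrightarrow> s j \<in> carrier_vec r" "\<And>j. j < N \<Longrightarrow> col P j = Q\<^sup>T *\<^sub>v s j" by metis
  define St where "St = mat_of_cols r (map s [0..<N])"
  have St: "St \<in> carrier_mat r N" unfolding St_def by (intro carrier_matI) auto
  have QT: "Q\<^sup>T \<in> carrier_mat N r" using Q by simp
  have PQ: "P = Q\<^sup>T * St"
  proof (rule mat_col_eqI)
    fix j assume "j < dim_col (Q\<^sup>T * St)"
    then have j: "j < N" using St by simp
    have "col St j = s j" unfolding St_def using s(1)[OF j] j by simp
    then show "col P j = col (Q\<^sup>T * St) j" using col_mult2[OF QT St j] s(2)[OF j] by simp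
  qed (use P QT St in auto)
  have VQ: "V0 *\<^sub>v (Q\<^sup>T *\<^sub>v c) = 0\<^sub>v n" if c: "c \<in> carrier_vec r" for c
  proof (rule eq_vecI)
    fix i assume "i < dim_vec (0\<^sub>v n :: int vec)"
    then have i: "i < n" by simp
    have car: "Q\<^sup>T *\<^sub>v c \<in> carrier_vec N" using QT c by auto
    have "(V0 *\<^sub>v (Q\<^sup>T *\<^sub>v c)) $ i = unit_vec n i \<bullet> (V0 *\<^sub>v (Q\<^sup>T *\<^sub>v c))" using V0 i car by simp
    also have "\<dots> = (V0\<^sup>T *\<^sub>v unit_vec n i) \<bullet> (Q\<^sup>T *\<^sub>v c)"
      using transpose_vec_mult_scalar[OF V0 car unit_vec_carrier] by simp
    also have "\<dots> = c \<bullet> (Q *\<^sub>v (V0\<^sup>T *\<^sub>v unit_vec n i))"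
    proof -
      have car': "V0\<^sup>T *\<^sub>v unit_vec n i \<in> carrier_vec N" by (rule V0_T_carrier)
      show ?thesis using transpose_vec_mult_scalar[OF Q car' c] comm_scalar_prod[OF car' car] by simp
    qed
    also have "\<dots> = 0" using Q_V0[of "unit_vec n i"] c by simp
    finally show "(V0 *\<^sub>v (Q\<^sup>T *\<^sub>v c)) $ i = 0\<^sub>v n $ i" using i by simp
  qed (use V0 in auto)
  have StQ: "St *\<^sub>v (Q\<^sup>T *\<^sub>v c) = c" if c: "c \<in> carrier_vec r" for c
  proof -
    let ?q = "Q\<^sup>T *\<^sub>v c"
    have q: "?q \<in> carrier_vec N" using QT c by auto
    have "P *\<^sub>v ?q = ?q"
    proof -
      have "P *\<^sub>v ?q = 1\<^sub>m N *\<^sub>v ?q - (R * V0) *\<^sub>v ?q" unfolding P_def by (rule minus_mult_distrib_mat_vec) (use R V0 q in auto)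
      also have "(R * V0) *\<^sub>v ?q = 0\<^sub>v N" using assoc_mult_mat_vec[OF R(1) V0 q] VQ[OF c] R(1) by (auto intro!: eq_vecI)
      finally show ?thesis using q by simp
    qed
    then have "?q = Q\<^sup>T *\<^sub>v (St *\<^sub>v ?q)" unfolding PQ using assoc_mult_mat_vec[OF QT St q] by simp
    moreover have "St *\<^sub>v ?q \<in> carrier_vec r" using St q by auto
    ultimately show ?thesis using relations_basis[OF q VQ[OF c]] c by (metis (no_types, lifting))
  qed
  define S where "S = St\<^sup>T"
  have S: "S \<in> carrier_mat N r" unfolding S_def using St by simp
  have "St * Q\<^sup>T = 1\<^sub>m r"
  proof (rule mat_col_eqI)
    fix j assume "j < dim_col (1\<^sub>m r :: int mat)"
    then have j: "j < r" by simp
    have "col (Q\<^sup>T) j = Q\<^sup>T *\<^sub>v unit_vec r j" using QT j by (intro eq_vecI) auto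
    then show "col (St * Q\<^sup>T) j = col (1\<^sub>m r) j" using col_mult2[OF St QT j] StQ[of "unit_vec r j"] j by simp
  qed (use St QT in auto)
  then have "(St * Q\<^sup>T)\<^sup>T = 1\<^sub>m r" by simp
  then have QS: "Q * S = 1\<^sub>m r" unfolding S_def using transpose_mult[OF St QT] by simp
  have "cls a = cls (0\<^sub>v N)" if a: "a \<in> carrier_vec N" "Q *\<^sub>v a = 0\<^sub>v r" for a
  proof -
    have TP: "P\<^sup>T = S * Q" unfolding PQ S_def using transpose_mult[OF QT St] by simp
    have RV: "R * V0 \<in> carrier_mat N N" using R(1) V0 by auto
    have "P\<^sup>T = 1\<^sub>m N - V0\<^sup>T * R\<^sup>T"
      unfolding P_def using transpose_minus[OF one_carrier_mat RV] transpose_mult[OF R(1) V0] by simp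
    then have "(1\<^sub>m N - V0\<^sup>T * R\<^sup>T) *\<^sub>v a = (S * Q) *\<^sub>v a" using TP by simp
    moreover have "(S * Q) *\<^sub>v a = 0\<^sub>v N" using assoc_mult_mat_vec[OF S Q a(1)] a(2) S by (auto intro!: eq_vecI)
    moreover have "(1\<^sub>m N - V0\<^sup>T * R\<^sup>T) *\<^sub>v a = a - V0\<^sup>T *\<^sub>v (R\<^sup>T *\<^sub>v a)"
      using minus_mult_distrib_mat_vec[of "1\<^sub>m N" N N "V0\<^sup>T * R\<^sup>T" a]
        assoc_mult_mat_vec[of "V0\<^sup>T" N n "R\<^sup>T" N a] V0 R(1) a(1) by simp
    ultimately have z: "a - V0\<^sup>T *\<^sub>v (R\<^sup>T *\<^sub>v a) = 0\<^sub>v N" by simp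
    have car: "V0\<^sup>T *\<^sub>v (R\<^sup>T *\<^sub>v a) \<in> carrier_vec N" by (rule V0_T_carrier)
    have "a - 0\<^sub>v N = V0\<^sup>T *\<^sub>v (R\<^sup>T *\<^sub>v a)"
    proof (rule eq_vecI)
      fix i assume "i < dim_vec (V0\<^sup>T *\<^sub>v (R\<^sup>T *\<^sub>v a))"
      then have i: "i < N" using carrier_vecD[OF car] by simp
      then have "a $ i - (V0\<^sup>T *\<^sub>v (R\<^sup>T *\<^sub>v a)) $ i = 0"
        using arg_cong[OF z, of "\<lambda>x. x $ i"] index_minus_vec(1)[of i "V0\<^sup>T *\<^sub>v (R\<^sup>T *\<^sub>v a)" a]
          carrier_vecD[OF car] by (metis index_zero_vec(1))
      then show "(a - 0\<^sub>v N) $ i = (V0\<^sup>T *\<^sub>v (R\<^sup>T *\<^sub>v a)) $ i"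
        using i a(1) by (simp del: index_mult_mat_vec)
    qed (use a(1) carrier_vecD[OF car] in auto)
    moreover have "R\<^sup>T *\<^sub>v a \<in> carrier_vec n" using R(1) by (intro carrier_vecI) simp
    ultimately show ?thesis using cls_eq_iff[OF a(1) zero_carrier_vec] by blast
  qed
  then show ?thesis using that S QS by blast
qed

lemma Q_section: obtains S where "S \<in> carrier_mat N r" "Q * S = 1\<^sub>m r"
proof (rule Q_right_inverse)
  fix S assume "S \<in> carrier_mat N r" "Q * S = 1\<^sub>m r"
  then show thesis by (rule that)
qed

text \<open>So the class group is free of rank \<open>r\<close>, with \<open>Q\<close> as the degree map.\<close>

lemma cls_eq_Q_iff:
  assumes ab: "a \<in> carrier_vec N" "b \<in> carrier_vec N"
  shows "cls a = cls b \<longleftrightarrow> Q *\<^sub>v a = Q *\<^sub>v b"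
proof
  assume "Q *\<^sub>v a = Q *\<^sub>v b"
  then have "Q *\<^sub>v (a - b) = 0\<^sub>v r" using mult_minus_distrib_mat_vec[OF Q ab] Q ab by simp
  then have "cls (a - b) = cls (0\<^sub>v N)" using Q_right_inverse ab by (metis minus_carrier_vec)
  then show "cls a = cls b" using cls_eq_iff[of "a - b" "0\<^sub>v N"] cls_eq_iff[OF ab] ab by simp
qed (rule Q_cls_eq[OF ab])

end


section \<open>Columns of matrices and full-dimensional cones\<close>

lemma cols_in_enumeration:
  assumes A: "A \<in> carrier_mat p q" and S: "S \<subseteq> {..<q}"
  shows "\<exists>e. bij_betw e {..<card S} S \<and> cols_in A S \<in> carrier_mat p (card S) \<and> (\<forall>k<card S. col (cols_in A S) k = col A (e k))"
proof -
  have fin: "finite S" using S finite_subset by blast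
  have SI: "S \<inter> {..<dim_col A} = S" using A S by auto
  define L where "L = sorted_list_of_set S"
  have L: "distinct L" "set L = S" "length L = card S" unfolding L_def using fin by auto
  have W: "cols_in A S = mat_of_cols p (map (col A) L)" unfolding cols_in_def SI L_def using A by simp
  have "bij_betw ((!) L) {..<card S} S" using bij_betw_nth[OF L(1) _ L(2)[symmetric]] L(3) by auto
  moreover have "cols_in A S \<in> carrier_mat p (card S)" unfolding W using L(3) by (intro carrier_matI) auto
  moreover have "col (cols_in A S) k = col A (L ! k)" if "k < card S" for k
    unfolding W using that L(3) A by (subst col_mat_of_cols) (auto intro!: carrier_vecI)
  ultimately show ?thesis by blast
qed

lemma cols_in_mult:
  fixes A :: "int mat"
  assumes A: "A \<in> carrier_mat p q" and S: "S \<subseteq> {..<q}" and e: "bij_betw e {..<card S} S"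
    "cols_in A S \<in> carrier_mat p (card S)" "\<forall>k<card S. col (cols_in A S) k = col A (e k)"
    and b: "b \<in> carrier_vec q" "\<And>j. j < q \<Longrightarrow> j \<notin> S \<Longrightarrow> b $ j = 0"
  shows "A *\<^sub>v b = cols_in A S *\<^sub>v vec (card S) (\<lambda>k. b $ e k)"
proof (rule eq_vecI)
  fix i assume "i < dim_vec (cols_in A S *\<^sub>v vec (card S) (\<lambda>k. b $ e k))"
  then have i: "i < p" using e(2) by simp
  have "(A *\<^sub>v b) $ i = (\<Sum>j<q. A $$ (i, j) * b $ j)" using A b(1) i by (simp add: scalar_prod_def lessThan_atLeast0)
  also have "\<dots> = (\<Sum>j\<in>S. A $$ (i, j) * b $ j)" using b(2) S by (intro sum.mono_neutral_right) auto
  also have "\<dots> = (\<Sum>k<card S. A $$ (i, e k) * b $ e k)" by (rule sum.reindex_bij_betw[OF e(1), symmetric])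
  also have "\<dots> = (\<Sum>k<card S. cols_in A S $$ (i, k) * b $ e k)"
  proof (rule sum.cong)
    fix k assume "k \<in> {..<card S}"
    then have k: "k < card S" by simp
    have "e k < q" using bij_betwE[OF e(1)] k S by auto
    then have "cols_in A S $$ (i, k) = A $$ (i, e k)"
      using arg_cong[OF e(3)[rule_format, OF k], of "\<lambda>x. x $ i"] A e(2) i k by simp
    then show "A $$ (i, e k) * b $ e k = cols_in A S $$ (i, k) * b $ e k" by simp
  qed simp
  also have "\<dots> = (cols_in A S *\<^sub>v vec (card S) (\<lambda>k. b $ e k)) $ i"
    using e(2) i by (simp add: scalar_prod_def lessThan_atLeast0)
  finally show "(A *\<^sub>v b) $ i = (cols_in A S *\<^sub>v vec (card S) (\<lambda>k. b $ e k)) $ i" .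
qed (use A e(2) in auto)

lemma cols_in_mult_ex:
  fixes A :: "int mat"
  assumes A: "A \<in> carrier_mat p q" and S: "S \<subseteq> {..<q}" and c: "c \<in> carrier_vec (card S)"
  shows "\<exists>b. b \<in> carrier_vec q \<and> (\<forall>j<q. j \<notin> S \<longrightarrow> b $ j = 0) \<and> cols_in A S *\<^sub>v c = A *\<^sub>v b \<and> (b = 0\<^sub>v q \<longrightarrow> c = 0\<^sub>v (card S))"
proof -
  obtain e where e: "bij_betw e {..<card S} S"
    "cols_in A S \<in> carrier_mat p (card S)" "\<forall>k<card S. col (cols_in A S) k = col A (e k)"
    using cols_in_enumeration[OF A S] by blast
  define b where "b = vec q (\<lambda>j. if j \<in> S then c $ inv_into {..<card S} e j else 0)"
  have ek: "b $ e k = c $ k" if "k < card S" for k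
  proof -
    have "e k \<in> S" using bij_betwE[OF e(1)] that by auto
    then show ?thesis unfolding b_def using S bij_betw_inv_into_left[OF e(1), of k] that by auto
  qed
  have b: "b \<in> carrier_vec q" "\<And>j. j < q \<Longrightarrow> j \<notin> S \<Longrightarrow> b $ j = 0" unfolding b_def by auto
  have "vec (card S) (\<lambda>k. b $ e k) = c" using ek c by (intro eq_vecI) auto
  then have "cols_in A S *\<^sub>v c = A *\<^sub>v b" using cols_in_mult[OF A S e b] by simp
  moreover have "c = 0\<^sub>v (card S)" if "b = 0\<^sub>v q"
  proof (rule eq_vecI)
    fix k assume "k < dim_vec (0\<^sub>v (card S) :: int vec)"
    then have k: "k < card S" by simp
    then have "e k < q" using bij_betwE[OF e(1)] S by auto
    then show "c $ k = 0\<^sub>v (card S) $ k" using ek[OF k] that k by simp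
  qed (use c in simp)
  ultimately show ?thesis using b by blast
qed

lemma col_lattice_cols_in:
  fixes A :: "int mat"
  assumes A: "A \<in> carrier_mat p q" and S: "S \<subseteq> {..<q}"
  shows "x \<in> col_lattice (cols_in A S) \<longleftrightarrow> (\<exists>b\<in>carrier_vec q. (\<forall>j<q. j \<notin> S \<longrightarrow> b $ j = 0) \<and> x = A *\<^sub>v b)"
proof -
  obtain e where e: "bij_betw e {..<card S} S"
    "cols_in A S \<in> carrier_mat p (card S)" "\<forall>k<card S. col (cols_in A S) k = col A (e k)"
    using cols_in_enumeration[OF A S] by blast
  have iff: "x \<in> col_lattice (cols_in A S) \<longleftrightarrow> (\<exists>c\<in>carrier_vec (card S). x = cols_in A S *\<^sub>v c)"
    unfolding col_lattice_def using e(2) by auto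
  show ?thesis unfolding iff
  proof
    assume "\<exists>c\<in>carrier_vec (card S). x = cols_in A S *\<^sub>v c"
    then obtain c where c: "c \<in> carrier_vec (card S)" "x = cols_in A S *\<^sub>v c" by blast
    show "\<exists>b\<in>carrier_vec q. (\<forall>j<q. j \<notin> S \<longrightarrow> b $ j = 0) \<and> x = A *\<^sub>v b"
      using cols_in_mult_ex[OF A S c(1)] c(2) by auto
  next
    assume "\<exists>b\<in>carrier_vec q. (\<forall>j<q. j \<notin> S \<longrightarrow> b $ j = 0) \<and> x = A *\<^sub>v b"
    then obtain b where b: "b \<in> carrier_vec q" "\<forall>j<q. j \<notin> S \<longrightarrow> b $ j = 0" "x = A *\<^sub>v b" by blast
    have "x = cols_in A S *\<^sub>v vec (card S) (\<lambda>k. b $ e k)" unfolding b(3) by (rule cols_in_mult[OF A S e b(1)]) (use b(2) in blast)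
    then show "\<exists>c\<in>carrier_vec (card S). x = cols_in A S *\<^sub>v c" using vec_carrier by blast
  qed
qed

context weighted_fan
begin

text \<open>The index sets do not depend on the fan matrix: multiplication by \<open>E\<close> maps the columns of \<open>V\<close> back to the ray
  generators.\<close>

lemma index_sets_iff:
  assumes EV: "fan_matrix n r \<rho> E V"
  shows "I \<in> index_sets n r \<Sigma> E V \<longleftrightarrow> I \<subseteq> {..<N} \<and> max_cone ({..<N} - I)"
proof -
  have E: "E \<in> carrier_mat n n" and V: "V \<in> carrier_mat n N" and vE: "\<And>j. j < N \<Longrightarrow> v j = E *\<^sub>v col V j"
    using EV unfolding fan_matrix_def by auto
  define J where "J = {..<N} - I"
  have J: "J \<subseteq> {..<N}" unfolding J_def by blast
  define W where "W = cols_in V J"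
  obtain e where e: "bij_betw e {..<card J} J" "W \<in> carrier_mat n (card J)" "\<forall>k<card J. col W k = col V (e k)"
    using cols_in_enumeration[OF V J] unfolding W_def by blast
  have off: "cols_off V I = W" unfolding cols_off_def W_def J_def using V by simp
  have EW: "E * W \<in> carrier_mat n (card J)" using E e(2) by simp
  have "(\<lambda>x. real_mat E *\<^sub>v x) ` mat_cone (real_mat W) = mat_cone (real_mat (E * W))"
  proof -
    have "real_mat E *\<^sub>v (real_mat W *\<^sub>v c) = real_mat (E * W) *\<^sub>v c" if "c \<in> carrier_vec (card J)" for c
      unfolding of_int_hom.mat_hom_mult[OF E e(2)]
      by (rule assoc_mult_mat_vec[symmetric, where ?n\<^sub>1.0 = n and ?n\<^sub>2.0 = n and ?n\<^sub>3.0 = "card J"]) (use E e(2) that in auto)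
    then show ?thesis unfolding mat_cone_def setcompr_eq_image image_image using e(2) E by (intro image_cong) auto
  qed
  also have "\<dots> = cone_of n (col (real_mat (E * W))) {..<card J}" by (rule mat_cone_eq) (use EW in simp)
  also have "\<dots> = cone_of n rv (e ` {..<card J})"
  proof -
    have "col (real_mat (E * W)) k = rv (e k)" if "k < card J" for k
    proof -
      have "e k < N" using bij_betwE[OF e(1)] that J by auto
      then have "rv (e k) = real_vec (col (E * W) k)" using vE col_mult2[OF E e(2) that] e(3) that by simp
      then show ?thesis using EW that by (intro eq_vecI) auto
    qed
    then show ?thesis
      by (intro cone_of_rescale(1)[of _ _ "\<lambda>_. 1"])
        (use bij_betw_imp_inj_on[OF e(1)] bij_betwE[OF e(1)] J rv_carrier in \<open>auto simp: subset_iff\<close>)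
  qed
  also have "e ` {..<card J} = J" using e(1) by (rule bij_betw_imp_surj_on)
  finally have "(\<lambda>x. real_mat E *\<^sub>v x) ` mat_cone (real_mat (cols_off V I)) = cone_of n rv J" unfolding off .
  then show ?thesis unfolding index_sets_def using max_cone_unique[OF J] unfolding J_def by simp
qed

definition complements :: "nat set set" where
  "complements = {I. I \<subseteq> {..<N} \<and> max_cone ({..<N} - I)}"

lemma complements_eq: "fan_matrix n r \<rho> E V \<Longrightarrow> index_sets n r \<Sigma> E V = complements"
  unfolding complements_def using index_sets_iff by blast

lemma complements_finite: "finite complements" and complements_nonempty: "complements \<noteq> {}"
proof -
  show "finite complements" by (rule finite_subset[of _ "Pow {..<N}"]) (auto simp: complements_def)
  obtain J where J: "max_cone J" by (rule max_cone_ex)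
  then have "{..<N} - ({..<N} - J) = J" unfolding max_cone_def by blast
  then have "{..<N} - J \<in> complements" unfolding complements_def using J by auto
  then show "complements \<noteq> {}" by blast
qed

lemma cols_in_square:
  assumes "I \<in> complements"
  shows "cols_in Q I \<in> carrier_mat r r" "card I = r"
proof -
  have I: "I \<subseteq> {..<N}" "card ({..<N} - I) = n" using assms unfolding complements_def max_cone_def by auto
  have "card ({..<N} - I) = N - card I" using card_Diff_subset[of I "{..<N}"] I(1) finite_subset[OF I(1)] by simp
  moreover have "card I \<le> N" using card_mono[OF _ I(1)] by simp
  ultimately show c: "card I = r" using I(2) by simp
  show "cols_in Q I \<in> carrier_mat r r" using cols_in_enumeration[OF Q I(1)] c by auto
qed

text \<open>Subtracting the divisor of a character that agrees with \<open>a\<close> on the rays of a cone moves \<open>a\<close>, within its class,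
  to a divisor supported on the complementary rays; so membership of \<open>Q a\<close> in the lattice of these columns of
  \<open>Q\<close> expresses that the divisor is principal on the chart of the cone.\<close>

lemma locally_linear_iff:
  assumes a: "a \<in> carrier_vec N"
  shows "locally_linear a \<longleftrightarrow> (\<forall>I\<in>complements. Q *\<^sub>v a \<in> col_lattice (cols_in Q I))"
proof -
  have one: "(\<exists>m\<in>M_lattice n. \<forall>j\<in>{..<N} - I. a $ j = l j m) \<longleftrightarrow> Q *\<^sub>v a \<in> col_lattice (cols_in Q I)"
    if I: "I \<subseteq> {..<N}" for I
    unfolding col_lattice_cols_in[OF Q I]
  proof
    assume "\<exists>m\<in>M_lattice n. \<forall>j\<in>{..<N} - I. a $ j = l j m"
    then obtain m where m: "\<forall>j\<in>{..<N} - I. a $ j = l j m" by blast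
    let ?y = "vec n (lookup m)"
    let ?w = "V0\<^sup>T *\<^sub>v ?y"
    have w: "?w $ j = l j m" if "j < N" for j
      using V0_T_mult[OF vec_carrier that] l_M_of[OF that] l_as_scalar_prod[OF that] by simp
    have b: "a - ?w \<in> carrier_vec N" using V0_T_carrier by (rule minus_carrier_vec[OF a])
    have "Q *\<^sub>v (a - ?w) = Q *\<^sub>v a - Q *\<^sub>v ?w" by (rule mult_minus_distrib_mat_vec[OF Q a V0_T_carrier])
    also have "\<dots> = Q *\<^sub>v a" using Q_V0[OF vec_carrier] Q by (intro eq_vecI) auto
    finally have "Q *\<^sub>v a = Q *\<^sub>v (a - ?w)" ..
    moreover have "(a - ?w) $ j = 0" if "j < N" "j \<notin> I" for j
      using index_minus_vec(1)[of j ?w a] carrier_vecD[OF V0_T_carrier] w m that by simp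
    ultimately show "\<exists>b\<in>carrier_vec N. (\<forall>j<N. j \<notin> I \<longrightarrow> b $ j = 0) \<and> Q *\<^sub>v a = Q *\<^sub>v b" using b by blast
  next
    assume "\<exists>b\<in>carrier_vec N. (\<forall>j<N. j \<notin> I \<longrightarrow> b $ j = 0) \<and> Q *\<^sub>v a = Q *\<^sub>v b"
    then obtain b where b: "b \<in> carrier_vec N" "\<forall>j<N. j \<notin> I \<longrightarrow> b $ j = 0" "Q *\<^sub>v a = Q *\<^sub>v b" by blast
    then have "cls a = cls b" using cls_eq_Q_iff[OF a b(1)] by simp
    then obtain y where y: "y \<in> carrier_vec n" "a - b = V0\<^sup>T *\<^sub>v y" using cls_eq_iff[OF a b(1)] by blast
    have "a $ j = l j (M_of n y)" if "j \<in> {..<N} - I" for j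
      using arg_cong[OF y(2), of "\<lambda>x. x $ j"] V0_T_mult[OF y(1), of j] that b a by simp
    then show "\<exists>m\<in>M_lattice n. \<forall>j\<in>{..<N} - I. a $ j = l j m" by (intro bexI[of _ "M_of n y"]) auto
  qed
  show ?thesis
  proof
    assume "locally_linear a"
    then show "\<forall>I\<in>complements. Q *\<^sub>v a \<in> col_lattice (cols_in Q I)"
      unfolding locally_linear_def complements_def using one by auto
  next
    assume R: "\<forall>I\<in>complements. Q *\<^sub>v a \<in> col_lattice (cols_in Q I)"
    show "locally_linear a" unfolding locally_linear_def
    proof (intro allI impI)
      fix J assume J: "max_cone J"
      then have eq: "{..<N} - ({..<N} - J) = J" unfolding max_cone_def by blast
      then have "{..<N} - J \<in> complements" unfolding complements_def using J by auto
      then show "\<exists>m\<in>M_lattice n. \<forall>j\<in>J. a $ j = l j m" using R one[of "{..<N} - J"] eq by auto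
    qed
  qed
qed

text \<open>A linear relation among the columns of \<open>Q\<^sub>I\<close> is an invariant divisor supported on \<open>I\<close> that is the divisor of a
  character. The character is orthogonal to the rays outside \<open>I\<close>, which span the space.\<close>

lemma det_cols_nonzero:
  assumes I: "I \<in> complements"
  shows "det (cols_in Q I) \<noteq> 0"
proof
  assume "det (cols_in Q I) = 0"
  then obtain c where c: "c \<in> carrier_vec r" "c \<noteq> 0\<^sub>v r" "cols_in Q I *\<^sub>v c = 0\<^sub>v r"
    using det_0_iff_vec_prod_zero[OF cols_in_square(1)[OF I]] by blast
  have IN: "I \<subseteq> {..<N}" and J: "max_cone ({..<N} - I)" using I unfolding complements_def by auto
  have cI: "card I = r" by (rule cols_in_square(2)[OF I])
  obtain b where b: "b \<in> carrier_vec N" "\<forall>j<N. j \<notin> I \<longrightarrow> b $ j = 0" "cols_in Q I *\<^sub>v c = Q *\<^sub>v b" "b = 0\<^sub>v N \<longrightarrow> c = 0\<^sub>v r"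
    using cols_in_mult_ex[OF Q IN, of c] c(1) unfolding cI by blast
  have "Q *\<^sub>v b = Q *\<^sub>v 0\<^sub>v N" unfolding b(3)[symmetric] c(3) using Q by (intro eq_vecI) auto
  then have "cls b = cls (0\<^sub>v N)" using cls_eq_Q_iff[OF b(1)] by simp
  then obtain y where y: "y \<in> carrier_vec n" "b - 0\<^sub>v N = V0\<^sup>T *\<^sub>v y"
    using cls_eq_iff[OF b(1) zero_carrier_vec] by blast
  have bj: "b $ j = l j (M_of n y)" if "j < N" for j
    using arg_cong[OF y(2), of "\<lambda>x. x $ j"] V0_T_mult[OF y(1) that] that b(1) by simp
  have "M_of n y = 0" by (rule forms_separate[OF J M_of_in]) (use bj b(2) in auto)
  then have "b $ j = 0" if "j < N" for j using bj[OF that] unfolding l_def by simp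
  then have "b = 0\<^sub>v N" using b(1) by (intro eq_vecI) auto
  then show False using b(4) c(2) by blast
qed

end


section \<open>The basis of the class group given by a Hermite normal form\<close>

lemma sum_lessThan_add: "(\<Sum>i<(r::nat) + n. f i) = (\<Sum>i<r. f i) + (\<Sum>i<n. f (r + i))" for f :: "nat \<Rightarrow> int"
  by (induction n) auto

lemma upper_rows_carrier: "A \<in> carrier_mat p q \<Longrightarrow> upper_rows k A \<in> carrier_mat k q"
  unfolding upper_rows_def by (intro carrier_matI) auto

lemma lower_rows_carrier: "A \<in> carrier_mat p q \<Longrightarrow> k \<le> p \<Longrightarrow> lower_rows k A \<in> carrier_mat k q"
  unfolding lower_rows_def by (intro carrier_matI) auto

lemma row_upper_rows: "A \<in> carrier_mat p q \<Longrightarrow> k \<le> p \<Longrightarrow> i < k \<Longrightarrow> row (upper_rows k A) i = row A i"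
  unfolding upper_rows_def by (subst mat_of_rows_row) auto

lemma row_lower_rows: "A \<in> carrier_mat (m + k) q \<Longrightarrow> i < k \<Longrightarrow> row (lower_rows k A) i = row A (m + i)"
  unfolding lower_rows_def by (subst mat_of_rows_row) auto

lemma row_append_rows_left:
  assumes "A \<in> carrier_mat p q" "B \<in> carrier_mat k q" "i < p"
  shows "row (A @\<^sub>r B) i = row A i"
  unfolding append_rows_def
  by (subst row_four_block_mat(1)[where ?nr1.0 = p and ?nc1.0 = q and ?nc2.0 = 0 and ?nr2.0 = k])
    (use assms in \<open>auto intro!: eq_vecI\<close>)

lemma row_append_rows_right:
  assumes "A \<in> carrier_mat p q" "B \<in> carrier_mat k q" "i < k"
  shows "row (A @\<^sub>r B) (p + i) = row B i"
  unfolding append_rows_def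
  by (subst row_four_block_mat(2)[where ?nr1.0 = p and ?nc1.0 = q and ?nc2.0 = 0 and ?nr2.0 = k])
    (use assms in \<open>auto intro!: eq_vecI\<close>)

lemma append_rows_split: "A \<in> carrier_mat (p + k) q \<Longrightarrow> A = upper_rows p A @\<^sub>r lower_rows k A"
proof (rule eq_rowI)
  assume A: "A \<in> carrier_mat (p + k) q"
  have U: "upper_rows p A \<in> carrier_mat p q" and L: "lower_rows k A \<in> carrier_mat k q"
    using upper_rows_carrier[OF A] lower_rows_carrier[OF A] by auto
  show "row A i = row (upper_rows p A @\<^sub>r lower_rows k A) i" if "i < dim_row (upper_rows p A @\<^sub>r lower_rows k A)" for i
  proof (cases "i < p")
    case True
    then show ?thesis using row_append_rows_left[OF U L True] row_upper_rows[OF A _ True] by simp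
  next
    case False
    have "i < p + k" using that carrier_append_rows[OF U L] by auto
    then have "i - p < k" "p + (i - p) = i" using False by auto
    then show ?thesis using row_append_rows_right[OF U L, of "i - p"] row_lower_rows[OF A, of "i - p"] by simp
  qed
next
  assume A: "A \<in> carrier_mat (p + k) q"
  have "upper_rows p A @\<^sub>r lower_rows k A \<in> carrier_mat (p + k) q"
    by (rule carrier_append_rows[OF upper_rows_carrier[OF A] lower_rows_carrier[OF A]]) simp
  then show "dim_row A = dim_row (upper_rows p A @\<^sub>r lower_rows k A)" "dim_col A = dim_col (upper_rows p A @\<^sub>r lower_rows k A)"
    using A by auto
qed

lemma append_rows_transpose_mult:
  fixes A B :: "int mat"
  assumes A: "A \<in> carrier_mat p q" and B: "B \<in> carrier_mat k q" and c: "c \<in> carrier_vec p" and d: "d \<in> carrier_vec k"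
  shows "(A @\<^sub>r B)\<^sup>T *\<^sub>v (c @\<^sub>v d) = A\<^sup>T *\<^sub>v c + B\<^sup>T *\<^sub>v d"
proof (rule eq_vecI)
  have AB: "A @\<^sub>r B \<in> carrier_mat (p + k) q" by (rule carrier_append_rows[OF A B])
  show "dim_vec ((A @\<^sub>r B)\<^sup>T *\<^sub>v (c @\<^sub>v d)) = dim_vec (A\<^sup>T *\<^sub>v c + B\<^sup>T *\<^sub>v d)"
    using A B carrier_matD(2)[OF AB] by simp
  fix j assume "j < dim_vec (A\<^sup>T *\<^sub>v c + B\<^sup>T *\<^sub>v d)"
  then have j: "j < q" using B by simp
  have l: "(A @\<^sub>r B) $$ (i, j) = A $$ (i, j)" if "i < p" for i
    using arg_cong[OF row_append_rows_left[OF A B that], of "\<lambda>x. x $ j"] carrier_matD[OF AB] A that j by simp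
  have u: "(A @\<^sub>r B) $$ (p + i, j) = B $$ (i, j)" if "i < k" for i
    using arg_cong[OF row_append_rows_right[OF A B that], of "\<lambda>x. x $ j"] carrier_matD[OF AB] B that j by simp
  have "((A @\<^sub>r B)\<^sup>T *\<^sub>v (c @\<^sub>v d)) $ j = (\<Sum>i<p + k. (A @\<^sub>r B) $$ (i, j) * (c @\<^sub>v d) $ i)"
    using carrier_matD[OF AB] j c d by (simp add: scalar_prod_def lessThan_atLeast0)
  also have "\<dots> = (\<Sum>i<p. A $$ (i, j) * c $ i) + (\<Sum>i<k. B $$ (i, j) * d $ i)"
    unfolding sum_lessThan_add using l u c d by simp
  also have "\<dots> = (A\<^sup>T *\<^sub>v c + B\<^sup>T *\<^sub>v d) $ j"
    using A B j c d by (simp add: scalar_prod_def lessThan_atLeast0)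
  finally show "((A @\<^sub>r B)\<^sup>T *\<^sub>v (c @\<^sub>v d)) $ j = (A\<^sup>T *\<^sub>v c + B\<^sup>T *\<^sub>v d) $ j" .
qed

locale hermite_weighted_fan = weighted_fan +
  fixes U :: "int mat"
  assumes U: "U \<in> carrier_mat (n + r) (n + r)" and U_inv: "invertible_mat U"
    and hnf: "hermite_normal_form (U * Q\<^sup>T)"
begin

abbreviation "U1 \<equiv> upper_rows r U"
abbreviation "U2 \<equiv> lower_rows n U"

lemma U1: "U1 \<in> carrier_mat r N" and U2: "U2 \<in> carrier_mat n N"
  using upper_rows_carrier[OF U] lower_rows_carrier[OF U] by auto

lemma U1T_carrier: "U1\<^sup>T *\<^sub>v c \<in> carrier_vec N" and U2T_carrier: "U2\<^sup>T *\<^sub>v d \<in> carrier_vec N"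
  using U1 U2 by (auto intro!: carrier_vecI)

lemma U_split: "U = U1 @\<^sub>r U2"
  by (rule append_rows_split[of _ _ _ "n + r"]) (use U in \<open>simp add: add.commute\<close>)

lemma U_inverse: obtains W where "W \<in> carrier_mat N N" "U * W = 1\<^sub>m N" "W * U = 1\<^sub>m N"
proof -
  obtain W where W: "inverts_mat U W" "inverts_mat W U" using U_inv unfolding invertible_mat_def by blast
  have UW: "U * W = 1\<^sub>m N" using W(1) U unfolding inverts_mat_def by simp
  have WU: "W * U = 1\<^sub>m (dim_row W)" using W(2) unfolding inverts_mat_def .
  have "dim_col W = N" using arg_cong[OF UW, of dim_col] by simp
  moreover have "dim_row W = N" using arg_cong[OF WU, of dim_col] U by simp
  ultimately show ?thesis using that[of W] UW WU by auto
qed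

text \<open>The weights generate \<open>\<int>\<^sup>r\<close>, so the normal form has the unit vectors on top of a zero block.\<close>

lemma U_Q: "i < N \<Longrightarrow> j < r \<Longrightarrow> (U * Q\<^sup>T) $$ (i, j) = (if i = j then 1 else 0)"
proof -
  assume ij: "i < N" "j < r"
  obtain W where W: "W \<in> carrier_mat N N" "U * W = 1\<^sub>m N" "W * U = 1\<^sub>m N" using U_inverse .
  obtain S where S: "S \<in> carrier_mat N r" "Q * S = 1\<^sub>m r" using Q_section .
  have QT: "Q\<^sup>T \<in> carrier_mat N r" and ST: "S\<^sup>T \<in> carrier_mat r N" using Q S by auto
  have SQ: "S\<^sup>T * Q\<^sup>T = 1\<^sub>m r" using transpose_mult[OF Q S(1)] S(2) by simp
  have X: "S\<^sup>T * W \<in> carrier_mat r N" using ST W(1) by simp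
  have "S\<^sup>T * W * (U * Q\<^sup>T) = S\<^sup>T * (W * (U * Q\<^sup>T))"
    by (rule assoc_mult_mat[OF ST W(1)]) (use U QT in auto)
  also have "W * (U * Q\<^sup>T) = Q\<^sup>T"
    using assoc_mult_mat[OF W(1) U QT] W(3) QT by simp
  finally have inv: "S\<^sup>T * W * (U * Q\<^sup>T) = 1\<^sub>m r" using SQ by simp
  have H: "U * Q\<^sup>T \<in> carrier_mat N r" using U QT by simp
  show ?thesis
    by (rule hermite_normal_form_left_invertible[of _ r n, OF _ hnf _ inv]) (use H X ij in \<open>simp_all add: add.commute\<close>)
qed

lemma Q_row_U: "i < N \<Longrightarrow> Q *\<^sub>v row U i = vec r (\<lambda>j. if i = j then 1 else 0)"
proof (rule eq_vecI)
  fix j assume i: "i < N" and "j < dim_vec (vec r (\<lambda>j. if i = j then 1 else 0) :: int vec)"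
  then have j: "j < r" by simp
  have "(Q *\<^sub>v row U i) $ j = (U * Q\<^sup>T) $$ (i, j)"
    using Q U i j by (simp add: comm_scalar_prod[of _ N])
  then show "(Q *\<^sub>v row U i) $ j = vec r (\<lambda>j. if i = j then 1 else 0) $ j" using U_Q[OF i j] j by simp
qed (use Q in auto)

lemma Q_U1: "c \<in> carrier_vec r \<Longrightarrow> Q *\<^sub>v (U1\<^sup>T *\<^sub>v c) = c"
proof -
  assume c: "c \<in> carrier_vec r"
  have "Q * U1\<^sup>T = 1\<^sub>m r"
  proof (rule mat_col_eqI)
    fix i assume "i < dim_col (1\<^sub>m r :: int mat)"
    then have i: "i < r" by simp
    have "col (Q * U1\<^sup>T) i = Q *\<^sub>v row U i"
      using col_mult2[OF Q, of "U1\<^sup>T" r i] U1 i row_upper_rows[OF U _ i] by simp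
    also have "\<dots> = unit_vec r i" using Q_row_U[of i] i by (auto simp: unit_vec_def)
    finally show "col (Q * U1\<^sup>T) i = col (1\<^sub>m r) i" using i by simp
  qed (use Q U1 in auto)
  then show ?thesis using assoc_mult_mat_vec[OF Q, of "U1\<^sup>T" r c] U1 c by simp
qed

lemma Q_U2: "d \<in> carrier_vec n \<Longrightarrow> Q *\<^sub>v (U2\<^sup>T *\<^sub>v d) = 0\<^sub>v r"
proof -
  assume d: "d \<in> carrier_vec n"
  have "Q * U2\<^sup>T = 0\<^sub>m r n"
  proof (rule mat_col_eqI)
    fix i assume "i < dim_col (0\<^sub>m r n :: int mat)"
    then have i: "i < n" by simp
    have "row U2 i = row U (r + i)" by (rule row_lower_rows[OF _ i]) (use U in \<open>simp add: add.commute\<close>)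
    then have "col (Q * U2\<^sup>T) i = Q *\<^sub>v row U (r + i)"
      using col_mult2[OF Q, of "U2\<^sup>T" n i] U2 i by simp
    also have "\<dots> = 0\<^sub>v r" using Q_row_U[of "r + i"] i by auto
    finally show "col (Q * U2\<^sup>T) i = col (0\<^sub>m r n) i" using i by simp
  qed (use Q U2 in auto)
  then have "Q *\<^sub>v (U2\<^sup>T *\<^sub>v d) = 0\<^sub>m r n *\<^sub>v d" using assoc_mult_mat_vec[OF Q, of "U2\<^sup>T" n d] U2 d by simp
  also have "\<dots> = 0\<^sub>v r" using d by (intro eq_vecI) auto
  finally show ?thesis .
qed

text \<open>The rows of \<open>U\<close> are a basis of \<open>\<int>\<^sup>N\<close>, and the coefficients of the upper ones are the degrees.\<close>

lemma U_decomposition: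
  assumes a: "a \<in> carrier_vec N"
  shows "\<exists>d\<in>carrier_vec n. a = U1\<^sup>T *\<^sub>v (Q *\<^sub>v a) + U2\<^sup>T *\<^sub>v d"
proof -
  obtain W where W: "W \<in> carrier_mat N N" "U * W = 1\<^sub>m N" "W * U = 1\<^sub>m N" using U_inverse .
  define w where "w = W\<^sup>T *\<^sub>v a"
  have w: "w \<in> carrier_vec (r + n)" unfolding w_def using W(1) by (intro carrier_vecI) simp
  have UT: "U\<^sup>T \<in> carrier_mat N N" and WT: "W\<^sup>T \<in> carrier_mat N N" using U W(1) by auto
  have "U\<^sup>T * W\<^sup>T = 1\<^sub>m N" using transpose_mult[OF W(1) U] W(3) by simp
  then have "a = U\<^sup>T *\<^sub>v w" unfolding w_def using assoc_mult_mat_vec[OF UT WT a] a by simp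
  also have "\<dots> = U1\<^sup>T *\<^sub>v vec_first w r + U2\<^sup>T *\<^sub>v vec_last w n"
    using append_rows_transpose_mult[OF U1 U2, of "vec_first w r" "vec_last w n", folded U_split] vec_first_last_append[OF w] by simp
  finally have a_eq: "a = U1\<^sup>T *\<^sub>v vec_first w r + U2\<^sup>T *\<^sub>v vec_last w n" .
  have "Q *\<^sub>v a = vec_first w r"
    unfolding a_eq using mult_add_distrib_mat_vec[OF Q U1T_carrier U2T_carrier] Q_U1[of "vec_first w r"] Q_U2[of "vec_last w n"] by simp
  then show ?thesis using a_eq by (metis vec_last_carrier)
qed

lemma U2T_inj:
  assumes d: "d \<in> carrier_vec n" and 0: "U2\<^sup>T *\<^sub>v d = 0\<^sub>v N"
  shows "d = 0\<^sub>v n"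
proof -
  obtain W where W: "W \<in> carrier_mat N N" "U * W = 1\<^sub>m N" "W * U = 1\<^sub>m N" using U_inverse .
  have UT: "U\<^sup>T \<in> carrier_mat N N" and WT: "W\<^sup>T \<in> carrier_mat N N" using U W(1) by auto
  have inv: "W\<^sup>T * U\<^sup>T = 1\<^sub>m N" using transpose_mult[OF U W(1)] W(2) by simp
  define w where "w = 0\<^sub>v r @\<^sub>v d"
  have w: "w \<in> carrier_vec N" unfolding w_def using d by (intro carrier_vecI) (simp add: add.commute)
  have "U\<^sup>T *\<^sub>v w = U1\<^sup>T *\<^sub>v 0\<^sub>v r + U2\<^sup>T *\<^sub>v d" unfolding w_def
    by (rule append_rows_transpose_mult[OF U1 U2 zero_carrier_vec d, folded U_split])
  also have "\<dots> = 0\<^sub>v N" unfolding 0 using U1 by (intro eq_vecI) auto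
  finally have Uw: "U\<^sup>T *\<^sub>v w = 0\<^sub>v N" .
  have "w = (W\<^sup>T * U\<^sup>T) *\<^sub>v w" unfolding inv using w by simp
  also have "\<dots> = W\<^sup>T *\<^sub>v 0\<^sub>v N" by (subst assoc_mult_mat_vec[OF WT UT w]) (simp only: Uw)
  also have "\<dots> = 0\<^sub>v N" using WT by (intro eq_vecI) auto
  finally have z: "w = 0\<^sub>v N" .
  show ?thesis
  proof (rule eq_vecI)
    fix i assume "i < dim_vec (0\<^sub>v n :: int vec)"
    then have i: "i < n" by simp
    have "d $ i = w $ (r + i)" unfolding w_def using i d by simp
    also have "\<dots> = 0" unfolding z using i by simp
    finally show "d $ i = 0\<^sub>v n $ i" using i by simp
  qed (use d in simp)
qed

lemma cls_U1_surj:
  assumes "y \<in> carrier (Cl n \<Sigma>)"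
  shows "\<exists>c\<in>carrier_vec r. \<forall>c'\<in>carrier_vec r. y = cls (U1\<^sup>T *\<^sub>v c') \<longleftrightarrow> c' = c"
proof -
  obtain a where a: "a \<in> carrier_vec N" "y = cls a" using cls_surj[OF assms] by blast
  have iff: "y = cls (U1\<^sup>T *\<^sub>v c) \<longleftrightarrow> c = Q *\<^sub>v a" if "c \<in> carrier_vec r" for c
    using cls_eq_Q_iff[OF a(1) U1T_carrier] Q_U1[OF that] a(2) by auto
  have "Q *\<^sub>v a \<in> carrier_vec r" using Q by (intro carrier_vecI) simp
  then show ?thesis using iff by (intro bexI[of _ "Q *\<^sub>v a"] ballI) auto
qed

lemma row_class_eq: "i < r \<Longrightarrow> row_class n \<Sigma> \<rho> U i = cls (row U1 i)"
  unfolding row_class_def cls_def toric_eq using row_upper_rows[OF U, of r i] by simp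

lemma row_class_carrier: "i < r \<Longrightarrow> row_class n \<Sigma> \<rho> U i \<in> carrier (Cl n \<Sigma>)"
  using row_class_eq[of i] cls_carrier[of "row U1 i"] U1 by simp

lemma Z_comb_row_class:
  assumes c: "c \<in> carrier_vec r"
  shows "Z_comb (Cl n \<Sigma>) r (row_class n \<Sigma> \<rho> U) c = cls (U1\<^sup>T *\<^sub>v c)"
proof -
  have "Z_comb (Cl n \<Sigma>) r (row_class n \<Sigma> \<rho> U) c = Z_comb (Cl n \<Sigma>) r (\<lambda>i. cls (row U1 i)) c"
  proof -
    interpret comm_group "Cl n \<Sigma>" by (rule comm_group_Cl)
    show ?thesis unfolding Z_comb_def
      by (rule finprod_cong') (use row_class_eq row_class_carrier in auto)
  qed
  also have "\<dots> = cls (Z_comb (int_vec_group N) r (row U1) c)"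
    by (rule Z_comb_hom[OF comm_group_int_vec comm_group_Cl cls_hom, symmetric]) (use U1 in \<open>auto simp: int_vec_group_def\<close>)
  also have "\<dots> = cls (U1\<^sup>T *\<^sub>v c)" using Z_comb_rows[OF U1 c] by simp
  finally show ?thesis .
qed

lemma row_class_basis: "Z_basis (Cl n \<Sigma>) r (row_class n \<Sigma> \<rho> U)"
  unfolding Z_basis_def
proof (intro conjI allI impI ballI)
  fix y assume y: "y \<in> carrier (Cl n \<Sigma>)"
  show "\<exists>!c. c \<in> carrier_vec r \<and> y = Z_comb (Cl n \<Sigma>) r (row_class n \<Sigma> \<rho> U) c"
  proof -
    obtain c where c: "c \<in> carrier_vec r" "\<forall>c'\<in>carrier_vec r. y = cls (U1\<^sup>T *\<^sub>v c') \<longleftrightarrow> c' = c"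
      using cls_U1_surj[OF y] by (rule bexE)
    show ?thesis
    proof (rule ex1I[of _ c])
      show "c \<in> carrier_vec r \<and> y = Z_comb (Cl n \<Sigma>) r (row_class n \<Sigma> \<rho> U) c"
        unfolding Z_comb_row_class[OF c(1)] using c(1) bspec[OF c(2) c(1)] by simp
      fix c' assume "c' \<in> carrier_vec r \<and> y = Z_comb (Cl n \<Sigma>) r (row_class n \<Sigma> \<rho> U) c'"
      then have c': "c' \<in> carrier_vec r" "y = Z_comb (Cl n \<Sigma>) r (row_class n \<Sigma> \<rho> U) c'" by (rule conjunct1, rule conjunct2)
      show "c' = c" using bspec[OF c(2) c'(1)] trans[OF c'(2) Z_comb_row_class[OF c'(1)]] by (rule iffD1)
    qed
  qed
qed (rule row_class_carrier)

lemma Pic_coordinates: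
  assumes c: "c \<in> carrier_vec r"
  shows "Z_comb (Cl n \<Sigma>) r (row_class n \<Sigma> \<rho> U) c \<in> Pic n \<Sigma> \<longleftrightarrow> (\<forall>I\<in>complements. c \<in> col_lattice (cols_in Q I))"
proof -
  let ?a = "U1\<^sup>T *\<^sub>v c"
  have a: "?a \<in> carrier_vec N" by (rule U1T_carrier)
  have "Z_comb (Cl n \<Sigma>) r (row_class n \<Sigma> \<rho> U) c \<in> Pic n \<Sigma> \<longleftrightarrow> cls ?a \<in> Pic n \<Sigma>"
    by (subst Z_comb_row_class[OF c]) (rule refl)
  also have "\<dots> \<longleftrightarrow> locally_linear ?a" by (rule cls_Pic_iff[OF a])
  also have "\<dots> \<longleftrightarrow> (\<forall>I\<in>complements. Q *\<^sub>v ?a \<in> col_lattice (cols_in Q I))" by (rule locally_linear_iff[OF a])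
  also have "\<dots> \<longleftrightarrow> (\<forall>I\<in>complements. c \<in> col_lattice (cols_in Q I))" by (subst Q_U1[OF c]) (rule refl)
  finally show ?thesis .
qed

end


section \<open>Bases of the Cartier divisors and the index of the Picard group\<close>

context hermite_weighted_fan
begin

lemma carrier_W_T: "carrier (W_T n \<Sigma>) = toric ` carrier_vec N"
proof -
  have cones: "orbit_divisor n ` cones n \<Sigma> 1 = D ` {..<N}"
  proof -
    have rays: "\<rho> ` {..<N} = cones n \<Sigma> 1" using pws unfolding poly_weighted_space_def bij_betw_def by blast
    have "orbit_divisor n ` cones n \<Sigma> 1 = (\<lambda>j. orbit_divisor n (\<rho> j)) ` {..<N}" unfolding rays[symmetric] image_image by (rule refl)
    also have "\<dots> = D ` {..<N}" using orbit_divisor_ray by (intro image_cong) auto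
    finally show ?thesis .
  qed
  show ?thesis
  proof (intro equalityI subsetI)
    fix E assume "E \<in> carrier (W_T n \<Sigma>)"
    then have "keys E \<subseteq> D ` {..<N}" unfolding W_T_def cones by simp
    then show "E \<in> toric ` carrier_vec N" by (rule toric_surj) blast
  next
    fix E assume "E \<in> toric ` carrier_vec N"
    then show "E \<in> carrier (W_T n \<Sigma>)" unfolding W_T_def cones using keys_toric by auto
  qed
qed

lemma toric_W_T: "a \<in> carrier_vec N \<Longrightarrow> toric a \<in> carrier (W_T n \<Sigma>)"
  unfolding carrier_W_T by blast

lemma comm_group_W_T: "comm_group (W_T n \<Sigma>)"
  unfolding W_T_def by (rule abelian_free_Abelian_group)

lemma mult_W_T: "x \<otimes>\<^bsub>W_T n \<Sigma>\<^esub> y = x + y"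
  unfolding W_T_def by simp

lemma toric_hom: "toric \<in> hom (int_vec_group N) (W_T n \<Sigma>)"
  by (intro homI) (auto simp: int_vec_group_def toric_W_T mult_W_T toric_add)

lemma C_T_eq: "C_T n \<Sigma> = toric ` {a \<in> carrier_vec N. locally_linear a}"
  unfolding C_T_def carrier_W_T using toric_cartier_iff by blast

lemma toric_C_T_iff: "a \<in> carrier_vec N \<Longrightarrow> toric a \<in> C_T n \<Sigma> \<longleftrightarrow> locally_linear a"
  unfolding C_T_def using toric_W_T toric_cartier_iff by blast

text \<open>The Picard group in the coordinates of the class group.\<close>

definition pic_lattice :: "int vec set" where
  "pic_lattice = (\<Inter>I\<in>complements. col_lattice (cols_in Q I))"

lemma locally_linear_lattice: "a \<in> carrier_vec N \<Longrightarrow> locally_linear a \<longleftrightarrow> Q *\<^sub>v a \<in> pic_lattice"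
  unfolding pic_lattice_def using locally_linear_iff by blast

lemma lattice_pic: "lattice r pic_lattice"
proof -
  have L: "lattice r (col_lattice (cols_in Q I))" if "I \<in> complements" for I
    by (rule lattice_col_lattice[OF cols_in_square(1)[OF that]])
  obtain I where I: "I \<in> complements" using complements_nonempty by blast
  have "pic_lattice \<subseteq> carrier_vec r" unfolding pic_lattice_def using latticeD(1)[OF L[OF I]] I by blast
  moreover have "0\<^sub>v r \<in> pic_lattice" unfolding pic_lattice_def using latticeD(2)[OF L] by blast
  moreover have "x - y \<in> pic_lattice" if "x \<in> pic_lattice" "y \<in> pic_lattice" for x y
    using that latticeD(3)[OF L] unfolding pic_lattice_def by simp
  ultimately show ?thesis unfolding lattice_def by blast
qed

lemma locally_linear_diff:
  assumes "a \<in> carrier_vec N" "b \<in> carrier_vec N" "locally_linear a" "locally_linear b"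
  shows "locally_linear (a - b)"
proof -
  have "Q *\<^sub>v (a - b) = Q *\<^sub>v a - Q *\<^sub>v b" by (rule mult_minus_distrib_mat_vec[OF Q assms(1,2)])
  then show ?thesis using assms latticeD(3)[OF lattice_pic] by (simp add: locally_linear_lattice)
qed

lemma locally_linear_zero: "locally_linear (0\<^sub>v N)"
proof -
  have "Q *\<^sub>v 0\<^sub>v N = 0\<^sub>v r" using Q by (intro eq_vecI) auto
  then show ?thesis using latticeD(2)[OF lattice_pic] by (simp add: locally_linear_lattice)
qed

text \<open>Used for the class map and for \<open>toric\<close>, whose images are the Picard group and the invariant Cartier divisors.\<close>

lemma hom_image_subgroup:
  assumes G: "comm_group G" and h: "h \<in> hom (int_vec_group N) G"
  shows "subgroup (h ` {a \<in> carrier_vec N. locally_linear a}) G"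
proof -
  interpret i: group_hom "int_vec_group N" G h
    by (rule group_hom.intro) (use comm_group_int_vec[THEN comm_group.axioms(2)] G[THEN comm_group.axioms(2)] h in \<open>auto simp: group_hom_axioms_def\<close>)
  have neg: "- a \<in> carrier_vec N \<and> locally_linear (- a)" if "a \<in> carrier_vec N" "locally_linear a" for a
    using locally_linear_diff[OF zero_carrier_vec that(1) locally_linear_zero that(2)] that(1) by simp
  have inv: "inv\<^bsub>int_vec_group N\<^esub> a = - a" if "a \<in> carrier_vec N" for a
    by (rule i.G.inv_equality) (use that in \<open>auto simp: int_vec_group_def\<close>)
  have "a + b \<in> {a \<in> carrier_vec N. locally_linear a}" if a: "a \<in> carrier_vec N" "locally_linear a"
    and b: "b \<in> carrier_vec N" "locally_linear b" for a b
  proof -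
    have "a - (- b) = a + b" using a(1) b(1) by (intro eq_vecI) auto
    then show ?thesis using locally_linear_diff[of a "- b"] a b neg[OF b] by auto
  qed
  then have "subgroup {a \<in> carrier_vec N. locally_linear a} (int_vec_group N)"
    using locally_linear_zero neg inv by (intro i.G.subgroupI) (auto simp: int_vec_group_def intro!: exI[of _ "0\<^sub>v N"])
  then show ?thesis by (rule i.subgroup_img_is_subgroup)
qed

lemma C_T_subgroup: "subgroup (C_T n \<Sigma>) (W_T n \<Sigma>)"
  unfolding C_T_eq by (rule hom_image_subgroup[OF comm_group_W_T toric_hom])

lemma Pic_eq: "Pic n \<Sigma> = cls ` {a \<in> carrier_vec N. locally_linear a}"
proof (intro equalityI subsetI)
  fix x assume x: "x \<in> Pic n \<Sigma>"
  then obtain E where "E \<in> cartier n \<Sigma>" "x = div_class n \<Sigma> E" unfolding Pic_def by blast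
  then have "x \<in> carrier (Cl n \<Sigma>)" unfolding carrier_Cl cartier_iff by blast
  then obtain a where a: "a \<in> carrier_vec N" "x = cls a" by (rule cls_surj)
  then show "x \<in> cls ` {a \<in> carrier_vec N. locally_linear a}" using x cls_Pic_iff[OF a(1)] by blast
next
  fix x assume "x \<in> cls ` {a \<in> carrier_vec N. locally_linear a}"
  then show "x \<in> Pic n \<Sigma>" using cls_Pic_iff by blast
qed

lemma Pic_subgroup: "subgroup (Pic n \<Sigma>) (Cl n \<Sigma>)"
  unfolding Pic_eq by (rule hom_image_subgroup[OF comm_group_Cl cls_hom])

text \<open>The rows of \<open>V\<^sub>0\<close> have degree zero, so they are combinations of the lower rows of \<open>U\<close>: \<open>V\<^sub>0 = E U\<^sub>2\<close>. As \<open>V\<^sub>0\<close> has a right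
  inverse, so has \<open>E\<close>, which is square and hence invertible over \<open>\<int>\<close>.\<close>

lemma fan_matrix_lower_rows: "\<exists>E. fan_matrix n r \<rho> E U2"
proof -
  have "\<exists>d\<in>carrier_vec n. V0\<^sup>T *\<^sub>v unit_vec n i = U2\<^sup>T *\<^sub>v d" for i
  proof -
    let ?a = "V0\<^sup>T *\<^sub>v unit_vec n i"
    obtain d where d: "d \<in> carrier_vec n" "?a = U1\<^sup>T *\<^sub>v (Q *\<^sub>v ?a) + U2\<^sup>T *\<^sub>v d"
      using U_decomposition[OF V0_T_carrier] by (rule bexE)
    have "?a = U1\<^sup>T *\<^sub>v 0\<^sub>v r + U2\<^sup>T *\<^sub>v d" using d(2) unfolding Q_V0[OF unit_vec_carrier] .
    also have "\<dots> = U2\<^sup>T *\<^sub>v d" using U1 U2 by (intro eq_vecI) auto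
    finally show ?thesis using d(1) by blast
  qed
  then obtain e where e: "\<And>i. e i \<in> carrier_vec n" "\<And>i. V0\<^sup>T *\<^sub>v unit_vec n i = U2\<^sup>T *\<^sub>v e i" by metis
  define E where "E = mat n n (\<lambda>(i, j). e i $ j)"
  have E: "E \<in> carrier_mat n n" unfolding E_def by simp
  have rowE: "row E i = e i" if "i < n" for i unfolding E_def using e(1)[of i] that by (intro eq_vecI) auto
  have V0E: "V0 = E * U2"
  proof (rule eq_matI)
    fix i j assume "i < dim_row (E * U2)" "j < dim_col (E * U2)"
    then have i: "i < n" and j: "j < N" using E U2 by auto
    have "V0 $$ (i, j) = (V0\<^sup>T *\<^sub>v unit_vec n i) $ j" using V0 i j by simp
    also have "\<dots> = col U2 j \<bullet> e i" unfolding e(2) using U2 j by simp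
    also have "\<dots> = (E * U2) $$ (i, j)" using E U2 i j rowE[OF i] e(1)[of i] by (simp add: comm_scalar_prod[of _ n])
    finally show "V0 $$ (i, j) = (E * U2) $$ (i, j)" .
  qed (use V0 E U2 in auto)
  obtain R where R: "R \<in> carrier_mat N n" "V0 * R = 1\<^sub>m n" using V0_right_inverse .
  define X where "X = U2 * R"
  have X: "X \<in> carrier_mat n n" unfolding X_def using U2 R(1) by simp
  have EX: "E * X = 1\<^sub>m n" unfolding X_def using assoc_mult_mat[OF E U2 R(1)] R(2) V0E by simp
  have "det E * det X = 1" using det_mult[OF E X] EX by simp
  then have detE: "det E \<noteq> 0" by auto
  have comb: "Z_comb (int_vec_group n) n (col E) c = E *\<^sub>v c" if "c \<in> carrier_vec n" for c by (rule Z_comb_cols[OF E that])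
  have "Z_basis (int_vec_group n) n (col E)" unfolding Z_basis_def
  proof (intro conjI allI impI ballI)
    fix i assume "i < n"
    then show "col E i \<in> carrier (int_vec_group n)" using E by (simp add: int_vec_group_def)
  next
    fix y assume "y \<in> carrier (int_vec_group n)"
    then have y: "y \<in> carrier_vec n" by (simp add: int_vec_group_def)
    show "\<exists>!c. c \<in> carrier_vec n \<and> y = Z_comb (int_vec_group n) n (col E) c"
    proof (rule ex1I[of _ "X *\<^sub>v y"])
      have Xy: "X *\<^sub>v y \<in> carrier_vec n" using X y by simp
      have "E *\<^sub>v (X *\<^sub>v y) = y" using assoc_mult_mat_vec[OF E X y] EX y by simp
      then show "X *\<^sub>v y \<in> carrier_vec n \<and> y = Z_comb (int_vec_group n) n (col E) (X *\<^sub>v y)" using Xy comb[OF Xy] by simp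
      fix c assume "c \<in> carrier_vec n \<and> y = Z_comb (int_vec_group n) n (col E) c"
      then have c: "c \<in> carrier_vec n" "y = E *\<^sub>v c" using comb[of c] by auto
      have "E *\<^sub>v (c - X *\<^sub>v y) = E *\<^sub>v c - E *\<^sub>v (X *\<^sub>v y)" by (rule mult_minus_distrib_mat_vec[OF E c(1) Xy])
      also have "\<dots> = 0\<^sub>v n" unfolding \<open>E *\<^sub>v (X *\<^sub>v y) = y\<close> c(2)[symmetric] using y by simp
      finally have "E *\<^sub>v (c - X *\<^sub>v y) = 0\<^sub>v n" .
      then have z: "c - X *\<^sub>v y = 0\<^sub>v n" using det_0_iff_vec_prod_zero[OF E] detE c(1) Xy by (metis minus_carrier_vec)
      show "c = X *\<^sub>v y"
      proof (rule eq_vecI)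
        fix i assume i: "i < dim_vec (X *\<^sub>v y)"
        then have "(c - X *\<^sub>v y) $ i = c $ i - (X *\<^sub>v y) $ i" by (rule index_minus_vec(1))
        moreover have "(c - X *\<^sub>v y) $ i = 0" unfolding z using i X by simp
        ultimately show "c $ i = (X *\<^sub>v y) $ i" by simp
      qed (use c(1) X in auto)
    qed
  qed
  moreover have "v j = E *\<^sub>v col U2 j" if "j < N" for j
    using col_mult2[OF E U2 that] col_V0[OF that] V0E by simp
  ultimately have "fan_matrix n r \<rho> E U2" unfolding fan_matrix_def using E U2 by blast
  then show ?thesis by blast
qed

text \<open>An invariant Cartier divisor differs from a unique combination of the rows of \<open>B U\<^sub>1\<close>, given by its class, by a divisor of
  degree zero, which is a unique combination of the rows of \<open>U\<^sub>2\<close>.\<close>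

lemma cartier_basis:
  assumes B: "B \<in> carrier_mat r r"
    and basis: "Z_basis (Pic_group n \<Sigma>) r (\<lambda>i. Z_comb (Cl n \<Sigma>) r (row_class n \<Sigma> \<rho> U) (row B i))"
  shows "Z_basis (C_T_group n \<Sigma>) (n + r) (\<lambda>i. toric (row ((B * U1) @\<^sub>r U2) i))"
proof -
  define C where "C = (B * U1) @\<^sub>r U2"
  have BU: "B * U1 \<in> carrier_mat r N" using B U1 by simp
  have C: "C \<in> carrier_mat N N" unfolding C_def using carrier_append_rows[OF BU U2] by (simp add: add.commute)
  have BUT: "(B * U1)\<^sup>T *\<^sub>v c \<in> carrier_vec N" for c using BU U1 by (intro carrier_vecI) simp
  have g: "Z_comb (Cl n \<Sigma>) r (row_class n \<Sigma> \<rho> U) (row B i) = cls (row (B * U1) i)" if i: "i < r" for i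
  proof -
    have b: "row B i \<in> carrier_vec r" using B i by simp
    have "row (B * U1) i = U1\<^sup>T *\<^sub>v row B i" using B U1 i by (intro eq_vecI) (auto simp: comm_scalar_prod[of _ r])
    then show ?thesis using Z_comb_row_class[OF b] by simp
  qed
  have g_Pic: "cls (row (B * U1) i) \<in> Pic n \<Sigma>" if i: "i < r" for i
    using basis i g[OF i] unfolding Z_basis_def by auto
  have comb: "Z_comb (Pic_group n \<Sigma>) r (\<lambda>i. Z_comb (Cl n \<Sigma>) r (row_class n \<Sigma> \<rho> U) (row B i)) c = cls ((B * U1)\<^sup>T *\<^sub>v c)"
    if c: "c \<in> carrier_vec r" for c
  proof -
    interpret comm_group "Cl n \<Sigma>" by (rule comm_group_Cl)
    have Cl: "cls (row (B * U1) i) \<in> carrier (Cl n \<Sigma>)" if "i < r" for i using that BU U1 by (intro cls_carrier) simp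
    have "Z_comb (Pic_group n \<Sigma>) r (\<lambda>i. Z_comb (Cl n \<Sigma>) r (row_class n \<Sigma> \<rho> U) (row B i)) c
        = Z_comb (Cl n \<Sigma>) r (\<lambda>i. Z_comb (Cl n \<Sigma>) r (row_class n \<Sigma> \<rho> U) (row B i)) c"
      by (rule Z_comb_subgroup[OF comm_group_Cl Pic_subgroup]) (use g g_Pic in simp)
    also have "\<dots> = Z_comb (Cl n \<Sigma>) r (\<lambda>i. cls (row (B * U1) i)) c"
      unfolding Z_comb_def[of _ _ _ c] by (rule finprod_cong') (use g Cl in auto)
    also have "\<dots> = cls (Z_comb (int_vec_group N) r (row (B * U1)) c)"
      by (rule Z_comb_hom[OF comm_group_int_vec comm_group_Cl cls_hom, symmetric]) (use BU in \<open>auto simp: int_vec_group_def\<close>)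
    finally show ?thesis unfolding Z_comb_rows[OF BU c] .
  qed
  have rows: "toric (row C i) \<in> C_T n \<Sigma>" if i: "i < N" for i
  proof -
    have car: "row C i \<in> carrier_vec N" using C i by simp
    have "locally_linear (row C i)"
    proof (cases "i < r")
      case True
      have rc: "row (B * U1) i \<in> carrier_vec N" using BU True by simp
      show ?thesis using g_Pic[OF True] cls_Pic_iff[OF rc] row_append_rows_left[OF BU U2 True] unfolding C_def by simp
    next
      case False
      then have k: "i - r < n" "r + (i - r) = i" using i by auto
      have rc: "row U2 (i - r) \<in> carrier_vec N" using U2 k by simp
      have "row U2 (i - r) = U2\<^sup>T *\<^sub>v unit_vec n (i - r)" using U2 k by (intro eq_vecI) auto
      then have "Q *\<^sub>v row U2 (i - r) = 0\<^sub>v r" using Q_U2[OF unit_vec_carrier] by simp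
      then have "locally_linear (row U2 (i - r))" using locally_linear_lattice[OF rc] latticeD(2)[OF lattice_pic] by simp
      then show ?thesis using row_append_rows_right[OF BU U2 k(1)] k(2) unfolding C_def by simp
    qed
    then show ?thesis using toric_C_T_iff[OF car] by simp
  qed
  have combC: "Z_comb (C_T_group n \<Sigma>) N (\<lambda>i. toric (row C i)) c = toric (C\<^sup>T *\<^sub>v c)" if c: "c \<in> carrier_vec N" for c
  proof -
    have "Z_comb (C_T_group n \<Sigma>) N (\<lambda>i. toric (row C i)) c = Z_comb (W_T n \<Sigma>) N (\<lambda>i. toric (row C i)) c"
      by (rule Z_comb_subgroup[OF comm_group_W_T C_T_subgroup rows])
    also have "\<dots> = toric (Z_comb (int_vec_group N) N (row C) c)"
      by (rule Z_comb_hom[OF comm_group_int_vec comm_group_W_T toric_hom, symmetric]) (use C in \<open>auto simp: int_vec_group_def\<close>)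
    finally show ?thesis unfolding Z_comb_rows[OF C c] .
  qed
  have CT: "C\<^sup>T *\<^sub>v c \<in> carrier_vec N" for c using C by (intro carrier_vecI) simp
  have split: "C\<^sup>T *\<^sub>v (c @\<^sub>v d) = (B * U1)\<^sup>T *\<^sub>v c + U2\<^sup>T *\<^sub>v d"
    if "c \<in> carrier_vec r" "d \<in> carrier_vec n" for c d
    unfolding C_def by (rule append_rows_transpose_mult[OF BU U2 that])
  have Q_split: "Q *\<^sub>v (C\<^sup>T *\<^sub>v (c @\<^sub>v d)) = Q *\<^sub>v ((B * U1)\<^sup>T *\<^sub>v c)"
    if "c \<in> carrier_vec r" "d \<in> carrier_vec n" for c d
  proof -
    have "Q *\<^sub>v (C\<^sup>T *\<^sub>v (c @\<^sub>v d)) = Q *\<^sub>v ((B * U1)\<^sup>T *\<^sub>v c) + Q *\<^sub>v (U2\<^sup>T *\<^sub>v d)"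
      unfolding split[OF that] by (rule mult_add_distrib_mat_vec[OF Q BUT U2T_carrier])
    also have "\<dots> = Q *\<^sub>v ((B * U1)\<^sup>T *\<^sub>v c)" unfolding Q_U2[OF that(2)] using Q by (intro eq_vecI) auto
    finally show ?thesis .
  qed
  have inj: "c = d" if c: "c \<in> carrier_vec r" "c' \<in> carrier_vec n" and d: "d \<in> carrier_vec r" "d' \<in> carrier_vec n"
    and eq: "C\<^sup>T *\<^sub>v (c @\<^sub>v c') = C\<^sup>T *\<^sub>v (d @\<^sub>v d')"
    and ll: "locally_linear (C\<^sup>T *\<^sub>v (c @\<^sub>v c'))" for c c' d d'
  proof -
    have "Q *\<^sub>v ((B * U1)\<^sup>T *\<^sub>v c) = Q *\<^sub>v ((B * U1)\<^sup>T *\<^sub>v d)"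
      using Q_split[OF c] Q_split[OF d] eq by simp
    then have same: "cls ((B * U1)\<^sup>T *\<^sub>v c) = cls ((B * U1)\<^sup>T *\<^sub>v d)" using cls_eq_Q_iff[OF BUT BUT] by simp
    have "locally_linear ((B * U1)\<^sup>T *\<^sub>v c)"
      using ll locally_linear_lattice[OF CT] locally_linear_lattice[OF BUT] Q_split[OF c] by simp
    then have "cls ((B * U1)\<^sup>T *\<^sub>v c) \<in> carrier (Pic_group n \<Sigma>)" using cls_Pic_iff[OF BUT] by simp
    then have "\<exists>!e. e \<in> carrier_vec r \<and> cls ((B * U1)\<^sup>T *\<^sub>v c)
        = Z_comb (Pic_group n \<Sigma>) r (\<lambda>i. Z_comb (Cl n \<Sigma>) r (row_class n \<Sigma> \<rho> U) (row B i)) e"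
      using basis unfolding Z_basis_def by blast
    then show "c = d" using comb[OF c(1)] comb[OF d(1)] same c(1) d(1) by (metis (no_types, lifting))
  qed
  have main: "\<exists>!c. c \<in> carrier_vec N \<and> a = C\<^sup>T *\<^sub>v c" if a: "a \<in> carrier_vec N" "locally_linear a" for a
  proof -
    have "cls a \<in> carrier (Pic_group n \<Sigma>)" using cls_Pic_iff[OF a(1)] a(2) by simp
    then obtain c where c: "c \<in> carrier_vec r"
      "cls a = Z_comb (Pic_group n \<Sigma>) r (\<lambda>i. Z_comb (Cl n \<Sigma>) r (row_class n \<Sigma> \<rho> U) (row B i)) c"
      using basis unfolding Z_basis_def by blast
    have "cls a = cls ((B * U1)\<^sup>T *\<^sub>v c)" using c(2) comb[OF c(1)] by simp
    then have Qa: "Q *\<^sub>v a = Q *\<^sub>v ((B * U1)\<^sup>T *\<^sub>v c)" using cls_eq_Q_iff[OF a(1) BUT] by simp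
    define b where "b = a - (B * U1)\<^sup>T *\<^sub>v c"
    have b: "b \<in> carrier_vec N" unfolding b_def by (rule minus_carrier_vec[OF a(1) BUT])
    have "Q *\<^sub>v b = Q *\<^sub>v a - Q *\<^sub>v ((B * U1)\<^sup>T *\<^sub>v c)" unfolding b_def by (rule mult_minus_distrib_mat_vec[OF Q a(1) BUT])
    also have "\<dots> = 0\<^sub>v r" unfolding Qa using Q by (intro eq_vecI) auto
    finally have Qb: "Q *\<^sub>v b = 0\<^sub>v r" .
    obtain d where d: "d \<in> carrier_vec n" "b = U1\<^sup>T *\<^sub>v (Q *\<^sub>v b) + U2\<^sup>T *\<^sub>v d"
      using U_decomposition[OF b] by (rule bexE)
    have "b = U1\<^sup>T *\<^sub>v 0\<^sub>v r + U2\<^sup>T *\<^sub>v d" using d(2) unfolding Qb .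
    also have "\<dots> = U2\<^sup>T *\<^sub>v d" using U1 U2 by (intro eq_vecI) auto
    finally have bd: "b = U2\<^sup>T *\<^sub>v d" .
    have "a = (B * U1)\<^sup>T *\<^sub>v c + b"
    proof (rule eq_vecI)
      fix i assume "i < dim_vec ((B * U1)\<^sup>T *\<^sub>v c + b)"
      then have "i < N" using b by simp
      then show "a $ i = ((B * U1)\<^sup>T *\<^sub>v c + b) $ i"
        unfolding b_def using carrier_vecD[OF BUT[of c]] a(1) by (simp del: index_mult_mat_vec)
    qed (use a(1) b in simp)
    then have aC: "a = C\<^sup>T *\<^sub>v (c @\<^sub>v d)" using split[OF c(1) d(1)] bd by simp
    have cd: "c @\<^sub>v d \<in> carrier_vec N" using c(1) d(1) by (intro carrier_vecI) simp
    show ?thesis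
    proof (rule ex1I[of _ "c @\<^sub>v d"])
      show "c @\<^sub>v d \<in> carrier_vec N \<and> a = C\<^sup>T *\<^sub>v (c @\<^sub>v d)" using cd aC by blast
      fix e assume e: "e \<in> carrier_vec N \<and> a = C\<^sup>T *\<^sub>v e"
      define c' d' where "c' = vec_first e r" and "d' = vec_last e n"
      have c': "c' \<in> carrier_vec r" and d': "d' \<in> carrier_vec n" unfolding c'_def d'_def by auto
      have "e \<in> carrier_vec (r + n)" using e by (simp add: add.commute)
      then have ee: "e = c' @\<^sub>v d'" unfolding c'_def d'_def using vec_first_last_append by metis
      have eq: "C\<^sup>T *\<^sub>v (c @\<^sub>v d) = C\<^sup>T *\<^sub>v (c' @\<^sub>v d')" using aC e ee by simp
      have cc: "c = c'" by (rule inj[OF c(1) d(1) c' d' eq]) (use a(2) aC in simp)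
      have U2d: "U2\<^sup>T *\<^sub>v d = U2\<^sup>T *\<^sub>v d'"
      proof (rule eq_vecI)
        fix i assume "i < dim_vec (U2\<^sup>T *\<^sub>v d')"
        then have i: "i < N" using carrier_vecD[OF U2T_carrier] by metis
        have "((B * U1)\<^sup>T *\<^sub>v c + U2\<^sup>T *\<^sub>v d) $ i = ((B * U1)\<^sup>T *\<^sub>v c + U2\<^sup>T *\<^sub>v d') $ i"
          using eq unfolding cc split[OF c' d(1)] split[OF c' d'] by simp
        then show "(U2\<^sup>T *\<^sub>v d) $ i = (U2\<^sup>T *\<^sub>v d') $ i"
          using i carrier_vecD[OF U2T_carrier] by (simp del: index_mult_mat_vec)
      qed (use U2 in simp)
      have "U2\<^sup>T *\<^sub>v (d - d') = U2\<^sup>T *\<^sub>v d - U2\<^sup>T *\<^sub>v d'"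
        by (rule mult_minus_distrib_mat_vec) (use U2 d(1) d' in auto)
      also have "\<dots> = 0\<^sub>v N" unfolding U2d using carrier_vecD[OF U2T_carrier] by (intro eq_vecI) (auto simp del: index_mult_mat_vec)
      finally have z: "d - d' = 0\<^sub>v n" using U2T_inj d(1) d' by (meson minus_carrier_vec)
      have "d = d'"
      proof (rule eq_vecI)
        fix i assume i: "i < dim_vec d'"
        then show "d $ i = d' $ i" using arg_cong[OF z, of "\<lambda>x. x $ i"] d' by simp
      qed (use d(1) d' in simp)
      then show "e = c @\<^sub>v d" using ee cc by simp
    qed
  qed
  have "Z_basis (C_T_group n \<Sigma>) N (\<lambda>i. toric (row C i))" unfolding Z_basis_def
  proof (intro conjI allI impI ballI)
    fix y assume "y \<in> carrier (C_T_group n \<Sigma>)"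
    then obtain a where a: "a \<in> carrier_vec N" "locally_linear a" "y = toric a" unfolding C_T_eq by auto
    have iff: "y = Z_comb (C_T_group n \<Sigma>) N (\<lambda>i. toric (row C i)) c \<longleftrightarrow> a = C\<^sup>T *\<^sub>v c" if "c \<in> carrier_vec N" for c
      unfolding combC[OF that] a(3) using toric_inj[OF a(1) CT] by auto
    then have "(\<lambda>c. c \<in> carrier_vec N \<and> y = Z_comb (C_T_group n \<Sigma>) N (\<lambda>i. toric (row C i)) c)
        = (\<lambda>c. c \<in> carrier_vec N \<and> a = C\<^sup>T *\<^sub>v c)" by (intro ext conj_cong refl)
    then show "\<exists>!c. c \<in> carrier_vec N \<and> y = Z_comb (C_T_group n \<Sigma>) N (\<lambda>i. toric (row C i)) c" using main[OF a(1,2)] by simp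
  qed (use rows in simp)
  then show ?thesis unfolding C_def .
qed

end


context hermite_weighted_fan
begin

definition \<delta> :: int where "\<delta> = delta Q complements"

lemma delta_pos: "0 < \<delta>"
proof -
  have "\<delta> \<noteq> 0" unfolding \<delta>_def delta_def
    using Lcm_0_iff[of "(\<lambda>I. det (cols_in Q I)) ` complements"] complements_finite det_cols_nonzero by auto
  moreover have "0 \<le> \<delta>" unfolding \<delta>_def delta_def by simp
  ultimately show ?thesis by simp
qed

lemma delta_smult: "x \<in> carrier_vec r \<Longrightarrow> \<delta> \<cdot>\<^sub>v x \<in> pic_lattice"
  unfolding pic_lattice_def
proof
  fix I assume x: "x \<in> carrier_vec r" and I: "I \<in> complements"
  have "det (cols_in Q I) dvd \<delta>" unfolding \<delta>_def delta_def using I by simp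
  then show "\<delta> \<cdot>\<^sub>v x \<in> col_lattice (cols_in Q I)" by (rule det_smult_in_col_lattice[OF cols_in_square(1)[OF I] x])
qed

text \<open>A power is an integral combination of length one, so it is preserved by the homomorphism \<open>toric\<close>.\<close>

lemma toric_power:
  assumes a: "a \<in> carrier_vec N"
  shows "toric a [^]\<^bsub>W_T n \<Sigma>\<^esub> k = toric (k \<cdot>\<^sub>v a)"
proof -
  have one: "Z_comb G 1 (\<lambda>_. x) (vec 1 (\<lambda>_. k)) = x [^]\<^bsub>G\<^esub> k" if G: "comm_group G" and x: "x \<in> carrier G" for G :: "('b, 'c) monoid_scheme" and x
  proof -
    interpret comm_group G by (rule G)
    show ?thesis unfolding One_nat_def using x by (subst Z_comb_Suc[OF G]) (simp_all add: Z_comb_0[OF G])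
  qed
  have "toric a [^]\<^bsub>W_T n \<Sigma>\<^esub> k = Z_comb (W_T n \<Sigma>) 1 (\<lambda>_. toric a) (vec 1 (\<lambda>_. k))"
    by (rule one[OF comm_group_W_T toric_W_T[OF a], symmetric])
  also have "\<dots> = toric (Z_comb (int_vec_group N) 1 (\<lambda>_. a) (vec 1 (\<lambda>_. k)))"
    by (rule Z_comb_hom[OF comm_group_int_vec comm_group_W_T toric_hom, symmetric]) (use a in \<open>simp add: int_vec_group_def\<close>)
  also have "Z_comb (int_vec_group N) 1 (\<lambda>_. a) (vec 1 (\<lambda>_. k)) = k \<cdot>\<^sub>v a"
    by (subst Z_comb_int_vec) (use a in \<open>auto intro!: eq_vecI\<close>)
  finally show ?thesis .
qed

lemma delta_W_T:
  assumes "E \<in> carrier (W_T n \<Sigma>)"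
  shows "E [^]\<^bsub>W_T n \<Sigma>\<^esub> \<delta> \<in> C_T n \<Sigma>"
proof -
  obtain a where a: "a \<in> carrier_vec N" "E = toric a" using assms unfolding carrier_W_T by blast
  have "Q *\<^sub>v a \<in> carrier_vec r" using Q by (intro carrier_vecI) simp
  moreover have "Q *\<^sub>v (\<delta> \<cdot>\<^sub>v a) = \<delta> \<cdot>\<^sub>v (Q *\<^sub>v a)" using Q a(1) by (intro eq_vecI) auto
  ultimately have "Q *\<^sub>v (\<delta> \<cdot>\<^sub>v a) \<in> pic_lattice" using delta_smult by simp
  then have "locally_linear (\<delta> \<cdot>\<^sub>v a)" using locally_linear_lattice[of "\<delta> \<cdot>\<^sub>v a"] a(1) by simp
  then show ?thesis unfolding a(2) toric_power[OF a(1)] using toric_C_T_iff[of "\<delta> \<cdot>\<^sub>v a"] a(1) by simp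
qed

lemma degree_surj:
  assumes "z \<in> carrier_vec r"
  shows "\<exists>a\<in>carrier_vec N. Q *\<^sub>v a = z"
  using Q_U1[OF assms] U1T_carrier by blast

text \<open>Both \<open>Cl(X)\<close> and \<open>W\<^sub>T(X)\<close> map onto \<open>\<int>\<^sup>r\<close> by \<open>Q\<close>, and the Cartier classes and the invariant Cartier divisors are
  the preimages of one lattice, so both quotients have as many elements as that lattice has residues. Its basis matrix
  has the index as determinant, and each \<open>det Q\<^sub>I\<close> divides it.\<close>

lemma index:
  "finite (rcosets\<^bsub>Cl n \<Sigma>\<^esub> Pic n \<Sigma>) \<and> finite (rcosets\<^bsub>W_T n \<Sigma>\<^esub> C_T n \<Sigma>) \<and>
   card (rcosets\<^bsub>Cl n \<Sigma>\<^esub> Pic n \<Sigma>) = card (rcosets\<^bsub>W_T n \<Sigma>\<^esub> C_T n \<Sigma>) \<and>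
   \<delta> dvd int (card (rcosets\<^bsub>Cl n \<Sigma>\<^esub> Pic n \<Sigma>))"
proof -
  obtain B R where BR: "B \<in> carrier_mat r r" "pic_lattice = col_lattice B" "finite R" "int (card R) = det B"
    "R \<subseteq> carrier_vec r" "\<forall>x\<in>carrier_vec r. \<exists>!y. y \<in> R \<and> x - y \<in> pic_lattice"
    using lattice_basis_index[OF lattice_pic delta_pos delta_smult] by auto
  have "det (cols_in Q I) dvd int (card R)" if I: "I \<in> complements" for I
    unfolding BR(4)
  proof (rule det_dvd_of_sublattice[OF cols_in_square(1)[OF I] BR(1)])
    show "col_lattice B \<subseteq> col_lattice (cols_in Q I)" unfolding BR(2)[symmetric] pic_lattice_def using I by blast
  qed
  then have dvd: "\<delta> dvd int (card R)" unfolding \<delta>_def delta_def by (intro Lcm_least) auto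
  have Qc: "Q *\<^sub>v a \<in> carrier_vec r" for a using Q by (intro carrier_vecI) simp
  define \<chi> where "\<chi> = (\<lambda>x. Q *\<^sub>v (SOME a. a \<in> carrier_vec N \<and> x = cls a))"
  have \<chi>: "\<chi> (cls a) = Q *\<^sub>v a" if a: "a \<in> carrier_vec N" for a
  proof -
    define b where "b = (SOME b. b \<in> carrier_vec N \<and> cls a = cls b)"
    have b: "b \<in> carrier_vec N" "cls a = cls b"
      unfolding b_def using someI[of "\<lambda>b. b \<in> carrier_vec N \<and> cls a = cls b" a] a by auto
    have "\<chi> (cls a) = Q *\<^sub>v b" unfolding \<chi>_def b_def ..
    also have "\<dots> = Q *\<^sub>v a" using cls_eq_Q_iff[OF a b(1)] b(2) by simp
    finally show ?thesis .
  qed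
  have Cl: "finite (rcosets\<^bsub>Cl n \<Sigma>\<^esub> Pic n \<Sigma>)" "card (rcosets\<^bsub>Cl n \<Sigma>\<^esub> Pic n \<Sigma>) = card R"
  proof -
    have 1: "group (Cl n \<Sigma>)" using comm_group_Cl by (rule comm_group.axioms(2))
    have 2: "\<chi> x \<in> carrier_vec r" for x unfolding \<chi>_def by (rule Qc)
    have 3: "\<chi> (x \<otimes>\<^bsub>Cl n \<Sigma>\<^esub> y) = \<chi> x + \<chi> y" if xy: "x \<in> carrier (Cl n \<Sigma>)" "y \<in> carrier (Cl n \<Sigma>)" for x y
    proof -
      obtain a where a: "a \<in> carrier_vec N" "x = cls a" using cls_surj[OF xy(1)] by blast
      obtain b where b: "b \<in> carrier_vec N" "y = cls b" using cls_surj[OF xy(2)] by blast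
      have "\<chi> (x \<otimes>\<^bsub>Cl n \<Sigma>\<^esub> y) = Q *\<^sub>v (a + b)" unfolding a(2) b(2) cls_add[OF a(1) b(1), symmetric] by (rule \<chi>) (use a b in simp)
      then show ?thesis unfolding a(2) b(2) \<chi>[OF a(1)] \<chi>[OF b(1)] using mult_add_distrib_mat_vec[OF Q a(1) b(1)] by simp
    qed
    have 4: "\<exists>x\<in>carrier (Cl n \<Sigma>). \<chi> x = z" if "z \<in> carrier_vec r" for z
      using degree_surj[OF that] \<chi> cls_carrier by blast
    have 5: "Pic n \<Sigma> = {x \<in> carrier (Cl n \<Sigma>). \<chi> x \<in> pic_lattice}"
    proof (intro equalityI subsetI)
      fix x assume "x \<in> Pic n \<Sigma>"
      then obtain a where "a \<in> carrier_vec N" "locally_linear a" "x = cls a" unfolding Pic_eq by blast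
      then show "x \<in> {x \<in> carrier (Cl n \<Sigma>). \<chi> x \<in> pic_lattice}" using \<chi> cls_carrier locally_linear_lattice by simp
    next
      fix x assume x: "x \<in> {x \<in> carrier (Cl n \<Sigma>). \<chi> x \<in> pic_lattice}"
      then obtain a where a: "a \<in> carrier_vec N" "x = cls a" using cls_surj by blast
      then show "x \<in> Pic n \<Sigma>" unfolding Pic_eq using x \<chi>[OF a(1)] locally_linear_lattice[OF a(1)] by simp
    qed
    show "finite (rcosets\<^bsub>Cl n \<Sigma>\<^esub> Pic n \<Sigma>)" "card (rcosets\<^bsub>Cl n \<Sigma>\<^esub> Pic n \<Sigma>) = card R"
      using rcosets_of_preimage[OF 1 2 3 4 5 lattice_pic BR(3,5,6)] by simp_all
  qed
  define \<xi> where "\<xi> = (\<lambda>E. Q *\<^sub>v vec N (\<lambda>j. lookup E (D j)))"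
  have \<xi>: "\<xi> (toric a) = Q *\<^sub>v a" if a: "a \<in> carrier_vec N" for a
  proof -
    have "vec N (\<lambda>j. lookup (toric a) (D j)) = a" using lookup_toric_D[OF a] a by (intro eq_vecI) auto
    then show ?thesis unfolding \<xi>_def by simp
  qed
  have "finite (rcosets\<^bsub>W_T n \<Sigma>\<^esub> C_T n \<Sigma>)" "card (rcosets\<^bsub>W_T n \<Sigma>\<^esub> C_T n \<Sigma>) = card R"
  proof -
    have 1: "group (W_T n \<Sigma>)" using comm_group_W_T by (rule comm_group.axioms(2))
    have 2: "\<xi> x \<in> carrier_vec r" for x unfolding \<xi>_def by (rule Qc)
    have 3: "\<xi> (x \<otimes>\<^bsub>W_T n \<Sigma>\<^esub> y) = \<xi> x + \<xi> y" if xy: "x \<in> carrier (W_T n \<Sigma>)" "y \<in> carrier (W_T n \<Sigma>)" for x y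
    proof -
      obtain a where a: "a \<in> carrier_vec N" "x = toric a" using xy(1) unfolding carrier_W_T by blast
      obtain b where b: "b \<in> carrier_vec N" "y = toric b" using xy(2) unfolding carrier_W_T by blast
      have "\<xi> (x \<otimes>\<^bsub>W_T n \<Sigma>\<^esub> y) = Q *\<^sub>v (a + b)"
        unfolding a(2) b(2) mult_W_T toric_add[OF a(1) b(1), symmetric] by (rule \<xi>) (use a b in simp)
      then show ?thesis unfolding a(2) b(2) \<xi>[OF a(1)] \<xi>[OF b(1)] using mult_add_distrib_mat_vec[OF Q a(1) b(1)] by simp
    qed
    have 4: "\<exists>x\<in>carrier (W_T n \<Sigma>). \<xi> x = z" if "z \<in> carrier_vec r" for z
      using degree_surj[OF that] \<xi> toric_W_T by blast
    have 5: "C_T n \<Sigma> = {x \<in> carrier (W_T n \<Sigma>). \<xi> x \<in> pic_lattice}"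
      unfolding C_T_eq carrier_W_T using \<xi> locally_linear_lattice by auto
    show "finite (rcosets\<^bsub>W_T n \<Sigma>\<^esub> C_T n \<Sigma>)" "card (rcosets\<^bsub>W_T n \<Sigma>\<^esub> C_T n \<Sigma>) = card R"
      using rcosets_of_preimage[OF 1 2 3 4 5 lattice_pic BR(3,5,6)] by simp_all
  qed
  then show ?thesis using Cl dvd by simp
qed

lemma C_block:
  assumes B: "B \<in> carrier_mat r r"
  shows "four_block_mat B (0\<^sub>m r n) (0\<^sub>m n r) (1\<^sub>m n) * U = (B * U1) @\<^sub>r U2"
proof -
  have "four_block_mat B (0\<^sub>m r n) (0\<^sub>m n r) (1\<^sub>m n) * U
      = four_block_mat B (0\<^sub>m r n) (0\<^sub>m n r) (1\<^sub>m n) * four_block_mat U1 (0\<^sub>m r 0) U2 (0\<^sub>m n 0)"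
    using U_split carrier_matD(1)[OF U1] carrier_matD(1)[OF U2] unfolding append_rows_def by metis
  also have "\<dots> = four_block_mat (B * U1 + 0\<^sub>m r n * U2) (B * 0\<^sub>m r 0 + 0\<^sub>m r n * 0\<^sub>m n 0)
      (0\<^sub>m n r * U1 + 1\<^sub>m n * U2) (0\<^sub>m n r * 0\<^sub>m r 0 + 1\<^sub>m n * 0\<^sub>m n 0)"
    by (rule mult_four_block_mat[OF B _ _ _ U1 _ U2]) auto
  also have "\<dots> = four_block_mat (B * U1) (0\<^sub>m r 0) U2 (0\<^sub>m n 0)"
  proof -
    have BU: "B * U1 \<in> carrier_mat r N" using B U1 by simp
    have "B * U1 + 0\<^sub>m r n * U2 = B * U1" using BU U2 by simp
    moreover have "0\<^sub>m n r * U1 + 1\<^sub>m n * U2 = U2" using U1 U2 by simp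
    moreover have "B * 0\<^sub>m r 0 + 0\<^sub>m r n * 0\<^sub>m n 0 = 0\<^sub>m r 0" "0\<^sub>m n r * 0\<^sub>m r 0 + 1\<^sub>m n * 0\<^sub>m n 0 = (0\<^sub>m n 0 :: int mat)"
      using B by (auto intro!: eq_matI)
    ultimately show ?thesis by simp
  qed
  also have "\<dots> = (B * U1) @\<^sub>r U2" unfolding append_rows_def using carrier_matD(1)[OF B] carrier_matD(1)[OF U2] by simp
  finally show ?thesis .
qed

end


theorem theorem2p9:
  fixes n r :: nat
    and \<Sigma> :: "real vec set set"
    and \<rho> :: "nat \<Rightarrow> real vec set"
    and Q U :: "int mat"
  assumes X: "poly_weighted_space n r \<Sigma> \<rho>"
    and Q: "weight_matrix n r \<Sigma> \<rho> Q" "reduced_matrix Q"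
    and U: "U \<in> carrier_mat (n + r) (n + r)" "invertible_mat U"
      "hermite_normal_form (U * transpose_mat Q)"
  shows
    "Z_basis (Cl n \<Sigma>) r (row_class n \<Sigma> \<rho> U) \<and>

     (\<forall>E V. fan_matrix n r \<rho> E V \<longrightarrow>
        {c \<in> carrier_vec r. Z_comb (Cl n \<Sigma>) r (row_class n \<Sigma> \<rho> U) c \<in> Pic n \<Sigma>}
          = (\<Inter>I\<in>index_sets n r \<Sigma> E V. col_lattice (cols_in Q I))) \<and>

     (\<forall>B C. B \<in> carrier_mat r r \<and>
        Z_basis (Pic_group n \<Sigma>) r
          (\<lambda>i. Z_comb (Cl n \<Sigma>) r (row_class n \<Sigma> \<rho> U) (row B i)) \<and>
        C = four_block_mat B (0\<^sub>m r n) (0\<^sub>m n r) (1\<^sub>m n) * U \<longrightarrow>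
          C = (B * upper_rows r U) @\<^sub>r lower_rows n U \<and>
          (\<exists>E. fan_matrix n r \<rho> E (lower_rows n U)) \<and>
          Z_basis (C_T_group n \<Sigma>) (n + r) (\<lambda>i. toric_divisor n \<rho> (row C i))) \<and>

     (\<forall>E V \<delta>. fan_matrix n r \<rho> E V \<and> \<delta> = delta Q (index_sets n r \<Sigma> E V) \<longrightarrow>
        (\<forall>D\<in>carrier (W_T n \<Sigma>). D [^]\<^bsub>W_T n \<Sigma>\<^esub> \<delta> \<in> C_T n \<Sigma>) \<and>
        finite (rcosets\<^bsub>Cl n \<Sigma>\<^esub> Pic n \<Sigma>) \<and>
        finite (rcosets\<^bsub>W_T n \<Sigma>\<^esub> C_T n \<Sigma>) \<and>
        card (rcosets\<^bsub>Cl n \<Sigma>\<^esub> Pic n \<Sigma>) = card (rcosets\<^bsub>W_T n \<Sigma>\<^esub> C_T n \<Sigma>) \<and>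
        \<delta> dvd int (card (rcosets\<^bsub>Cl n \<Sigma>\<^esub> Pic n \<Sigma>)))"
proof -
  interpret h: hermite_weighted_fan n r \<Sigma> \<rho> Q U
    by unfold_locales (use X Q U in auto)
  show ?thesis
  proof (intro conjI allI impI ballI)
    show "Z_basis (Cl n \<Sigma>) r (row_class n \<Sigma> \<rho> U)" by (rule h.row_class_basis)
  next
    fix E V assume "fan_matrix n r \<rho> E V"
    then have eq: "index_sets n r \<Sigma> E V = h.complements" by (rule h.complements_eq)
    have "c \<in> carrier_vec r" if "c \<in> h.pic_lattice" for c using that latticeD(1)[OF h.lattice_pic] by blast
    then show "{c \<in> carrier_vec r. Z_comb (Cl n \<Sigma>) r (row_class n \<Sigma> \<rho> U) c \<in> Pic n \<Sigma>}
          = (\<Inter>I\<in>index_sets n r \<Sigma> E V. col_lattice (cols_in Q I))"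
      unfolding eq using h.Pic_coordinates unfolding h.pic_lattice_def by blast
  next
    fix B C
    assume BC: "B \<in> carrier_mat r r \<and>
        Z_basis (Pic_group n \<Sigma>) r (\<lambda>i. Z_comb (Cl n \<Sigma>) r (row_class n \<Sigma> \<rho> U) (row B i)) \<and>
        C = four_block_mat B (0\<^sub>m r n) (0\<^sub>m n r) (1\<^sub>m n) * U"
    then have B: "B \<in> carrier_mat r r"
      and basis: "Z_basis (Pic_group n \<Sigma>) r (\<lambda>i. Z_comb (Cl n \<Sigma>) r (row_class n \<Sigma> \<rho> U) (row B i))" by (rule conjunct1, elim conjE)
    show C: "C = (B * upper_rows r U) @\<^sub>r lower_rows n U" using BC h.C_block[OF B] by simp
    show "\<exists>E. fan_matrix n r \<rho> E (lower_rows n U)" by (rule h.fan_matrix_lower_rows)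
    show "Z_basis (C_T_group n \<Sigma>) (n + r) (\<lambda>i. toric_divisor n \<rho> (row C i))"
      unfolding C h.toric_eq by (rule h.cartier_basis[OF B basis])
  next
    fix E V \<delta> assume "fan_matrix n r \<rho> E V \<and> \<delta> = delta Q (index_sets n r \<Sigma> E V)"
    then have \<delta>: "\<delta> = h.\<delta>" using h.complements_eq unfolding h.\<delta>_def by simp
    show "D [^]\<^bsub>W_T n \<Sigma>\<^esub> \<delta> \<in> C_T n \<Sigma>" if "D \<in> carrier (W_T n \<Sigma>)" for D
      unfolding \<delta> by (rule h.delta_W_T[OF that])
    show "finite (rcosets\<^bsub>Cl n \<Sigma>\<^esub> Pic n \<Sigma>)" "finite (rcosets\<^bsub>W_T n \<Sigma>\<^esub> C_T n \<Sigma>)"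
      "card (rcosets\<^bsub>Cl n \<Sigma>\<^esub> Pic n \<Sigma>) = card (rcosets\<^bsub>W_T n \<Sigma>\<^esub> C_T n \<Sigma>)"
      "\<delta> dvd int (card (rcosets\<^bsub>Cl n \<Sigma>\<^esub> Pic n \<Sigma>))"
      unfolding \<delta> using h.index by auto
  qed
qed


end
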